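(* There is an algorithm that, for every sequence $S[1:n]$ of $n$ distinct real numbers and every integer $k\geq 3$, computes the length of a longest subsequence of $S$ that is a $k$-rollercoaster in $O(n\log^2 n)$ time.
   Context: A subsequence of $S[1:n]=(S[1],\dots,S[n])$ is a sequence $(S[i_1],\dots,S[i_m])$ with $1\le i_1<\dots<i_m\le n$ (not necessarily contiguous). A run of a sequence is a maximal contiguous subsequence that is increasing or decreasing. For $k\geq 3$, a $k$-rollercoaster is a sequence of numbers every run of which has length at least $k$. *)

theory Defs
  imports Complex_Main "HOL-Library.Sublist" "HOL-Library.Landau_Symbols"
begin

section \<open>Rollercoasters\<close>

definition slice :: "'a list \<Rightarrow> nat \<Rightarrow> nat \<Rightarrow> 'a list" where
  "slice xs i j = take (j - i) (drop i xs)"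

definition monotonic :: "'a::linorder list \<Rightarrow> bool" where
  "monotonic xs \<longleftrightarrow> sorted_wrt (<) xs \<or> sorted_wrt (>) xs"

text \<open>
  Runs are identified by their position, the half-open interval from \<open>i\<close> to \<open>j\<close>, and are nonempty.
  Neighbouring runs overlap in the peak or valley between them.
\<close>

definition is_run :: "'a::linorder list \<Rightarrow> nat \<Rightarrow> nat \<Rightarrow> bool" where
  "is_run xs i j \<longleftrightarrow>
     i < j \<and> j \<le> length xs \<and> monotonic (slice xs i j) \<and>
     (\<forall>i' j'. i' \<le> i \<and> j \<le> j' \<and> j' \<le> length xs \<and> monotonic (slice xs i' j') \<longrightarrow>
        i' = i \<and> j' = j)"

definition rollercoaster :: "nat \<Rightarrow> 'a::linorder list \<Rightarrow> bool" where
  "rollercoaster k xs \<longleftrightarrow> (\<forall>i j. is_run xs i j \<longrightarrow> k \<le> j - i)"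

text \<open>
  The empty list has no runs and hence is a rollercoaster, so the maximum below is always
  attained; it is \<open>0\<close> if no nonempty subsequence is a rollercoaster.
\<close>

definition longest_rollercoaster_length :: "nat \<Rightarrow> 'a::linorder list \<Rightarrow> nat" where
  "longest_rollercoaster_length k xs = Max {length ys |ys. subseq ys xs \<and> rollercoaster k ys}"

lemma rollercoaster_Nil: "rollercoaster k []"
  by (simp add: rollercoaster_def is_run_def)

lemma longest_rollercoaster_length_attained:
  shows "\<exists>ys. subseq ys xs \<and> rollercoaster k ys \<and> length ys = longest_rollercoaster_length k xs"
    and "subseq ys xs \<Longrightarrow> rollercoaster k ys \<Longrightarrow> length ys \<le> longest_rollercoaster_length k xs"
proof -
  let ?L = "{length ys |ys. subseq ys xs \<and> rollercoaster k ys}"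
  have fin: "finite ?L"
    by (rule finite_subset[of _ "{..length xs}"]) (auto dest: list_emb_length)
  moreover have "?L \<noteq> {}"
    using rollercoaster_Nil[of k] by (auto intro!: exI[of _ "[]"])
  ultimately have "Max ?L \<in> ?L" by (rule Max_in)
  then show "\<exists>ys. subseq ys xs \<and> rollercoaster k ys \<and> length ys = longest_rollercoaster_length k xs"
    unfolding longest_rollercoaster_length_def by force
  show "subseq ys xs \<Longrightarrow> rollercoaster k ys \<Longrightarrow> length ys \<le> longest_rollercoaster_length k xs"
    unfolding longest_rollercoaster_length_def using fin by (auto intro!: Max_ge)
qed


section \<open>The model of computation\<close>

text \<open>
  Algorithms are programs of a random access machine with unit-cost operations. Its memory consists
  of named registers and named, unbounded arrays, all holding natural numbers. The input sequence
  \<open>S\<close> of reals is a separate read-only array (indexed from \<open>0\<close>), whose entries can only be compared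
  with each other. Arithmetic is limited to machine words: a program gets stuck as soon as it
  computes a number greater than the bound \<open>W\<close> or accesses \<open>S\<close> out of range. Subtraction is truncated at \<open>0\<close>, and division by
  \<open>0\<close> yields \<open>0\<close>.
\<close>

type_synonym vname = string
type_synonym state = "(vname \<Rightarrow> nat) \<times> (vname \<Rightarrow> nat \<Rightarrow> nat)"

datatype aexp =
    N nat
  | V vname
  | Load vname aexp
  | Plus aexp aexp
  | Minus aexp aexp
  | Times aexp aexp
  | Div aexp aexp

datatype bexp =
    Less aexp aexp
  | InputLess aexp aexp
  | Neg bexp
  | Conj bexp bexp

datatype com =
    Skip
  | Assign vname aexp
  | Store vname aexp aexp
  | Seq com com
  | Cond bexp com com
  | While bexp com

fun aval :: "state \<Rightarrow> aexp \<Rightarrow> nat" where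
  "aval s (N n) = n"
| "aval s (V x) = fst s x"
| "aval s (Load a e) = snd s a (aval s e)"
| "aval s (Plus e f) = aval s e + aval s f"
| "aval s (Minus e f) = aval s e - aval s f"
| "aval s (Times e f) = aval s e * aval s f"
| "aval s (Div e f) = aval s e div aval s f"

text \<open>
  \<open>afits\<close> and \<open>bfits\<close> say that an evaluation does not get stuck. Stored numbers need no check,
  because only numbers that fit are ever stored (lemma \<open>exec_fits\<close> below).
\<close>

fun afits :: "nat \<Rightarrow> state \<Rightarrow> aexp \<Rightarrow> bool" where
  "afits W s (N n) \<longleftrightarrow> n \<le> W"
| "afits W s (V x) \<longleftrightarrow> True"
| "afits W s (Load a e) \<longleftrightarrow> afits W s e"
| "afits W s (Plus e f) \<longleftrightarrow> afits W s e \<and> afits W s f \<and> aval s e + aval s f \<le> W"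
| "afits W s (Minus e f) \<longleftrightarrow> afits W s e \<and> afits W s f"
| "afits W s (Times e f) \<longleftrightarrow> afits W s e \<and> afits W s f \<and> aval s e * aval s f \<le> W"
| "afits W s (Div e f) \<longleftrightarrow> afits W s e \<and> afits W s f"

fun bval :: "real list \<Rightarrow> state \<Rightarrow> bexp \<Rightarrow> bool" where
  "bval S s (Less e f) \<longleftrightarrow> aval s e < aval s f"
| "bval S s (InputLess e f) \<longleftrightarrow> S ! aval s e < S ! aval s f"
| "bval S s (Neg b) \<longleftrightarrow> \<not> bval S s b"
| "bval S s (Conj b c) \<longleftrightarrow> bval S s b \<and> bval S s c"

fun bfits :: "real list \<Rightarrow> nat \<Rightarrow> state \<Rightarrow> bexp \<Rightarrow> bool" where
  "bfits S W s (Less e f) \<longleftrightarrow> afits W s e \<and> afits W s f"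
| "bfits S W s (InputLess e f) \<longleftrightarrow>
     afits W s e \<and> afits W s f \<and> aval s e < length S \<and> aval s f < length S"
| "bfits S W s (Neg b) \<longleftrightarrow> bfits S W s b"
| "bfits S W s (Conj b c) \<longleftrightarrow> bfits S W s b \<and> bfits S W s c"

fun acost :: "aexp \<Rightarrow> nat" where
  "acost (N n) = 1"
| "acost (V x) = 1"
| "acost (Load a e) = 1 + acost e"
| "acost (Plus e f) = 1 + acost e + acost f"
| "acost (Minus e f) = 1 + acost e + acost f"
| "acost (Times e f) = 1 + acost e + acost f"
| "acost (Div e f) = 1 + acost e + acost f"

fun bcost :: "bexp \<Rightarrow> nat" where
  "bcost (Less e f) = 1 + acost e + acost f"
| "bcost (InputLess e f) = 1 + acost e + acost f"
| "bcost (Neg b) = 1 + bcost b"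
| "bcost (Conj b c) = 1 + bcost b + bcost c"

text \<open>
  \<open>exec S W c s t s'\<close>: started in state \<open>s\<close> on input \<open>S\<close> with word bound \<open>W\<close>, the program \<open>c\<close>
  terminates after \<open>t\<close> steps in state \<open>s'\<close>.
\<close>

inductive exec :: "real list \<Rightarrow> nat \<Rightarrow> com \<Rightarrow> state \<Rightarrow> nat \<Rightarrow> state \<Rightarrow> bool"
  for S :: "real list" and W :: nat where
  Skip: "exec S W Skip s 1 s"
| Assign: "afits W s e \<Longrightarrow>
    exec S W (Assign x e) s (1 + acost e) ((fst s)(x := aval s e), snd s)"
| Store: "afits W s i \<Longrightarrow> afits W s e \<Longrightarrow>
    exec S W (Store a i e) s (1 + acost i + acost e)
      (fst s, (snd s)(a := (snd s a)(aval s i := aval s e)))"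
| Seq: "exec S W c1 s1 t1 s2 \<Longrightarrow> exec S W c2 s2 t2 s3 \<Longrightarrow>
    exec S W (Seq c1 c2) s1 (t1 + t2) s3"
| CondTrue: "bfits S W s b \<Longrightarrow> bval S s b \<Longrightarrow> exec S W c1 s t s' \<Longrightarrow>
    exec S W (Cond b c1 c2) s (1 + bcost b + t) s'"
| CondFalse: "bfits S W s b \<Longrightarrow> \<not> bval S s b \<Longrightarrow> exec S W c2 s t s' \<Longrightarrow>
    exec S W (Cond b c1 c2) s (1 + bcost b + t) s'"
| WhileFalse: "bfits S W s b \<Longrightarrow> \<not> bval S s b \<Longrightarrow>
    exec S W (While b c) s (1 + bcost b) s"
| WhileTrue: "bfits S W s1 b \<Longrightarrow> bval S s1 b \<Longrightarrow> exec S W c s1 t1 s2 \<Longrightarrow>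
    exec S W (While b c) s2 t2 s3 \<Longrightarrow>
    exec S W (While b c) s1 (1 + bcost b + t1 + t2) s3"

inductive_cases exec_SkipE: "exec S W Skip s t s'"
inductive_cases exec_AssignE: "exec S W (Assign x e) s t s'"
inductive_cases exec_StoreE: "exec S W (Store a i e) s t s'"
inductive_cases exec_SeqE: "exec S W (Seq c1 c2) s t s'"
inductive_cases exec_CondE: "exec S W (Cond b c1 c2) s t s'"
inductive_cases exec_WhileE: "exec S W (While b c) s t s'"

lemma exec_deterministic:
  "exec S W c s t s' \<Longrightarrow> exec S W c s u s'' \<Longrightarrow> t = u \<and> s' = s''"
proof (induction arbitrary: u s'' rule: exec.induct)
  case Skip then show ?case by (auto elim: exec_SkipE)
next
  case Assign then show ?case by (auto elim: exec_AssignE)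
next
  case Store then show ?case by (auto elim: exec_StoreE)
next
  case (Seq c1 s1 t1 s2 c2 t2 s3)
  from Seq.prems obtain u1 u2 r
    where u: "u = u1 + u2" and 1: "exec S W c1 s1 u1 r" and 2: "exec S W c2 r u2 s''"
    by (rule exec_SeqE)
  from Seq.IH(1)[OF 1] have "t1 = u1" "s2 = r" by simp_all
  with Seq.IH(2) 2 u show ?case by simp
next
  case (CondTrue s b c1 t s' c2)
  from CondTrue.prems CondTrue.hyps obtain v where u: "u = 1 + bcost b + v" and 1: "exec S W c1 s v s''"
    by (auto elim!: exec_CondE)
  from CondTrue.IH[OF 1] u show ?case by simp
next
  case (CondFalse s b c2 t s' c1)
  from CondFalse.prems CondFalse.hyps obtain v where u: "u = 1 + bcost b + v" and 1: "exec S W c2 s v s''"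
    by (auto elim!: exec_CondE)
  from CondFalse.IH[OF 1] u show ?case by simp
next
  case (WhileFalse s b c)
  from WhileFalse.prems show ?case
    by (rule exec_WhileE) (use WhileFalse.hyps in simp_all)
next
  case (WhileTrue s1 b c t1 s2 t2 s3)
  from WhileTrue.prems show ?case
  proof (rule exec_WhileE)
    fix u1 r u2
    assume u: "u = Suc (bcost b + u1 + u2)"
      and 1: "exec S W c s1 u1 r" and 2: "exec S W (While b c) r u2 s''"
    from WhileTrue.IH(1)[OF 1] have "t1 = u1" "s2 = r" by simp_all
    with WhileTrue.IH(2) 2 u show ?case by simp
  qed (use WhileTrue.hyps in simp_all)
qed

definition state_fits :: "nat \<Rightarrow> state \<Rightarrow> bool" where
  "state_fits W s \<longleftrightarrow> (\<forall>x. fst s x \<le> W) \<and> (\<forall>a i. snd s a i \<le> W)"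

lemma aval_fits: "state_fits W s \<Longrightarrow> afits W s e \<Longrightarrow> aval s e \<le> W"
proof (induction e)
  case (Minus e f) then show ?case by (auto intro: le_trans[OF diff_le_self])
next
  case (Div e f) then show ?case by (auto intro: le_trans[OF div_le_dividend])
qed (auto simp: state_fits_def)

lemma exec_fits: "exec S W c s t s' \<Longrightarrow> state_fits W s \<Longrightarrow> state_fits W s'"
  by (induction rule: exec.induct) (use aval_fits in \<open>auto simp: state_fits_def\<close>)

text \<open>The length of the input and \<open>k\<close> are given in registers; all other memory is zero.\<close>

definition initial_state :: "real list \<Rightarrow> nat \<Rightarrow> state" where
  "initial_state S k = ((\<lambda>_. 0)(''n'' := length S, ''k'' := k), \<lambda>_ _. 0)"

definition result :: "state \<Rightarrow> nat" where
  "result s = fst s ''out''"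

text \<open>
  A word can hold numbers up to \<open>(n + k)\<^sup>c\<close> for a constant \<open>c\<close>, i.e. it has \<open>O(log (n + k))\<close> bits.
  The step count is bounded in terms of \<open>n\<close> alone, uniformly in the entries of \<open>S\<close> and in \<open>k\<close>.
\<close>

definition computes_longest_rollercoaster_length_in_time :: "com \<Rightarrow> (nat \<Rightarrow> nat) \<Rightarrow> bool" where
  "computes_longest_rollercoaster_length_in_time P T \<longleftrightarrow>
     (\<exists>c>0. \<forall>(S::real list) k. distinct S \<longrightarrow> k \<ge> 3 \<longrightarrow>
        (\<exists>t s. exec S ((length S + k) ^ c) P (initial_state S k) t s \<and>
           t \<le> T (length S) \<and> result s = longest_rollercoaster_length k S))"

end

theory Submission imports Defs begin

text \<open>
  Let \<open>opt b k S r\<close> be the length of a longest \<open>k\<close>-rollercoaster in the first \<open>r\<close> elements whose last run goes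
  up or down according to \<open>b\<close>. Cutting off the last run, which starts at some \<open>l\<close>, gives
  \<open>opt b k S r = max (max 1 (opt (\<not> b) k S (l + 1)) + lis l r - 1)\<close> over all \<open>l < r\<close> with \<open>lis l r \<ge> k\<close>, where
  \<open>lis l r\<close> is the length of a longest monotone subsequence of the elements \<open>l, \<dots>, r - 1\<close>. It does no
  harm that such a subsequence need not start at \<open>l\<close>: gluing it to a rollercoaster in the first \<open>l + 1\<close> elements
  still gives a rollercoaster of that length.

  All numbers \<open>lis l r\<close> are encoded by one permutation: \<open>r - l - lis l r\<close> counts the \<open>i \<ge> l\<close> with \<open>D i < r\<close>.
  It is computed by divide and conquer on the values; merging the low and the high values is a product of
  permutations whose dominance counts multiply as \<open>(min, +)\<close> matrices, and this product takes
  \<open>O(n log n)\<close> steps, again by divide and conquer. This gives \<open>O(n log\<^sup>2 n)\<close>.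

  When \<open>r\<close> grows by one, \<open>lis l r\<close> grows by one exactly for the \<open>l \<ge> T r\<close> for some threshold \<open>T r\<close>, and the \<open>l\<close> with
  \<open>lis l r \<ge> k\<close> form an initial segment. So the recursion is evaluated with a binary tree that supports adding
  to all \<open>l\<close> above a threshold and taking the overall maximum, in \<open>O(n log n)\<close> steps.
\<close>

section \<open>Products of permutations\<close>

text \<open>Why a product appears: an increasing subsequence of a window \<open>[l, r)\<close> is a
  chain of low values in some \<open>[l, j)\<close> followed by a chain of high values in
  \<open>[j, r)\<close>. For the defect \<open>r - l - lis l r\<close> the maximum over the cuts
  \<open>j\<close> becomes a minimum of sums. Extra strands turn both summands into dominance counts
  of genuine permutations; that their product is again of this form follows since its full counts
  grow by exactly one from each column to the next. The machine has no recursion, so each divide and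
  conquer is unrolled: all blocks of one size are treated in one pass, the arrays of all levels are
  kept, and lengths are padded to a power of two. The recurrences for \<open>opt True\<close> and
  \<open>opt False\<close> feed each other. This is harmless:
  \<open>opt (\<not> b) k S (l + 1)\<close> is asked for only once a chain of length
  \<open>k \<ge> 3\<close> starts at or after \<open>l\<close>, and then \<open>l + 1\<close> lies
  strictly before the current \<open>r\<close>. The number \<open>k\<close> is only ever compared
  with others, which keeps the running time independent of it.\<close>

definition ndom :: "nat set \<Rightarrow> (nat \<Rightarrow> nat) \<Rightarrow> nat \<Rightarrow> nat \<Rightarrow> nat" where
  "ndom X f i k = card {x \<in> X. i \<le> x \<and> f x < k}"

definition ncod :: "nat set \<Rightarrow> (nat \<Rightarrow> nat) \<Rightarrow> nat \<Rightarrow> nat \<Rightarrow> nat" where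
  "ncod Y g j k = card {y \<in> Y. y < k \<and> j \<le> g y}"

text \<open>
  The dominance counts of \<open>r\<close> are the \<open>(min, +)\<close> product of those of \<open>\<alpha>\<close> and of the inverse of \<open>\<beta>\<close>. The second
  factor is given by its inverse because this is the direction in which it is split.
\<close>

definition sticky :: "nat set \<Rightarrow> nat set \<Rightarrow> nat \<Rightarrow> nat \<Rightarrow> (nat \<Rightarrow> nat) \<Rightarrow> (nat \<Rightarrow> nat) \<Rightarrow> (nat \<Rightarrow> nat) \<Rightarrow> bool" where
  "sticky X Y b e \<alpha> \<beta> r \<longleftrightarrow> bij_betw r X Y \<and>
     (\<forall>i k. (\<forall>j\<in>{b..e}. ndom X r i k \<le> ndom X \<alpha> i j + ncod Y \<beta> j k) \<and>
            (\<exists>j\<in>{b..e}. ndom X r i k = ndom X \<alpha> i j + ncod Y \<beta> j k))"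

text \<open>The cut \<open>j = t\<close> leaves the only strand to \<open>\<beta>\<close>, the cut
  \<open>j = Suc t\<close> leaves it to \<open>\<alpha>\<close>. The smaller of the two indicators
  is their product, which is the count of \<open>r\<close>. This is the base case of the divide and
  conquer.\<close>

lemma sticky_singleton:
  assumes "\<alpha> s = t" "\<beta> u = t" "r s = u"
  shows "sticky {s} {u} t (Suc t) \<alpha> \<beta> r"
proof -
  have A: "ndom {s} f i k = (if i \<le> s \<and> f s < k then 1 else 0)" for f i k
    by (auto simp: ndom_def intro: arg_cong[where f=card, of _ "{s}", simplified])
  have B: "ncod {u} f i k = (if u < k \<and> i \<le> f u then 1 else 0)" for f i k
    by (auto simp: ncod_def intro: arg_cong[where f=card, of _ "{u}", simplified])
  show ?thesis
    unfolding sticky_def A B using assms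
    by (auto simp: bij_betw_def intro: bexI[of _ t] bexI[of _ "Suc t"])
qed

section \<open>Merging the products for low and for high intermediate values\<close>

text \<open>Only the intermediate values are separated, into \<open>{b..mid}\<close> and
  \<open>{mid..e}\<close>; the rows and the columns of the two subproblems interleave in
  \<open>{b..<e}\<close>, and sorting this out is the work of the merge.\<close>

locale block_merge =
  fixes b mid e :: nat and \<alpha> \<beta> c :: "nat \<Rightarrow> nat"
  assumes bme: "b \<le> mid" "mid \<le> e"
    and bij_\<alpha>: "bij_betw \<alpha> {b..<e} {b..<e}"
    and bij_\<beta>: "bij_betw \<beta> {b..<e} {b..<e}"
    and lo: "sticky {x\<in>{b..<e}. \<alpha> x < mid} {y\<in>{b..<e}. \<beta> y < mid} b mid \<alpha> \<beta> c"
    and hi: "sticky {x\<in>{b..<e}. mid \<le> \<alpha> x} {y\<in>{b..<e}. mid \<le> \<beta> y} mid e \<alpha> \<beta> c"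
begin

abbreviation "Xlo \<equiv> {x\<in>{b..<e}. \<alpha> x < mid}"
abbreviation "Xhi \<equiv> {x\<in>{b..<e}. mid \<le> \<alpha> x}"
abbreviation "Ylo \<equiv> {y\<in>{b..<e}. \<beta> y < mid}"
abbreviation "Yhi \<equiv> {y\<in>{b..<e}. mid \<le> \<beta> y}"

text \<open>
  The permutation \<open>c\<close> combines the products for low and for high intermediate values. \<open>Flo\<close> and \<open>Fhi\<close> are the
  minima over low and over high intermediate values. Since \<open>Flo - Fhi\<close> is monotone in both arguments, the
  points where the smaller one changes form a staircase, which can be walked along in linear time.
\<close>

definition Flo where "Flo i k = ndom Xlo c i k + card {y \<in> Yhi. y < k}"
definition Fhi where "Fhi i k = card {x \<in> Xlo. i \<le> x} + ndom Xhi c i k"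
definition M where "M i k = min (Flo i k) (Fhi i k)"

lemma bij_lo: "bij_betw c Xlo Ylo" and bij_hi: "bij_betw c Xhi Yhi"
  using lo hi by (auto simp: sticky_def)

lemma c_lo: "x \<in> {b..<e} \<Longrightarrow> c x \<in> {b..<e} \<and> (\<beta> (c x) < mid \<longleftrightarrow> \<alpha> x < mid)"
  using bij_betwE[OF bij_lo] bij_betwE[OF bij_hi]
  by (cases "\<alpha> x < mid") (auto simp: not_less)

lemma inj_c: "inj_on c {b..<e}"
proof (rule inj_onI)
  fix x y assume *: "x \<in> {b..<e}" "y \<in> {b..<e}" "c x = c y"
  then have "\<alpha> x < mid \<longleftrightarrow> \<alpha> y < mid" using c_lo[of x] c_lo[of y] by simp
  then show "x = y" using * bij_betw_imp_inj_on[OF bij_lo] bij_betw_imp_inj_on[OF bij_hi]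
    by (cases "\<alpha> x < mid") (auto simp: inj_on_def not_less)
qed

lemma bij_c: "bij_betw c {b..<e} {b..<e}"
  by (metis (no_types, lifting) c_lo endo_inj_surj finite_atLeastLessThan image_subsetI inj_c inj_on_imp_bij_betw)

text \<open>For a cut \<open>j \<le> mid\<close> the count of \<open>\<alpha>\<close> sees low rows
  only, while that of \<open>\<beta>\<close> contains every high column below \<open>k\<close>; the
  minimum over such cuts is therefore \<open>Flo\<close>. Cuts \<open>j \<ge> mid\<close> give
  \<open>Fhi\<close> in the same way. So \<open>M\<close> is the wanted product of matrices, and
  what remains is to recognize it as the count of a permutation.\<close>

lemma M_le: assumes "j \<in> {b..e}"
  shows "M i k \<le> ndom {b..<e} \<alpha> i j + ncod {b..<e} \<beta> j k" (is ?A)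
    and "\<exists>j\<in>{b..e}. M i k = ndom {b..<e} \<alpha> i j + ncod {b..<e} \<beta> j k" (is ?B)
proof -
  have 1: "ndom {b..<e} \<alpha> i j = ndom Xlo \<alpha> i j" if "j \<le> mid" for j
    unfolding ndom_def using that by (intro arg_cong[where f=card]) auto
  have 2: "ncod {b..<e} \<beta> j k = ncod Ylo \<beta> j k + card {y \<in> Yhi. y < k}" if "j \<le> mid" for j
    unfolding ncod_def using that
    by (subst card_Un_disjoint[symmetric]) (auto intro!: arg_cong[where f=card])
  have 3: "ndom {b..<e} \<alpha> i j = card {x\<in>Xlo. i \<le> x} + ndom Xhi \<alpha> i j" if "mid \<le> j" for j
    unfolding ndom_def using that
    by (subst card_Un_disjoint[symmetric]) (auto intro!: arg_cong[where f=card])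
  have 4: "ncod {b..<e} \<beta> j k = ncod Yhi \<beta> j k" if "mid \<le> j" for j
    unfolding ncod_def using that by (intro arg_cong[where f=card]) auto
  have lo1: "ndom Xlo c i k \<le> ndom Xlo \<alpha> i j + ncod Ylo \<beta> j k" if "b \<le> j" "j \<le> mid" for j
    using lo that unfolding sticky_def by auto
  have hi1: "ndom Xhi c i k \<le> ndom Xhi \<alpha> i j + ncod Yhi \<beta> j k" if "mid \<le> j" "j \<le> e" for j
    using hi that unfolding sticky_def by auto
  show ?A
  proof (cases "j \<le> mid")
    case True then show ?thesis using lo1[of j] assms by (simp add: M_def Flo_def 1 2)
  next
    case False then show ?thesis using hi1[of j] assms by (simp add: M_def Fhi_def 3 4)
  qed
  obtain j1 where j1: "b \<le> j1" "j1 \<le> mid" "ndom Xlo c i k = ndom Xlo \<alpha> i j1 + ncod Ylo \<beta> j1 k"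
    using lo unfolding sticky_def by fastforce
  obtain j2 where j2: "mid \<le> j2" "j2 \<le> e" "ndom Xhi c i k = ndom Xhi \<alpha> i j2 + ncod Yhi \<beta> j2 k"
    using hi unfolding sticky_def by fastforce
  have e1: "Flo i k = ndom {b..<e} \<alpha> i j1 + ncod {b..<e} \<beta> j1 k" using j1 by (simp add: Flo_def 1 2)
  have e2: "Fhi i k = ndom {b..<e} \<alpha> i j2 + ncod {b..<e} \<beta> j2 k" using j2 by (simp add: Fhi_def 3 4)
  have "M i k = Flo i k \<or> M i k = Fhi i k" by (auto simp: M_def min_def)
  then show ?B
    using e1 e2 j1(1,2) j2(1,2) bme by (metis atLeastAtMost_iff order_trans)
qed

text \<open>The increment of \<open>Fhi\<close> exceeds that of \<open>Flo\<close> by 0 or 1 in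
  every case, so \<open>Fhi - Flo\<close> grows by 0 or 1 on the way up to row
  \<open>i\<close>.\<close>

lemma row_step:
  assumes "i \<in> {b..<e}"
  shows "Flo i k = Flo (Suc i) k + (if \<alpha> i < mid \<and> c i < k then 1 else 0)"
    and "Fhi i k = Fhi (Suc i) k + (if \<alpha> i < mid \<or> c i < k then 1 else 0)"
proof -
  have A: "ndom X c i k = ndom X c (Suc i) k + (if i \<in> X \<and> c i < k then 1 else 0)" if "finite X" for X
  proof -
    have "{x\<in>X. i \<le> x \<and> c x < k} = (if i \<in> X \<and> c i < k then insert i {x\<in>X. Suc i \<le> x \<and> c x < k} else {x\<in>X. Suc i \<le> x \<and> c x < k})"
      by (auto simp: Suc_le_eq order_le_less)
    then show ?thesis using that by (simp add: ndom_def)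
  qed
  have B: "card {x\<in>Xlo. i \<le> x} = card {x\<in>Xlo. Suc i \<le> x} + (if i \<in> Xlo then 1 else 0)"
  proof -
    have "{x\<in>Xlo. i \<le> x} = (if i \<in> Xlo then insert i {x\<in>Xlo. Suc i \<le> x} else {x\<in>Xlo. Suc i \<le> x})"
      by (auto simp: Suc_le_eq order_le_less)
    then show ?thesis by simp
  qed
  show "Flo i k = Flo (Suc i) k + (if \<alpha> i < mid \<and> c i < k then 1 else 0)"
    unfolding Flo_def by (subst A) (use assms in auto)
  show "Fhi i k = Fhi (Suc i) k + (if \<alpha> i < mid \<or> c i < k then 1 else 0)"
    unfolding Fhi_def by (subst A, simp, subst B) (use assms in auto)
qed

text \<open>Here the increment of \<open>Flo\<close> is the larger one, so \<open>Fhi - Flo\<close>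
  falls by 0 or 1 when column \<open>k\<close> is passed. The amount is decided by the class of the
  column and by comparing the current row with the row \<open>w\<close> of its point.\<close>

lemma col_step:
  assumes "w \<in> {b..<e}" and k: "k = c w"
  shows "Flo i (Suc k) = Flo i k + (if \<beta> k < mid then (if i \<le> w then 1 else 0) else 1)"
    and "Fhi i (Suc k) = Fhi i k + (if \<beta> k < mid then 0 else (if i \<le> w then 1 else 0))"
proof -
  have A: "ndom X c i (Suc k) = ndom X c i k + (if w \<in> X \<and> i \<le> w then 1 else 0)" if "X \<subseteq> {b..<e}" for X
  proof -
    have "finite X" using that finite_subset by blast
    have inj: "c x = k \<longleftrightarrow> x = w" if "x \<in> X" for x
      unfolding k using inj_on_eq_iff[OF inj_c subsetD[OF \<open>X \<subseteq> {b..<e}\<close> that] assms(1)] .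
    have "{x\<in>X. i \<le> x \<and> c x < Suc k} = (if w \<in> X \<and> i \<le> w then insert w {x\<in>X. i \<le> x \<and> c x < k} else {x\<in>X. i \<le> x \<and> c x < k})"
      by (auto simp: less_Suc_eq inj eq_commute[of k])
    note eq = this
    show ?thesis
      unfolding ndom_def eq using \<open>finite X\<close> k by simp
  qed
  have kk: "k \<in> {b..<e}" "\<beta> k < mid \<longleftrightarrow> \<alpha> w < mid" using c_lo[OF assms(1)] k by auto
  have B: "card {y\<in>Yhi. y < Suc k} = card {y\<in>Yhi. y < k} + (if k \<in> Yhi then 1 else 0)"
  proof -
    have "{y\<in>Yhi. y < Suc k} = (if k \<in> Yhi then insert k {y\<in>Yhi. y < k} else {y\<in>Yhi. y < k})"
      by (auto simp: less_Suc_eq)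
    then show ?thesis by simp
  qed
  show "Flo i (Suc k) = Flo i k + (if \<beta> k < mid then (if i \<le> w then 1 else 0) else 1)"
    unfolding Flo_def by (subst A, force, subst B) (use assms kk in auto)
  show "Fhi i (Suc k) = Fhi i k + (if \<beta> k < mid then 0 else (if i \<le> w then 1 else 0))"
    unfolding Fhi_def by (subst A, force) (use assms kk in auto)
qed

lemma col_step_outside:
  assumes "k \<notin> {b..<e}"
  shows "Flo i (Suc k) = Flo i k" and "Fhi i (Suc k) = Fhi i k"
proof -
  have "{x\<in>X. i \<le> x \<and> c x < Suc k} = {x\<in>X. i \<le> x \<and> c x < k}" if "X \<subseteq> {b..<e}" for X
    using c_lo assms that by (force simp: less_Suc_eq)
  then have A: "ndom X c i (Suc k) = ndom X c i k" if "X \<subseteq> {b..<e}" for X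
    using that by (simp add: ndom_def)
  have B: "{y\<in>Yhi. y < Suc k} = {y\<in>Yhi. y < k}" using assms by (auto simp: less_Suc_eq)
  show "Flo i (Suc k) = Flo i k" unfolding Flo_def B by (subst A) auto
  show "Fhi i (Suc k) = Fhi i k" unfolding Fhi_def by (subst A) auto
qed

text \<open>Monotonicity of \<open>Flo - Fhi\<close> in the column, rearranged so that no truncated
  subtraction occurs.\<close>

lemma delta_mono:
  assumes "k \<le> k'" shows "Flo i k + Fhi i k' \<le> Flo i k' + Fhi i k"
  using assms
proof (induction k' rule: dec_induct)
  case base then show ?case by simp
next
  case (step n)
  show ?case
  proof (cases "n \<in> {b..<e}")
    case True
    then obtain w where "w \<in> {b..<e}" "n = c w" using bij_c unfolding bij_betw_def by (metis imageE)
    from col_step[OF this, of i] step show ?thesis by (auto split: if_splits)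
  next
    case False then show ?thesis using col_step_outside[OF False, of i] step by simp
  qed
qed

text \<open>In the last column both sides count all low rows from \<open>i\<close> on, and the high
  rows counted by \<open>Fhi\<close> are no more than the high columns counted by
  \<open>Flo\<close>, because the two high classes have the same size. So the walk never has to
  leave the block to the right.\<close>

lemma F_end:
  shows "Fhi i e \<le> Flo i e"
proof -
  have "ndom Xlo c i e = card {x\<in>Xlo. i \<le> x}"
    unfolding ndom_def using c_lo by (intro arg_cong[where f=card]) fastforce
  moreover have "ndom Xhi c i e \<le> card Xhi" unfolding ndom_def by (intro card_mono) auto
  moreover have "card Xhi = card Yhi" using bij_hi bij_betw_same_card by blast
  moreover have "{y \<in> Yhi. y < e} = Yhi" by auto
  ultimately show ?thesis by (simp add: Flo_def Fhi_def)
qed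

lemma F_start: "Flo e b = 0" "Fhi e b = 0"
proof -
  have 1: "{x \<in> X. e \<le> x \<and> c x < b} = {}" if "X \<subseteq> {b..<e}" for X using that by auto
  have 2: "{y \<in> Yhi. y < b} = {}" "{x \<in> Xlo. e \<le> x} = {}" by auto
  show "Flo e b = 0" "Fhi e b = 0" unfolding Flo_def Fhi_def ndom_def 2 by (subst 1; auto)+
qed

text \<open>If \<open>k < e\<close>, column \<open>k\<close> is the last one with
  \<open>Flo \<le> Fhi\<close> in row \<open>Suc i\<close>: up to \<open>k\<close> the minimum
  \<open>M\<close> is \<open>Flo\<close>, beyond it is \<open>Fhi\<close>. Adding row
  \<open>i\<close> raises \<open>M\<close> by the increment of \<open>Flo\<close> on the left and by
  that of \<open>Fhi\<close> on the right. If \<open>rs\<close> holds, these are constantly 0 and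
  constantly 1, and the point of the row is at \<open>k\<close>; otherwise they fit together to the
  step at \<open>c i\<close>.\<close>

lemma ant_row:
  fixes i k defines "rs \<equiv> (if \<alpha> i < mid then k \<le> c i else c i < k)"
  assumes i: "i \<in> {b..<e}" and k: "b \<le> k" "k \<le> e" and eq: "Flo (Suc i) k = Fhi (Suc i) k"
    and next_col: "k = e \<or> Flo (Suc i) (Suc k) = Suc (Fhi (Suc i) (Suc k))"
  shows "Flo i k + (if rs then 1 else 0) = Fhi i k"
    and "M i k' = M (Suc i) k' + (if (if rs then k else c i) < k' then 1 else 0)"
    and "rs \<Longrightarrow> k < e"
proof -
  show A: "Flo i k + (if rs then 1 else 0) = Fhi i k"
    using row_step[OF i, of k] eq by (auto simp: rs_def)
  show B: "k < e" if rs
  proof (rule ccontr)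
    assume "\<not> k < e" then have "k = e" using k by simp
    then show False using F_end[of i] A that by simp
  qed
  have le: "Flo (Suc i) k' \<le> Fhi (Suc i) k'" if "k' \<le> k" using delta_mono[OF that, of "Suc i"] eq by simp
  have ge: "Fhi (Suc i) k' + 1 \<le> Flo (Suc i) k'" if "k < k'" "k < e"
    using delta_mono[of "Suc k" k' "Suc i"] next_col that by simp
  have ge2: "Fhi (Suc i) k' \<le> Flo (Suc i) k'" if "k < k'"
    using delta_mono[of "k" k' "Suc i"] eq that by simp
  note rsx = row_step[OF i, of k']
  show "M i k' = M (Suc i) k' + (if (if rs then k else c i) < k' then 1 else 0)"
  proof (cases "k' \<le> k")
    case True
    then show ?thesis using le[OF True] rsx by (auto simp: M_def rs_def)
  next
    case False
    then have kk: "k < k'" by simp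
    show ?thesis
    proof (cases "k < e")
      case True then show ?thesis using ge[OF kk True] rsx kk by (auto simp: M_def rs_def)
    next
      case False
      then have "\<not> rs" using B by blast
      moreover have "c i < e" using c_lo[OF i] by simp
      ultimately show ?thesis using ge2[OF kk] rsx kk k False by (auto simp: M_def rs_def split: if_splits)
    qed
  qed
qed

text \<open>Summing the row increments from row \<open>e\<close> upwards shows that the dominance
  counts of \<open>r\<close> are \<open>M\<close>. Bijectivity comes from
  \<open>M b k = k - b\<close>: each column adds one to the full count and hence must contain a
  point of \<open>r\<close>.\<close>

lemma sticky_of_rows:
  assumes rows: "\<And>i k. i \<in> {b..<e} \<Longrightarrow> M i k = M (Suc i) k + (if r i < k then 1 else 0)"
    and r: "\<And>i. i \<in> {b..<e} \<Longrightarrow> r i \<in> {b..<e}"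
  shows "sticky {b..<e} {b..<e} b e \<alpha> \<beta> r"
proof -
  let ?X = "{b..<e}"
  have be: "b \<le> e" using bme by simp
  have nd: "ndom ?X r i k = ndom ?X r (Suc i) k + (if r i < k then 1 else 0)" if "i \<in> ?X" for i k
  proof -
    have "{x\<in>?X. i \<le> x \<and> r x < k} = (if r i < k then insert i {x\<in>?X. Suc i \<le> x \<and> r x < k} else {x\<in>?X. Suc i \<le> x \<and> r x < k})"
      using that by (auto simp: Suc_le_eq order_le_less)
    then show ?thesis by (simp add: ndom_def)
  qed
  have Me: "M e k = 0" for k
  proof -
    have 1: "{x \<in> X. e \<le> x \<and> c x < k} = {}" if "X \<subseteq> {b..<e}" for X using that by auto
    have 2: "{x \<in> Xlo. e \<le> x} = {}" by auto
    have "Fhi e k = 0" unfolding Fhi_def ndom_def 2 by (subst 1; auto)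
    then show ?thesis by (simp add: M_def)
  qed
  have main: "b \<le> i \<Longrightarrow> i \<le> e \<Longrightarrow> ndom ?X r i k = M i k" for i k
  proof (induction "e - i" arbitrary: i)
    case 0 then have "i = e" by simp
    moreover have "{x \<in> ?X. e \<le> x \<and> r x < k} = {}" by auto
    ultimately show ?case by (simp add: Me ndom_def)
  next
    case (Suc d)
    then have "ndom ?X r (Suc i) k = M (Suc i) k" by simp
    then show ?case using nd[of i k] rows[of i k] Suc by simp
  qed
  \<comment> \<open>\<open>sticky\<close> quantifies over all natural numbers \<open>i\<close>. Rows
    before the block count like row \<open>b\<close>, and from row \<open>e\<close> on everything is
    0.\<close>
  have M_big: "M i k = ndom ?X r i k" for i k
  proof (cases "b \<le> i")
    case True
    show ?thesis
    proof (cases "i \<le> e")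
      case True then show ?thesis using main \<open>b \<le> i\<close> by simp
    next
      case False
      have 1: "{x \<in> X. i \<le> x \<and> c x < k} = {}" if "X \<subseteq> {b..<e}" for X using that False by auto
      have 2: "{x \<in> Xlo. i \<le> x} = {}" "{x \<in> ?X. i \<le> x \<and> r x < k} = {}" using False by auto
      have "Fhi i k = 0" unfolding Fhi_def ndom_def 2 by (subst 1; auto)
      then show ?thesis using 2 by (simp add: M_def ndom_def)
    qed
  next
    case False
    have eq: "{x \<in> X. i \<le> x \<and> f x < k} = {x \<in> X. b \<le> x \<and> f x < k}" if "X \<subseteq> {b..<e}" for X and f :: "nat \<Rightarrow> nat"
      using that False by auto
    have eq2: "{x \<in> Xlo. i \<le> x} = {x \<in> Xlo. b \<le> x}" using False by auto
    have nd: "ndom X f i k = ndom X f b k" if "X \<subseteq> {b..<e}" for X f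
      unfolding ndom_def by (subst eq[OF that]) simp
    have n: "ndom Xlo c i k = ndom Xlo c b k" "ndom Xhi c i k = ndom Xhi c b k"
      using nd[of Xlo c] nd[of Xhi c] by blast+
    have "M i k = M b k" by (simp only: M_def Flo_def Fhi_def eq2 n)
    also have "\<dots> = ndom ?X r b k" using main[of b k] be by simp
    also have "\<dots> = ndom ?X r i k" using nd[of ?X r] by simp
    finally show ?thesis .
  qed
  have Mb: "M b k = k - b" if k: "b \<le> k" "k \<le> e" for k
  proof -
    have "c ` {x\<in>Xlo. b \<le> x \<and> c x < k} = {y\<in>Ylo. y < k}"
      using bij_lo unfolding bij_betw_def by auto
    moreover have "card (c ` {x\<in>Xlo. b \<le> x \<and> c x < k}) = card {x\<in>Xlo. b \<le> x \<and> c x < k}"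
      by (rule card_image, rule inj_on_subset[OF inj_c]) auto
    ultimately have L: "ndom Xlo c b k = card {y\<in>Ylo. y < k}" by (simp only: ndom_def)
    have "c ` {x\<in>Xhi. b \<le> x \<and> c x < k} = {y\<in>Yhi. y < k}"
      using bij_hi unfolding bij_betw_def by auto
    moreover have "card (c ` {x\<in>Xhi. b \<le> x \<and> c x < k}) = card {x\<in>Xhi. b \<le> x \<and> c x < k}"
      by (rule card_image, rule inj_on_subset[OF inj_c]) auto
    ultimately have H: "ndom Xhi c b k = card {y\<in>Yhi. y < k}" by (simp only: ndom_def)
    have "{x \<in> Xlo. b \<le> x} = Xlo" by auto
    then have "card {x \<in> Xlo. b \<le> x} = card Ylo" using bij_betw_same_card[OF bij_lo] by simp
    moreover have "card {y\<in>Ylo. y < k} \<le> card Ylo" by (intro card_mono) auto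
    ultimately have "M b k = card {y\<in>Ylo. y < k} + card {y\<in>Yhi. y < k}"
      unfolding M_def Flo_def Fhi_def L H by simp
    also have "\<dots> = card ({y\<in>Ylo. y < k} \<union> {y\<in>Yhi. y < k})"
      by (subst card_Un_disjoint) auto
    also have "{y\<in>Ylo. y < k} \<union> {y\<in>Yhi. y < k} = {b..<k}" using k by auto
    finally show ?thesis by simp
  qed
  have surj: "y \<in> r ` ?X" if "y \<in> ?X" for y
  proof (rule ccontr)
    assume no: "y \<notin> r ` ?X"
    have "{x\<in>?X. b \<le> x \<and> r x < Suc y} = {x\<in>?X. b \<le> x \<and> r x < y}"
      using no by (auto simp: less_Suc_eq)
    then have "M b (Suc y) = M b y" by (simp add: M_big ndom_def)
    then show False using Mb[of y] Mb[of "Suc y"] that by (simp add: Suc_diff_le)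
  qed
  have "r ` ?X = ?X" using surj r by (intro equalityI subsetI) auto
  then have "bij_betw r ?X ?X" by (simp add: bij_betw_def eq_card_imp_inj_on)
  moreover have "b \<in> {b..e}" using be by simp
  ultimately show ?thesis unfolding sticky_def M_big[symmetric] using M_le by blast
qed

end

section \<open>Transport of products along order embeddings\<close>

text \<open>The threshold \<open>i'\<close> is the image of the least row that is at least
  \<open>i\<close>, or a number above all images if there is none. It is chosen before
  \<open>h\<close>, so that one \<open>i'\<close> serves \<open>\<alpha>\<close> and
  \<open>r\<close> alike.\<close>

lemma ndom_transport:
  assumes f: "strict_mono_on X f" and fin: "finite X"
  obtains i' where "\<And>h' h k. (\<And>x. x \<in> X \<Longrightarrow> h' (f x) = h x) \<Longrightarrow> ndom X h i k = ndom (f ` X) h' i' k"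
proof (cases "{x\<in>X. i \<le> x} = {}")
  case True
  show ?thesis
  proof (rule that[of "Suc (Max (insert 0 (f ` X)))"])
    fix h' h :: "nat \<Rightarrow> nat" and k
    have 1: "{x \<in> X. i \<le> x \<and> h x < k} = {}" using True by auto
    have 2: "{x \<in> f ` X. Suc (Max (insert 0 (f ` X))) \<le> x \<and> h' x < k} = {}"
      using fin by (auto simp: Suc_le_eq)
    show "ndom X h i k = ndom (f ` X) h' (Suc (Max (insert 0 (f ` X)))) k"
      by (simp only: ndom_def 1 2)
  qed
next
  case False
  let ?m = "Min {x\<in>X. i \<le> x}"
  have m: "?m \<in> {x\<in>X. i \<le> x}" using False fin by (intro Min_in) auto
  have iff: "i \<le> x \<longleftrightarrow> f ?m \<le> f x" if "x \<in> X" for x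
  proof
    assume "i \<le> x" then have "?m \<le> x" using that fin by (intro Min_le) auto
    then show "f ?m \<le> f x" using f m that by (auto simp: strict_mono_on_leD)
  next
    assume "f ?m \<le> f x" then have "?m \<le> x" using f m that
      by (metis (mono_tags, lifting) linorder_not_le mem_Collect_eq strict_mono_onD)
    then show "i \<le> x" using m by auto
  qed
  have inj: "inj_on f X" using f strict_mono_on_imp_inj_on by blast
  show ?thesis
  proof (rule that[of "f ?m"])
    fix h' h :: "nat \<Rightarrow> nat" and k
    assume h: "\<And>x. x \<in> X \<Longrightarrow> h' (f x) = h x"
    have "{x \<in> f ` X. f ?m \<le> x \<and> h' x < k} = f ` {x \<in> X. i \<le> x \<and> h x < k}"
      using h iff by auto
    moreover have "inj_on f {x \<in> X. i \<le> x \<and> h x < k}" by (rule inj_on_subset[OF inj]) auto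
    ultimately show "ndom X h i k = ndom (f ` X) h' (f ?m) k" by (simp add: ndom_def card_image)
  qed
qed

lemma cut_transport:
  fixes f :: "nat \<Rightarrow> nat"
  assumes f: "strict_mono_on X f" and fin: "finite X"
  obtains k' where "\<And>x. x \<in> X \<Longrightarrow> x < k \<longleftrightarrow> f x < k'"
proof (cases "{x\<in>X. k \<le> x} = {}")
  case True
  have "x < k \<longleftrightarrow> f x < Suc (Max (insert 0 (f ` X)))" if "x \<in> X" for x
  proof -
    have "f x \<le> Max (insert 0 (f ` X))" using fin that by simp
    then show ?thesis using True that by (auto simp: less_Suc_eq_le)
  qed
  then show ?thesis using that by blast
next
  case False
  let ?m = "Min {x\<in>X. k \<le> x}"
  have m: "?m \<in> {x\<in>X. k \<le> x}" using False fin by (intro Min_in) auto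
  have "x < k \<longleftrightarrow> f x < f ?m" if x: "x \<in> X" for x
  proof
    assume "x < k" then show "f x < f ?m" using m f x by (auto intro: strict_mono_onD)
  next
    assume *: "f x < f ?m"
    show "x < k"
    proof (rule ccontr)
      assume "\<not> x < k" then have "?m \<le> x" using x fin by (intro Min_le) auto
      then show False using * f m x by (metis (mono_tags, lifting) linorder_not_le mem_Collect_eq strict_mono_on_leD)
    qed
  qed
  then show ?thesis using that by blast
qed

text \<open>Only the order among the rows and among the columns enters a product, so it may be
  computed after renumbering both increasingly. The intermediate values stay as they are.\<close>

lemma sticky_transport:
  assumes st: "sticky (f ` X) (g ` Y) b e \<alpha>' \<beta>' r'"
    and f: "strict_mono_on X f" and g: "strict_mono_on Y g" and fin: "finite X" "finite Y"
    and \<alpha>: "\<And>x. x \<in> X \<Longrightarrow> \<alpha>' (f x) = \<alpha> x" and \<beta>: "\<And>y. y \<in> Y \<Longrightarrow> \<beta>' (g y) = \<beta> y"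
    and r: "\<And>x. x \<in> X \<Longrightarrow> r x \<in> Y \<and> g (r x) = r' (f x)"
  shows "sticky X Y b e \<alpha> \<beta> r"
proof -
  have injf: "inj_on f X" and injg: "inj_on g Y" using f g strict_mono_on_imp_inj_on by blast+
  have bij': "bij_betw r' (f ` X) (g ` Y)" using st by (simp add: sticky_def)
  have "inj_on r X"
    by (rule inj_onI) (metis bij' bij_betw_imp_inj_on injf inj_on_eq_iff imageI r)
  moreover have "r ` X = Y"
  proof
    show "r ` X \<subseteq> Y" using r by auto
    show "Y \<subseteq> r ` X"
    proof
      fix y assume y: "y \<in> Y"
      then have "g y \<in> r' ` (f ` X)" using bij' by (auto simp: bij_betw_def)
      then obtain x where "x \<in> X" "g y = r' (f x)" by auto
      then have "r x = y" using r[of x] y injg by (metis inj_on_eq_iff)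
      then show "y \<in> r ` X" using \<open>x \<in> X\<close> by auto
    qed
  qed
  ultimately have bij: "bij_betw r X Y" by (simp add: bij_betw_def)
  { fix i k
    obtain i' where i': "\<And>h' h k. (\<And>x. x \<in> X \<Longrightarrow> h' (f x) = h x) \<Longrightarrow> ndom X h i k = ndom (f ` X) h' i' k"
      using ndom_transport[OF f fin(1)] by blast
    obtain k' where k': "\<And>x. x \<in> Y \<Longrightarrow> x < k \<longleftrightarrow> g x < k'"
      using cut_transport[OF g fin(2)] by blast
    have 1: "ndom X \<alpha> i j = ndom (f ` X) \<alpha>' i' j" for j by (rule i'[of \<alpha>' \<alpha>]) (rule \<alpha>)
    have "ndom X r i k = ndom X (\<lambda>x. g (r x)) i k'"
      unfolding ndom_def using r k' by (intro arg_cong[where f=card]) auto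
    also have "\<dots> = ndom (f ` X) r' i' k'" by (rule i') (use r in simp)
    finally have 2: "ndom X r i k = ndom (f ` X) r' i' k'" .
    have 3: "ncod Y \<beta> j k = ncod (g ` Y) \<beta>' j k'" for j
    proof -
      have "{y \<in> g ` Y. y < k' \<and> j \<le> \<beta>' y} = g ` {y \<in> Y. y < k \<and> j \<le> \<beta> y}"
        using k' \<beta> by auto
      moreover have "inj_on g {y \<in> Y. y < k \<and> j \<le> \<beta> y}" by (rule inj_on_subset[OF injg]) auto
      ultimately show ?thesis by (simp add: ncod_def card_image)
    qed
    have "(\<forall>j\<in>{b..e}. ndom X r i k \<le> ndom X \<alpha> i j + ncod Y \<beta> j k) \<and>
            (\<exists>j\<in>{b..e}. ndom X r i k = ndom X \<alpha> i j + ncod Y \<beta> j k)"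
      unfolding 1 2 3 using st unfolding sticky_def by blast }
  then show ?thesis using bij by (simp add: sticky_def)
qed

section \<open>Blocks and stable counting sort\<close>

text \<open>
  The position of \<open>i\<close> after a stable counting sort by the block of size \<open>z\<close> that contains \<open>a i\<close>.
\<close>

definition dst :: "(nat \<Rightarrow> nat) \<Rightarrow> nat \<Rightarrow> nat \<Rightarrow> nat" where
  "dst a z i = (a i div z) * z + card {i'. i' < i \<and> a i' div z = a i div z}"

definition block_perm :: "nat \<Rightarrow> nat \<Rightarrow> (nat \<Rightarrow> nat) \<Rightarrow> bool" where
  "block_perm w z a \<longleftrightarrow> bij_betw a {..<w} {..<w} \<and> (\<forall>x<w. a x div z = x div z)"

text \<open>The products of all blocks of one size sit side by side in a single array, so that a
  whole level of the recursion is one object.\<close>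

definition block_sticky :: "nat \<Rightarrow> nat \<Rightarrow> (nat \<Rightarrow> nat) \<Rightarrow> (nat \<Rightarrow> nat) \<Rightarrow> (nat \<Rightarrow> nat) \<Rightarrow> bool" where
  "block_sticky w z \<alpha> \<beta> r \<longleftrightarrow>
    (\<forall>q. q * z < w \<longrightarrow> sticky {q*z..<q*z+z} {q*z..<q*z+z} (q*z) (q*z+z) \<alpha> \<beta> r)"

lemma div_eq_iff_block: "0 < z \<Longrightarrow> x div z = q \<longleftrightarrow> x \<in> {q*z..<q*z+z}" for z :: nat
  by (metis add.commute atLeastLessThan_iff div_nat_eqI dividend_less_div_times
      div_mult_self1_is_m div_times_less_eq_dividend mult.commute mult_Suc_right)

lemma block_in_range:
  fixes z w q :: nat
  assumes "z dvd w" "q * z < w" shows "q * z + z \<le> w"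
proof -
  obtain k where "w = z * k" using assms by (auto elim: dvdE)
  then have "q < k" using assms by (metis mult.commute mult_less_cancel1)
  then have "Suc q * z \<le> k * z" by (intro mult_le_mono1) simp
  then show ?thesis using \<open>w = z * k\<close> by (simp add: mult.commute)
qed

lemma dst_class_card:
  assumes a: "bij_betw a {..<w} {..<w}" and z: "0 < z" "z dvd w" and i: "i < w"
  shows "card {i'. i' < i \<and> a i' div z = a i div z} < z" "(a i div z) * z + z \<le> w"
proof -
  let ?q = "a i div z"
  have ai: "a i < w" using a i by (auto dest: bij_betwE)
  then have "?q * z < w" using div_times_less_eq_dividend[of "a i" z] by linarith
  then show le: "?q * z + z \<le> w" using block_in_range z by blast
  have sub: "{i'. i' < i \<and> a i' div z = ?q} \<subset> {i'. i' < w \<and> a i' div z = ?q}"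
    using i by auto
  have "a ` {i'. i' < w \<and> a i' div z = ?q} \<subseteq> {?q*z..<?q*z+z}"
    using div_eq_iff_block[OF z(1)] by blast
  moreover have "inj_on a {i'. i' < w \<and> a i' div z = ?q}"
    using a by (auto simp: bij_betw_def intro: inj_on_subset)
  ultimately have "card {i'. i' < w \<and> a i' div z = ?q} \<le> z"
    using card_inj_on_le[of a _ "{?q*z..<?q*z+z}"] by fastforce
  moreover have "card {i'. i' < i \<and> a i' div z = ?q} < card {i'. i' < w \<and> a i' div z = ?q}"
    by (rule psubset_card_mono[OF _ sub]) simp
  ultimately show "card {i'. i' < i \<and> a i' div z = ?q} < z" by simp
qed

lemma dst_div:
  assumes "bij_betw a {..<w} {..<w}" "0 < z" "z dvd w" "i < w"
  shows "dst a z i div z = a i div z" "dst a z i < w"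
proof -
  let ?c = "card {i'. i' < i \<and> a i' div z = a i div z}"
  note c = dst_class_card[OF assms]
  have "(a i div z * z + ?c) div z = a i div z" using c(1) by simp
  then show "dst a z i div z = a i div z" by (simp only: dst_def)
  have "a i div z * z + ?c < w" using c by linarith
  then show "dst a z i < w" by (simp only: dst_def)
qed

lemma dst_mono:
  assumes "i < j" "a i div z = a j div z"
  shows "dst a z i < dst a z j"
proof -
  have "{i'. i' < i \<and> a i' div z = a i div z} \<subset> {i'. i' < j \<and> a i' div z = a j div z}"
    using assms by (auto simp: psubset_eq)
  then show ?thesis using assms by (simp add: dst_def psubset_card_mono)
qed

lemma dst_bij:
  assumes "bij_betw a {..<w} {..<w}" "0 < z" "z dvd w"
  shows "bij_betw (dst a z) {..<w} {..<w}"
proof -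
  have "inj_on (dst a z) {..<w}"
  proof (rule inj_onI)
    fix i j assume *: "i \<in> {..<w}" "j \<in> {..<w}" "dst a z i = dst a z j"
    then have "a i div z = a j div z" using dst_div[OF assms] by (metis lessThan_iff)
    then show "i = j" using dst_mono[of i j a z] dst_mono[of j i a z] *
      by (metis less_irrefl linorder_less_linear)
  qed
  moreover have "dst a z ` {..<w} \<subseteq> {..<w}" using dst_div[OF assms] by auto
  ultimately show ?thesis
    by (simp add: bij_betw_def endo_inj_surj)
qed

lemma dst_image:
  assumes "bij_betw a {..<w} {..<w}" "0 < z" "z dvd w" "q * z < w"
  shows "dst a z ` {i. i < w \<and> a i div z = q} = {q*z..<q*z+z}"
proof -
  note b = dst_bij[OF assms(1-3)] note d = dst_div[OF assms(1-3)]
  have w: "q * z + z \<le> w" using block_in_range assms by blast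
  show ?thesis
  proof (intro equalityI subsetI)
    fix s assume "s \<in> dst a z ` {i. i < w \<and> a i div z = q}"
    then obtain i where "i < w" "a i div z = q" "s = dst a z i" by auto
    then show "s \<in> {q*z..<q*z+z}" using d[of i] div_eq_iff_block[OF assms(2), of s q] by simp
  next
    fix s assume s: "s \<in> {q*z..<q*z+z}"
    then have "s \<in> {..<w}" using w by auto
    then obtain i where "i < w" "s = dst a z i" using b by (auto simp: bij_betw_def)
    moreover have "s div z = q" using s div_eq_iff_block[OF assms(2)] by blast
    ultimately show "s \<in> dst a z ` {i. i < w \<and> a i div z = q}" using d[of i] by auto
  qed
qed

text \<open>Sorting moves the entries of each class into the block with the number of the class, so
  the sorted array preserves blocks of the smaller size and can be split further.\<close>

lemma dst_block_perm:
  assumes a: "bij_betw a {..<w} {..<w}" and z: "0 < z" "z dvd w"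
    and a': "\<And>i. i < w \<Longrightarrow> a' (dst a z i) = a i"
  shows "block_perm w z a'"
proof -
  note b = dst_bij[OF a z]
  have "bij_betw (a' \<circ> dst a z) {..<w} {..<w}"
    using a a' by (subst bij_betw_cong[of _ _ a]) auto
  then have "bij_betw a' {..<w} {..<w}"
    using b bij_betw_comp_iff by blast
  moreover have "a' x div z = x div z" if x: "x < w" for x
  proof -
    obtain i where "i < w" "x = dst a z i" using b x by (auto simp: bij_betw_def)
    then show ?thesis using a' dst_div[OF a z] by simp
  qed
  ultimately show ?thesis by (simp add: block_perm_def)
qed

lemma block_perm_bij_block:
  assumes "block_perm w z a" "0 < z" "q * z + z \<le> w"
  shows "bij_betw a {q*z..<q*z+z} {q*z..<q*z+z}"
proof -
  have "a ` {q*z..<q*z+z} \<subseteq> {q*z..<q*z+z}"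
  proof
    fix y assume "y \<in> a ` {q*z..<q*z+z}"
    then obtain x where x: "x \<in> {q*z..<q*z+z}" "y = a x" by auto
    then have "x div z = q" using div_eq_iff_block[OF assms(2)] by blast
    moreover have "x < w" using x assms(3) by auto
    ultimately have "y div z = q" using x(2) assms(1) by (simp add: block_perm_def)
    then show "y \<in> {q*z..<q*z+z}" using div_eq_iff_block[OF assms(2)] by blast
  qed
  moreover have "inj_on a {q*z..<q*z+z}"
    using assms by (auto simp: block_perm_def bij_betw_def intro: inj_on_subset)
  ultimately show ?thesis by (simp add: bij_betw_def endo_inj_surj)
qed

text \<open>The low and the high rows of block \<open>q\<close> of size \<open>2*z\<close> are the
  classes \<open>2*q\<close> and \<open>2*q+1\<close> of the division into blocks of size
  \<open>z\<close>; this links the halves in \<open>block_merge\<close> to the classes of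
  \<open>dst\<close>.\<close>

lemma half_block:
  assumes a: "block_perm w (2*z) a" and z: "0 < z" "2*z dvd w" and q: "q * (2*z) < w"
  shows "{x\<in>{q*(2*z)..<q*(2*z)+2*z}. a x < q*(2*z)+z} = {i. i < w \<and> a i div z = 2*q}"
    and "{x\<in>{q*(2*z)..<q*(2*z)+2*z}. q*(2*z)+z \<le> a x} = {i. i < w \<and> a i div z = 2*q+1}"
proof -
  have w: "q*(2*z)+2*z \<le> w" using block_in_range[OF z(2) q] .
  have iff: "i \<in> {q*(2*z)..<q*(2*z)+2*z} \<longleftrightarrow> a i \<in> {q*(2*z)..<q*(2*z)+2*z}" if "i < w" for i
    using a that div_eq_iff_block[of "2*z" i q] div_eq_iff_block[of "2*z" "a i" q] z
    by (simp add: block_perm_def)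
  have A: "a i div z = 2*q \<longleftrightarrow> a i \<in> {q*(2*z)..<q*(2*z)+z}"
    "a i div z = 2*q+1 \<longleftrightarrow> a i \<in> {q*(2*z)+z..<q*(2*z)+2*z}" for i
    using div_eq_iff_block[OF z(1), of "a i" "2*q"] div_eq_iff_block[OF z(1), of "a i" "2*q+1"]
    by (simp_all add: algebra_simps)
  show "{x\<in>{q*(2*z)..<q*(2*z)+2*z}. a x < q*(2*z)+z} = {i. i < w \<and> a i div z = 2*q}"
    unfolding A
  proof (rule set_eqI)
    fix x show "x \<in> {x\<in>{q*(2*z)..<q*(2*z)+2*z}. a x < q*(2*z)+z} \<longleftrightarrow>
      x \<in> {i. i < w \<and> a i \<in> {q*(2*z)..<q*(2*z)+z}}"
      using iff[of x] w by (cases "x < w") auto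
  qed
  show "{x\<in>{q*(2*z)..<q*(2*z)+2*z}. q*(2*z)+z \<le> a x} = {i. i < w \<and> a i div z = 2*q+1}"
    unfolding A
  proof (rule set_eqI)
    fix x show "x \<in> {x\<in>{q*(2*z)..<q*(2*z)+2*z}. q*(2*z)+z \<le> a x} \<longleftrightarrow>
      x \<in> {i. i < w \<and> a i \<in> {q*(2*z)+z..<q*(2*z)+2*z}}"
      using iff[of x] w by (cases "x < w") auto
  qed
qed

text \<open>The sorts of the rows and of the columns are increasing on each class, so
  \<open>sticky_transport\<close> carries the products \<open>r'\<close> of the half blocks back to
  the unsorted indices. The permutation \<open>c\<close> is \<open>r'\<close> with the sorting
  undone on both sides, as \<open>ga\<close> and \<open>gb\<close> invert the two sorts.\<close>

lemma level_step:
  assumes z: "0 < z" "2*z dvd w" and \<alpha>: "block_perm w (2*z) \<alpha>" and \<beta>: "block_perm w (2*z) \<beta>"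
    and \<alpha>': "\<And>i. i < w \<Longrightarrow> \<alpha>' (dst \<alpha> z i) = \<alpha> i \<and> ga (dst \<alpha> z i) = i"
    and \<beta>': "\<And>i. i < w \<Longrightarrow> \<beta>' (dst \<beta> z i) = \<beta> i \<and> gb (dst \<beta> z i) = i"
    and r': "block_sticky w z \<alpha>' \<beta>' r'"
    and c: "\<And>s. s < w \<Longrightarrow> c (ga s) = gb (r' s)"
    and q: "q * (2*z) < w"
  shows "block_merge (q*(2*z)) (q*(2*z)+z) (q*(2*z)+2*z) \<alpha> \<beta> c"
proof -
  have zw: "z dvd w" using z dvd_mult_right by blast
  have w: "q*(2*z)+2*z \<le> w" using block_in_range[OF z(2) q] .
  have ba: "bij_betw \<alpha> {..<w} {..<w}" and bb: "bij_betw \<beta> {..<w} {..<w}"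
    using \<alpha> \<beta> by (auto simp: block_perm_def)
  have part: "sticky {i. i < w \<and> \<alpha> i div z = p} {i. i < w \<and> \<beta> i div z = p} (p*z) (p*z+z) \<alpha> \<beta> c"
    if p: "p * z < w" for p
  proof -
    let ?X = "{i. i < w \<and> \<alpha> i div z = p}" and ?Y = "{i. i < w \<and> \<beta> i div z = p}"
    have imX: "dst \<alpha> z ` ?X = {p*z..<p*z+z}" by (rule dst_image[OF ba z(1) zw p])
    have imY: "dst \<beta> z ` ?Y = {p*z..<p*z+z}" by (rule dst_image[OF bb z(1) zw p])
    have st: "sticky {p*z..<p*z+z} {p*z..<p*z+z} (p*z) (p*z+z) \<alpha>' \<beta>' r'"
      using r' p by (simp add: block_sticky_def)
    show ?thesis
    proof (rule sticky_transport[where f = "dst \<alpha> z" and g = "dst \<beta> z"])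
      show "sticky (dst \<alpha> z ` ?X) (dst \<beta> z ` ?Y) (p*z) (p*z+z) \<alpha>' \<beta>' r'"
        unfolding imX imY by (rule st)
      show "strict_mono_on ?X (dst \<alpha> z)" by (rule strict_mono_onI) (auto intro: dst_mono)
      show "strict_mono_on ?Y (dst \<beta> z)" by (rule strict_mono_onI) (auto intro: dst_mono)
      show "finite ?X" "finite ?Y" by simp_all
      show "\<alpha>' (dst \<alpha> z x) = \<alpha> x" if "x \<in> ?X" for x using \<alpha>' that by simp
      show "\<beta>' (dst \<beta> z x) = \<beta> x" if "x \<in> ?Y" for x using \<beta>' that by simp
      fix x assume x: "x \<in> ?X"
      let ?s = "dst \<alpha> z x"
      have s: "?s \<in> {p*z..<p*z+z}" using imX x by blast
      have "r' ?s \<in> {p*z..<p*z+z}" using st s by (auto simp: sticky_def dest: bij_betwE)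
      then obtain y where y: "y \<in> ?Y" "r' ?s = dst \<beta> z y" using imY by blast
      have "c x = gb (r' ?s)"
        using c[of ?s] \<alpha>'[of x] dst_div(2)[OF ba z(1) zw, of x] x by simp
      also have "\<dots> = y" using y \<beta>' by simp
      finally show "c x \<in> ?Y \<and> dst \<beta> z (c x) = r' ?s" using y by simp
    qed
  qed
  have e: "2*q*z = q*(2*z)" "(2*q+1)*z = q*(2*z)+z" "q*(2*z)+z+z = q*(2*z)+2*z" by (simp_all add: algebra_simps)
  show ?thesis
  proof
    show "q*(2*z) \<le> q*(2*z)+z" "q*(2*z)+z \<le> q*(2*z)+2*z" by simp_all
    show "bij_betw \<alpha> {q*(2*z)..<q*(2*z)+2*z} {q*(2*z)..<q*(2*z)+2*z}"
      using block_perm_bij_block[OF \<alpha> _ w] z by simp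
    show "bij_betw \<beta> {q*(2*z)..<q*(2*z)+2*z} {q*(2*z)..<q*(2*z)+2*z}"
      using block_perm_bij_block[OF \<beta> _ w] z by simp
    show "sticky {x \<in> {q*(2*z)..<q*(2*z)+2*z}. \<alpha> x < q*(2*z)+z}
       {y \<in> {q*(2*z)..<q*(2*z)+2*z}. \<beta> y < q*(2*z)+z} (q*(2*z)) (q*(2*z)+z) \<alpha> \<beta> c"
      unfolding half_block(1)[OF \<alpha> z q] half_block(1)[OF \<beta> z q]
      using part[of "2*q"] w z unfolding e by simp
    show "sticky {x \<in> {q*(2*z)..<q*(2*z)+2*z}. q*(2*z)+z \<le> \<alpha> x}
       {y \<in> {q*(2*z)..<q*(2*z)+2*z}. q*(2*z)+z \<le> \<beta> y} (q*(2*z)+z) (q*(2*z)+2*z) \<alpha> \<beta> c"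
      unfolding half_block(2)[OF \<alpha> z q] half_block(2)[OF \<beta> z q]
      using part[of "2*q+1"] w z unfolding e by simp
  qed
qed

section \<open>Longest increasing subsequences of windows\<close>

definition lis :: "(nat \<Rightarrow> nat) \<Rightarrow> nat \<Rightarrow> nat \<Rightarrow> nat" where
  "lis a l r = Max (card ` {C. C \<subseteq> {l..<r} \<and> strict_mono_on C a})"

lemma finite_chains: "finite {C. C \<subseteq> {l..<r::nat} \<and> P C}"
  by (rule finite_subset[of _ "Pow {l..<r}"]) auto

lemma lis_ge: "C \<subseteq> {l..<r} \<Longrightarrow> strict_mono_on C a \<Longrightarrow> card C \<le> lis a l r"
  unfolding lis_def by (rule Max_ge) (auto intro: finite_imageI finite_chains)

lemma lis_attained:
  obtains C where "C \<subseteq> {l..<r}" "strict_mono_on C a" "lis a l r = card C"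
proof -
  have "lis a l r \<in> card ` {C. C \<subseteq> {l..<r} \<and> strict_mono_on C a}"
    unfolding lis_def
  proof (rule Max_in)
    show "finite (card ` {C. C \<subseteq> {l..<r} \<and> strict_mono_on C a})"
      by (intro finite_imageI finite_chains)
    have "{} \<in> {C. C \<subseteq> {l..<r} \<and> strict_mono_on C a}" by (simp add: strict_mono_on_def)
    then show "card ` {C. C \<subseteq> {l..<r} \<and> strict_mono_on C a} \<noteq> {}" by blast
  qed
  then show ?thesis using that by auto
qed

lemma lis_le: "lis a l r \<le> r - l"
  by (metis lis_attained card_atLeastLessThan card_mono finite_atLeastLessThan)

lemma initial_segment:
  fixes D :: "nat set"
  assumes "D \<subseteq> {s..<t}" and down: "\<And>x y. y \<in> D \<Longrightarrow> s \<le> x \<Longrightarrow> x < y \<Longrightarrow> x \<in> D"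
  shows "D = {s..<s + card D}"
proof (cases "D = {}")
  case False
  have fin: "finite D" using assms(1) finite_subset by blast
  let ?M = "Max D"
  have M: "?M \<in> D" using False fin by simp
  have "D = {s..<Suc ?M}"
  proof (intro equalityI subsetI)
    fix x assume "x \<in> D" then show "x \<in> {s..<Suc ?M}" using assms(1) Max_ge[OF fin] by (auto simp: less_Suc_eq_le)
  next
    fix x assume "x \<in> {s..<Suc ?M}" then show "x \<in> D" using down[OF M, of x] M by (cases "x = ?M") auto
  qed
  moreover have "s \<le> ?M" using M assms(1) by auto
  ultimately show ?thesis by (metis card_atLeastLessThan le_SucI le_add_diff_inverse)
qed simp

text \<open>
  A block of \<open>m\<close> sequence positions has \<open>2 * m\<close> strands, numbered from \<open>2 * v\<close> so that the strands of all
  blocks of the same size together form one permutation.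
\<close>

definition repr :: "(nat \<Rightarrow> nat) \<Rightarrow> (nat \<Rightarrow> nat) \<Rightarrow> nat \<Rightarrow> nat \<Rightarrow> bool" where
  "repr a p v m \<longleftrightarrow> (\<forall>l\<in>{v..v+m}. \<forall>r\<in>{v..v+m}.
     card {x\<in>{v+m+l..<2*v+2*m}. p x < v + r} = (r - l) - lis a l r)"

section \<open>Splitting a block of the sequence by values\<close>

text \<open>The abstract form of one pass of the counting sort on a block of the sequence:
  \<open>d\<close> lists the low values before the high ones, keeping the order of positions within
  each half, and \<open>g\<close> undoes it.\<close>

locale value_split =
  fixes v m :: nat and a a' d g :: "nat \<Rightarrow> nat"
  assumes d_bij: "bij_betw d {v..<v+2*m} {v..<v+2*m}"
    and g_d: "\<And>y. y \<in> {v..<v+2*m} \<Longrightarrow> g (d y) = y"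
    and a'_d: "\<And>y. y \<in> {v..<v+2*m} \<Longrightarrow> a' (d y) = a y"
    and d_mono: "\<And>x y. x \<in> {v..<v+2*m} \<Longrightarrow> y \<in> {v..<v+2*m} \<Longrightarrow> x < y \<Longrightarrow> (d x < v + m \<longleftrightarrow> d y < v + m) \<Longrightarrow> d x < d y"
    and lo_hi: "\<And>x y. x \<in> {v..<v+2*m} \<Longrightarrow> y \<in> {v..<v+2*m} \<Longrightarrow> d x < v + m \<Longrightarrow> v + m \<le> d y \<Longrightarrow> a x < a y"
begin

abbreviation "I \<equiv> {v..<v+2*m}"

lemma d_in: "y \<in> I \<Longrightarrow> d y \<in> I" using d_bij by (auto dest: bij_betwE)
lemma g_in: "u \<in> I \<Longrightarrow> g u \<in> I" and d_g: "u \<in> I \<Longrightarrow> d (g u) = u"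
proof -
  assume "u \<in> I"
  then have "u \<in> d ` I" using bij_betw_imp_surj_on[OF d_bij] by simp
  then obtain y where "y \<in> I" "u = d y" by blast
  then show "g u \<in> I" "d (g u) = u" using g_d[of y] by simp_all
qed

text \<open>A cut of the block before position \<open>l\<close> induces the cuts
  \<open>v + c1 l\<close> and \<open>v + m + c2 l\<close> of its low and of its high half.\<close>

definition "c1 l = card {y\<in>{v..<l}. d y < v + m}"
definition "c2 l = card {y\<in>{v..<l}. v + m \<le> d y}"

lemma c12: "v \<le> l \<Longrightarrow> c1 l + c2 l = l - v"
proof -
  have "c1 l + c2 l = card ({y\<in>{v..<l}. d y < v + m} \<union> {y\<in>{v..<l}. v + m \<le> d y})"
    unfolding c1_def c2_def by (subst card_Un_disjoint) auto
  also have "{y\<in>{v..<l}. d y < v + m} \<union> {y\<in>{v..<l}. v + m \<le> d y} = {v..<l}" by auto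
  finally show ?thesis by simp
qed

lemma c_mono: "l \<le> l' \<Longrightarrow> c1 l \<le> c1 l'" "l \<le> l' \<Longrightarrow> c2 l \<le> c2 l'"
  unfolding c1_def c2_def by (auto intro!: card_mono)

lemma inj_d: "inj_on d I" using d_bij by (simp add: bij_betw_def)

lemma cut_lo: assumes "v \<le> l" "l \<le> v+2*m"
  shows "d ` {y\<in>{v..<l}. d y < v + m} = {v..<v + c1 l}"
proof -
  let ?D = "d ` {y\<in>{v..<l}. d y < v + m}"
  have "?D = {v..<v + card ?D}"
  proof (rule initial_segment[where t = "v+m"])
    show "?D \<subseteq> {v..<v+m}" using d_in assms by auto
    fix x y assume y: "y \<in> ?D" and x: "v \<le> x" "x < y"
    then obtain z where z: "z \<in> {v..<l}" "d z < v + m" "y = d z" by auto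
    have "x \<in> I" using x z by auto
    have gx: "g x \<in> I" "d (g x) = x" using g_in d_g \<open>x \<in> I\<close> by auto
    have "g x < z"
    proof (rule ccontr)
      assume "\<not> g x < z"
      then have "z < g x \<or> z = g x" by auto
      then show False using d_mono[of z "g x"] z gx x assms by auto
    qed
    then show "x \<in> ?D" using gx z x by (intro image_eqI[of _ _ "g x"]) auto
  qed
  moreover have "card ?D = c1 l" unfolding c1_def
    by (rule card_image, rule inj_on_subset[OF inj_d]) (use assms in auto)
  ultimately show ?thesis by simp
qed

lemma cut_hi: assumes "v \<le> l" "l \<le> v+2*m"
  shows "d ` {y\<in>{v..<l}. v + m \<le> d y} = {v+m..<v+m + c2 l}"
proof -
  let ?D = "d ` {y\<in>{v..<l}. v + m \<le> d y}"
  have "?D = {v+m..<v+m + card ?D}"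
  proof (rule initial_segment[where t = "v+2*m"])
    show "?D \<subseteq> {v+m..<v+2*m}" using d_in assms by auto
    fix x y assume y: "y \<in> ?D" and x: "v + m \<le> x" "x < y"
    then obtain z where z: "z \<in> {v..<l}" "v + m \<le> d z" "y = d z" by auto
    have "z \<in> I" using z assms by auto
    have "x \<in> I" using x z d_in[OF \<open>z \<in> I\<close>] by auto
    have gx: "g x \<in> I" "d (g x) = x" using g_in d_g \<open>x \<in> I\<close> by auto
    have "g x < z"
    proof (rule ccontr)
      assume "\<not> g x < z"
      then have "z < g x \<or> z = g x" by auto
      then show False using d_mono[of z "g x"] z gx x \<open>z \<in> I\<close> by auto
    qed
    then show "x \<in> ?D" using gx z x by (intro image_eqI[of _ _ "g x"]) auto
  qed
  moreover have "card ?D = c2 l" unfolding c2_def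
    by (rule card_image, rule inj_on_subset[OF inj_d]) (use assms in auto)
  ultimately show ?thesis by simp
qed

text \<open>Since \<open>d\<close> is increasing on the low positions, those before \<open>l\<close>
  form an initial segment of the low half (\<open>cut_lo\<close>). This turns windows of
  \<open>a\<close> into windows of \<open>a'\<close>.\<close>

lemma less_iff_lo:
  assumes "v \<le> l" "l \<le> v+2*m" "y \<in> I" "d y < v + m"
  shows "d y < v + c1 l \<longleftrightarrow> y < l"
proof -
  have "d y < v + c1 l \<longleftrightarrow> d y \<in> d ` {y\<in>{v..<l}. d y < v + m}"
    unfolding cut_lo[OF assms(1,2)] using d_in[OF assms(3)] by simp
  also have "\<dots> \<longleftrightarrow> y \<in> {y\<in>{v..<l}. d y < v + m}"
    by (rule inj_on_image_mem_iff[OF inj_d assms(3)]) (use assms in auto)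
  finally show ?thesis using assms by auto
qed

lemma less_iff_hi:
  assumes "v \<le> l" "l \<le> v+2*m" "y \<in> I" "v + m \<le> d y"
  shows "d y < v + m + c2 l \<longleftrightarrow> y < l"
proof -
  have "d y < v + m + c2 l \<longleftrightarrow> d y \<in> d ` {y\<in>{v..<l}. v + m \<le> d y}"
    unfolding cut_hi[OF assms(1,2)] using assms by simp
  also have "\<dots> \<longleftrightarrow> y \<in> {y\<in>{v..<l}. v + m \<le> d y}"
    by (rule inj_on_image_mem_iff[OF inj_d assms(3)]) (use assms in auto)
  finally show ?thesis using assms by auto
qed

lemma c1_le: "l \<le> v+2*m \<Longrightarrow> c1 l \<le> m" and c2_le: "l \<le> v+2*m \<Longrightarrow> c2 l \<le> m"
proof -
  assume l: "l \<le> v+2*m"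
  have "c1 l \<le> card {v..<v+m}" unfolding c1_def
    by (rule card_inj_on_le[of d]) (use l d_in in \<open>auto intro: inj_on_subset[OF inj_d]\<close>)
  then show "c1 l \<le> m" by simp
  have "c2 l \<le> card {v+m..<v+2*m}" unfolding c2_def
    by (rule card_inj_on_le[of d]) (use l d_in in \<open>auto intro: inj_on_subset[OF inj_d]\<close>)
  then show "c2 l \<le> m" by simp
qed

lemma g_mono:
  assumes "x \<in> I" "y \<in> I" "x < y" "x < v + m \<longleftrightarrow> y < v + m" shows "g x < g y"
proof (rule ccontr)
  assume "\<not> g x < g y"
  then have "g y < g x \<or> g x = g y" by auto
  then show False
    using d_mono[of "g y" "g x"] assms g_in d_g by (metis less_asym less_irrefl)
qed

text \<open>Every low value is below every high one, so a chain of low values before the cut can be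
  continued by any chain of high values after it.\<close>

lemma lis_split_ge:
  assumes "v \<le> l" "l \<le> j" "j \<le> r" "r \<le> v + 2*m"
  shows "lis a' (v + c1 l) (v + c1 j) + lis a' (v+m+c2 j) (v+m+c2 r) \<le> lis a l r"
proof -
  obtain C1 where C1: "C1 \<subseteq> {v + c1 l..<v + c1 j}" "strict_mono_on C1 a'" "lis a' (v + c1 l) (v + c1 j) = card C1"
    by (rule lis_attained)
  obtain C2 where C2: "C2 \<subseteq> {v+m+c2 j..<v+m+c2 r}" "strict_mono_on C2 a'" "lis a' (v+m+c2 j) (v+m+c2 r) = card C2"
    by (rule lis_attained)
  have j: "v \<le> j" "j \<le> v+2*m" "v \<le> r" "l \<le> v+2*m" using assms by auto
  have u1: "u \<in> I \<and> u < v + m \<and> l \<le> g u \<and> g u < j" if "u \<in> C1" for u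
  proof -
    have "v + c1 l \<le> u" "u < v + c1 j" "u < v + m" using C1(1) c1_le[OF j(2)] that by auto
    moreover from this have u: "u \<in> I" by auto
    ultimately show ?thesis
      using less_iff_lo[OF assms(1) j(4) g_in[OF u]] less_iff_lo[OF j(1,2) g_in[OF u]] d_g[OF u] u
      by (metis not_less)
  qed
  have u2: "u \<in> I \<and> v + m \<le> u \<and> j \<le> g u \<and> g u < r" if "u \<in> C2" for u
  proof -
    have "v + m + c2 j \<le> u" "u < v + m + c2 r" "u < v + 2*m" using C2(1) c2_le[OF assms(4)] that by auto
    moreover from this have u: "u \<in> I" by auto
    ultimately show ?thesis
      using less_iff_hi[OF j(1,2) g_in[OF u]] less_iff_hi[OF j(3) assms(4) g_in[OF u]] d_g[OF u] u
      by (metis add_leD1 not_less)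
  qed
  have ag: "a (g u) = a' u" if "u \<in> I" for u using a'_d[OF g_in[OF that]] d_g[OF that] by simp
  have inj: "inj_on g I" by (rule inj_on_inverseI[of _ d]) (simp add: d_g)
  let ?C = "g ` C1 \<union> g ` C2"
  have "?C \<subseteq> {l..<r}" using u1 u2 assms by fastforce
  moreover have "strict_mono_on ?C a"
  proof (rule strict_mono_onI)
    fix x y assume "x \<in> ?C" "y \<in> ?C" "x < y"
    then obtain s t where s: "x = g s" "s \<in> C1 \<union> C2" and t: "y = g t" "t \<in> C1 \<union> C2" by auto
    have I: "s \<in> I" "t \<in> I" using s t u1 u2 by auto
    have mono: "s < t" if "s < v + m \<longleftrightarrow> t < v + m"
      using g_mono[of t s] I that \<open>x < y\<close> s t by (metis less_asym less_irrefl nat_neq_iff)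
    consider "s \<in> C1" "t \<in> C1" | "s \<in> C2" "t \<in> C2" | "s \<in> C1" "t \<in> C2" | "s \<in> C2" "t \<in> C1"
      using s t by blast
    then have "a' s < a' t"
    proof cases
      case 1 then show ?thesis using mono u1 C1(2) by (auto dest: strict_mono_onD)
    next
      case 2 then show ?thesis using mono u2 C2(2) by (metis leD strict_mono_onD)
    next
      case 3 then show ?thesis
        using lo_hi[of "g s" "g t"] u1[of s] u2[of t] g_in d_g ag I by metis
    next
      case 4 then show ?thesis using u1[of t] u2[of s] \<open>x < y\<close> s t by auto
    qed
    then show "a x < a y" using ag I s t by simp
  qed
  ultimately have "card ?C \<le> lis a l r" by (rule lis_ge)
  moreover have "card ?C = card C1 + card C2"
  proof -
    have fin: "finite C1" "finite C2" using C1(1) C2(1) finite_subset by blast+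
    have "g ` C1 \<inter> g ` C2 = {}" using u1 u2 by fastforce
    then have "card ?C = card (g ` C1) + card (g ` C2)" using fin by (simp add: card_Un_disjoint)
    moreover have "inj_on g C1" "inj_on g C2" using inj u1 u2 by (meson inj_on_subset subsetI)+
    ultimately show ?thesis by (simp add: card_image)
  qed
  ultimately show ?thesis using C1(3) C2(3) by simp
qed

text \<open>The cut is placed right after the last low element of a longest chain, or at
  \<open>l\<close> if it has none. The values along the chain increase, so all its high elements
  come after its low ones and thus after the cut.\<close>

lemma lis_split_le:
  assumes "v \<le> l" "l \<le> r" "r \<le> v + 2*m"
  obtains j where "l \<le> j" "j \<le> r"
    "lis a l r \<le> lis a' (v + c1 l) (v + c1 j) + lis a' (v+m+c2 j) (v+m+c2 r)"
proof -
  obtain C where C: "C \<subseteq> {l..<r}" "strict_mono_on C a" "lis a l r = card C" by (rule lis_attained)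
  have fin: "finite C" using C finite_subset by blast
  have CI: "C \<subseteq> I" using C assms by auto
  let ?L = "{x\<in>C. d x < v + m}" and ?H = "{x\<in>C. v + m \<le> d x}"
  define j where "j = (if ?L = {} then l else Suc (Max ?L))"
  have jL: "x < j" if "x \<in> ?L" for x
  proof -
    have "x \<le> Max ?L" by (rule Max_ge) (use fin that in auto)
    moreover have "?L \<noteq> {}" using that by blast
    ultimately show ?thesis by (simp only: j_def if_False less_Suc_eq_le)
  qed
  have j_cases: "j = l \<or> (\<exists>x\<in>?L. j = Suc x)"
  proof (cases "?L = {}")
    case False
    then have "Max ?L \<in> ?L" by (intro Max_in) (use fin in auto)
    then show ?thesis using False by (auto simp: j_def)
  qed (simp add: j_def)
  have jH: "j \<le> y" if "y \<in> ?H" for y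
    using j_cases
  proof
    assume "\<exists>x\<in>?L. j = Suc x"
    then obtain x where x: "x \<in> ?L" "j = Suc x" by blast
    have mem: "x \<in> C" "y \<in> C" "d x < v + m" "v + m \<le> d y" using x(1) that by auto
    have "a x < a y" by (rule lo_hi) (use mem CI in auto)
    moreover have "a y < a x" if "y < x" using strict_mono_onD[OF C(2) mem(2,1) that] .
    ultimately have "x < y" by (metis less_asym less_irrefl nat_neq_iff)
    then show ?thesis using x by simp
  next
    assume "j = l" then show ?thesis using that C by auto
  qed
  have lj: "l \<le> j" "j \<le> r" using j_cases C assms by (auto simp: Suc_le_eq)
  have j: "v \<le> j" "j \<le> v+2*m" "v \<le> r" "l \<le> v+2*m" using assms lj by auto
  have sm: "strict_mono_on (d ` D) a'" if "D = ?L \<or> D = ?H" for D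
  proof (rule strict_mono_onI)
    fix s t assume "s \<in> d ` D" "t \<in> d ` D" "s < t"
    then obtain x y where x: "x \<in> D" "s = d x" and y: "y \<in> D" "t = d y" by auto
    have I: "x \<in> I" "y \<in> I" "x \<in> C" "y \<in> C" using x y that CI by auto
    have "x < y"
    proof (rule ccontr)
      assume "\<not> x < y"
      then consider "y < x" | "x = y" by linarith
      then show False
      proof cases
        case 1 then have "d y < d x" using d_mono[of y x] I x y that by auto
        then show False using x y \<open>s < t\<close> by simp
      qed (use x y \<open>s < t\<close> in simp)
    qed
    then have "a x < a y" using C(2) I by (auto dest: strict_mono_onD)
    then show "a' s < a' t" using a'_d I x y by simp
  qed
  have "d ` ?L \<subseteq> {v + c1 l..<v + c1 j}"
  proof
    fix s assume "s \<in> d ` ?L"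
    then obtain x where x: "x \<in> ?L" "s = d x" by auto
    then have "l \<le> x" "x < j" "x \<in> I" using C CI jL by auto
    then show "s \<in> {v + c1 l..<v + c1 j}"
      using less_iff_lo[OF assms(1) j(4), of x] less_iff_lo[OF j(1,2), of x] x by auto
  qed
  from lis_ge[OF this sm] have 1: "card (d ` ?L) \<le> lis a' (v + c1 l) (v + c1 j)" by simp
  have "d ` ?H \<subseteq> {v + m + c2 j..<v + m + c2 r}"
  proof
    fix s assume "s \<in> d ` ?H"
    then obtain x where x: "x \<in> ?H" "s = d x" by auto
    then have "j \<le> x" "x < r" "x \<in> I" using C CI jH by auto
    then show "s \<in> {v + m + c2 j..<v + m + c2 r}"
      using less_iff_hi[OF j(3) assms(3), of x] less_iff_hi[OF j(1,2), of x] x by auto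
  qed
  from lis_ge[OF this sm] have 2: "card (d ` ?H) \<le> lis a' (v+m+c2 j) (v+m+c2 r)" by simp
  have "card (d ` ?L) = card ?L" "card (d ` ?H) = card ?H"
    using CI by (auto intro!: card_image inj_on_subset[OF inj_d])
  moreover have "card C = card ?L + card ?H"
    using fin by (subst card_Un_disjoint[symmetric]) (auto intro: arg_cong[where f=card])
  ultimately show ?thesis using that[OF lj] C(3) 1 2 by simp
qed

end

lemma surj_imp_bij:
  assumes "finite X" "X \<subseteq> f ` X" shows "bij_betw f X X"
proof -
  have "f ` X = X"
    using assms by (metis card_image_le card_seteq finite_imageI)
  then show ?thesis using assms(1) by (simp add: bij_betw_def eq_card_imp_inj_on)
qed

lemma ndom_mono: "finite X \<Longrightarrow> j \<le> j' \<Longrightarrow> ndom X f i j \<le> ndom X f i j'"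
  unfolding ndom_def by (rule card_mono) auto

lemma ncod_antimono: "finite X \<Longrightarrow> j \<le> j' \<Longrightarrow> ncod X f j' k \<le> ncod X f j k"
  unfolding ncod_def by (rule card_mono) auto

section \<open>The merged braid as a product\<close>

text \<open>
  \<open>A\<close> and the inverse of \<open>B\<close> are the braids of the low and of the high values, padded by strands that cross the
  positions of the other half. The primed sequence \<open>a'\<close> lists the low values and then the high values.
\<close>

locale braid_merge = value_split +
  fixes p A B :: "nat \<Rightarrow> nat"
  assumes p1: "bij_betw p {2*v..<2*v+2*m} {2*v..<2*v+2*m}"
    and p2: "bij_betw p {2*v+2*m..<2*v+4*m} {2*v+2*m..<2*v+4*m}"
    and r1: "repr a' p v m" and r2: "repr a' p (v+m) m"
    and A_id: "\<And>u. u \<in> {v..<v+m} \<Longrightarrow> A (v+u) = v+u"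
    and A_virt: "\<And>u. u \<in> {v..<v+m} \<Longrightarrow> A (v+u+m) = (if p (v+u) < 2*v+m then v+m+g (p (v+u) - v) else p (v+u) + 2*m)"
    and A_lo: "\<And>u. u \<in> {v..<v+m} \<Longrightarrow> A (v+2*m+g u) = (if p (v+u+m) < 2*v+m then v+m+g (p (v+u+m) - v) else p (v+u+m) + 2*m)"
    and A_hi: "\<And>u. u \<in> {v+m..<v+2*m} \<Longrightarrow> A (v+2*m+g u) = v+m+g u"
    and B_lo: "\<And>u. u \<in> {v..<v+m} \<Longrightarrow> B (v+g u) = v+m+g u"
    and B_virt: "\<And>u. u \<in> {v+m..<v+2*m} \<Longrightarrow>
        B (if p (v+u+m) < 2*v+3*m then v+g (p (v+u+m) - v - m) else p (v+u+m) - m) = v+u-m"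
    and B_hi: "\<And>u. u \<in> {v+m..<v+2*m} \<Longrightarrow>
        B (if p (v+u+2*m) < 2*v+3*m then v+g (p (v+u+2*m) - v - m) else p (v+u+2*m) - m) = v+m+g u"
    and B_id: "\<And>u. u \<in> {v+m..<v+2*m} \<Longrightarrow> B (v+u+2*m) = v+u+2*m"
begin

abbreviation "X \<equiv> {2*v..<2*v+4*m}"

lemma p1_in: "x \<in> {2*v..<2*v+2*m} \<Longrightarrow> p x \<in> {2*v..<2*v+2*m}"
  and p2_in: "x \<in> {2*v+2*m..<2*v+4*m} \<Longrightarrow> p x \<in> {2*v+2*m..<2*v+4*m}"
  using p1 p2 by (auto dest: bij_betwE)

lemma p1_surj: "y \<in> {2*v..<2*v+2*m} \<Longrightarrow> \<exists>x\<in>{2*v..<2*v+2*m}. p x = y"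
  and p2_surj: "y \<in> {2*v+2*m..<2*v+4*m} \<Longrightarrow> \<exists>x\<in>{2*v+2*m..<2*v+4*m}. p x = y"
  using imageE[OF equalityD2[OF bij_betw_imp_surj_on[OF p1], THEN subsetD]]
    imageE[OF equalityD2[OF bij_betw_imp_surj_on[OF p2], THEN subsetD]]
  by blast+

lemma A_all: assumes "x \<in> {2*v..<2*v+2*m}"
  shows "\<exists>x'\<in>X. A x' = (if p x < 2*v+m then v+m+g (p x - v) else p x + 2*m)"
proof (cases "x < 2*v+m")
  case True
  then have "x - v \<in> {v..<v+m}" "v + (x - v) = x" using assms by auto
  from A_virt[OF this(1)] this(2) show ?thesis using assms by (intro bexI[of _ "x+m"]) auto
next
  case False
  then have "x - v - m \<in> I" using assms by auto
  then have "g (x-v-m) \<in> I" by (rule g_in)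
  have u: "x - v - m \<in> {v..<v+m}" "v + (x - v - m) + m = x" using False assms by auto
  show ?thesis using A_lo[OF u(1)] \<open>g (x-v-m) \<in> I\<close> unfolding u(2)
    by (intro bexI[of _ "v+2*m+g (x-v-m)"]) auto
qed

text \<open>There are four kinds of columns. The first \<open>m\<close> belong to idle strands. The
  middle \<open>2*m\<close> stand for the positions of the block and are reached through
  \<open>p\<close> at a low value and by a straight strand at a high one, which gives two kinds. The
  last \<open>m\<close> are the remaining columns of the low braid.\<close>

lemma bij_A: "bij_betw A X X"
proof (rule surj_imp_bij)
  show "X \<subseteq> A ` X"
  proof
    fix y assume y: "y \<in> X"
    consider "y < 2*v+m" | "2*v+m \<le> y" "y < 2*v+3*m" "d (y-v-m) < v+m"
      | "2*v+m \<le> y" "y < 2*v+3*m" "v+m \<le> d (y-v-m)" | "2*v+3*m \<le> y"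
      by linarith
    then show "y \<in> A ` X"
    proof cases
      case 1
      then have "y - v \<in> {v..<v+m}" "v + (y - v) = y" using y by auto
      from A_id[OF this(1)] this(2) show ?thesis using y by (intro image_eqI[of _ _ y]) auto
    next
      case 2
      let ?z = "y - v - m"
      have z: "?z \<in> I" using 2 by auto
      have dz: "d ?z \<in> I" "g (d ?z) = ?z" using z d_in g_d by blast+
      then have "v + d ?z \<in> {2*v..<2*v+2*m}" by auto
      then obtain x where x: "x \<in> {2*v..<2*v+2*m}" "p x = v + d ?z" using p1_surj by blast
      then show ?thesis using A_all[OF x(1)] 2 dz by (auto simp: image_iff)
    next
      case 3
      let ?z = "y - v - m"
      have z: "?z \<in> I" using 3 by auto
      have dz: "d ?z \<in> I" "g (d ?z) = ?z" using z d_in g_d by blast+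
      have "A (v+2*m+g (d ?z)) = v + m + g (d ?z)" by (rule A_hi) (use 3 dz in auto)
      then show ?thesis using dz 3 by (intro image_eqI[of _ _ "y+m"]) (auto simp: algebra_simps)
    next
      case 4
      then have "y - 2*m \<in> {2*v..<2*v+2*m}" using y by auto
      then obtain x where x: "x \<in> {2*v..<2*v+2*m}" "p x = y - 2*m" using p1_surj by blast
      obtain x' where "x' \<in> X" "A x' = (if p x < 2*v+m then v+m+g (p x - v) else p x + 2*m)"
        using A_all[OF x(1)] by blast
      then show ?thesis using x(2) 4 by (intro image_eqI[of _ _ x']) auto
    qed
  qed
qed simp

text \<open>The mirror image of \<open>bij_A\<close>: now the low positions have straight strands,
  the high ones are reached through the high braid, and the idle strands are the last
  \<open>m\<close>.\<close>

lemma bij_B: "bij_betw B X X"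
proof (rule surj_imp_bij)
  have idx: "(if p x < 2*v+3*m then v+g (p x - v - m) else p x - m) \<in> X" if "x \<in> {2*v+2*m..<2*v+4*m}" for x
  proof (cases "p x < 2*v+3*m")
    case True
    then have "p x - v - m \<in> I" using p2_in[OF that] by auto
    then have "g (p x - v - m) \<in> I" by (rule g_in)
    then show ?thesis using True by auto
  next
    case False then show ?thesis using p2_in[OF that] by auto
  qed
  show "X \<subseteq> B ` X"
  proof
    fix y assume y: "y \<in> X"
    consider "y < 2*v+m" | "2*v+m \<le> y" "y < 2*v+3*m" "d (y-v-m) < v+m"
      | "2*v+m \<le> y" "y < 2*v+3*m" "v+m \<le> d (y-v-m)" | "2*v+3*m \<le> y"
      by linarith
    then show "y \<in> B ` X"
    proof cases
      case 1
      let ?u = "y - v + m"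
      have u: "?u \<in> {v+m..<v+2*m}" "v + ?u + m \<in> {2*v+2*m..<2*v+4*m}" "v + ?u - m = y" using 1 y by auto
      show ?thesis by (rule image_eqI[OF _ idx[OF u(2)]]) (simp only: B_virt[OF u(1)] u(3))
    next
      case 2
      let ?z = "y - v - m"
      have z: "?z \<in> I" using 2 by auto
      have dz: "d ?z \<in> I" "g (d ?z) = ?z" using z d_in g_d by blast+
      have "B (v+g (d ?z)) = v + m + g (d ?z)" by (rule B_lo) (use 2 dz in auto)
      then show ?thesis using dz 2 by (intro image_eqI[of _ _ "v+?z"]) auto
    next
      case 3
      let ?z = "y - v - m"
      have z: "?z \<in> I" using 3 by auto
      have dz: "d ?z \<in> I" "g (d ?z) = ?z" using z d_in g_d by blast+
      have "v + d ?z + 2*m \<in> {2*v+2*m..<2*v+4*m}" using 3 dz by auto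
      moreover have "d ?z \<in> {v+m..<v+2*m}" "v + m + g (d ?z) = y" using 3 dz by auto
      ultimately show ?thesis
        by (intro image_eqI[OF _ idx[of "v + d ?z + 2*m"]]) (simp_all only: B_hi)
    next
      case 4
      then have "y - v - 2*m \<in> {v+m..<v+2*m}" "v + (y - v - 2*m) + 2*m = y" using y by auto
      from B_id[OF this(1)] this(2) show ?thesis using y by (intro image_eqI[of _ _ y]) auto
    qed
  qed
qed simp

text \<open>Counted are the high positions in \<open>[l, j)\<close>, whose strands run straight, and
  those low strands that \<open>p\<close> sends to the left of the cut; by \<open>repr\<close> the
  latter number \<open>c1 j - c1 l\<close> minus the \<open>lis\<close> of the low window. Together
  with \<open>c12\<close> this is the defect. The form as a sum avoids truncated
  subtraction.\<close>

lemma ndom_A: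
  assumes l: "v \<le> l" "l \<le> j" "j \<le> v+2*m"
  shows "ndom X A (v+2*m+l) (v+m+j) + lis a' (v + c1 l) (v + c1 j) = j - l"
proof -
  let ?hi = "{y\<in>{l..<j}. v + m \<le> d y}"
  let ?lo = "{x\<in>{v+m+(v+c1 l)..<2*v+2*m}. p x < v + (v + c1 j)}"
  have l': "l \<le> v+2*m" "v \<le> j" using l by auto
  have cj: "c1 j \<le> m" "c1 l \<le> c1 j" using c1_le l c_mono by auto
  have lo_mem: "A (v+2*m+y) < v+m+j \<longleftrightarrow> p (v+d y+m) < v + (v + c1 j)" if y: "y \<in> I" "d y < v + m" for y
  proof -
    have dy: "d y \<in> {v..<v+m}" "g (d y) = y" using y d_in[of y] g_d[of y] by auto
    have Ay: "A (v+2*m+y) = (if p (v+d y+m) < 2*v+m then v+m+g (p (v+d y+m) - v) else p (v+d y+m) + 2*m)"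
      using A_lo[OF dy(1)] dy by simp
    have pin: "p (v+d y+m) \<in> {2*v..<2*v+2*m}" by (rule p1_in) (use dy in auto)
    show ?thesis
    proof (cases "p (v+d y+m) < 2*v+m")
      case True
      let ?u = "p (v+d y+m) - v"
      have u: "?u \<in> I" "?u < v + m" using True pin by auto
      have "g ?u < j \<longleftrightarrow> ?u < v + c1 j"
        using less_iff_lo[OF l'(2) l(3) g_in[OF u(1)]] d_g[OF u(1)] u by simp
      moreover have "v \<le> ?u" "p (v+d y+m) = ?u + v" using pin by auto
      ultimately show ?thesis using True Ay by auto
    next
      case False then show ?thesis using Ay l cj by auto
    qed
  qed
  have hi_mem: "A (v+2*m+y) < v+m+j \<longleftrightarrow> y < j" if "y \<in> I" "v + m \<le> d y" for y
    using A_hi[of "d y"] d_in[of y] g_d[of y] that by auto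
  have "{x\<in>X. v+2*m+l \<le> x \<and> A x < v+m+j}
      = (\<lambda>y. v+2*m+y) ` (?hi \<union> g ` ((\<lambda>x. x - v - m) ` ?lo))" (is "?S = ?T")
  proof (intro equalityI subsetI)
    fix x assume x: "x \<in> ?S"
    define y where "y = x - v - 2*m"
    have y: "x = v+2*m+y" "l \<le> y" "y \<in> I" using x l by (auto simp: y_def)
    show "x \<in> ?T"
    proof (cases "d y < v + m")
      case True
      have "p (v+d y+m) < v + (v + c1 j)" using lo_mem[OF y(3) True] x y by simp
      moreover have "v + c1 l \<le> d y" using less_iff_lo[OF l(1) l'(1) y(3) True] y by simp
      ultimately have "v + d y + m \<in> ?lo" using True by auto
      then have "g (v + d y + m - v - m) \<in> g ` ((\<lambda>x. x - v - m) ` ?lo)" by blast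
      moreover have "g (v + d y + m - v - m) = y" using g_d[OF y(3)] by simp
      ultimately have "y \<in> ?hi \<union> g ` ((\<lambda>x. x - v - m) ` ?lo)" by simp
      then show ?thesis unfolding y(1) by (rule imageI)
    next
      case False
      then show ?thesis using hi_mem[OF y(3)] x y by auto
    qed
  next
    fix x assume "x \<in> ?T"
    then obtain y where y: "x = v+2*m+y" "y \<in> ?hi \<or> y \<in> g ` ((\<lambda>x. x - v - m) ` ?lo)" by blast
    from y(2) show "x \<in> ?S"
    proof
      assume "y \<in> ?hi"
      then show ?thesis using hi_mem[of y] l y by auto
    next
      assume "y \<in> g ` ((\<lambda>x. x - v - m) ` ?lo)"
      then obtain x' where x': "x' \<in> ?lo" "y = g (x' - v - m)" by blast
      have u: "x' - v - m \<in> I" "x' - v - m < v + m" "v + c1 l \<le> x' - v - m" using x' by auto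
      have yI: "y \<in> I" and dy: "d y = x' - v - m" using g_in[OF u(1)] d_g[OF u(1)] x' by auto
      have "v + d y + m = x'" using dy x' by auto
      then have "A x < v+m+j" using lo_mem[OF yI] dy u x' y(1) by simp
      moreover have "l \<le> y" using less_iff_lo[OF l(1) l'(1) yI] dy u by simp
      ultimately show ?thesis using y(1) yI by auto
    qed
  qed
  then have "ndom X A (v+2*m+l) (v+m+j) = card (?hi \<union> g ` ((\<lambda>x. x - v - m) ` ?lo))"
    by (simp add: ndom_def card_image)
  also have "\<dots> = card ?hi + card (g ` ((\<lambda>x. x - v - m) ` ?lo))"
  proof (rule card_Un_disjoint)
    show "?hi \<inter> g ` ((\<lambda>x. x - v - m) ` ?lo) = {}"
    proof -
      have "d y < v + m" if "y \<in> g ` ((\<lambda>x. x - v - m) ` ?lo)" for y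
      proof -
        have "y \<in> (\<lambda>x. g (x - v - m)) ` ?lo" using that unfolding image_image .
        then obtain x where x: "x \<in> ?lo" "y = g (x - v - m)" by (elim imageE)
        then have "x - v - m \<in> I" "x - v - m < v + m" by auto
        then show ?thesis using d_g x(2) by simp
      qed
      then show ?thesis by (intro equalityI subsetI) (auto simp only: Int_iff mem_Collect_eq not_less[symmetric])
    qed
  qed auto
  also have "card (g ` ((\<lambda>x. x - v - m) ` ?lo)) = card ?lo"
    unfolding image_image
  proof (rule card_image, rule inj_onI)
    fix x y assume *: "x \<in> ?lo" "y \<in> ?lo" "g (x - v - m) = g (y - v - m)"
    then have "x - v - m \<in> I" "y - v - m \<in> I" by auto
    then have "x - v - m = y - v - m" using *(3) d_g by metis
    then show "x = y" using * by auto
  qed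
  also have "card ?lo = (v + c1 j - (v + c1 l)) - lis a' (v + c1 l) (v + c1 j)"
    using r1 cj unfolding repr_def by auto
  also have "card ?hi = c2 j - c2 l"
  proof -
    have "c2 j = card ({y\<in>{v..<l}. v + m \<le> d y} \<union> ?hi)"
      unfolding c2_def by (rule arg_cong[where f=card]) (use l in auto)
    also have "\<dots> = c2 l + card ?hi" unfolding c2_def by (subst card_Un_disjoint) auto
    finally show ?thesis by simp
  qed
  finally have *: "ndom X A (v+2*m+l) (v+m+j) =
     c2 j - c2 l + (v + c1 j - (v + c1 l) - lis a' (v + c1 l) (v + c1 j))" .
  show ?thesis
    using * lis_le[of a' "v + c1 l" "v + c1 j"] c12[of l] c12[of j] c_mono[OF l(2)] l by linarith
qed

text \<open>The roles are exchanged: the low positions in \<open>[j, r)\<close> have straight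
  strands, and the high ones contribute the defect of the high braid.\<close>

lemma ncod_B:
  assumes l: "v \<le> j" "j \<le> r" "r \<le> v+2*m"
  shows "ncod X B (v+m+j) (v+r) + lis a' (v+m+c2 j) (v+m+c2 r) = r - j"
proof -
  let ?lo = "{y\<in>{j..<r}. d y < v + m}"
  let ?hi = "{x\<in>{v+m+m+(v+m+c2 j)..<2*(v+m)+2*m}. p x < v+m + (v+m + c2 r)}"
  let ?h = "\<lambda>x. g (p x - v - m)"
  have l': "j \<le> v+2*m" "v \<le> r" using l by auto
  have cj: "c2 r \<le> m" "c2 j \<le> c2 r" using c2_le l c_mono by auto
  have lo_mem: "B (v+y) = v+m+y" if "y \<in> I" "d y < v + m" for y
    using B_lo[of "d y"] d_in[of y] g_d[of y] that by auto
  have B_p: "B (v + g (p x - v - m)) = (if x < 2*v+3*m then x - 2*m else v+m+g (x-v-2*m))"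
    if "x \<in> {2*v+2*m..<2*v+4*m}" "p x < 2*v+3*m" for x
  proof (cases "x < 2*v+3*m")
    case True
    then have u: "x - v - m \<in> {v+m..<v+2*m}" "v + (x - v - m) + m = x" "v + (x - v - m) - m = x - 2*m"
      using that by auto
    show ?thesis using B_virt[OF u(1)] True that(2) unfolding u(2,3) by simp
  next
    case False
    then have u: "x - v - 2*m \<in> {v+m..<v+2*m}" "v + (x - v - 2*m) + 2*m = x" using that by auto
    show ?thesis using B_hi[OF u(1)] False that(2) unfolding u(2) by simp
  qed
  have hi_mem: "v+m+j \<le> B (v + g (p x - v - m)) \<longleftrightarrow> v+m+m+(v+m+c2 j) \<le> x"
    if x: "x \<in> {2*v+2*m..<2*v+4*m}" "p x < 2*v+3*m" for x
  proof (cases "x < 2*v+3*m")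
    case True then show ?thesis using B_p[OF x] x l by auto
  next
    case False
    let ?u = "x - v - 2*m"
    have u: "?u \<in> I" "v + m \<le> ?u" using False x by auto
    have "g ?u < j \<longleftrightarrow> ?u < v + m + c2 j"
      using less_iff_hi[OF l(1) l'(1) g_in[OF u(1)]] d_g[OF u(1)] u by simp
    then show ?thesis using B_p[OF x] False u by auto
  qed
  have hi_col: "g (p x - v - m) < r \<longleftrightarrow> p x < v+m + (v+m + c2 r)" "g (p x - v - m) \<in> I" "v + m \<le> d (g (p x - v - m))"
    if x: "x \<in> {2*v+2*m..<2*v+4*m}" "p x < 2*v+3*m" for x
  proof -
    let ?u = "p x - v - m"
    have u: "?u \<in> I" "v + m \<le> ?u" using x p2_in[OF x(1)] by auto
    have "g ?u < r \<longleftrightarrow> ?u < v + m + c2 r"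
      using less_iff_hi[OF l'(2) l(3) g_in[OF u(1)]] d_g[OF u(1)] u by simp
    then show "g (p x - v - m) < r \<longleftrightarrow> p x < v+m + (v+m + c2 r)" using u by auto
    show "g (p x - v - m) \<in> I" using g_in u by blast
    show "v + m \<le> d (g (p x - v - m))" using d_g u by metis
  qed
  have sub: "x \<in> {2*v+2*m..<2*v+4*m} \<and> p x < 2*v+3*m" if "x \<in> ?hi" for x
    using that cj by auto
  have "{y\<in>X. y < v+r \<and> v+m+j \<le> B y} = (\<lambda>y. v+y) ` (?lo \<union> ?h ` ?hi)" (is "?S = ?T")
  proof (intro equalityI subsetI)
    fix x assume x: "x \<in> ?S"
    define y where "y = x - v"
    have y: "x = v+y" "y < r" "y \<in> I" using x l by (auto simp: y_def)
    show "x \<in> ?T"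
    proof (cases "d y < v + m")
      case True
      then show ?thesis using lo_mem[OF y(3) True] x y by auto
    next
      case False
      have dy: "d y \<in> I" "g (d y) = y" using d_in[OF y(3)] g_d[OF y(3)] by auto
      then have "v + m + d y \<in> {2*v+2*m..<2*v+4*m}" using False by auto
      then obtain x' where x': "x' \<in> {2*v+2*m..<2*v+4*m}" "p x' = v+m+d y" using p2_surj by blast
      have px: "p x' < 2*v+3*m" using x' dy by auto
      have hy: "?h x' = y" using x' dy by simp
      have "x' \<in> ?hi" using hi_mem[OF x'(1) px] hi_col(1)[OF x'(1) px] hy x y x' by auto
      then have "y \<in> ?h ` ?hi" using hy by blast
      then show ?thesis using y(1) by blast
    qed
  next
    fix x assume "x \<in> ?T"
    then obtain y where y: "x = v+y" "y \<in> ?lo \<or> y \<in> ?h ` ?hi" by blast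
    from y(2) show "x \<in> ?S"
    proof
      assume "y \<in> ?lo"
      then show ?thesis using lo_mem[of y] l y by auto
    next
      assume "y \<in> ?h ` ?hi"
      then obtain x' where x': "x' \<in> ?hi" "y = ?h x'" by blast
      note s = sub[OF x'(1)]
      have "y < r" "y \<in> I" "v+m+j \<le> B (v+y)"
        using hi_col[of x'] hi_mem[of x'] s x' by auto
      then show ?thesis using y(1) by auto
    qed
  qed
  then have "ncod X B (v+m+j) (v+r) = card (?lo \<union> ?h ` ?hi)"
    by (simp add: ncod_def card_image)
  also have "\<dots> = card ?lo + card (?h ` ?hi)"
  proof (rule card_Un_disjoint)
    show "?lo \<inter> ?h ` ?hi = {}"     proof -
      have "v + m \<le> d (?h x)" if "x \<in> ?hi" for x using hi_col(3) sub[OF that] by blast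
      then show ?thesis by fastforce
    qed
  qed auto
  also have "card (?h ` ?hi) = card ?hi"
  proof (rule card_image, rule inj_onI)
    fix x y assume *: "x \<in> ?hi" "y \<in> ?hi" "?h x = ?h y"
    have I: "p x - v - m \<in> I" "p y - v - m \<in> I" using sub[OF *(1)] sub[OF *(2)] p2_in[of x] p2_in[of y] by auto
    then have "p x - v - m = p y - v - m" using *(3) d_g by metis
    then have "p x = p y" using sub[OF *(1)] sub[OF *(2)] p2_in[of x] p2_in[of y] by auto
    then show "x = y" using p2 sub[OF *(1)] sub[OF *(2)] by (metis bij_betw_imp_inj_on inj_onD)
  qed
  also have "card ?hi = (v + m + c2 r - (v + m + c2 j)) - lis a' (v+m+c2 j) (v+m+c2 r)"
    using r2 cj unfolding repr_def by auto
  also have "card ?lo = c1 r - c1 j"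
  proof -
    have "c1 r = card ({y\<in>{v..<j}. d y < v + m} \<union> ?lo)"
      unfolding c1_def by (rule arg_cong[where f=card]) (use l in auto)
    also have "\<dots> = c1 j + card ?lo" unfolding c1_def by (subst card_Un_disjoint) auto
    finally show ?thesis by simp
  qed
  finally have *: "ncod X B (v+m+j) (v+r) =
     c1 r - c1 j + (v + m + c2 r - (v + m + c2 j) - lis a' (v+m+c2 j) (v+m+c2 r))" .
  show ?thesis
    using * lis_le[of a' "v + m + c2 j" "v + m + c2 r"] c12[of j] c12[of r] c_mono[OF l(2)] l by linarith
qed

text \<open>At the intermediate index \<open>v + m + j\<close> with \<open>l \<le> j \<le> r\<close>
  the two factors add up to \<open>r - l\<close> minus the sum of the two partial chain lengths.
  Minimizing over \<open>j\<close> therefore subtracts the longest chain of the window, by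
  \<open>lis_split_ge\<close> and \<open>lis_split_le\<close>.\<close>

lemma repr_merge:
  assumes st: "sticky X X (2*v) (2*v+4*m) A B R"
  shows "repr a R v (2*m)"
  unfolding repr_def
proof (intro ballI)
  fix l r assume l: "l \<in> {v..v+2*m}" and r: "r \<in> {v..v+2*m}"
  have eq: "card {x\<in>{v+2*m+l..<2*v+2*(2*m)}. R x < v + r} = ndom X R (v+2*m+l) (v+r)" (is "?n = _")
    unfolding ndom_def by (rule arg_cong[where f=card]) (use l in auto)
  have upper: "?n \<le> ndom X A (v+2*m+l) j + ncod X B j (v+r)" if "j \<in> {2*v..2*v+4*m}" for j
    using st that eq unfolding sticky_def by simp
  have "\<exists>j\<in>{2*v..2*v+4*m}. ndom X R (v+2*m+l) (v+r) = ndom X A (v+2*m+l) j + ncod X B j (v+r)"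
    using st by (simp only: sticky_def)
  then obtain j0 where j0: "?n = ndom X A (v+2*m+l) j0 + ncod X B j0 (v+r)"
    unfolding eq by blast
  show "?n = r - l - lis a l r"
  proof (cases "l \<le> r")
    case True
    have val: "ndom X A (v+2*m+l) (v+m+j) + ncod X B (v+m+j) (v+r)
        + (lis a' (v + c1 l) (v + c1 j) + lis a' (v+m+c2 j) (v+m+c2 r)) = r - l"
      if "l \<le> j" "j \<le> r" for j
      using ndom_A[of l j] ncod_B[of j r] l r that by simp
    obtain j where j: "l \<le> j" "j \<le> r"
      "lis a l r \<le> lis a' (v + c1 l) (v + c1 j) + lis a' (v+m+c2 j) (v+m+c2 r)"
      using lis_split_le[of l r] True l r by auto
    have "?n \<le> r - l - lis a l r"
      using upper[of "v+m+j"] val[OF j(1,2)] j l r by auto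
    moreover have "r - l - lis a l r \<le> ?n"
    proof -
      \<comment> \<open>The minimum in \<open>sticky\<close> may be attained at an index
        \<open>j0\<close> outside of the meaningful range. Moving it to the nearer end of the range
        does not increase the sum: one summand is 0 there and the other one is monotone.\<close>
      define j' where "j' = max l (min r (j0 - v - m))"
      have j': "l \<le> j'" "j' \<le> r" using True by (auto simp: j'_def)
      have "ndom X A (v+2*m+l) (v+m+j') + ncod X B (v+m+j') (v+r) \<le> ?n"
      proof -
        consider "j0 < v+m+l" | "v+m+l \<le> j0" "j0 \<le> v+m+r" | "v+m+r < j0" by linarith
        then show ?thesis
        proof cases
          case 1
          then have "j' = l" using True by (auto simp: j'_def)
          moreover have "ndom X A (v+2*m+l) (v+m+l) = 0" using ndom_A[of l l] l by simp
          moreover have "ncod X B (v+m+l) (v+r) \<le> ncod X B j0 (v+r)" by (rule ncod_antimono) (use 1 in auto)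
          ultimately show ?thesis using j0 by simp
        next
          case 2
          then have "v+m+j' = j0" by (auto simp: j'_def)
          then show ?thesis using j0 by simp
        next
          case 3
          then have "j' = r" using True by (auto simp: j'_def)
          moreover have "ncod X B (v+m+r) (v+r) = 0" using ncod_B[of r r] r by simp
          moreover have "ndom X A (v+2*m+l) (v+m+r) \<le> ndom X A (v+2*m+l) j0" by (rule ndom_mono) (use 3 in auto)
          ultimately show ?thesis using j0 by simp
        qed
      qed
      moreover have "lis a' (v + c1 l) (v + c1 j') + lis a' (v+m+c2 j') (v+m+c2 r) \<le> lis a l r"
        by (rule lis_split_ge) (use l r j' in auto)
      ultimately show ?thesis using val[OF j'] by linarith
    qed
    ultimately show ?thesis by simp
  next
    case False
    have "ndom X A (v+2*m+l) (v+m+l) = 0" using ndom_A[of l l] l by simp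
    moreover have "ncod X B (v+m+l) (v+r) \<le> ncod X B (v+m+r) (v+r)" by (rule ncod_antimono) (use False in auto)
    moreover have "ncod X B (v+m+r) (v+r) = 0" using ncod_B[of r r] r by simp
    ultimately have "?n = 0" using upper[of "v+m+l"] l by simp
    then show ?thesis using False by simp
  qed
qed

end

section \<open>Reasoning about programs\<close>

definition tri :: "real list \<Rightarrow> nat \<Rightarrow> com \<Rightarrow> state \<Rightarrow> nat \<Rightarrow> (state \<Rightarrow> bool) \<Rightarrow> bool" where
  "tri S W c s T Q \<longleftrightarrow> (\<exists>t s'. exec S W c s t s' \<and> t \<le> T \<and> Q s')"

text \<open>Meant for loop-free code: arriving at a \<open>While\<close> makes it
  \<open>False\<close>, so the placeholder 0 that \<open>cost\<close> assigns to a loop never enters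
  a bound.\<close>

fun wp :: "real list \<Rightarrow> nat \<Rightarrow> com \<Rightarrow> state \<Rightarrow> (state \<Rightarrow> bool) \<Rightarrow> bool" where
  "wp S W Skip s Q \<longleftrightarrow> Q s"
| "wp S W (Assign x e) s Q \<longleftrightarrow> afits W s e \<and> Q ((fst s)(x := aval s e), snd s)"
| "wp S W (Store a i e) s Q \<longleftrightarrow> afits W s i \<and> afits W s e \<and>
     Q (fst s, (snd s)(a := (snd s a)(aval s i := aval s e)))"
| "wp S W (Seq c1 c2) s Q \<longleftrightarrow> wp S W c1 s (\<lambda>s'. wp S W c2 s' Q)"
| "wp S W (Cond b c1 c2) s Q \<longleftrightarrow> bfits S W s b \<and>
     (bval S s b \<longrightarrow> wp S W c1 s Q) \<and> (\<not> bval S s b \<longrightarrow> wp S W c2 s Q)"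
| "wp S W (While b c) s Q \<longleftrightarrow> False"

fun cost :: "com \<Rightarrow> nat" where
  "cost Skip = 1"
| "cost (Assign x e) = 1 + acost e"
| "cost (Store a i e) = 1 + acost i + acost e"
| "cost (Seq c1 c2) = cost c1 + cost c2"
| "cost (Cond b c1 c2) = 1 + bcost b + max (cost c1) (cost c2)"
| "cost (While b c) = 0"

fun regs :: "com \<Rightarrow> vname set" where
  "regs Skip = {}"
| "regs (Assign x e) = {x}"
| "regs (Store a i e) = {}"
| "regs (Seq c1 c2) = regs c1 \<union> regs c2"
| "regs (Cond b c1 c2) = regs c1 \<union> regs c2"
| "regs (While b c) = regs c"

fun arrs :: "com \<Rightarrow> vname set" where
  "arrs Skip = {}"
| "arrs (Assign x e) = {}"
| "arrs (Store a i e) = {a}"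
| "arrs (Seq c1 c2) = arrs c1 \<union> arrs c2"
| "arrs (Cond b c1 c2) = arrs c1 \<union> arrs c2"
| "arrs (While b c) = arrs c"

lemma exec_frame:
  "exec S W c s t s' \<Longrightarrow> (\<forall>x. x \<notin> regs c \<longrightarrow> fst s' x = fst s x) \<and> (\<forall>a. a \<notin> arrs c \<longrightarrow> snd s' a = snd s a)"
  by (induction rule: exec.induct) auto

lemma tri_wp:
  assumes "wp S W c s Q" "cost c \<le> T" shows "tri S W c s T Q"
proof -
  have "\<exists>t s'. exec S W c s t s' \<and> t \<le> cost c \<and> Q s'" using assms(1)
  proof (induction c arbitrary: s Q)
    case (Seq c1 c2)
    from Seq.IH(1)[of s "\<lambda>s'. wp S W c2 s' Q"] Seq.prems
    obtain t1 s1 where 1: "exec S W c1 s t1 s1" "t1 \<le> cost c1" "wp S W c2 s1 Q" by auto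
    from Seq.IH(2)[OF 1(3)] obtain t2 s2 where "exec S W c2 s1 t2 s2" "t2 \<le> cost c2" "Q s2" by auto
    with 1 show ?case by (intro exI[of _ "t1+t2"] exI[of _ s2]) (auto intro: exec.Seq)
  next
    case (Cond b c1 c2)
    show ?case
    proof (cases "bval S s b")
      case True
      then have "wp S W c1 s Q" using Cond.prems by simp
      from Cond.IH(1)[OF this] obtain t s' where "exec S W c1 s t s'" "t \<le> cost c1" "Q s'" by blast
      with True Cond.prems show ?thesis
        by (intro exI[of _ "1 + bcost b + t"] exI[of _ s']) (auto intro: exec.CondTrue[simplified])
    next
      case False
      then have "wp S W c2 s Q" using Cond.prems by simp
      from Cond.IH(2)[OF this] obtain t s' where "exec S W c2 s t s'" "t \<le> cost c2" "Q s'" by blast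
      with False Cond.prems show ?thesis
        by (intro exI[of _ "1 + bcost b + t"] exI[of _ s']) (auto intro: exec.CondFalse[simplified])
    qed
  next
    case Skip then show ?case using exec.Skip[of S W s] by (intro exI[of _ 1] exI[of _ s]) auto
  next
    case (Assign x e)
    then show ?case using exec.Assign[of W s e S x]
      by (intro exI[of _ "1 + acost e"] exI[of _ "((fst s)(x := aval s e), snd s)"]) simp
  next
    case (Store a i e)
    then show ?case using exec.Store[of W s i e S a]
      by (intro exI[of _ "1 + acost i + acost e"]
          exI[of _ "(fst s, (snd s)(a := (snd s a)(aval s i := aval s e)))"]) simp
  qed simp
  then show ?thesis using assms(2) unfolding tri_def by (meson order_trans)
qed

text \<open>The second premise obtains that everything outside the syntactic footprint of
  \<open>c1\<close> is unchanged (\<open>exec_frame\<close>). Intermediate conditions thus mention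
  only what \<open>c1\<close> writes.\<close>

lemma tri_Seq:
  assumes "tri S W c1 s T1 Q1"
    and "\<And>s1. Q1 s1 \<Longrightarrow> (\<And>x. x \<notin> regs c1 \<Longrightarrow> fst s1 x = fst s x) \<Longrightarrow>
      (\<And>a. a \<notin> arrs c1 \<Longrightarrow> snd s1 a = snd s a) \<Longrightarrow> tri S W c2 s1 T2 Q"
    and "T1 + T2 \<le> T"
  shows "tri S W (Seq c1 c2) s T Q"
proof -
  obtain t1 s1 where 1: "exec S W c1 s t1 s1" "t1 \<le> T1" "Q1 s1" using assms(1) by (auto simp: tri_def)
  have "tri S W c2 s1 T2 Q" using assms(2)[OF 1(3)] exec_frame[OF 1(1)] by blast
  then obtain t2 s2 where "exec S W c2 s1 t2 s2" "t2 \<le> T2" "Q s2" by (auto simp: tri_def)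
  with 1 assms(3) show ?thesis unfolding tri_def
    by (intro exI[of _ "t1+t2"] exI[of _ s2]) (auto intro: exec.Seq)
qed

lemma tri_conseq:
  assumes "tri S W c s T Q"
    and "\<And>s1. Q s1 \<Longrightarrow> (\<And>x. x \<notin> regs c \<Longrightarrow> fst s1 x = fst s x) \<Longrightarrow>
      (\<And>a. a \<notin> arrs c \<Longrightarrow> snd s1 a = snd s a) \<Longrightarrow> Q' s1"
    and "T \<le> T'"
  shows "tri S W c s T' Q'"
proof -
  obtain t1 s1 where 1: "exec S W c s t1 s1" "t1 \<le> T" "Q s1" using assms(1) by (auto simp: tri_def)
  have "Q' s1" using assms(2)[OF 1(3)] exec_frame[OF 1(1)] by blast
  with 1 assms(3) show ?thesis unfolding tri_def by (meson order_trans)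
qed

lemma tri_Cond:
  assumes "bfits S W s b" "bval S s b \<Longrightarrow> tri S W c1 s T1 Q" "\<not> bval S s b \<Longrightarrow> tri S W c2 s T1 Q"
    and "1 + bcost b + T1 \<le> T"
  shows "tri S W (Cond b c1 c2) s T Q"
proof (cases "bval S s b")
  case True
  then obtain t s' where "exec S W c1 s t s'" "t \<le> T1" "Q s'" using assms by (auto simp: tri_def)
  with True assms show ?thesis unfolding tri_def
    by (intro exI[of _ "1 + bcost b + t"] exI[of _ s']) (auto intro: exec.CondTrue[simplified])
next
  case False
  then obtain t s' where "exec S W c2 s t s'" "t \<le> T1" "Q s'" using assms by (auto simp: tri_def)
  with False assms show ?thesis unfolding tri_def
    by (intro exI[of _ "1 + bcost b + t"] exI[of _ s']) (auto intro: exec.CondFalse[simplified])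
qed

text \<open>The variant \<open>n\<close> may drop by any amount in a round. It bounds the rounds,
  and the final failing test is paid by the summand 1.\<close>

lemma tri_While:
  assumes I: "I n s"
    and step: "\<And>n s. I n s \<Longrightarrow> bfits S W s b \<and>
      (bval S s b \<longrightarrow> 0 < n \<and> tri S W c s B (\<lambda>s'. \<exists>m<n. I m s')) \<and> (\<not> bval S s b \<longrightarrow> Q s)"
    and T: "(n + 1) * (B + 1 + bcost b) \<le> T"
  shows "tri S W (While b c) s T Q"
proof -
  have "\<exists>t s'. exec S W (While b c) s t s' \<and> t \<le> (n + 1) * (B + 1 + bcost b) \<and> Q s'"
    using I
  proof (induction n arbitrary: s rule: less_induct)
    case (less n)
    note st = step[OF less.prems]
    show ?case
    proof (cases "bval S s b")
      case False
      then have "exec S W (While b c) s (1 + bcost b) s" "Q s" using st by (auto intro: exec.WhileFalse[simplified])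
      then show ?thesis by (intro exI[of _ "1 + bcost b"] exI[of _ s]) (auto simp: algebra_simps)
    next
      case True
      then obtain t1 s1 m where 1: "exec S W c s t1 s1" "t1 \<le> B" "m < n" "I m s1"
        using st unfolding tri_def by blast
      from less.IH[OF 1(3,4)] obtain t2 s2 where
        2: "exec S W (While b c) s1 t2 s2" "t2 \<le> (m + 1) * (B + 1 + bcost b)" "Q s2" by blast
      have "exec S W (While b c) s (1 + bcost b + t1 + t2) s2"
        using exec.WhileTrue[OF _ True 1(1) 2(1)] st by blast
      moreover have "1 + bcost b + t1 + t2 \<le> (n + 1) * (B + 1 + bcost b)"
      proof -
        have "(m + 2) * (B + 1 + bcost b) \<le> (n + 1) * (B + 1 + bcost b)"
          using 1(3) by (intro mult_le_mono1) simp
        then show ?thesis using 1(2) 2(2) by (simp add: algebra_simps)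
      qed
      ultimately show ?thesis using 2(3) by blast
    qed
  qed
  then show ?thesis using T unfolding tri_def by (meson order_trans)
qed

definition For :: "vname \<Rightarrow> vname \<Rightarrow> com \<Rightarrow> com" where
  "For x h c = While (Less (V x) (V h)) (Seq c (Assign x (Plus (V x) (N 1))))"

lemma regs_For [simp]: "regs (For x h c) = insert x (regs c)"
  and arrs_For [simp]: "arrs (For x h c) = arrs c"
  by (auto simp: For_def)

text \<open>The invariant for \<open>Suc i\<close> is asserted of the state with the counter already
  advanced, although \<open>c\<close> ends before the increment. The overhead of 8 per round
  consists of 4 for the test and 4 for the increment.\<close>

lemma tri_For:
  assumes xh: "x \<noteq> h" and init: "fst s x = a" "fst s h = b" "a \<le> b" "I a s" and W: "b \<le> W"
    and step: "\<And>i s. a \<le> i \<Longrightarrow> i < b \<Longrightarrow> fst s x = i \<Longrightarrow> fst s h = b \<Longrightarrow> I i s \<Longrightarrow>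
      tri S W c s B (\<lambda>s'. fst s' x = i \<and> fst s' h = b \<and> I (Suc i) ((fst s')(x := Suc i), snd s'))"
    and final: "\<And>s. fst s x = b \<Longrightarrow> fst s h = b \<Longrightarrow> I b s \<Longrightarrow> Q s"
    and T: "(b - a + 1) * (B + 8) \<le> T"
  shows "tri S W (For x h c) s T Q"
  unfolding For_def
proof (rule tri_While[where B = "B + 4" and n = "b - a" and
      I = "\<lambda>n s. n \<le> b - a \<and> fst s x = b - n \<and> fst s h = b \<and> I (b - n) s"])
  show "b - a \<le> b - a \<and> fst s x = b - (b - a) \<and> fst s h = b \<and> I (b - (b - a)) s" using init by simp
  show "(b - a + 1) * (B + 4 + 1 + bcost (Less (V x) (V h))) \<le> T"
    using T by (simp add: algebra_simps)
  fix n s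
  assume *: "n \<le> b - a \<and> fst s x = b - n \<and> fst s h = b \<and> I (b - n) s"
  show "bfits S W s (Less (V x) (V h)) \<and>
    (bval S s (Less (V x) (V h)) \<longrightarrow> 0 < n \<and>
      tri S W (Seq c (Assign x (Plus (V x) (N 1)))) s (B + 4)
        (\<lambda>s'. \<exists>m<n. m \<le> b - a \<and> fst s' x = b - m \<and> fst s' h = b \<and> I (b - m) s')) \<and>
    (\<not> bval S s (Less (V x) (V h)) \<longrightarrow> Q s)"
  proof (intro conjI impI)
    assume "bval S s (Less (V x) (V h))"
    then have n: "0 < n" using * by simp
    then show "0 < n" .
    have st: "tri S W c s B (\<lambda>s'. fst s' x = b - n \<and> fst s' h = b \<and> I (Suc (b - n)) ((fst s')(x := Suc (b - n)), snd s'))"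
      by (rule step) (use * n init in auto)
    show "tri S W (Seq c (Assign x (Plus (V x) (N 1)))) s (B + 4)
        (\<lambda>s'. \<exists>m<n. m \<le> b - a \<and> fst s' x = b - m \<and> fst s' h = b \<and> I (b - m) s')"
    proof (rule tri_Seq[OF st])
      fix s1 assume 1: "fst s1 x = b - n \<and> fst s1 h = b \<and> I (Suc (b - n)) ((fst s1)(x := Suc (b - n)), snd s1)"
      have e: "b - (n - 1) = Suc (b - n)" using n * init by auto
      show "tri S W (Assign x (Plus (V x) (N 1))) s1 4 (\<lambda>s'. \<exists>m<n. m \<le> b - a \<and> fst s' x = b - m \<and> fst s' h = b \<and> I (b - m) s')"
        by (rule tri_wp) (use 1 n * xh W init e in \<open>auto intro!: exI[of _ "n - 1"]\<close>)
    qed simp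
  next
    assume "\<not> bval S s (Less (V x) (V h))"
    then have "n = 0" using * init by auto
    then show "Q s" using * final by simp
  qed simp
qed

abbreviation seq (infixr ";;" 60) where "c1 ;; c2 \<equiv> Seq c1 c2"

section \<open>The product on the machine\<close>

text \<open>A class has exactly \<open>z\<close> members, so its slots start at \<open>q\<close>
  without a counting pass. The array \<open>''Q''\<close> holds at \<open>q\<close> the next free
  slot of the class and is used at multiples of \<open>z\<close> only.\<close>

definition split_body :: "vname \<Rightarrow> vname \<Rightarrow> vname \<Rightarrow> com" where
  "split_body A G w =
     Assign ''q'' (Times (Div (Load A (Plus (V ''l'') (V ''i''))) (V ''z'')) (V ''z''));;
     Assign ''d'' (Plus (Plus (V ''l'') (V w)) (Load ''Q'' (V ''q'')));;
     Store A (V ''d'') (Load A (Plus (V ''l'') (V ''i'')));;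
     Store G (V ''d'') (V ''i'');;
     Store ''Q'' (V ''q'') (Plus (Load ''Q'' (V ''q'')) (N 1))"

definition split_level :: "vname \<Rightarrow> vname \<Rightarrow> vname \<Rightarrow> com" where
  "split_level A G w =
     Assign ''i'' (N 0);; For ''i'' w (Store ''Q'' (V ''i'') (V ''i''));;
     Assign ''i'' (N 0);; For ''i'' w (split_body A G w)"

definition split_prog :: "vname \<Rightarrow> vname \<Rightarrow> vname \<Rightarrow> com" where
  "split_prog A G w =
     Assign ''l'' (N 0);;
     While (Less (N 1) (V ''z''))
       (Assign ''z'' (Div (V ''z'') (N 2));;
        split_level A G w;;
        Assign ''l'' (Plus (V ''l'') (V w)))"

definition split_names :: "vname \<Rightarrow> vname \<Rightarrow> vname \<Rightarrow> bool" where
  "split_names A G w \<longleftrightarrow> A \<noteq> G \<and> A \<noteq> ''Q'' \<and> G \<noteq> ''Q'' \<and> w \<notin> {''l'', ''i'', ''z'', ''q'', ''d''}"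

lemma regs_split [simp]: "regs (split_level A G w) = {''i'', ''q'', ''d''}"
  "regs (split_prog A G w) = {''i'', ''q'', ''d'', ''l'', ''z''}"
  "arrs (split_level A G w) = {''Q'', A, G}"
  "arrs (split_prog A G w) = {''Q'', A, G}"
  by (auto simp: split_level_def split_prog_def split_body_def)

text \<open>The cells below \<open>l + wn\<close> hold the current and all earlier levels. They must
  survive, because the ascent reads them again.\<close>

definition split_inv :: "vname \<Rightarrow> vname \<Rightarrow> state \<Rightarrow> nat \<Rightarrow> nat \<Rightarrow> nat \<Rightarrow> (nat \<Rightarrow> nat) \<Rightarrow> nat \<Rightarrow> state \<Rightarrow> bool" where
  "split_inv A G s0 l wn z a i s \<longleftrightarrow>
     fst s ''l'' = l \<and> fst s ''z'' = z \<and>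
     (\<forall>j<l+wn. snd s A j = snd s0 A j \<and> snd s G j = snd s0 G j) \<and>
     (\<forall>j<i. snd s A (l + wn + dst a z j) = a j \<and> snd s G (l + wn + dst a z j) = j) \<and>
     (\<forall>p. p * z < wn \<longrightarrow> snd s ''Q'' (p * z) = p * z + card {j. j < i \<and> a j div z = p})"

lemma split_body_correct:
  assumes nm: "split_names A G w" and a: "bij_betw a {..<wn} {..<wn}" and z: "0 < z" "z dvd wn"
    and aA: "\<And>j. j < wn \<Longrightarrow> snd s0 A (l + j) = a j"
    and W: "l + 2 * wn \<le> W" "1 \<le> W"
    and i: "i < wn" "fst s ''i'' = i" "fst s w = wn" and I: "split_inv A G s0 l wn z a i s"
  shows "wp S W (split_body A G w) s (\<lambda>s'. fst s' ''i'' = i \<and> fst s' w = wn \<and>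
     split_inv A G s0 l wn z a (Suc i) ((fst s')(''i'' := Suc i), snd s'))"
proof -
  let ?p = "a i div z"
  let ?q = "?p * z"
  let ?d = "l + wn + dst a z i"
  note cc = dst_class_card[OF a z i(1)]
  have ai: "a i < wn" using a i by (auto dest: bij_betwE)
  have A1: "snd s A (l + i) = a i" using I i aA by (simp add: split_inv_def)
  have q: "?q < wn" using cc(2) z by simp
  have Qq: "snd s ''Q'' ?q = dst a z i"
    using I q by (simp add: split_inv_def dst_def)
  have dw: "dst a z i < wn" using dst_div[OF a z i(1)] by simp
  have dne: "dst a z j \<noteq> dst a z i" if "j < i" for j
    using bij_betw_imp_inj_on[OF dst_bij[OF a z]] that i by (auto dest!: inj_onD)
  have card_Suc: "card {j. j < Suc i \<and> a j div z = p} =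
      card {j. j < i \<and> a j div z = p} + (if p = ?p then 1 else 0)" for p
  proof -
    have "{j. j < Suc i \<and> a j div z = p} = (if p = ?p then insert i {j. j < i \<and> a j div z = p} else {j. j < i \<and> a j div z = p})"
      by (auto simp: less_Suc_eq)
    then show ?thesis by simp
  qed
  have pz: "p * z = ?q \<longleftrightarrow> p = ?p" for p using z by simp
  have names: "A \<noteq> G" "A \<noteq> ''Q''" "G \<noteq> ''Q''" "G \<noteq> A" "''Q'' \<noteq> A" "''Q'' \<noteq> G"
    "w \<noteq> ''l''" "w \<noteq> ''i''" "w \<noteq> ''z''" "w \<noteq> ''q''" "w \<noteq> ''d''"
    using nm by (auto simp: split_names_def)
  have I': "fst s ''l'' = l" "fst s ''z'' = z"
     "\<And>j. j<l+wn \<Longrightarrow> snd s A j = snd s0 A j \<and> snd s G j = snd s0 G j"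
     "\<And>j. j<i \<Longrightarrow> snd s A (l + wn + dst a z j) = a j \<and> snd s G (l + wn + dst a z j) = j"
     "\<And>p. p * z < wn \<Longrightarrow> snd s ''Q'' (p * z) = p * z + card {j. j < i \<and> a j div z = p}"
    using I by (auto simp: split_inv_def)
  have qa: "?q \<le> W" using q W by simp
  show ?thesis
    unfolding split_body_def split_inv_def
    using names i I' A1 Qq W dw qa ai
    using z by (simp add: card_Suc pz All_less_Suc dne dst_def[of a z i, symmetric])
qed

lemma split_level_correct:
  assumes nm: "split_names A G w" and a: "bij_betw a {..<wn} {..<wn}" and z: "0 < z" "z dvd wn"
    and s: "fst s0 ''l'' = l" "fst s0 ''z'' = z" "fst s0 w = wn"
    and aA: "\<And>j. j < wn \<Longrightarrow> snd s0 A (l + j) = a j"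
    and W: "l + 2 * wn \<le> W" "1 \<le> W"
  shows "tri S W (split_level A G w) s0 (70 * (wn + 1)) (\<lambda>s'.
     (\<forall>j<l+wn. snd s' A j = snd s0 A j \<and> snd s' G j = snd s0 G j) \<and>
     (\<forall>j<wn. snd s' A (l + wn + dst a z j) = a j \<and> snd s' G (l + wn + dst a z j) = j))"
proof -
  have names: "A \<noteq> G" "A \<noteq> ''Q''" "G \<noteq> ''Q''" "G \<noteq> A" "''Q'' \<noteq> A" "''Q'' \<noteq> G"
    "w \<noteq> ''l''" "w \<noteq> ''i''" "w \<noteq> ''z''" "w \<noteq> ''q''" "w \<noteq> ''d''"
    using nm by (auto simp: split_names_def)
  show ?thesis unfolding split_level_def
  proof (rule tri_Seq)
    show "tri S W (Assign ''i'' (N 0)) s0 2 (\<lambda>s. s = ((fst s0)(''i'' := 0), snd s0))"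
      by (rule tri_wp) (use W in auto)
    fix s1 assume s1: "s1 = ((fst s0)(''i'' := 0), snd s0)"
    show "tri S W (For ''i'' w (Store ''Q'' (V ''i'') (V ''i''));;
     Assign ''i'' (N 0);; For ''i'' w (split_body A G w)) s1 (70 * wn + 66) (\<lambda>s'.
     (\<forall>j<l+wn. snd s' A j = snd s0 A j \<and> snd s' G j = snd s0 G j) \<and>
     (\<forall>j<wn. snd s' A (l + wn + dst a z j) = a j \<and> snd s' G (l + wn + dst a z j) = j))"
    proof (rule tri_Seq)
      show "tri S W (For ''i'' w (Store ''Q'' (V ''i'') (V ''i''))) s1 (11*wn+11) (\<lambda>s. \<forall>j<wn. snd s ''Q'' j = j)"
      proof (rule tri_For[where I="\<lambda>i s. \<forall>j<i. snd s ''Q'' j = j" and a=0 and b=wn and B=3])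
        fix i s assume "i < wn" "fst s ''i'' = i" "fst s w = wn" "\<forall>j<i. snd s ''Q'' j = j"
        then show "tri S W (Store ''Q'' (V ''i'') (V ''i'')) s 3 (\<lambda>s'. fst s' ''i'' = i \<and> fst s' w = wn \<and>
            (\<forall>j<Suc i. snd ((fst s')(''i'' := Suc i), snd s') ''Q'' j = j))"
          by (intro tri_wp) (auto simp: less_Suc_eq)
      qed (use s s1 names W in auto)
      fix s2 assume s2: "\<forall>j<wn. snd s2 ''Q'' j = j"
        "\<And>x. x \<notin> regs (For ''i'' w (Store ''Q'' (V ''i'') (V ''i''))) \<Longrightarrow> fst s2 x = fst s1 x"
        "\<And>x. x \<notin> arrs (For ''i'' w (Store ''Q'' (V ''i'') (V ''i''))) \<Longrightarrow> snd s2 x = snd s1 x"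
      show "tri S W (Assign ''i'' (N 0);; For ''i'' w (split_body A G w)) s2 (59*wn+55) (\<lambda>s'.
       (\<forall>j<l+wn. snd s' A j = snd s0 A j \<and> snd s' G j = snd s0 G j) \<and>
       (\<forall>j<wn. snd s' A (l + wn + dst a z j) = a j \<and> snd s' G (l + wn + dst a z j) = j))"
      proof (rule tri_Seq)
        show "tri S W (Assign ''i'' (N 0)) s2 2 (\<lambda>s. s = ((fst s2)(''i'' := 0), snd s2))"
          by (rule tri_wp) (use W in auto)
        fix s3 assume s3: "s3 = ((fst s2)(''i'' := 0), snd s2)"
        show "tri S W (For ''i'' w (split_body A G w)) s3 (53*wn+53) (\<lambda>s'.
         (\<forall>j<l+wn. snd s' A j = snd s0 A j \<and> snd s' G j = snd s0 G j) \<and>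
         (\<forall>j<wn. snd s' A (l + wn + dst a z j) = a j \<and> snd s' G (l + wn + dst a z j) = j))"
        proof (rule tri_For[where I="split_inv A G s0 l wn z a" and a=0 and b=wn and B=45])
          show "split_inv A G s0 l wn z a 0 s3"
            unfolding split_inv_def using s s1 s2 s3 names by auto
          fix i s assume *: "i < wn" "fst s ''i'' = i" "fst s w = wn" "split_inv A G s0 l wn z a i s"
          show "tri S W (split_body A G w) s 45 (\<lambda>s'. fst s' ''i'' = i \<and> fst s' w = wn \<and>
             split_inv A G s0 l wn z a (Suc i) ((fst s')(''i'' := Suc i), snd s'))"
            by (rule tri_wp[OF split_body_correct[OF nm a z aA W *]]) (auto simp: split_body_def)
        qed (use s s1 s2 s3 names W in \<open>auto simp: split_inv_def\<close>)
      qed simp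
    qed simp
  qed simp
qed

text \<open>The array after \<open>k\<close> sorting passes, with blocks of size
  \<open>2 ^ (L - k)\<close>. The map \<open>gmap\<close> below leads from a slot of level
  \<open>Suc k\<close> back to its slot in level \<open>k\<close>.\<close>

primrec lvl :: "nat \<Rightarrow> (nat \<Rightarrow> nat) \<Rightarrow> nat \<Rightarrow> nat \<Rightarrow> nat \<Rightarrow> nat" where
  "lvl wn a L 0 = a"
| "lvl wn a L (Suc k) = (\<lambda>x. lvl wn a L k (inv_into {..<wn} (dst (lvl wn a L k) (2 ^ (L - Suc k))) x))"

definition gmap :: "nat \<Rightarrow> (nat \<Rightarrow> nat) \<Rightarrow> nat \<Rightarrow> nat \<Rightarrow> nat \<Rightarrow> nat" where
  "gmap wn a L k = inv_into {..<wn} (dst (lvl wn a L k) (2 ^ (L - Suc k)))"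

lemma pow_dvd_level: "2 ^ L dvd (wn::nat) \<Longrightarrow> 2 ^ (L - k) dvd wn"
  by (metis diff_le_self dvd_trans le_imp_power_dvd)

lemma lvl_bij:
  assumes "bij_betw a {..<wn} {..<wn}" "2 ^ L dvd wn"
  shows "bij_betw (lvl wn a L k) {..<wn} {..<wn}"
proof (induction k)
  case (Suc k)
  have "bij_betw (inv_into {..<wn} (dst (lvl wn a L k) (2 ^ (L - Suc k)))) {..<wn} {..<wn}"
    by (intro bij_betw_inv_into dst_bij Suc pow_dvd_level assms) simp
  from bij_betw_trans[OF this Suc] show ?case by (simp add: comp_def)
qed (use assms in simp)

lemma lvl_dst:
  assumes "bij_betw a {..<wn} {..<wn}" "2 ^ L dvd wn" "i < wn"
  shows "lvl wn a L (Suc k) (dst (lvl wn a L k) (2 ^ (L - Suc k)) i) = lvl wn a L k i"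
    and "gmap wn a L k (dst (lvl wn a L k) (2 ^ (L - Suc k)) i) = i"
proof -
  have "bij_betw (dst (lvl wn a L k) (2 ^ (L - Suc k))) {..<wn} {..<wn}"
    by (intro dst_bij lvl_bij pow_dvd_level assms) simp
  then have "inv_into {..<wn} (dst (lvl wn a L k) (2 ^ (L - Suc k))) (dst (lvl wn a L k) (2 ^ (L - Suc k)) i) = i"
    using assms(3) by (intro inv_into_f_f) (auto simp: bij_betw_def)
  then show "lvl wn a L (Suc k) (dst (lvl wn a L k) (2 ^ (L - Suc k)) i) = lvl wn a L k i"
    "gmap wn a L k (dst (lvl wn a L k) (2 ^ (L - Suc k)) i) = i" by (simp_all add: gmap_def)
qed

lemma lvl_block_perm:
  assumes "block_perm wn (2 ^ L) a" "2 ^ L dvd wn"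
  shows "block_perm wn (2 ^ (L - k)) (lvl wn a L k)"
proof (cases k)
  case 0 then show ?thesis using assms by simp
next
  case (Suc k')
  have a: "bij_betw a {..<wn} {..<wn}" using assms by (simp add: block_perm_def)
  show ?thesis unfolding Suc
    by (rule dst_block_perm[OF lvl_bij[OF a assms(2)] _ pow_dvd_level[OF assms(2)] lvl_dst(1)[OF a assms(2)]]) simp_all
qed

text \<open>The back pointers in \<open>G\<close> are stored one level lower than the index of
  \<open>gmap\<close> suggests: those kept with level \<open>Suc j\<close> lead back to level
  \<open>j\<close>.\<close>

definition levels_at :: "vname \<Rightarrow> vname \<Rightarrow> nat \<Rightarrow> (nat \<Rightarrow> nat) \<Rightarrow> nat \<Rightarrow> nat \<Rightarrow> state \<Rightarrow> bool" where
  "levels_at A G wn a L k s \<longleftrightarrow>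
     (\<forall>j\<le>k. \<forall>i<wn. snd s A (j * wn + i) = lvl wn a L j i) \<and>
     (\<forall>j<k. \<forall>i<wn. snd s G (Suc j * wn + i) = gmap wn a L j i)"

lemma split_prog_correct:
  assumes nm: "split_names A G w" and a: "bij_betw a {..<wn} {..<wn}" and L: "2 ^ L dvd wn"
    and s: "fst s0 ''z'' = 2 ^ L" "fst s0 w = wn" "\<And>i. i < wn \<Longrightarrow> snd s0 A i = a i"
    and W: "(L + 2) * wn \<le> W" "2 \<le> W"
  shows "tri S W (split_prog A G w) s0 ((L + 1) * (90 * (wn + 1)) + 2)
     (\<lambda>s. fst s ''l'' = L * wn \<and> fst s ''z'' = 1 \<and> levels_at A G wn a L L s)"
proof -
  have names: "A \<noteq> G" "A \<noteq> ''Q''" "G \<noteq> ''Q''" "G \<noteq> A" "''Q'' \<noteq> A" "''Q'' \<noteq> G"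
    "w \<noteq> ''l''" "w \<noteq> ''i''" "w \<noteq> ''z''" "w \<noteq> ''q''" "w \<noteq> ''d''"
    using nm by (auto simp: split_names_def)
  let ?I = "\<lambda>n s. n \<le> L \<and> fst s ''z'' = 2 ^ n \<and> fst s ''l'' = (L - n) * wn \<and> fst s w = wn \<and> levels_at A G wn a L (L - n) s"
  show ?thesis unfolding split_prog_def
  proof (rule tri_Seq)
    show "tri S W (Assign ''l'' (N 0)) s0 2 (\<lambda>s. s = ((fst s0)(''l'' := 0), snd s0))"
      by (rule tri_wp) auto
    fix s1 assume s1: "s1 = ((fst s0)(''l'' := 0), snd s0)"
    show "tri S W (While (Less (N 1) (V ''z'')) (Assign ''z'' (Div (V ''z'') (N 2)) ;; split_level A G w ;; Assign ''l'' (Plus (V ''l'') (V w))))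
      s1 ((L + 1) * (90 * (wn + 1))) (\<lambda>s. fst s ''l'' = L * wn \<and> fst s ''z'' = 1 \<and> levels_at A G wn a L L s)"
    proof (rule tri_While[where I = ?I and n = L and B = "70 * (wn + 1) + 8"])
      show "?I L s1" using s s1 names by (simp add: levels_at_def)
      fix n s assume I: "?I n s"
      show "bfits S W s (Less (N 1) (V ''z'')) \<and>
         (bval S s (Less (N 1) (V ''z'')) \<longrightarrow> 0 < n \<and>
          tri S W (Assign ''z'' (Div (V ''z'') (N 2)) ;; split_level A G w ;; Assign ''l'' (Plus (V ''l'') (V w))) s
            (70 * (wn + 1) + 8) (\<lambda>s'. \<exists>m<n. ?I m s')) \<and>
         (\<not> bval S s (Less (N 1) (V ''z'')) \<longrightarrow>
            fst s ''l'' = L * wn \<and> fst s ''z'' = 1 \<and> levels_at A G wn a L L s)"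
      proof (intro conjI impI)
        show "bfits S W s (Less (N 1) (V ''z''))" using W by simp
      next
        assume "bval S s (Less (N 1) (V ''z''))"
        then have "1 < (2::nat) ^ n" using I by simp
        then show n: "0 < n" by (cases n) auto
        define k where "k = L - n"
        have kL: "L - (n - 1) = Suc k" "L - Suc k = n - 1" "Suc k \<le> L" using n I by (auto simp: k_def)
        let ?a = "lvl wn a L k" let ?z = "2 ^ (L - Suc k) :: nat"
        have I': "fst s ''z'' = 2 * ?z" "fst s ''l'' = k * wn" "fst s w = wn" "levels_at A G wn a L k s"
          using I n kL by (auto simp: k_def power_eq_if)
        have Wk: "k * wn + 2 * wn \<le> W"
        proof -
          have "(k + 2) * wn \<le> (L + 2) * wn" using kL by (intro mult_le_mono1) simp
          moreover have "(k + 2) * wn = k * wn + 2 * wn" by (rule add_mult_distrib)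
          ultimately show ?thesis using W(1) by linarith
        qed
        show "tri S W (Assign ''z'' (Div (V ''z'') (N 2)) ;; split_level A G w ;; Assign ''l'' (Plus (V ''l'') (V w))) s
            (70 * (wn + 1) + 8) (\<lambda>s'. \<exists>m<n. ?I m s')"
        proof (rule tri_Seq)
          show "tri S W (Assign ''z'' (Div (V ''z'') (N 2))) s 4 (\<lambda>s'. s' = ((fst s)(''z'' := ?z), snd s))"
            by (rule tri_wp) (use W I' in auto)
          fix s2 assume s2: "s2 = ((fst s)(''z'' := ?z), snd s)"
          show "tri S W (split_level A G w ;; Assign ''l'' (Plus (V ''l'') (V w))) s2 (70 * (wn + 1) + 4) (\<lambda>s'. \<exists>m<n. ?I m s')"
          proof (rule tri_Seq)
            show "tri S W (split_level A G w) s2 (70 * (wn + 1)) (\<lambda>s'.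
              (\<forall>j<k*wn+wn. snd s' A j = snd s2 A j \<and> snd s' G j = snd s2 G j) \<and>
              (\<forall>j<wn. snd s' A (k*wn + wn + dst ?a ?z j) = ?a j \<and> snd s' G (k*wn + wn + dst ?a ?z j) = j))"
              by (rule split_level_correct[OF nm lvl_bij[OF a L] _ pow_dvd_level[OF L]])
                (use s2 I' names Wk W in \<open>auto simp: levels_at_def\<close>)
            fix s3 assume s3: "(\<forall>j<k*wn+wn. snd s3 A j = snd s2 A j \<and> snd s3 G j = snd s2 G j) \<and>
              (\<forall>j<wn. snd s3 A (k*wn + wn + dst ?a ?z j) = ?a j \<and> snd s3 G (k*wn + wn + dst ?a ?z j) = j)"
              and fr: "\<And>x. x \<notin> regs (split_level A G w) \<Longrightarrow> fst s3 x = fst s2 x"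
            have new: "snd s3 A (Suc k * wn + i) = lvl wn a L (Suc k) i \<and> snd s3 G (Suc k * wn + i) = gmap wn a L k i"
              if "i < wn" for i
            proof -
              have "bij_betw (dst ?a ?z) {..<wn} {..<wn}"
                by (intro dst_bij lvl_bij pow_dvd_level a L) simp
              then have "i \<in> dst ?a ?z ` {..<wn}" using that bij_betw_imp_surj_on by blast
              then obtain j where j: "j < wn" "i = dst ?a ?z j" by auto
              have "snd s3 A (k*wn + wn + i) = ?a j \<and> snd s3 G (k*wn + wn + i) = j"
                unfolding j(2) using s3 j(1) by blast
              then show ?thesis unfolding j(2) using lvl_dst[OF a L j(1), of k] by (simp add: algebra_simps)
            qed
            have old: "snd s3 A (j * wn + i) = snd s A (j * wn + i) \<and> snd s3 G (j * wn + i) = snd s G (j * wn + i)"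
              if "j \<le> k" "i < wn" for i j
            proof -
              have "j * wn \<le> k * wn" using that by simp
              then have "j * wn + i < k * wn + wn" using that by linarith
              then show ?thesis using s3 s2 by simp
            qed
            have lev: "levels_at A G wn a L (Suc k) s3"
              unfolding levels_at_def
            proof (intro conjI allI impI)
              fix j i assume "j \<le> Suc k" "i < wn"
              then show "snd s3 A (j * wn + i) = lvl wn a L j i"
                using I'(4) old[of j i] new[of i] unfolding levels_at_def le_Suc_eq by auto
            next
              fix j i assume "j < Suc k" "i < wn"
              then show "snd s3 G (Suc j * wn + i) = gmap wn a L j i"
                using I'(4) old[of "Suc j" i] new[of i] unfolding levels_at_def less_Suc_eq
                by (metis Suc_leI)
            qed
            show "tri S W (Assign ''l'' (Plus (V ''l'') (V w))) s3 4 (\<lambda>s'. \<exists>m<n. ?I m s')"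
            proof (rule tri_wp)
              have "fst s3 ''l'' = k * wn" "fst s3 ''z'' = ?z" "fst s3 w = wn"
                using fr s2 I' names by auto
              then show "wp S W (Assign ''l'' (Plus (V ''l'') (V w))) s3 (\<lambda>s'. \<exists>m<n. ?I m s')"
                using lev Wk kL n I names by (auto simp: levels_at_def intro!: exI[of _ "n - 1"])
            qed simp
          qed simp
        qed simp
      next
        assume "\<not> bval S s (Less (N 1) (V ''z''))"
        then have "\<not> 1 < (2::nat) ^ n" using I by simp
        then have "n = 0" using one_less_power[of "2::nat" n] by (cases "n = 0") auto
        then show "fst s ''l'' = L * wn" "fst s ''z'' = 1" "levels_at A G wn a L L s" using I by auto
      qed
    next
      show "(L + 1) * (70 * (wn + 1) + 8 + 1 + bcost (Less (N 1) (V ''z''))) \<le> (L + 1) * (90 * (wn + 1))"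
        by (intro mult_le_mono2) simp
    qed
  qed simp
qed

section \<open>The walk along the staircase\<close>

text \<open>
  The walk is at row \<open>r\<close> and column \<open>c\<close>, with \<open>e = Fhi - Flo \<in> {0, 1}\<close>; \<open>t\<close> is the amount by which
  \<open>e\<close> is smaller in the next column, or \<open>2\<close> if there is no next column.
\<close>

definition ant_step :: com where
  "ant_step =
    Cond (Less (V ''c'') (V ''f''))
      (Cond (Less (Load ''B'' (Plus (V ''l'') (V ''c''))) (V ''h''))
        (Cond (Less (Load ''Y'' (V ''c'')) (V ''r'')) (Assign ''t'' (N 0)) (Assign ''t'' (N 1)))
        (Cond (Less (Load ''Y'' (V ''c'')) (V ''r'')) (Assign ''t'' (N 1)) (Assign ''t'' (N 0))))
      (Assign ''t'' (N 2));;
    Cond (Less (V ''t'') (Plus (V ''e'') (N 1)))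
      (Assign ''e'' (Minus (V ''e'') (V ''t''));; Assign ''c'' (Plus (V ''c'') (N 1)))
      (Assign ''r'' (Minus (V ''r'') (N 1));;
       Cond (Less (Load ''A'' (Plus (V ''l'') (V ''r''))) (V ''h''))
         (Cond (Less (Load ''X'' (V ''r'')) (V ''c'')) (Assign ''e'' (N 0)) (Assign ''e'' (N 1)))
         (Cond (Less (Load ''X'' (V ''r'')) (V ''c'')) (Assign ''e'' (N 1)) (Assign ''e'' (N 0)));;
       Cond (Less (N 0) (V ''e''))
         (Store ''R'' (V ''r'') (V ''c'')) (Store ''R'' (V ''r'') (Load ''X'' (V ''r''))))"

definition ant_init :: com where
  "ant_init =
    Assign ''f'' (Plus (V ''b'') (V ''y''));; Assign ''h'' (Plus (V ''b'') (V ''z''));;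
    Assign ''c'' (V ''b'');; Assign ''e'' (N 0);; Assign ''r'' (V ''f'')"

definition ant_block :: com where
  "ant_block = ant_init;; While (Less (V ''b'') (V ''r'')) ant_step;;
    Assign ''b'' (V ''f'')"

lemma regs_ant [simp]: "regs ant_block = {''f'', ''h'', ''c'', ''e'', ''r'', ''b'', ''t''}"
  "arrs ant_block = {''R''}"
  by (auto simp: ant_block_def ant_step_def ant_init_def)

context block_merge
begin

definition ant_data :: "nat \<Rightarrow> state \<Rightarrow> bool" where
  "ant_data l s \<longleftrightarrow> (\<forall>x\<in>{b..<e}. snd s ''A'' (l + x) = \<alpha> x \<and> snd s ''B'' (l + x) = \<beta> x \<and>
     snd s ''X'' x = c x \<and> snd s ''Y'' (c x) = x)"

text \<open>The variant \<open>n\<close> adds the rows and the columns still ahead. Each step uses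
  up one of either kind, which makes the walk linear in the size of the block.\<close>

definition ant_inv :: "nat \<Rightarrow> state \<Rightarrow> nat \<Rightarrow> state \<Rightarrow> bool" where
  "ant_inv l s0 n s \<longleftrightarrow> ant_data l s \<and> fst s ''l'' = l \<and> fst s ''b'' = b \<and> fst s ''f'' = e \<and> fst s ''h'' = mid \<and>
     b \<le> fst s ''r'' \<and> fst s ''r'' \<le> e \<and> b \<le> fst s ''c'' \<and> fst s ''c'' \<le> e \<and>
     n = (fst s ''r'' - b) + (e - fst s ''c'') \<and> fst s ''e'' \<le> 1 \<and>
     Flo (fst s ''r'') (fst s ''c'') + fst s ''e'' = Fhi (fst s ''r'') (fst s ''c'') \<and>
     (\<forall>x\<in>{fst s ''r''..<e}. snd s ''R'' x \<in> {b..<e} \<and> (\<forall>k. M x k = M (Suc x) k + (if snd s ''R'' x < k then 1 else 0))) \<and>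
     (\<forall>x. x \<notin> {b..<e} \<longrightarrow> snd s ''R'' x = snd s0 ''R'' x)"

lemma ant_step_correct:
  assumes I: "ant_inv l s0 n s" and br: "b < fst s ''r''" and W: "l + e \<le> W" "2 \<le> W"
  shows "wp S W ant_step s (\<lambda>s'. \<exists>m<n. ant_inv l s0 m s')"
proof -
  obtain fr ar where s: "s = (fr, ar)" by (cases s)
  define r cp ev where "r = fr ''r''" and "cp = fr ''c''" and "ev = fr ''e''"
  have regs: "fr ''r'' = r" "fr ''c'' = cp" "fr ''e'' = ev" "fr ''l'' = l" "fr ''b'' = b" "fr ''f'' = e" "fr ''h'' = mid"
    using I by (auto simp: ant_inv_def r_def cp_def ev_def s)
  have bnd: "b < r" "r \<le> e" "b \<le> cp" "cp \<le> e" "n = (r - b) + (e - cp)" "ev \<le> 1"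
    and eq: "Flo r cp + ev = Fhi r cp"
    and rows: "\<And>x. x \<in> {r..<e} \<Longrightarrow> ar ''R'' x \<in> {b..<e} \<and> (\<forall>k. M x k = M (Suc x) k + (if ar ''R'' x < k then 1 else 0))"
    and out: "\<And>x. x \<notin> {b..<e} \<Longrightarrow> ar ''R'' x = snd s0 ''R'' x"
    using I br unfolding ant_inv_def s by (auto simp: r_def cp_def ev_def)
  have dat: "\<And>x. x \<in> {b..<e} \<Longrightarrow> ar ''A'' (l + x) = \<alpha> x \<and> ar ''B'' (l + x) = \<beta> x \<and> ar ''X'' x = c x \<and> ar ''Y'' (c x) = x"
    using I by (auto simp: ant_inv_def ant_data_def s)
  define t where "t = (if cp < e then (if \<beta> cp < mid then (if ar ''Y'' cp < r then 0 else 1) else (if ar ''Y'' cp < r then 1 else 0)) else (2::nat))"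
  have w: "\<exists>w\<in>{b..<e}. cp = c w" if "cp < e"
  proof -
    have "cp \<in> c ` {b..<e}" using bij_betw_imp_surj_on[OF bij_c] bnd that by auto
    then show ?thesis by blast
  qed
  have col: "Flo r (Suc cp) + (ev - t) = Fhi r (Suc cp)" if "cp < e" "t \<le> ev"
  proof -
    from w[OF that(1)] obtain w where w: "w \<in> {b..<e}" "cp = c w" by blast
    then have "ar ''Y'' cp = w" using dat by simp
    then show ?thesis
      using col_step[OF w, of r] eq that by (auto simp: t_def split: if_splits)
  qed
  have colt: "Flo r (Suc cp) = Suc (Fhi r (Suc cp))" if "cp < e" "ev < t"
  proof -
    from w[OF that(1)] obtain w where w: "w \<in> {b..<e}" "cp = c w" by blast
    then have "ar ''Y'' cp = w" using dat by simp
    then show ?thesis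
      using col_step[OF w, of r] eq that by (auto simp: t_def split: if_splits)
  qed
  \<comment> \<open>If the column step is blocked then \<open>e = 0\<close>: inside the block
    \<open>t\<close> is at most 1, and in the last column \<open>F_end\<close> forces it. This
    supplies the equation \<open>Flo = Fhi\<close> that \<open>ant_row\<close> requires.\<close>
  have ev0: "ev = 0" if "ev < t"
  proof (cases "cp < e")
    case True then show ?thesis using that by (auto simp: t_def split: if_splits)
  next
    case False then show ?thesis using F_end[of r] eq bnd by simp
  qed
  define i where "i = r - 1"
  have i: "i \<in> {b..<e}" "Suc i = r" using bnd by (auto simp: i_def)
  define rs where "rs = (if \<alpha> i < mid then cp \<le> c i else c i < cp)"
  define Q where "Q = (\<lambda>s'. \<exists>m<n. ant_inv l s0 m s')"
  have adv: "Q (fr(''t'' := t, ''e'' := ev - t, ''c'' := Suc cp), ar)" if "t \<le> ev"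
  proof -
    have ce: "cp < e" using that bnd by (auto simp: t_def split: if_splits)
    show ?thesis unfolding Q_def
      by (rule exI[of _ "n - 1"]) (use bnd ce regs col[OF ce that] rows out dat in \<open>auto simp: ant_inv_def ant_data_def\<close>)
  qed
  have row: "Q (fr(''t'' := t, ''r'' := i, ''e'' := (if rs then 1 else 0)),
      ar(''R'' := (ar ''R'')(i := (if rs then cp else c i))))" if "ev < t"
  proof -
    have eqS: "Flo (Suc i) cp = Fhi (Suc i) cp" using eq ev0[OF that] i by simp
    have nxt: "cp = e \<or> Flo (Suc i) (Suc cp) = Suc (Fhi (Suc i) (Suc cp))"
      using colt that bnd i by force
    note R = ant_row[OF i(1) bnd(3,4) eqS nxt, folded rs_def]
    have in_b: "(if rs then cp else c i) \<in> {b..<e}" using R(3) bnd c_lo[OF i(1)] by auto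
    have "ar' ''R'' x \<in> {b..<e} \<and> (\<forall>k. M x k = M (Suc x) k + (if ar' ''R'' x < k then 1 else 0))"
      if "x \<in> {i..<e}" "ar' = ar(''R'' := (ar ''R'')(i := (if rs then cp else c i)))" for x ar'
    proof (cases "x = i")
      case True then show ?thesis using in_b R(2) that(2) by simp
    next
      case False
      then have "x \<in> {r..<e}" using that i by auto
      then show ?thesis using rows[of x] False that(2) by simp
    qed
    note rows' = this[OF _ refl]
    show ?thesis unfolding Q_def
    proof (rule exI[of _ "n - 1"], intro conjI)
      show "n - 1 < n" using bnd by simp
      show "ant_inv l s0 (n - 1) (fr(''t'' := t, ''r'' := i, ''e'' := (if rs then 1 else 0)),
        ar(''R'' := (ar ''R'')(i := (if rs then cp else c i))))"
        unfolding ant_inv_def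
        using rows' R(1) out dat regs bnd i by (simp add: ant_data_def)
    qed
  qed
  have dcp: "ar ''B'' (l + cp) = \<beta> cp" if "cp < e" using dat bnd that by auto
  have di: "ar ''A'' (l + i) = \<alpha> i" "ar ''X'' i = c i" using dat i by auto
  have W': "l + cp \<le> W" "l + i \<le> W" "1 \<le> W" "ev + 1 \<le> W" using W bnd i by auto
  have one: "wp S W (Cond (Less (V ''c'') (V ''f''))
      (Cond (Less (Load ''B'' (Plus (V ''l'') (V ''c''))) (V ''h''))
        (Cond (Less (Load ''Y'' (V ''c'')) (V ''r'')) (Assign ''t'' (N 0)) (Assign ''t'' (N 1)))
        (Cond (Less (Load ''Y'' (V ''c'')) (V ''r'')) (Assign ''t'' (N 1)) (Assign ''t'' (N 0))))
      (Assign ''t'' (N 2))) (fr, ar) P" if "P (fr(''t'' := t), ar)" for P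
    using that regs dcp W' W by (auto simp: t_def split: if_splits)
  have two: "wp S W (Cond (Less (V ''t'') (Plus (V ''e'') (N 1)))
      (Assign ''e'' (Minus (V ''e'') (V ''t''));; Assign ''c'' (Plus (V ''c'') (N 1)))
      (Assign ''r'' (Minus (V ''r'') (N 1));;
       Cond (Less (Load ''A'' (Plus (V ''l'') (V ''r''))) (V ''h''))
         (Cond (Less (Load ''X'' (V ''r'')) (V ''c'')) (Assign ''e'' (N 0)) (Assign ''e'' (N 1)))
         (Cond (Less (Load ''X'' (V ''r'')) (V ''c'')) (Assign ''e'' (N 1)) (Assign ''e'' (N 0)));;
       Cond (Less (N 0) (V ''e''))
         (Store ''R'' (V ''r'') (V ''c'')) (Store ''R'' (V ''r'') (Load ''X'' (V ''r'')))))
     (fr(''t'' := t), ar) Q"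
  proof (cases "t \<le> ev")
    case True
    have "cp < e" using True bnd by (auto simp: t_def split: if_splits)
    then have "cp + 1 \<le> W" using W by simp
    then show ?thesis using adv[OF True] True regs W' by simp
  next
    case False
    then have "ev < t" by simp
    from row[OF this] this di regs i_def[symmetric] W' show ?thesis
      by (cases "\<alpha> i < mid"; cases "c i < cp") (simp_all add: rs_def)
  qed
  show ?thesis unfolding ant_step_def s Q_def[symmetric]
    by (subst wp.simps(4), rule one, rule two)
qed

lemma ant_block_correct:
  assumes dat: "ant_data l s0" and s: "fst s0 ''l'' = l" "fst s0 ''b'' = b" "b + fst s0 ''y'' = e" "b + fst s0 ''z'' = mid"
    and W: "l + e \<le> W" "2 \<le> W"
  shows "tri S W ant_block s0 (150 * (e - b + 1)) (\<lambda>s. fst s ''b'' = e \<and>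
     sticky {b..<e} {b..<e} b e \<alpha> \<beta> (snd s ''R'') \<and> (\<forall>x. x \<notin> {b..<e} \<longrightarrow> snd s ''R'' x = snd s0 ''R'' x))"
proof -
  let ?s1 = "((fst s0)(''f'' := e, ''h'' := mid, ''c'' := b, ''e'' := 0, ''r'' := e), snd s0)"
  let ?Q = "\<lambda>s. fst s ''b'' = e \<and>
     sticky {b..<e} {b..<e} b e \<alpha> \<beta> (snd s ''R'') \<and> (\<forall>x. x \<notin> {b..<e} \<longrightarrow> snd s ''R'' x = snd s0 ''R'' x)"
  show ?thesis unfolding ant_block_def
  proof (rule tri_Seq)
    show "tri S W ant_init s0 14 (\<lambda>s. s = ?s1)"
      by (rule tri_wp) (use s W bme in \<open>auto simp: ant_init_def\<close>)
    fix s1 assume s1: "s1 = ?s1"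
    show "tri S W (While (Less (V ''b'') (V ''r'')) ant_step;; Assign ''b'' (V ''f'')) s1 (128 * (e - b) + 66) ?Q"
    proof (rule tri_Seq)
      show "tri S W (While (Less (V ''b'') (V ''r'')) ant_step) s1 ((2 * (e - b) + 1) * 64)
        (\<lambda>s. fst s ''f'' = e \<and> sticky {b..<e} {b..<e} b e \<alpha> \<beta> (snd s ''R'') \<and> (\<forall>x. x \<notin> {b..<e} \<longrightarrow> snd s ''R'' x = snd s0 ''R'' x))"
      proof (rule tri_While[where I = "ant_inv l s0" and n = "2 * (e - b)" and B = "60"])
        show "ant_inv l s0 (2 * (e - b)) s1"
          using dat s s1 bme F_start by (auto simp: ant_inv_def ant_data_def)
        fix n s assume I: "ant_inv l s0 n s"
        have fin: "sticky {b..<e} {b..<e} b e \<alpha> \<beta> (snd s ''R'')" if "fst s ''r'' \<le> b"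
          by (rule sticky_of_rows) (use I that in \<open>auto simp: ant_inv_def\<close>)
        show "bfits S W s (Less (V ''b'') (V ''r'')) \<and>
         (bval S s (Less (V ''b'') (V ''r'')) \<longrightarrow>
          0 < n \<and> tri S W ant_step s 60 (\<lambda>s'. \<exists>m<n. ant_inv l s0 m s')) \<and>
         (\<not> bval S s (Less (V ''b'') (V ''r'')) \<longrightarrow>
          fst s ''f'' = e \<and> sticky {b..<e} {b..<e} b e \<alpha> \<beta> (snd s ''R'') \<and>
          (\<forall>x. x \<notin> {b..<e} \<longrightarrow> snd s ''R'' x = snd s0 ''R'' x))"
        proof (intro conjI impI)
          assume b: "bval S s (Less (V ''b'') (V ''r''))"
          then have br: "b < fst s ''r''" using I by (simp add: ant_inv_def)
          then show "0 < n" using I by (auto simp: ant_inv_def)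
          show "tri S W ant_step s 60 (\<lambda>s'. \<exists>m<n. ant_inv l s0 m s')"
            by (rule tri_wp[OF ant_step_correct[OF I br W]]) (simp add: ant_step_def)
        qed (use I fin in \<open>auto simp: ant_inv_def\<close>)
      qed simp
      fix s2 assume "fst s2 ''f'' = e \<and> sticky {b..<e} {b..<e} b e \<alpha> \<beta> (snd s2 ''R'') \<and> (\<forall>x. x \<notin> {b..<e} \<longrightarrow> snd s2 ''R'' x = snd s0 ''R'' x)"
      then show "tri S W (Assign ''b'' (V ''f'')) s2 2 ?Q" by (intro tri_wp) auto
    qed simp
  qed simp
qed

end

section \<open>The ascent through the levels\<close>

text \<open>This undoes the sorting of rows and columns as in \<open>level_step\<close>. The walk
  needs the combined permutation by rows (\<open>''X''\<close>) and by columns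
  (\<open>''Y''\<close>), so both directions are stored.\<close>

definition comb_body :: com where
  "comb_body =
    Store ''X'' (Load ''Ga'' (Plus (V ''l'') (V ''i''))) (Load ''Gb'' (Plus (V ''l'') (Load ''R'' (V ''i''))));;
    Store ''Y'' (Load ''Gb'' (Plus (V ''l'') (Load ''R'' (V ''i'')))) (Load ''Ga'' (Plus (V ''l'') (V ''i'')))"

definition mult_level :: com where
  "mult_level =
    Assign ''i'' (N 0);; For ''i'' ''W'' comb_body;;
    (Assign ''l'' (Minus (V ''l'') (V ''W''));; Assign ''y'' (Plus (V ''z'') (V ''z''));; Assign ''b'' (N 0));;
    While (Less (V ''b'') (V ''W'')) ant_block;;
    Assign ''z'' (V ''y'')"

text \<open>On blocks of size 1 both fully sorted factors are the identity, and so is their product;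
  hence \<open>''R''\<close> starts with the identity, and the loop doubles the block size from
  there.\<close>

definition mult_prog :: com where
  "mult_prog =
    Assign ''z'' (V ''z0'');; split_prog ''A'' ''Ga'' ''W'';;
    Assign ''z'' (V ''z0'');; split_prog ''B'' ''Gb'' ''W'';;
    Assign ''i'' (N 0);; For ''i'' ''W'' (Store ''R'' (V ''i'') (V ''i''));;
    While (Less (V ''z'') (V ''z0'')) mult_level"

lemma sticky_cong:
  assumes "\<And>x. x \<in> X \<Longrightarrow> r x = r' x"
  shows "sticky X Y b e \<alpha> \<beta> r \<longleftrightarrow> sticky X Y b e \<alpha> \<beta> r'"
proof -
  have "ndom X r i k = ndom X r' i k" for i k
    unfolding ndom_def using assms by (intro arg_cong[where f=card]) auto
  moreover have "bij_betw r X Y \<longleftrightarrow> bij_betw r' X Y" using assms by (rule bij_betw_cong)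
  ultimately show ?thesis by (simp add: sticky_def)
qed

text \<open>Guarantees that the scattered writes of \<open>comb_body\<close> never collide.\<close>

lemma block_sticky_bij:
  assumes st: "block_sticky w z \<alpha> \<beta> r" and z: "0 < z" "z dvd w"
  shows "bij_betw r {..<w} {..<w}"
proof -
  have r: "r s \<in> {(s div z)*z..<(s div z)*z+z} \<and> r s < w" if "s < w" for s
  proof -
    let ?q = "s div z"
    have q: "?q * z < w" using that by (meson div_times_less_eq_dividend le_less_trans)
    have "s \<in> {?q*z..<?q*z+z}" using div_eq_iff_block[OF z(1)] by blast
    moreover have "bij_betw r {?q*z..<?q*z+z} {?q*z..<?q*z+z}"
      using st q by (simp add: block_sticky_def sticky_def)
    ultimately have "r s \<in> {?q*z..<?q*z+z}" by (rule bij_betwE[THEN bspec, rotated])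
    then show ?thesis using block_in_range[OF z(2) q] by auto
  qed
  have "inj_on r {..<w}"
  proof (rule inj_onI)
    fix s t assume *: "s \<in> {..<w}" "t \<in> {..<w}" "r s = r t"
    let ?q = "s div z"
    have "r s div z = s div z" "r t div z = t div z"
      using r[of s] r[of t] * div_eq_iff_block[OF z(1)] by blast+
    then have eq: "t div z = ?q" using * by simp
    have q: "?q * z < w" using *(1) by (meson div_times_less_eq_dividend le_less_trans lessThan_iff)
    have mem: "s \<in> {?q*z..<?q*z+z}" "t \<in> {?q*z..<?q*z+z}" using div_eq_iff_block[OF z(1)] eq by blast+
    have "sticky {?q*z..<?q*z+z} {?q*z..<?q*z+z} (?q*z) (?q*z+z) \<alpha> \<beta> r"
      using st q unfolding block_sticky_def by blast
    then have "bij_betw r {?q*z..<?q*z+z} {?q*z..<?q*z+z}" unfolding sticky_def by (rule conjunct1)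
    then show "s = t" by (rule inj_onD[OF bij_betw_imp_inj_on _ mem]) (rule *(3))
  qed
  moreover have "r ` {..<w} \<subseteq> {..<w}" using r by auto
  ultimately show ?thesis by (simp add: bij_betw_def endo_inj_surj)
qed

lemma ant_blocks_correct:
  assumes z: "0 < z" "2*z dvd wn" "0 < wn"
    and bm: "\<And>q. q * (2*z) < wn \<Longrightarrow> block_merge (q*(2*z)) (q*(2*z)+z) (q*(2*z)+2*z) \<alpha> \<beta> c"
    and dat: "\<And>x. x < wn \<Longrightarrow> snd s0 ''A'' (l + x) = \<alpha> x \<and> snd s0 ''B'' (l + x) = \<beta> x \<and>
      snd s0 ''X'' x = c x \<and> snd s0 ''Y'' (c x) = x"
    and s: "fst s0 ''l'' = l" "fst s0 ''b'' = 0" "fst s0 ''y'' = 2*z" "fst s0 ''z'' = z" "fst s0 ''W'' = wn"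
    and W: "l + wn \<le> W" "2 \<le> W"
  shows "tri S W (While (Less (V ''b'') (V ''W'')) ant_block) s0 (470 * (wn + 1))
    (\<lambda>s. block_sticky wn (2*z) \<alpha> \<beta> (snd s ''R''))"
proof -
  obtain nb where nb: "wn = nb * (2*z)" using z by (metis dvdE mult.commute)
  let ?I = "\<lambda>n s. n \<le> nb \<and> fst s ''b'' = (nb - n) * (2*z) \<and> fst s ''l'' = l \<and> fst s ''y'' = 2*z \<and> fst s ''z'' = z \<and>
    fst s ''W'' = wn \<and> (\<forall>a. a \<noteq> ''R'' \<longrightarrow> snd s a = snd s0 a) \<and>
    (\<forall>q<nb - n. sticky {q*(2*z)..<q*(2*z)+2*z} {q*(2*z)..<q*(2*z)+2*z} (q*(2*z)) (q*(2*z)+2*z) \<alpha> \<beta> (snd s ''R''))"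
  show ?thesis
  proof (rule tri_While[where I = ?I and n = nb and B = "150 * (2*z+1)"])
    show "?I nb s0" using s by simp
    fix n s assume I: "?I n s"
    show "bfits S W s (Less (V ''b'') (V ''W'')) \<and>
      (bval S s (Less (V ''b'') (V ''W'')) \<longrightarrow> 0 < n \<and>
         tri S W ant_block s (150 * (2*z+1)) (\<lambda>s'. \<exists>m<n. ?I m s')) \<and>
      (\<not> bval S s (Less (V ''b'') (V ''W'')) \<longrightarrow> block_sticky wn (2*z) \<alpha> \<beta> (snd s ''R''))"
    proof (intro conjI impI)
      assume "bval S s (Less (V ''b'') (V ''W''))"
      then have n: "0 < n" using I nb by (cases n) auto
      then show "0 < n" .
      have Is: "\<forall>q<nb - n. sticky {q*(2*z)..<q*(2*z)+2*z} {q*(2*z)..<q*(2*z)+2*z} (q*(2*z)) (q*(2*z)+2*z) \<alpha> \<beta> (snd s ''R'')"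
        using I by (elim conjE)
      define q where "q = nb - n"
      have q: "q * (2*z) < wn" "q < nb" "nb - (n - 1) = Suc q" using n I nb z by (auto simp: q_def)
      interpret bm: block_merge "q*(2*z)" "q*(2*z)+z" "q*(2*z)+2*z" \<alpha> \<beta> c by (rule bm[OF q(1)])
      have le: "q*(2*z)+2*z \<le> wn" by (rule block_in_range[OF z(2) q(1)])
      have d: "bm.ant_data l s" unfolding bm.ant_data_def using I dat le by auto
      have "tri S W ant_block s (150 * (q*(2*z)+2*z - q*(2*z) + 1)) (\<lambda>s'. fst s' ''b'' = q*(2*z)+2*z \<and>
         sticky {q*(2*z)..<q*(2*z)+2*z} {q*(2*z)..<q*(2*z)+2*z} (q*(2*z)) (q*(2*z)+2*z) \<alpha> \<beta> (snd s' ''R'') \<and>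
         (\<forall>x. x \<notin> {q*(2*z)..<q*(2*z)+2*z} \<longrightarrow> snd s' ''R'' x = snd s ''R'' x))"
        by (rule bm.ant_block_correct[OF d]) (use I le W in \<open>auto simp: q_def\<close>)
      then show "tri S W ant_block s (150 * (2*z+1)) (\<lambda>s'. \<exists>m<n. ?I m s')"
      proof (rule tri_conseq)
        fix s1 assume 1: "fst s1 ''b'' = q*(2*z)+2*z \<and>
         sticky {q*(2*z)..<q*(2*z)+2*z} {q*(2*z)..<q*(2*z)+2*z} (q*(2*z)) (q*(2*z)+2*z) \<alpha> \<beta> (snd s1 ''R'') \<and>
         (\<forall>x. x \<notin> {q*(2*z)..<q*(2*z)+2*z} \<longrightarrow> snd s1 ''R'' x = snd s ''R'' x)"
          and fr: "\<And>x. x \<notin> regs ant_block \<Longrightarrow> fst s1 x = fst s x"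
          "\<And>a. a \<notin> arrs ant_block \<Longrightarrow> snd s1 a = snd s a"
        have old: "sticky {p*(2*z)..<p*(2*z)+2*z} {p*(2*z)..<p*(2*z)+2*z} (p*(2*z)) (p*(2*z)+2*z) \<alpha> \<beta> (snd s1 ''R'')"
          if "p < q" for p
        proof -
          have "(p + 1) * (2*z) \<le> q * (2*z)" using that by (intro mult_le_mono1) simp
          then have "p*(2*z)+2*z \<le> q*(2*z)" by simp
          then have "snd s1 ''R'' x = snd s ''R'' x" if "x \<in> {p*(2*z)..<p*(2*z)+2*z}" for x
            using 1 that by simp
          then have "sticky {p*(2*z)..<p*(2*z)+2*z} {p*(2*z)..<p*(2*z)+2*z} (p*(2*z)) (p*(2*z)+2*z) \<alpha> \<beta> (snd s1 ''R'')
            = sticky {p*(2*z)..<p*(2*z)+2*z} {p*(2*z)..<p*(2*z)+2*z} (p*(2*z)) (p*(2*z)+2*z) \<alpha> \<beta> (snd s ''R'')"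
            by (rule sticky_cong)
          moreover have "sticky {p*(2*z)..<p*(2*z)+2*z} {p*(2*z)..<p*(2*z)+2*z} (p*(2*z)) (p*(2*z)+2*z) \<alpha> \<beta> (snd s ''R'')"
            by (rule Is[rule_format]) (use that in \<open>simp add: q_def\<close>)
          ultimately show ?thesis by simp
        qed
        show "\<exists>m<n. ?I m s1"
        proof (rule exI[of _ "n - 1"], intro conjI)
          show "\<forall>p<nb - (n - 1). sticky {p*(2*z)..<p*(2*z)+2*z} {p*(2*z)..<p*(2*z)+2*z} (p*(2*z)) (p*(2*z)+2*z) \<alpha> \<beta> (snd s1 ''R'')"
            unfolding q(3) All_less_Suc by (intro conjI allI impI, rule conjunct1[OF conjunct2[OF 1]], rule old)
        qed (use n 1 I fr q in auto)
      qed simp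
    next
      assume "\<not> bval S s (Less (V ''b'') (V ''W''))"
      then have "\<not> (nb - n) * (2*z) < nb * (2*z)" using I nb by simp
      then have "\<not> nb - n < nb" using z(1) by (simp only: mult_less_cancel2) simp
      then have n0: "nb - n = nb" by simp
      show "block_sticky wn (2*z) \<alpha> \<beta> (snd s ''R'')"
        unfolding block_sticky_def
      proof (intro allI impI)
        fix q assume "q * (2*z) < wn"
        then have "q < nb" using nb by simp
        then show "sticky {q*(2*z)..<q*(2*z)+2*z} {q*(2*z)..<q*(2*z)+2*z} (q*(2*z)) (q*(2*z)+2*z) \<alpha> \<beta> (snd s ''R'')"
          using I n0 by simp
      qed
    qed simp
  next
    \<comment> \<open>The costs of the blocks add up to a linear bound, because the number of blocks
      times their size is \<open>wn\<close> and each of the two is at most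
      \<open>wn\<close>.\<close>
    have "nb \<le> wn" "2*z \<le> wn" "nb * (2*z) = wn" using nb z by auto
    then show "(nb + 1) * (150 * (2*z+1) + 1 + bcost (Less (V ''b'') (V ''W''))) \<le> 470 * (wn + 1)"
      by (simp add: algebra_simps)
  qed
qed

lemma comb_correct:
  assumes ga: "bij_betw ga {..<wn} {..<wn}" and gb: "bij_betw gb {..<wn} {..<wn}" and R: "bij_betw (snd s0 ''R'') {..<wn} {..<wn}"
    and s: "fst s0 ''i'' = 0" "fst s0 ''l'' = l" "fst s0 ''W'' = wn"
    and G: "\<And>i. i < wn \<Longrightarrow> snd s0 ''Ga'' (l + i) = ga i \<and> snd s0 ''Gb'' (l + i) = gb i"
    and W: "l + wn \<le> W" "2 \<le> W"
  shows "tri S W (For ''i'' ''W'' comb_body) s0 (40 * (wn + 1)) (\<lambda>s. \<forall>i<wn.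
     snd s ''X'' (ga i) = gb (snd s0 ''R'' i) \<and> snd s ''Y'' (gb (snd s0 ''R'' i)) = ga i)"
proof -
  let ?R = "snd s0 ''R''"
  have Rw: "?R i < wn" if "i < wn" for i using R that by (auto dest: bij_betwE)
  have gne: "ga j \<noteq> ga i" if "j < i" "i < wn" for i j
    using bij_betw_imp_inj_on[OF ga] that by (auto dest!: inj_onD)
  have Rne: "gb (?R j) \<noteq> gb (?R i)" if "j < i" "i < wn" for i j
  proof
    assume "gb (?R j) = gb (?R i)"
    then have "?R j = ?R i" using bij_betw_imp_inj_on[OF gb] Rw[of j] Rw[of i] that by (auto dest!: inj_onD)
    then show False using bij_betw_imp_inj_on[OF R] that by (auto dest!: inj_onD)
  qed
  show ?thesis
  proof (rule tri_For[where a=0 and b=wn and B=30 and I="\<lambda>i s. fst s ''l'' = l \<and>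
      (\<forall>a. a \<noteq> ''X'' \<longrightarrow> a \<noteq> ''Y'' \<longrightarrow> snd s a = snd s0 a) \<and>
      (\<forall>j<i. snd s ''X'' (ga j) = gb (?R j) \<and> snd s ''Y'' (gb (?R j)) = ga j)"])
    fix i s
    assume *: "i < wn" "fst s ''i'' = i" "fst s ''W'' = wn"
      and I: "fst s ''l'' = l \<and> (\<forall>a. a \<noteq> ''X'' \<longrightarrow> a \<noteq> ''Y'' \<longrightarrow> snd s a = snd s0 a) \<and>
      (\<forall>j<i. snd s ''X'' (ga j) = gb (?R j) \<and> snd s ''Y'' (gb (?R j)) = ga j)"
    have "l + ?R i \<le> W" "l + i \<le> W" using Rw[OF *(1)] *(1) W by auto
    then show "tri S W comb_body s 30 (\<lambda>s'. fst s' ''i'' = i \<and> fst s' ''W'' = wn \<and>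
      fst ((fst s')(''i'' := Suc i), snd s') ''l'' = l \<and>
      (\<forall>a. a \<noteq> ''X'' \<longrightarrow> a \<noteq> ''Y'' \<longrightarrow> snd ((fst s')(''i'' := Suc i), snd s') a = snd s0 a) \<and>
      (\<forall>j<Suc i. snd ((fst s')(''i'' := Suc i), snd s') ''X'' (ga j) = gb (?R j) \<and>
         snd ((fst s')(''i'' := Suc i), snd s') ''Y'' (gb (?R j)) = ga j))"
      using * I G[OF *(1)] G[OF Rw[OF *(1)]] gne Rne
      by (intro tri_wp) (simp_all add: comb_body_def All_less_Suc)
  qed (use s W in auto)
qed

lemma regs_mult [simp]: "regs mult_level = {''i'', ''l'', ''y'', ''b'', ''z'', ''f'', ''h'', ''c'', ''e'', ''r'', ''t''}"
  "arrs mult_level = {''X'', ''Y'', ''R''}"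
  "regs mult_prog = {''i'', ''l'', ''y'', ''b'', ''z'', ''f'', ''h'', ''c'', ''e'', ''r'', ''t'', ''q'', ''d''}"
  "arrs mult_prog = {''X'', ''Y'', ''R'', ''A'', ''Ga'', ''B'', ''Gb'', ''Q''}"
  by (auto simp: mult_level_def mult_prog_def comb_body_def)

lemma mult_level_correct:
  assumes al: "block_perm wn (2 ^ L) \<alpha>" and be: "block_perm wn (2 ^ L) \<beta>" and L: "2 ^ L dvd wn" "0 < wn" "k < L"
    and s: "fst s0 ''l'' = Suc k * wn" "fst s0 ''z'' = 2 ^ (L - Suc k)" "fst s0 ''W'' = wn"
    and lev: "levels_at ''A'' ''Ga'' wn \<alpha> L L s0" "levels_at ''B'' ''Gb'' wn \<beta> L L s0"
    and st: "block_sticky wn (2 ^ (L - Suc k)) (lvl wn \<alpha> L (Suc k)) (lvl wn \<beta> L (Suc k)) (snd s0 ''R'')"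
    and W: "(L + 2) * wn \<le> W" "2 \<le> W"
  shows "tri S W mult_level s0 (540 * (wn + 1)) (\<lambda>s. fst s ''l'' = k * wn \<and> fst s ''z'' = 2 ^ (L - k) \<and>
    block_sticky wn (2 ^ (L - k)) (lvl wn \<alpha> L k) (lvl wn \<beta> L k) (snd s ''R''))" (is "tri S W _ _ _ ?Q")
proof -
  let ?z = "2 ^ (L - Suc k) :: nat"
  have z2: "2 ^ (L - k) = 2 * ?z" using L(3) by (metis Suc_diff_Suc power_Suc)
  have zd: "2 * ?z dvd wn" unfolding z2[symmetric] using L(1) by (rule pow_dvd_level)
  then have zd': "?z dvd wn" by (rule dvd_mult_right)
  have zw: "2 * ?z \<le> wn" using zd L(2) by (rule dvd_imp_le)
  have ba: "bij_betw \<alpha> {..<wn} {..<wn}" and bb: "bij_betw \<beta> {..<wn} {..<wn}"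
    using al be by (auto simp: block_perm_def)
  let ?ga = "gmap wn \<alpha> L k" let ?gb = "gmap wn \<beta> L k" let ?R = "snd s0 ''R''"
  have bga: "bij_betw ?ga {..<wn} {..<wn}" and bgb: "bij_betw ?gb {..<wn} {..<wn}" unfolding gmap_def
    by (intro bij_betw_inv_into dst_bij lvl_bij ba bb L zd'; simp)+
  have bR: "bij_betw ?R {..<wn} {..<wn}" by (rule block_sticky_bij[OF st _ zd']) simp
  have kl: "(Suc k + 2) * wn \<le> (L + 2) * wn" by (rule mult_le_mono1) (use L(3) in simp)
  have Wk: "Suc k * wn + wn \<le> W" "k * wn + wn \<le> W" "wn \<le> W" using kl W by (simp_all add: algebra_simps)
  show ?thesis unfolding mult_level_def
  proof (rule tri_Seq)
    show "tri S W (Assign ''i'' (N 0)) s0 2 (\<lambda>s. s = ((fst s0)(''i'' := 0), snd s0))"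
      by (rule tri_wp) auto
    fix s1 assume s1: "s1 = ((fst s0)(''i'' := 0), snd s0)"
    show "tri S W (For ''i'' ''W'' comb_body;; (Assign ''l'' (Minus (V ''l'') (V ''W''));; Assign ''y'' (Plus (V ''z'') (V ''z''));; Assign ''b'' (N 0));;
      While (Less (V ''b'') (V ''W'')) ant_block;; Assign ''z'' (V ''y'')) s1 (510 * (wn + 1) + 12) ?Q"
    proof (rule tri_Seq)
      show "tri S W (For ''i'' ''W'' comb_body) s1 (40 * (wn + 1)) (\<lambda>s. \<forall>i<wn.
         snd s ''X'' (?ga i) = ?gb (snd s1 ''R'' i) \<and> snd s ''Y'' (?gb (snd s1 ''R'' i)) = ?ga i)"
        by (rule comb_correct[OF bga bgb])
          (use s1 s bR lev L(3) Wk W in \<open>auto simp: levels_at_def simp del: mult_Suc\<close>)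
      fix s2 assume s2: "\<forall>i<wn. snd s2 ''X'' (?ga i) = ?gb (snd s1 ''R'' i) \<and> snd s2 ''Y'' (?gb (snd s1 ''R'' i)) = ?ga i"
        and f2: "\<And>x. x \<notin> regs (For ''i'' ''W'' comb_body) \<Longrightarrow> fst s2 x = fst s1 x"
        "\<And>a. a \<notin> arrs (For ''i'' ''W'' comb_body) \<Longrightarrow> snd s2 a = snd s1 a"
      have r2: "fst s2 ''l'' = Suc k * wn" "fst s2 ''z'' = ?z" "fst s2 ''W'' = wn"
        "snd s2 ''A'' = snd s0 ''A''" "snd s2 ''B'' = snd s0 ''B''"
        using f2 s s1 by (simp_all add: comb_body_def)
      let ?s3 = "((fst s2)(''l'' := k * wn, ''y'' := 2 * ?z, ''b'' := 0), snd s2)"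
      show "tri S W ((Assign ''l'' (Minus (V ''l'') (V ''W''));; Assign ''y'' (Plus (V ''z'') (V ''z''));; Assign ''b'' (N 0));;
        While (Less (V ''b'') (V ''W'')) ant_block;; Assign ''z'' (V ''y'')) s2 (470 * (wn + 1) + 12) ?Q"
      proof (rule tri_Seq)
        show "tri S W (Assign ''l'' (Minus (V ''l'') (V ''W''));; Assign ''y'' (Plus (V ''z'') (V ''z''));; Assign ''b'' (N 0)) s2 10 (\<lambda>s. s = ?s3)"
          by (rule tri_wp) (use r2 W zw Wk in auto)
        fix s3 assume s3: "s3 = ?s3"
        show "tri S W (While (Less (V ''b'') (V ''W'')) ant_block;; Assign ''z'' (V ''y'')) s3 (470 * (wn + 1) + 2) ?Q"
        proof (rule tri_Seq)
          let ?c = "snd s2 ''X''"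
          have c: "?c (?ga x) = ?gb (?R x)" if "x < wn" for x using s2 s1 that by simp
          show "tri S W (While (Less (V ''b'') (V ''W'')) ant_block) s3 (470 * (wn + 1))
            (\<lambda>s. block_sticky wn (2 * ?z) (lvl wn \<alpha> L k) (lvl wn \<beta> L k) (snd s ''R''))"
          proof (rule ant_blocks_correct[where c = ?c and l = "k * wn"])
            show "0 < ?z" "2 * ?z dvd wn" "0 < wn" using zd L by auto
            show "block_merge (q*(2*?z)) (q*(2*?z)+?z) (q*(2*?z)+2*?z) (lvl wn \<alpha> L k) (lvl wn \<beta> L k) ?c"
              if "q * (2*?z) < wn" for q
            proof (rule level_step[where ga = ?ga and gb = ?gb, OF _ zd])
              show "block_perm wn (2*?z) (lvl wn \<alpha> L k)" unfolding z2[symmetric] by (rule lvl_block_perm[OF al L(1)])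
              show "block_perm wn (2*?z) (lvl wn \<beta> L k)" unfolding z2[symmetric] by (rule lvl_block_perm[OF be L(1)])
            qed (use lvl_dst[OF ba L(1)] lvl_dst[OF bb L(1)] st c that in \<open>auto simp del: lvl.simps\<close>)
            show "snd s3 ''A'' (k * wn + x) = lvl wn \<alpha> L k x \<and> snd s3 ''B'' (k * wn + x) = lvl wn \<beta> L k x \<and>
              snd s3 ''X'' x = ?c x \<and> snd s3 ''Y'' (?c x) = x" if x: "x < wn" for x
            proof -
              have "x \<in> ?ga ` {..<wn}" using bij_betw_imp_surj_on[OF bga] x by simp
              then obtain y where y: "y < wn" "x = ?ga y" by auto
              have "snd s3 ''Y'' (?c x) = x" using s3 s2 s1 y by simp
              then show ?thesis using s3 r2 lev L(3) x by (simp add: levels_at_def)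
            qed
          qed (use s3 r2 Wk W in auto)
          fix s4 assume s4: "block_sticky wn (2 * ?z) (lvl wn \<alpha> L k) (lvl wn \<beta> L k) (snd s4 ''R'')"
            and f4: "\<And>x. x \<notin> regs (While (Less (V ''b'') (V ''W'')) ant_block) \<Longrightarrow> fst s4 x = fst s3 x"
          show "tri S W (Assign ''z'' (V ''y'')) s4 2 ?Q"
            by (rule tri_wp) (use s4 f4 s3 in \<open>auto simp: z2\<close>)
        qed simp
      qed simp
    qed simp
  qed simp
qed

lemma levels_at_cong: "snd s A = snd s' A \<Longrightarrow> snd s G = snd s' G \<Longrightarrow> levels_at A G wn a L k s = levels_at A G wn a L k s'"
  by (simp add: levels_at_def)

lemma block_sticky_1:
  assumes "\<And>i. i < wn \<Longrightarrow> \<alpha> i = i" "\<And>i. i < wn \<Longrightarrow> \<beta> i = i" "\<And>i. i < wn \<Longrightarrow> r i = i"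
  shows "block_sticky wn 1 \<alpha> \<beta> r"
  unfolding block_sticky_def using assms by (auto intro!: sticky_singleton simp: atLeastLessThanSuc)

lemma mult_prog_correct:
  assumes al: "block_perm wn (2 ^ L) \<alpha>" and be: "block_perm wn (2 ^ L) \<beta>" and L: "2 ^ L dvd wn" "0 < wn"
    and s: "fst s0 ''z0'' = 2 ^ L" "fst s0 ''W'' = wn"
    and ab: "\<And>i. i < wn \<Longrightarrow> snd s0 ''A'' i = \<alpha> i \<and> snd s0 ''B'' i = \<beta> i"
    and W: "(L + 2) * wn \<le> W" "2 \<le> W"
  shows "tri S W mult_prog s0 (800 * (L + 1) * (wn + 1)) (\<lambda>s. block_sticky wn (2 ^ L) \<alpha> \<beta> (snd s ''R''))"
    (is "tri S W _ _ _ ?Q")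
proof -
  have ba: "bij_betw \<alpha> {..<wn} {..<wn}" and bb: "bij_betw \<beta> {..<wn} {..<wn}"
    using al be by (auto simp: block_perm_def)
  have wW: "wn \<le> W" using W by (simp add: algebra_simps)
  let ?T = "(L + 1) * (90 * (wn + 1)) + 2"
  have nmA: "split_names ''A'' ''Ga'' ''W''" and nmB: "split_names ''B'' ''Gb'' ''W''" by (auto simp: split_names_def)
  show ?thesis unfolding mult_prog_def
  proof (rule tri_Seq)
    show "tri S W (Assign ''z'' (V ''z0'')) s0 2 (\<lambda>s. s = ((fst s0)(''z'' := 2 ^ L), snd s0))"
      by (rule tri_wp) (use s in auto)
    fix s1 assume s1: "s1 = ((fst s0)(''z'' := 2 ^ L), snd s0)"
    show "tri S W (split_prog ''A'' ''Ga'' ''W'';; Assign ''z'' (V ''z0'');; split_prog ''B'' ''Gb'' ''W'';;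
      Assign ''i'' (N 0);; For ''i'' ''W'' (Store ''R'' (V ''i'') (V ''i''));;
      While (Less (V ''z'') (V ''z0'')) mult_level) s1 (?T + (?T + ((L + 1) * (550 * (wn + 1)) + 20 * (wn + 1)))) ?Q"
    proof (rule tri_Seq)
      show "tri S W (split_prog ''A'' ''Ga'' ''W'') s1 ?T
        (\<lambda>s. fst s ''l'' = L * wn \<and> fst s ''z'' = 1 \<and> levels_at ''A'' ''Ga'' wn \<alpha> L L s)"
        by (rule split_prog_correct[OF nmA ba L(1) _ _ _ W]) (use s s1 ab in auto)
      fix s2 assume s2: "fst s2 ''l'' = L * wn \<and> fst s2 ''z'' = 1 \<and> levels_at ''A'' ''Ga'' wn \<alpha> L L s2"
        and f2: "\<And>x. x \<notin> regs (split_prog ''A'' ''Ga'' ''W'') \<Longrightarrow> fst s2 x = fst s1 x"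
         "\<And>x. x \<notin> arrs (split_prog ''A'' ''Ga'' ''W'') \<Longrightarrow> snd s2 x = snd s1 x"
      have r2: "fst s2 ''W'' = wn" "fst s2 ''z0'' = 2 ^ L" "snd s2 ''B'' = snd s0 ''B''"
        using f2 s1 s by simp_all
      show "tri S W (Assign ''z'' (V ''z0'');; split_prog ''B'' ''Gb'' ''W'';;
        Assign ''i'' (N 0);; For ''i'' ''W'' (Store ''R'' (V ''i'') (V ''i''));;
        While (Less (V ''z'') (V ''z0'')) mult_level) s2 (?T + ((L + 1) * (550 * (wn + 1)) + 20 * (wn + 1))) ?Q"
      proof (rule tri_Seq)
        show "tri S W (Assign ''z'' (V ''z0'')) s2 2 (\<lambda>s. s = ((fst s2)(''z'' := 2 ^ L), snd s2))"
          by (rule tri_wp) (use r2 in auto)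
        fix s3 assume s3: "s3 = ((fst s2)(''z'' := 2 ^ L), snd s2)"
        show "tri S W (split_prog ''B'' ''Gb'' ''W'';;
          Assign ''i'' (N 0);; For ''i'' ''W'' (Store ''R'' (V ''i'') (V ''i''));;
          While (Less (V ''z'') (V ''z0'')) mult_level) s3 (?T + ((L + 1) * (550 * (wn + 1)) + 18 * (wn + 1))) ?Q"
        proof (rule tri_Seq)
          show "tri S W (split_prog ''B'' ''Gb'' ''W'') s3 ?T
            (\<lambda>s. fst s ''l'' = L * wn \<and> fst s ''z'' = 1 \<and> levels_at ''B'' ''Gb'' wn \<beta> L L s)"
            by (rule split_prog_correct[OF nmB bb L(1) _ _ _ W]) (use r2 s3 ab in auto)
          fix s4 assume s4: "fst s4 ''l'' = L * wn \<and> fst s4 ''z'' = 1 \<and> levels_at ''B'' ''Gb'' wn \<beta> L L s4"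
            and f4: "\<And>x. x \<notin> regs (split_prog ''B'' ''Gb'' ''W'') \<Longrightarrow> fst s4 x = fst s3 x"
             "\<And>x. x \<notin> arrs (split_prog ''B'' ''Gb'' ''W'') \<Longrightarrow> snd s4 x = snd s3 x"
          have r4: "fst s4 ''W'' = wn" "fst s4 ''z0'' = 2 ^ L" using f4 s3 r2 by simp_all
          have "snd s4 ''A'' = snd s2 ''A''" "snd s4 ''Ga'' = snd s2 ''Ga''" using f4 s3 by simp_all
          from levels_at_cong[OF this] have lA: "levels_at ''A'' ''Ga'' wn \<alpha> L L s4" using s2 by simp
          show "tri S W (Assign ''i'' (N 0);; For ''i'' ''W'' (Store ''R'' (V ''i'') (V ''i''));;
            While (Less (V ''z'') (V ''z0'')) mult_level) s4 ((L + 1) * (550 * (wn + 1)) + 16 * (wn + 1)) ?Q"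
          proof (rule tri_Seq)
            show "tri S W (Assign ''i'' (N 0)) s4 2 (\<lambda>s. s = ((fst s4)(''i'' := 0), snd s4))"
              by (rule tri_wp) auto
            fix s5 assume s5: "s5 = ((fst s4)(''i'' := 0), snd s4)"
            show "tri S W (For ''i'' ''W'' (Store ''R'' (V ''i'') (V ''i''));;
              While (Less (V ''z'') (V ''z0'')) mult_level) s5 ((L + 1) * (550 * (wn + 1)) + 14 * (wn + 1)) ?Q"
            proof (rule tri_Seq)
              show "tri S W (For ''i'' ''W'' (Store ''R'' (V ''i'') (V ''i''))) s5 (14 * (wn + 1)) (\<lambda>s. \<forall>j<wn. snd s ''R'' j = j)"
                by (rule tri_For[where I="\<lambda>i s. \<forall>j<i. snd s ''R'' j = j" and a=0 and b=wn and B=3])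
                  (use s5 r4 wW in \<open>auto intro!: tri_wp simp: less_Suc_eq\<close>)
              fix s6 assume s6: "\<forall>j<wn. snd s6 ''R'' j = j"
                and f6: "\<And>x. x \<notin> regs (For ''i'' ''W'' (Store ''R'' (V ''i'') (V ''i''))) \<Longrightarrow> fst s6 x = fst s5 x"
                "\<And>x. x \<notin> arrs (For ''i'' ''W'' (Store ''R'' (V ''i'') (V ''i''))) \<Longrightarrow> snd s6 x = snd s5 x"
              let ?I = "\<lambda>n s. n \<le> L \<and> fst s ''l'' = n * wn \<and> fst s ''z'' = 2 ^ (L - n) \<and> fst s ''W'' = wn \<and> fst s ''z0'' = 2 ^ L \<and>
                levels_at ''A'' ''Ga'' wn \<alpha> L L s \<and> levels_at ''B'' ''Gb'' wn \<beta> L L s \<and>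
                block_sticky wn (2 ^ (L - n)) (lvl wn \<alpha> L n) (lvl wn \<beta> L n) (snd s ''R'')"
              show "tri S W (While (Less (V ''z'') (V ''z0'')) mult_level) s6 ((L + 1) * (550 * (wn + 1))) ?Q"
              proof (rule tri_While[where I = ?I and n = L and B = "540 * (wn + 1)"])
                have r6: "fst s6 ''l'' = L * wn" "fst s6 ''z'' = 1" "fst s6 ''W'' = wn" "fst s6 ''z0'' = 2 ^ L"
                  "snd s6 ''A'' = snd s4 ''A''" "snd s6 ''B'' = snd s4 ''B''" "snd s6 ''Ga'' = snd s4 ''Ga''" "snd s6 ''Gb'' = snd s4 ''Gb''"
                  using f6 s5 s4 r4 by simp_all
                \<comment> \<open>At the last level the blocks have size 1, and a permutation that
                  preserves such blocks is the identity.\<close>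
                have "lvl wn \<alpha> L L i = i" "lvl wn \<beta> L L i = i" if "i < wn" for i
                  using lvl_block_perm[OF al L(1), of L] lvl_block_perm[OF be L(1), of L] that
                  by (simp_all add: block_perm_def)
                then have "block_sticky wn 1 (lvl wn \<alpha> L L) (lvl wn \<beta> L L) (snd s6 ''R'')"
                  using s6 by (intro block_sticky_1) auto
                then show "?I L s6"
                  using r6 lA s4 levels_at_cong[of s6 "''A''" s4 "''Ga''"] levels_at_cong[of s6 "''B''" s4 "''Gb''"] by simp
                fix n s assume I: "?I n s"
                show "bfits S W s (Less (V ''z'') (V ''z0'')) \<and>
                  (bval S s (Less (V ''z'') (V ''z0'')) \<longrightarrow> 0 < n \<and>
                   tri S W mult_level s (540 * (wn + 1)) (\<lambda>s'. \<exists>m<n. ?I m s')) \<and>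
                  (\<not> bval S s (Less (V ''z'') (V ''z0'')) \<longrightarrow> ?Q s)"
                proof (intro conjI impI)
                  assume "bval S s (Less (V ''z'') (V ''z0''))"
                  then show n: "0 < n" using I by (cases n) auto
                  then obtain k where k: "n = Suc k" by (cases n) auto
                  have "tri S W mult_level s (540 * (wn + 1)) (\<lambda>s. fst s ''l'' = k * wn \<and> fst s ''z'' = 2 ^ (L - k) \<and>
                     block_sticky wn (2 ^ (L - k)) (lvl wn \<alpha> L k) (lvl wn \<beta> L k) (snd s ''R''))"
                    by (rule mult_level_correct[OF al be L _ _ _ _ _ _ _ W])
                      (use I k in \<open>auto simp del: lvl.simps mult_Suc\<close>)
                  then show "tri S W mult_level s (540 * (wn + 1)) (\<lambda>s'. \<exists>m<n. ?I m s')"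
                  proof (rule tri_conseq)
                    fix s7 assume 7: "fst s7 ''l'' = k * wn \<and> fst s7 ''z'' = 2 ^ (L - k) \<and>
                      block_sticky wn (2 ^ (L - k)) (lvl wn \<alpha> L k) (lvl wn \<beta> L k) (snd s7 ''R'')"
                      and f7: "\<And>x. x \<notin> regs mult_level \<Longrightarrow> fst s7 x = fst s x" "\<And>x. x \<notin> arrs mult_level \<Longrightarrow> snd s7 x = snd s x"
                    have "?I k s7"
                      using 7 f7 I k levels_at_cong[of s7 "''A''" s "''Ga''"] levels_at_cong[of s7 "''B''" s "''Gb''"] by simp
                    then show "\<exists>m<n. ?I m s7" using k by blast
                  qed simp
                next
                  assume "\<not> bval S s (Less (V ''z'') (V ''z0''))"
                  then have "\<not> (2::nat) ^ (L - n) < 2 ^ L" using I by simp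
                  then have "\<not> L - n < L" by simp
                  then have "n = 0" using I by auto
                  then show "?Q s" using I by simp
                qed simp
              next
                show "(L + 1) * (540 * (wn + 1) + 1 + bcost (Less (V ''z'') (V ''z0''))) \<le> (L + 1) * (550 * (wn + 1))"
                  by (intro mult_le_mono2) simp
              qed
            qed simp
          qed simp
        qed simp
      qed simp
    next
      show "?T + (?T + ((L + 1) * (550 * (wn + 1)) + 20 * (wn + 1))) \<le> ?T + (?T + ((L + 1) * (550 * (wn + 1)) + 20 * (wn + 1)))" by simp
    qed
  next
    show "2 + (?T + (?T + ((L + 1) * (550 * (wn + 1)) + 20 * (wn + 1)))) \<le> 800 * (L + 1) * (wn + 1)"
      by (simp add: algebra_simps)
  qed
qed

section \<open>Longest increasing subsequences on the machine\<close>

lemma block_perm_of_blocks: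
  assumes z: "0 < z" "z dvd w" and bl: "\<And>q. q * z < w \<Longrightarrow> bij_betw r {q*z..<q*z+z} {q*z..<q*z+z}"
  shows "block_perm w z r"
proof -
  have q: "(s div z) * z < w" if "s < w" for s
    using that by (meson div_times_less_eq_dividend le_less_trans)
  have mem: "s \<in> {(s div z)*z..<(s div z)*z+z}" for s using div_eq_iff_block[OF z(1)] by blast
  have r: "r s \<in> {(s div z)*z..<(s div z)*z+z}" if "s < w" for s
    using bij_betwE[OF bl[OF q[OF that]]] mem by blast
  have rd: "r s div z = s div z" if "s < w" for s using r[OF that] div_eq_iff_block[OF z(1)] by blast
  have rw: "r s < w" if "s < w" for s using r[OF that] block_in_range[OF z(2) q[OF that]] by auto
  have "inj_on r {..<w}"
  proof (rule inj_onI)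
    fix s t assume *: "s \<in> {..<w}" "t \<in> {..<w}" "r s = r t"
    then have eq: "t div z = s div z" using rd[of s] rd[of t] by simp
    have "s div z * z < w" using q * by simp
    from bij_betw_imp_inj_on[OF bl[OF this]] show "s = t"
      using mem[of s] mem[of t] eq *(3) unfolding inj_on_def by metis
  qed
  moreover have "r ` {..<w} \<subseteq> {..<w}" using rw by auto
  ultimately show ?thesis using rd by (simp add: block_perm_def bij_betw_def endo_inj_surj)
qed

text \<open>The only nonempty window of a single position has \<open>lis\<close> 1, so all defects
  are 0, and so are all counts of the identity.\<close>

lemma repr_1: "repr a id v 1"
proof -
  have 1: "lis a v (v + 1) = 1"
    using lis_ge[of "{v}" v "v+1" a] lis_le[of a v "v+1"] by (simp add: strict_mono_on_def)
  show ?thesis unfolding repr_def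
  proof (intro ballI)
    fix l r assume "l \<in> {v..v+1}" "r \<in> {v..v+1}"
    then have "l = v \<or> l = v+1" "r = v \<or> r = v+1" by auto
    moreover have "{x \<in> {v + 1 + v..<2 * v + 2 * 1}. id x < v + r} = {}" using \<open>r \<in> {v..v+1}\<close> by auto
    ultimately show "card {x \<in> {v + 1 + l..<2 * v + 2 * 1}. id x < v + r} = r - l - lis a l r"
      using 1 by auto
  qed
qed

section \<open>Rows and columns of the two factors\<close>

text \<open>Where column \<open>c\<close> of the low braid goes among the intermediate columns: the
  left half of its columns stands for the low positions, which \<open>g\<close> finds in the block,
  and the right half is moved past the columns of all positions.\<close>

definition phi :: "nat \<Rightarrow> (nat \<Rightarrow> nat) \<Rightarrow> nat \<Rightarrow> nat \<Rightarrow> nat" where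
  "phi m g v c = (if c < 2*v+m then v+m+g (c - v) else c + 2*m)"

text \<open>The counterpart for the high braid, whose sequence block starts at \<open>v + m\<close>,
  with targets among the final columns.\<close>

definition psi :: "nat \<Rightarrow> (nat \<Rightarrow> nat) \<Rightarrow> nat \<Rightarrow> nat \<Rightarrow> nat" where
  "psi m g v c = (if c < 2*v+3*m then v+g (c - v - m) else c - m)"

text \<open>The first factor \<open>A\<close> of the merge as one function on all blocks. A block of
  \<open>2*m\<close> positions has \<open>4*m\<close> strands, which is why \<open>v\<close> is
  computed from \<open>x div (4*m)\<close>.\<close>

definition row_A :: "nat \<Rightarrow> (nat \<Rightarrow> nat) \<Rightarrow> (nat \<Rightarrow> nat) \<Rightarrow> (nat \<Rightarrow> nat) \<Rightarrow> nat \<Rightarrow> nat" where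
  "row_A m d g p x = (let v = (x div (4*m)) * (2*m); y = x - v - 2*m in
     if x < 2*v+m then x else if x < 2*v+2*m then phi m g v (p (x - m))
     else if d y < v + m then phi m g v (p (v+m+d y)) else v+m+y)"

text \<open>The inverse of the second factor: it sends an intermediate index to a final column. The
  machine obtains the factor itself by storing \<open>x\<close> at the address that
  \<open>row_B\<close> gives for \<open>x\<close>.\<close>

definition row_B :: "nat \<Rightarrow> (nat \<Rightarrow> nat) \<Rightarrow> (nat \<Rightarrow> nat) \<Rightarrow> (nat \<Rightarrow> nat) \<Rightarrow> nat \<Rightarrow> nat" where
  "row_B m d g p x = (let v = (x div (4*m)) * (2*m); y = x - v - m in
     if x < 2*v+m then psi m g v (p (x + 2*m)) else if x < 2*v+3*m
     then (if d y < v + m then v+y else psi m g v (p (v+d y+2*m))) else x)"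

text \<open>Inside a block of size \<open>2*m\<close> the two classes of size \<open>m\<close> are a
  lower and an upper range of values, so sorting by class is splitting by value.\<close>

lemma value_split_level:
  assumes a: "block_perm w (2*m) a" and m: "0 < m" "2*m dvd w" and q: "q * (2*m) < w"
    and a': "\<And>i. i < w \<Longrightarrow> a' (dst a m i) = a i" and g: "\<And>i. i < w \<Longrightarrow> g (dst a m i) = i"
  shows "value_split (q*(2*m)) m a a' (dst a m) g"
proof -
  let ?v = "q*(2*m)" let ?d = "dst a m"
  have ba: "bij_betw a {..<w} {..<w}" using a by (simp add: block_perm_def)
  have mw: "m dvd w" using m(2) by (rule dvd_mult_right)
  have le: "?v + 2*m \<le> w" by (rule block_in_range[OF m(2) q])
  note dd = dst_div[OF ba m(1) mw]
  have lt: "x < w" if "x \<in> {?v..<?v+2*m}" for x using that le by auto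
  have d2: "?d x div (2*m) = x div (2*m)" if "x < w" for x
  proof -
    have "?d x div m div 2 = a x div m div 2" using dd(1)[OF that] by simp
    then show ?thesis using a that by (simp add: block_perm_def div_mult2_eq mult.commute[of 2 m])
  qed
  have "block_perm w (2*m) ?d" using d2 dst_bij[OF ba m(1) mw] by (simp add: block_perm_def)
  then have bd: "bij_betw ?d {?v..<?v+2*m} {?v..<?v+2*m}" using block_perm_bij_block[of w "2*m" ?d q] m le by simp
  have cls: "a x div m = (if ?d x < ?v + m then 2*q else 2*q+1)" if "x \<in> {?v..<?v+2*m}" for x
  proof -
    have "?d x \<in> {?v..<?v+2*m}" using bd that by (auto dest: bij_betwE)
    then have "?d x div m = (if ?d x < ?v + m then 2*q else 2*q+1)"
      using div_eq_iff_block[OF m(1), of "?d x" "2*q"] div_eq_iff_block[OF m(1), of "?d x" "2*q+1"]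
      by (auto simp: algebra_simps)
    then show ?thesis using dd(1)[OF lt[OF that]] by simp
  qed
  show ?thesis
  proof
    show "bij_betw ?d {?v..<?v+2*m} {?v..<?v+2*m}" by (rule bd)
    show "g (?d y) = y" "a' (?d y) = a y" if "y \<in> {?v..<?v+2*m}" for y using g a' lt[OF that] by auto
    show "?d x < ?d y" if "x \<in> {?v..<?v+2*m}" "y \<in> {?v..<?v+2*m}" "x < y" "(?d x < ?v + m) = (?d y < ?v + m)" for x y
      using cls[OF that(1)] cls[OF that(2)] that(3,4) by (intro dst_mono) auto
    show "a x < a y" if "x \<in> {?v..<?v+2*m}" "y \<in> {?v..<?v+2*m}" "?d x < ?v + m" "?v + m \<le> ?d y" for x y
    proof -
      have "a x div m < a y div m" using cls[OF that(1)] cls[OF that(2)] that(3,4) by simp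
      then show ?thesis by (meson div_le_mono leD leI)
    qed
  qed
qed

locale build_block = value_split +
  fixes p :: "nat \<Rightarrow> nat" and q :: nat
  assumes v: "v = q * (2*m)" and m: "0 < m"
    and p1: "bij_betw p {2*v..<2*v+2*m} {2*v..<2*v+2*m}"
    and p2: "bij_betw p {2*v+2*m..<2*v+4*m} {2*v+2*m..<2*v+4*m}"
begin

lemma div_block: "x \<in> {2*v..<2*v+4*m} \<Longrightarrow> (x div (4*m)) * (2*m) = v"
  using div_eq_iff_block[of "4*m" x q] m by (simp add: v)

lemma d_of_g: "u \<in> I \<Longrightarrow> d (g u) = u" "u \<in> I \<Longrightarrow> v \<le> g u \<and> g u < v + 2*m"
  using d_g g_in by auto

lemma row_A_eqs:
  "u \<in> {v..<v+m} \<Longrightarrow> row_A m d g p (v+u) = v+u"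
  "u \<in> {v..<v+m} \<Longrightarrow> row_A m d g p (v+u+m) = phi m g v (p (v+u))"
  "u \<in> {v..<v+m} \<Longrightarrow> row_A m d g p (v+2*m+g u) = phi m g v (p (v+u+m))"
  "u \<in> {v+m..<v+2*m} \<Longrightarrow> row_A m d g p (v+2*m+g u) = v+m+g u"
  using div_block[of "v+u"] div_block[of "v+u+m"] div_block[of "v+2*m+g u"] d_of_g[of u]
  by (auto simp: row_A_def Let_def algebra_simps)

lemma row_B_eqs:
  "u \<in> {v..<v+m} \<Longrightarrow> row_B m d g p (v+m+g u) = v+g u"
  "u \<in> {v+m..<v+2*m} \<Longrightarrow> row_B m d g p (v+u-m) = psi m g v (p (v+u+m))"
  "u \<in> {v+m..<v+2*m} \<Longrightarrow> row_B m d g p (v+m+g u) = psi m g v (p (v+u+2*m))"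
  "u \<in> {v+m..<v+2*m} \<Longrightarrow> row_B m d g p (v+u+2*m) = v+u+2*m"
proof -
  show "row_B m d g p (v+u-m) = psi m g v (p (v+u+m))" if u: "u \<in> {v+m..<v+2*m}"
  proof -
    obtain t where t: "u = v + m + t" using u by (metis atLeastLessThan_iff le_iff_add)
    have e: "v + u - m = 2*v + t" "t < m" "v + u + m = 2*v + t + 2*m" using t u by auto
    have "(2*v+t) div (4*m) * (2*m) = v" by (rule div_block) (use e(2) in simp)
    then show ?thesis using e(2) unfolding e(1,3) by (simp add: row_B_def Let_def)
  qed
qed (use div_block[of "v+m+g u"] div_block[of "v+u+2*m"] d_of_g[of u] in
      \<open>auto simp: row_B_def Let_def algebra_simps\<close>)

text \<open>Makes the addresses of the writes into \<open>B\<close> distinct, so that no later write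
  destroys an earlier one.\<close>

lemma bij_row_B: "bij_betw (row_B m d g p) {2*v..<2*v+4*m} {2*v..<2*v+4*m}"
proof (rule surj_imp_bij)
  let ?X = "{2*v..<2*v+4*m}" let ?f = "row_B m d g p"
  have p2s: "\<exists>x'\<in>?X. ?f x' = psi m g v y" if "y \<in> {2*v+2*m..<2*v+4*m}" for y
  proof -
    have "y \<in> p ` {2*v+2*m..<2*v+4*m}" using bij_betw_imp_surj_on[OF p2] that by simp
    then obtain x where x: "x \<in> {2*v+2*m..<2*v+4*m}" "y = p x" by blast
    show ?thesis
    proof (cases "x < 2*v+3*m")
      case True
      define u where "u = x - v - m"
      have u: "u \<in> {v+m..<v+2*m}" "v+u+m = x" using True x by (auto simp: u_def)
      have "v + u - m \<in> ?X" using u by auto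
      then show ?thesis using row_B_eqs(2)[OF u(1)] u x by auto
    next
      case False
      define u where "u = x - v - 2*m"
      have u: "u \<in> {v+m..<v+2*m}" "v+u+2*m = x" using False x by (auto simp: u_def)
      have "v + m + g u \<in> ?X" using u d_of_g(2)[of u] by auto
      then show ?thesis using row_B_eqs(3)[OF u(1)] u x by auto
    qed
  qed
  show "?X \<subseteq> ?f ` ?X"
  proof
    fix y assume y: "y \<in> ?X"
    consider "y < 2*v+2*m" "d (y-v) < v+m" | "y < 2*v+2*m" "v+m \<le> d (y-v)" | "2*v+2*m \<le> y" "y < 2*v+3*m" | "2*v+3*m \<le> y"
      by linarith
    then show "y \<in> ?f ` ?X"
    proof cases
      case 1
      have yI: "y - v \<in> I" using 1 y by auto
      note d = d_in[OF yI] g_d[OF yI]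
      have "?f (v+m+g (d (y-v))) = v + g (d (y-v))" by (rule row_B_eqs) (use 1 d in auto)
      then have "?f (v+m+(y-v)) = y" using d y by auto
      moreover have "v+m+(y-v) \<in> ?X" using 1 y by auto
      ultimately show ?thesis by (metis image_eqI)
    next
      case 2
      have yI: "y - v \<in> I" using 2 y by auto
      note d = d_in[OF yI] g_d[OF yI]
      have "v+m+d (y-v) \<in> {2*v+2*m..<2*v+4*m}" using 2 d by auto
      from p2s[OF this] obtain x' where x': "x' \<in> ?X" "?f x' = psi m g v (v+m+d (y-v))" by blast
      have "psi m g v (v+m+d (y-v)) = y" using d y by (auto simp: psi_def)
      then show ?thesis using x' by (metis image_eqI)
    next
      case 3
      have "y + m \<in> {2*v+2*m..<2*v+4*m}" using 3 by auto
      from p2s[OF this] obtain x' where x': "x' \<in> ?X" "?f x' = psi m g v (y+m)" by blast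
      have "psi m g v (y+m) = y" using 3 by (auto simp: psi_def)
      then show ?thesis using x' by (metis image_eqI)
    next
      case 4
      have "y - v - 2*m \<in> {v+m..<v+2*m}" "v + (y - v - 2*m) + 2*m = y" using 4 y by auto
      then have "?f y = y" using row_B_eqs(4)[of "y - v - 2*m"] by simp
      then show ?thesis using y by (metis image_eqI)
    qed
  qed
qed simp

lemma braid_merge_rows:
  assumes r1: "repr a' p v m" and r2: "repr a' p (v+m) m"
    and A: "\<And>u. u \<in> {v..<v+2*m} \<Longrightarrow> A (v+2*m+g u) = row_A m d g p (v+2*m+g u)"
       "\<And>u. u \<in> {v..<v+m} \<Longrightarrow> A (v+u) = row_A m d g p (v+u) \<and> A (v+u+m) = row_A m d g p (v+u+m)"
    and B: "\<And>u. u \<in> {v..<v+2*m} \<Longrightarrow> B (row_B m d g p (v+m+g u)) = v+m+g u"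
       "\<And>u. u \<in> {v+m..<v+2*m} \<Longrightarrow> B (row_B m d g p (v+u-m)) = v+u-m \<and> B (row_B m d g p (v+u+2*m)) = v+u+2*m"
  shows "braid_merge v m a a' d g p A B"
proof
  show "bij_betw p {2*v..<2*v+2*m} {2*v..<2*v+2*m}" "bij_betw p {2*v+2*m..<2*v+4*m} {2*v+2*m..<2*v+4*m}"
    by (rule p1 p2)+
  show "repr a' p v m" "repr a' p (v+m) m" by (rule r1 r2)+
  fix u
  show "A (v+u) = v+u" if "u \<in> {v..<v+m}" using A(2)[OF that] row_A_eqs[of u] that by simp
  show "A (v+u+m) = (if p (v+u) < 2*v+m then v+m+g (p (v+u) - v) else p (v+u) + 2*m)" if "u \<in> {v..<v+m}"
    using A(2)[OF that] row_A_eqs(2)[OF that] by (simp add: phi_def)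
  show "A (v+2*m+g u) = (if p (v+u+m) < 2*v+m then v+m+g (p (v+u+m) - v) else p (v+u+m) + 2*m)" if "u \<in> {v..<v+m}"
    using A(1)[of u] row_A_eqs(3)[OF that] that by (simp add: phi_def)
  show "A (v+2*m+g u) = v+m+g u" if "u \<in> {v+m..<v+2*m}"
    using A(1)[of u] row_A_eqs(4)[OF that] that by simp
  show "B (v+g u) = v+m+g u" if "u \<in> {v..<v+m}"
    using B(1)[of u] row_B_eqs(1)[OF that] that by simp
  show "B (if p (v+u+m) < 2*v+3*m then v+g (p (v+u+m) - v - m) else p (v+u+m) - m) = v+u-m" if "u \<in> {v+m..<v+2*m}"
    using B(2)[OF that] row_B_eqs(2)[OF that] by (simp add: psi_def)
  show "B (if p (v+u+2*m) < 2*v+3*m then v+g (p (v+u+2*m) - v - m) else p (v+u+2*m) - m) = v+m+g u" if "u \<in> {v+m..<v+2*m}"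
    using B(1)[of u] row_B_eqs(3)[OF that] that by (simp add: psi_def)
  show "B (v+u+2*m) = v+u+2*m" if "u \<in> {v+m..<v+2*m}" using B(2)[OF that] row_B_eqs(4)[OF that] by simp
qed

end

definition phi_code :: com where
  "phi_code = Cond (Less (V ''a'') (Plus (Plus (V ''v'') (V ''v'')) (V ''m'')))
     (Assign ''x'' (Plus (Plus (V ''v'') (V ''m'')) (Load ''Gk'' (Plus (V ''lr'') (Minus (V ''a'') (V ''v''))))))
     (Assign ''x'' (Plus (V ''a'') (V ''m2'')))"

definition psi_code :: com where
  "psi_code = Cond (Less (V ''a'') (Plus (Plus (Plus (V ''v'') (V ''v'')) (V ''m2'')) (V ''m'')))
     (Assign ''x'' (Plus (V ''v'') (Load ''Gk'' (Plus (V ''lr'') (Minus (Minus (V ''a'') (V ''v'')) (V ''m''))))))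
     (Assign ''x'' (Minus (V ''a'') (V ''m'')))"

text \<open>The index \<open>i\<close> runs over the numbering after the split, and
  \<open>g i\<close> is the position it came from. A low index owns three entries of
  \<open>A\<close> and one of \<open>B\<close>, a high index one of \<open>A\<close> and three of
  \<open>B\<close>; in total this covers all \<open>4*m\<close> strands of a block.\<close>

definition build_lo :: com where
  "build_lo =
     Store ''A'' (Plus (V ''v'') (V ''i'')) (Plus (V ''v'') (V ''i''));;
     Assign ''a'' (Load ''P'' (Plus (V ''v'') (V ''i'')));; phi_code;;
     Store ''A'' (Plus (Plus (V ''v'') (V ''i'')) (V ''m'')) (V ''x'');;
     Assign ''a'' (Load ''P'' (Plus (Plus (V ''v'') (V ''i'')) (V ''m'')));; phi_code;;
     Store ''A'' (Plus (Plus (V ''v'') (V ''m2'')) (V ''g'')) (V ''x'');;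
     Store ''B'' (Plus (V ''v'') (V ''g'')) (Plus (Plus (V ''v'') (V ''m'')) (V ''g''))"

definition build_hi :: com where
  "build_hi =
     Store ''A'' (Plus (Plus (V ''v'') (V ''m2'')) (V ''g'')) (Plus (Plus (V ''v'') (V ''m'')) (V ''g''));;
     Assign ''a'' (Load ''P'' (Plus (Plus (V ''v'') (V ''i'')) (V ''m'')));; psi_code;;
     Store ''B'' (V ''x'') (Minus (Plus (V ''v'') (V ''i'')) (V ''m''));;
     Assign ''a'' (Load ''P'' (Plus (Plus (V ''v'') (V ''i'')) (V ''m2'')));; psi_code;;
     Store ''B'' (V ''x'') (Plus (Plus (V ''v'') (V ''m'')) (V ''g''));;
     Store ''B'' (Plus (Plus (V ''v'') (V ''i'')) (V ''m2'')) (Plus (Plus (V ''v'') (V ''i'')) (V ''m2''))"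

definition build_body :: com where
  "build_body =
     Assign ''v'' (Times (Div (V ''i'') (V ''m2'')) (V ''m2''));;
     Assign ''g'' (Load ''Gk'' (Plus (V ''lr'') (V ''i'')));;
     Cond (Less (Minus (V ''i'') (V ''v'')) (V ''m'')) build_lo build_hi"

text \<open>An equivalence rather than an implication, so that it can be substituted inside a larger
  \<open>wp\<close> goal. The same holds for \<open>wp_psi_code\<close>.\<close>

lemma wp_phi_code:
  assumes "2 * fst s ''v'' \<le> fst s ''a''" "fst s ''a'' < 2 * fst s ''v'' + 2 * fst s ''m''" "fst s ''m2'' = 2 * fst s ''m''"
    and "2 * fst s ''v'' + 4 * fst s ''m'' \<le> W" "fst s ''lr'' + fst s ''v'' + 2 * fst s ''m'' \<le> W"
    and "\<And>u. u < fst s ''v'' + 2 * fst s ''m'' \<Longrightarrow> fst s ''v'' \<le> u \<Longrightarrow> snd s ''Gk'' (fst s ''lr'' + u) < fst s ''v'' + 2 * fst s ''m''"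
  shows "wp S W phi_code s Q \<longleftrightarrow> Q ((fst s)(''x'' := phi (fst s ''m'') (\<lambda>u. snd s ''Gk'' (fst s ''lr'' + u)) (fst s ''v'') (fst s ''a'')), snd s)"
proof -
  define c where "c = fst s ''a'' - fst s ''v''"
  show ?thesis
  proof (cases "fst s ''a'' < 2 * fst s ''v'' + fst s ''m''")
    case True
    have "c < fst s ''v'' + 2 * fst s ''m''" "fst s ''v'' \<le> c" using True assms(1) unfolding c_def by linarith+
    then have "fst s ''v'' + fst s ''m'' + snd s ''Gk'' (fst s ''lr'' + c) \<le> W" "fst s ''lr'' + c \<le> W"
      using assms(6)[of c] assms(4,5) by linarith+
    then show ?thesis using assms(1,3,4) True
      unfolding phi_code_def phi_def c_def by (simp add: mult_2[symmetric])
  next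
    case False
    then show ?thesis using assms(1-4) unfolding phi_code_def phi_def by (simp add: mult_2[symmetric])
  qed
qed

lemma wp_psi_code:
  assumes "2 * fst s ''v'' + 2 * fst s ''m'' \<le> fst s ''a''" "fst s ''a'' < 2 * fst s ''v'' + 4 * fst s ''m''" "fst s ''m2'' = 2 * fst s ''m''"
    and "2 * fst s ''v'' + 4 * fst s ''m'' \<le> W" "fst s ''lr'' + fst s ''v'' + 2 * fst s ''m'' \<le> W"
    and "\<And>u. u < fst s ''v'' + 2 * fst s ''m'' \<Longrightarrow> fst s ''v'' \<le> u \<Longrightarrow> snd s ''Gk'' (fst s ''lr'' + u) < fst s ''v'' + 2 * fst s ''m''"
  shows "wp S W psi_code s Q \<longleftrightarrow> Q ((fst s)(''x'' := psi (fst s ''m'') (\<lambda>u. snd s ''Gk'' (fst s ''lr'' + u)) (fst s ''v'') (fst s ''a'')), snd s)"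
proof -
  define c where "c = fst s ''a'' - fst s ''v'' - fst s ''m''"
  show ?thesis
  proof (cases "fst s ''a'' < 2 * fst s ''v'' + 3 * fst s ''m''")
    case True
    have "c < fst s ''v'' + 2 * fst s ''m''" "fst s ''v'' \<le> c" using True assms(1) unfolding c_def by linarith+
    then have "fst s ''v'' + snd s ''Gk'' (fst s ''lr'' + c) \<le> W" "fst s ''lr'' + c \<le> W"
      using assms(6)[of c] assms(4,5) by linarith+
    then show ?thesis using assms(1,3,4) True
      unfolding psi_code_def psi_def c_def by (simp add: mult_2[symmetric])
  next
    case False
    then show ?thesis using assms(1-4) unfolding psi_code_def psi_def by (simp add: mult_2[symmetric])
  qed
qed

context build_block
begin

lemma wp_build_lo:
  assumes s: "fst s ''v'' = v" "fst s ''i'' = i" "fst s ''m'' = m" "fst s ''m2'' = 2*m" "fst s ''lr'' = lr" "fst s ''g'' = g i"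
    and g: "\<And>u. snd s ''Gk'' (lr + u) = g u" and p: "snd s ''P'' = p"
    and i: "i \<in> {v..<v+m}" and W: "2 * v + 4 * m \<le> W" "lr + v + 2 * m \<le> W"
    and Q: "\<And>s'. (\<And>x. x \<notin> {''a'', ''x''} \<Longrightarrow> fst s' x = fst s x) \<Longrightarrow> (\<And>a. a \<notin> {''A'', ''B''} \<Longrightarrow> snd s' a = snd s a) \<Longrightarrow>
       snd s' ''A'' = (snd s ''A'')(v+i := row_A m d g p (v+i), v+i+m := row_A m d g p (v+i+m), v+2*m+g i := row_A m d g p (v+2*m+g i)) \<Longrightarrow>
       snd s' ''B'' = (snd s ''B'')(row_B m d g p (v+m+g i) := v+m+g i) \<Longrightarrow> Q s'"
  shows "wp S W build_lo s Q"
proof -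
  have gu: "g u < v + 2*m" if "v \<le> u" "u < v + 2*m" for u using d_of_g(2)[of u] that by simp
  have pin: "2*v \<le> p (v+i)" "p (v+i) < 2*v+2*m" "2*v \<le> p (v+i+m)" "p (v+i+m) < 2*v+2*m"
    using bij_betwE[OF p1] i by auto
  have "g i < v+2*m" using gu i by simp
  then have gi: "v + 2*m + g i \<le> W" "v + m + g i \<le> W" "v + g i \<le> W" using W(1) by linarith+
  show ?thesis unfolding build_lo_def
    using W pin i
    apply (simp add: s p)
    apply (subst wp_phi_code; (simp add: s g p gu)?)
    apply (subst wp_phi_code; (simp add: s g p gu gi)?)
    apply (rule Q; simp add: s row_A_eqs(1,2,3)[OF i] row_B_eqs(1)[OF i])
    done
qed

lemma wp_build_hi:
  assumes s: "fst s ''v'' = v" "fst s ''i'' = i" "fst s ''m'' = m" "fst s ''m2'' = 2*m" "fst s ''lr'' = lr" "fst s ''g'' = g i"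
    and g: "\<And>u. snd s ''Gk'' (lr + u) = g u" and p: "snd s ''P'' = p"
    and i: "i \<in> {v+m..<v+2*m}" and W: "2 * v + 4 * m \<le> W" "lr + v + 2 * m \<le> W"
    and Q: "\<And>s'. (\<And>x. x \<notin> {''a'', ''x''} \<Longrightarrow> fst s' x = fst s x) \<Longrightarrow> (\<And>a. a \<notin> {''A'', ''B''} \<Longrightarrow> snd s' a = snd s a) \<Longrightarrow>
       snd s' ''A'' = (snd s ''A'')(v+2*m+g i := row_A m d g p (v+2*m+g i)) \<Longrightarrow>
       snd s' ''B'' = (snd s ''B'')(row_B m d g p (v+i-m) := v+i-m, row_B m d g p (v+m+g i) := v+m+g i, row_B m d g p (v+i+2*m) := v+i+2*m) \<Longrightarrow> Q s'"
  shows "wp S W build_hi s Q"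
proof -
  have gu: "g u < v + 2*m" if "v \<le> u" "u < v + 2*m" for u using d_of_g(2)[of u] that by simp
  have pin: "2*v+2*m \<le> p (v+i+m)" "p (v+i+m) < 2*v+4*m" "2*v+2*m \<le> p (v+i+2*m)" "p (v+i+2*m) < 2*v+4*m"
    using bij_betwE[OF p2] i by auto
  have "g i < v+2*m" using gu i by simp
  then have gi: "v + 2*m + g i \<le> W" "v + m + g i \<le> W" "v + g i \<le> W" using W(1) by linarith+
  show ?thesis unfolding build_hi_def
    using W pin i
    apply (simp add: s p gi)
    apply (subst wp_psi_code; (simp add: s g p gu)?)
    apply (subst wp_psi_code; (simp add: s g p gu gi)?)
    apply (rule Q; simp add: s row_A_eqs(4)[OF i] row_B_eqs(2-4)[OF i])
    done
qed

end

text \<open>The share of index \<open>u\<close> in the two factors. The entries of \<open>B\<close>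
  are addressed through \<open>fB\<close>, the inverse of the array to be produced.\<close>

definition rows_ok :: "nat \<Rightarrow> (nat \<Rightarrow> nat) \<Rightarrow> (nat \<Rightarrow> nat) \<Rightarrow> (nat \<Rightarrow> nat) \<Rightarrow> (nat \<Rightarrow> nat) \<Rightarrow> (nat \<Rightarrow> nat) \<Rightarrow> nat \<Rightarrow> bool" where
  "rows_ok m g fA fB A B u \<longleftrightarrow> (let v = (u div (2*m)) * (2*m) in
     A (v+2*m+g u) = fA (v+2*m+g u) \<and> (u < v+m \<longrightarrow> A (v+u) = fA (v+u) \<and> A (v+u+m) = fA (v+u+m)) \<and>
     B (fB (v+m+g u)) = v+m+g u \<and> (v+m \<le> u \<longrightarrow> B (fB (v+u-m)) = v+u-m \<and> B (fB (v+u+2*m)) = v+u+2*m))"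

lemma build_correct:
  assumes bb: "\<And>q. q*(2*m) < nn \<Longrightarrow> build_block (q*(2*m)) m a a' d g p q"
    and m: "0 < m" "2*m dvd nn"
    and s: "fst s0 ''i'' = 0" "fst s0 ''m'' = m" "fst s0 ''m2'' = 2*m" "fst s0 ''lr'' = lr" "fst s0 ''N'' = nn"
    and g: "\<And>u. snd s0 ''Gk'' (lr + u) = g u" and p: "snd s0 ''P'' = p"
    and W: "lr + nn \<le> W" "2 * nn \<le> W" "1 \<le> W"
  shows "tri S W (For ''i'' ''N'' build_body) s0 (200 * (nn + 1))
    (\<lambda>s. \<forall>u<nn. rows_ok m g (row_A m d g p) (row_B m d g p) (snd s ''A'') (snd s ''B'') u)"
proof -
  let ?fA = "row_A m d g p" let ?fB = "row_B m d g p"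
  have m4: "0 < 4 * m" "4 * m dvd 2 * nn" using m by (auto elim!: dvdE)
  have "block_perm (2*nn) (4*m) ?fB"
  proof (rule block_perm_of_blocks[OF m4])
    fix q assume q: "q * (4*m) < 2*nn"
    have e: "q * (4*m) = 2 * (q * (2*m))" by simp
    have "q * (2*m) < nn" using q unfolding e by linarith
    then interpret build_block "q*(2*m)" m a a' d g p q by (rule bb)
    show "bij_betw ?fB {q*(4*m)..<q*(4*m)+4*m} {q*(4*m)..<q*(4*m)+4*m}" unfolding e by (rule bij_row_B)
  qed
  then have inj: "?fB x = ?fB y \<longleftrightarrow> x = y" if "x < 2*nn" "y < 2*nn" for x y
    using that by (auto simp: block_perm_def bij_betw_def inj_on_def)
  have range: "\<exists>q. u div (2*m) = q \<and> q*(2*m) < nn \<and> q*(2*m)+2*m \<le> nn \<and> build_block (q*(2*m)) m a a' d g p q \<and>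
     u \<in> {q*(2*m)..<q*(2*m)+2*m} \<and> g u \<in> {q*(2*m)..<q*(2*m)+2*m}" if "u < nn" for u
  proof -
    let ?q = "u div (2*m)"
    have q: "?q*(2*m) < nn" using that by (meson div_times_less_eq_dividend le_less_trans)
    interpret b0: build_block "?q*(2*m)" m a a' d g p ?q by (rule bb[OF q])
    have u: "u \<in> {?q*(2*m)..<?q*(2*m)+2*m}" using div_eq_iff_block[of "2*m" u ?q] m by simp
    show ?thesis using q block_in_range[OF m(2) q] u b0.g_in[OF u] bb[OF q] by blast
  qed
  show ?thesis
  proof (rule tri_For[where a=0 and b=nn and B=180 and I="\<lambda>i s. fst s ''m'' = m \<and> fst s ''m2'' = 2*m \<and> fst s ''lr'' = lr \<and>
      snd s ''Gk'' = snd s0 ''Gk'' \<and> snd s ''P'' = p \<and> (\<forall>u<i. rows_ok m g ?fA ?fB (snd s ''A'') (snd s ''B'') u)"])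
    fix i s assume i: "i < nn" "fst s ''i'' = i" "fst s ''N'' = nn" and I: "fst s ''m'' = m \<and> fst s ''m2'' = 2*m \<and> fst s ''lr'' = lr \<and>
      snd s ''Gk'' = snd s0 ''Gk'' \<and> snd s ''P'' = p \<and> (\<forall>u<i. rows_ok m g ?fA ?fB (snd s ''A'') (snd s ''B'') u)"
    obtain q where q: "i div (2*m) = q" "q*(2*m) < nn" "q*(2*m)+2*m \<le> nn" "build_block (q*(2*m)) m a a' d g p q"
      "i \<in> {q*(2*m)..<q*(2*m)+2*m}" using range[OF i(1)] by blast
    interpret bb: build_block "q*(2*m)" m a a' d g p q by (rule q(4))
    let ?v = "q*(2*m)"
    let ?s1 = "((fst s)(''v'' := ?v, ''g'' := g i), snd s)"
    have Is: "fst s ''m'' = m" "fst s ''m2'' = 2*m" "fst s ''lr'' = lr" "snd s ''Gk'' = snd s0 ''Gk''" "snd s ''P'' = p"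
      and Ir: "\<And>u. u<i \<Longrightarrow> rows_ok m g ?fA ?fB (snd s ''A'') (snd s ''B'') u" using I by auto
    have WW: "2 * ?v + 4 * m \<le> W" "lr + ?v + 2*m \<le> W" using q(3) W by linarith+
    let ?Q = "\<lambda>s'. fst s' ''i'' = i \<and> fst s' ''N'' = nn \<and> fst ((fst s')(''i'' := Suc i), snd s') ''m'' = m \<and>
       fst ((fst s')(''i'' := Suc i), snd s') ''m2'' = 2*m \<and> fst ((fst s')(''i'' := Suc i), snd s') ''lr'' = lr \<and>
       snd ((fst s')(''i'' := Suc i), snd s') ''Gk'' = snd s0 ''Gk'' \<and> snd ((fst s')(''i'' := Suc i), snd s') ''P'' = p \<and>
       (\<forall>u<Suc i. rows_ok m g ?fA ?fB (snd ((fst s')(''i'' := Suc i), snd s') ''A'') (snd ((fst s')(''i'' := Suc i), snd s') ''B'') u)"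
    have fin: "?Q s'" if fr: "\<And>x. x \<notin> {''a'', ''x''} \<Longrightarrow> fst s' x = fst ?s1 x" "\<And>a. a \<notin> {''A'', ''B''} \<Longrightarrow> snd s' a = snd ?s1 a"
      and ok: "\<And>u. u \<le> i \<Longrightarrow> rows_ok m g ?fA ?fB (snd s' ''A'') (snd s' ''B'') u" for s'
      using fr Is i ok by (auto simp: less_Suc_eq_le)
    have "wp S W (Cond (Less (Minus (V ''i'') (V ''v'')) (V ''m'')) build_lo build_hi) ?s1 ?Q"
    proof (cases "i < ?v + m")
      case True
      have lo: "i \<in> {?v..<?v+m}" using True q(5) by auto
      have "wp S W build_lo ?s1 ?Q"
      proof (rule bb.wp_build_lo[OF _ _ _ _ _ _ _ _ lo WW])
        fix s' assume fr: "\<And>x. x \<notin> {''a'', ''x''} \<Longrightarrow> fst s' x = fst ?s1 x" "\<And>a. a \<notin> {''A'', ''B''} \<Longrightarrow> snd s' a = snd ?s1 a"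
          and A: "snd s' ''A'' = (snd ?s1 ''A'')(?v+i := ?fA (?v+i), ?v+i+m := ?fA (?v+i+m), ?v+2*m+g i := ?fA (?v+2*m+g i))"
          and B: "snd s' ''B'' = (snd ?s1 ''B'')(?fB (?v+m+g i) := ?v+m+g i)"
        have gi: "?v+m+g i < 2*nn" using range[OF i(1)] q by auto
        have A': "snd s' ''A'' x = ?fA x" if "snd s ''A'' x = ?fA x \<or> x = ?v+i \<or> x = ?v+i+m \<or> x = ?v+2*m+g i" for x
          using that A by auto
        have B': "snd s' ''B'' (?fB x) = x" if "snd s ''B'' (?fB x) = x \<or> x = ?v+m+g i" "x < 2*nn" for x
          using that B inj[OF that(2) gi] by auto
        have ok: "rows_ok m g ?fA ?fB (snd s' ''A'') (snd s' ''B'') u" if "u \<le> i" for u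
        proof (cases "u = i")
          case True then show ?thesis using A' B' gi q(1) lo by (simp add: rows_ok_def Let_def)
        next
          case False
          have un: "u < nn" using that i(1) by linarith
          from range[OF un] obtain q' where q': "u div (2*m) = q'" "q'*(2*m)+2*m \<le> nn" "u \<in> {q'*(2*m)..<q'*(2*m)+2*m}" "g u \<in> {q'*(2*m)..<q'*(2*m)+2*m}"
            by blast
          have "q'*(2*m)+m+g u < 2*nn" "q'*(2*m)+u-m < 2*nn" "q'*(2*m)+u+2*m < 2*nn" using q'(2-4) by auto
          then show ?thesis using Ir[of u] False that A' B' by (simp add: rows_ok_def Let_def q'(1))
        qed
        from fin[OF fr ok] show "?Q s'" .
      qed (use Is i g in auto)
      moreover have "i - ?v < m" using lo by auto
      ultimately show ?thesis using Is i by simp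
    next
      case False
      have hi: "i \<in> {?v+m..<?v+2*m}" using False q(5) by auto
      have "wp S W build_hi ?s1 ?Q"
      proof (rule bb.wp_build_hi[OF _ _ _ _ _ _ _ _ hi WW])
        fix s' assume fr: "\<And>x. x \<notin> {''a'', ''x''} \<Longrightarrow> fst s' x = fst ?s1 x" "\<And>a. a \<notin> {''A'', ''B''} \<Longrightarrow> snd s' a = snd ?s1 a"
          and A: "snd s' ''A'' = (snd ?s1 ''A'')(?v+2*m+g i := ?fA (?v+2*m+g i))"
          and B: "snd s' ''B'' = (snd ?s1 ''B'')(?fB (?v+i-m) := ?v+i-m, ?fB (?v+m+g i) := ?v+m+g i, ?fB (?v+i+2*m) := ?v+i+2*m)"
        have gi: "?v+m+g i < 2*nn" "?v+i-m < 2*nn" "?v+i+2*m < 2*nn" using range[OF i(1)] q by auto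
        have A': "snd s' ''A'' x = ?fA x" if "snd s ''A'' x = ?fA x \<or> x = ?v+2*m+g i" for x using that A by auto
        have B': "snd s' ''B'' (?fB x) = x" if "snd s ''B'' (?fB x) = x \<or> x = ?v+i-m \<or> x = ?v+m+g i \<or> x = ?v+i+2*m" "x < 2*nn" for x
          using that B inj[OF that(2) gi(1)] inj[OF that(2) gi(2)] inj[OF that(2) gi(3)] by auto
        have ok: "rows_ok m g ?fA ?fB (snd s' ''A'') (snd s' ''B'') u" if "u \<le> i" for u
        proof (cases "u = i")
          case True then show ?thesis using A' B' gi q(1) hi by (simp add: rows_ok_def Let_def)
        next
          case False
          have un: "u < nn" using that i(1) by linarith
          from range[OF un] obtain q' where q': "u div (2*m) = q'" "q'*(2*m)+2*m \<le> nn" "u \<in> {q'*(2*m)..<q'*(2*m)+2*m}" "g u \<in> {q'*(2*m)..<q'*(2*m)+2*m}"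
            by blast
          have "q'*(2*m)+m+g u < 2*nn" "q'*(2*m)+u-m < 2*nn" "q'*(2*m)+u+2*m < 2*nn" using q'(2-4) by auto
          then show ?thesis using Ir[of u] False that A' B' by (simp add: rows_ok_def Let_def q'(1))
        qed
        from fin[OF fr ok] show "?Q s'" .
      qed (use Is i g in auto)
      moreover have "\<not> i - ?v < m" using hi by auto
      ultimately show ?thesis using Is i by simp
    qed
    then have "wp S W build_body s ?Q"
      unfolding build_body_def using Is i q(1,2,5) W g[of i] by simp
    then show "tri S W build_body s 180 ?Q"
      by (rule tri_wp) (simp add: build_body_def build_lo_def build_hi_def phi_code_def psi_code_def)
  qed (use s p W in auto)
qed

section \<open>Merging stages\<close>

definition stage :: com where
  "stage =
     (Assign ''m2'' (Plus (V ''m'') (V ''m''));; Assign ''z0'' (Plus (V ''m2'') (V ''m2''));; Assign ''i'' (N 0));;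
     For ''i'' ''N'' build_body;;
     mult_prog;;
     Assign ''i'' (N 0);; For ''i'' ''W'' (Store ''P'' (V ''i'') (Load ''R'' (V ''i'')));;
     Assign ''lr'' (Minus (V ''lr'') (V ''N''));; Assign ''m'' (V ''m2'')"

definition sea_regs :: "vname set" where
  "sea_regs = {''m2'', ''z0'', ''i'', ''lr'', ''m'', ''v'', ''g'', ''a'', ''x'',
    ''l'', ''y'', ''b'', ''z'', ''f'', ''h'', ''c'', ''e'', ''r'', ''t'', ''q'', ''d''}"

definition sea_arrs :: "vname set" where
  "sea_arrs = {''P'', ''X'', ''Y'', ''R'', ''A'', ''Ga'', ''B'', ''Gb'', ''Q'', ''K'', ''Gk''}"

lemma regs_build [simp]: "regs build_body = {''v'', ''g'', ''a'', ''x''}" "arrs build_body = {''A'', ''B''}"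
  by (auto simp: build_body_def build_lo_def build_hi_def phi_code_def psi_code_def)

lemma regs_stage [simp]: "regs stage = sea_regs"
  "arrs stage = {''P'', ''X'', ''Y'', ''R'', ''A'', ''Ga'', ''B'', ''Gb'', ''Q''}"
  by (auto simp: stage_def sea_regs_def)

definition braids :: "nat \<Rightarrow> nat \<Rightarrow> (nat \<Rightarrow> nat) \<Rightarrow> (nat \<Rightarrow> nat) \<Rightarrow> bool" where
  "braids nn m a p \<longleftrightarrow> (\<forall>q. q * m < nn \<longrightarrow>
     bij_betw p {2*(q*m)..<2*(q*m)+2*m} {2*(q*m)..<2*(q*m)+2*m} \<and> repr a p (q*m) m)"

text \<open>At level \<open>k\<close> each block lists the elements from a range of
  \<open>2 ^ (H - k)\<close> consecutive values in their original order. A stage merges neighbouring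
  ranges; level 0 is the sequence itself.\<close>

lemma stage_correct:
  assumes nn: "nn = 2 ^ H" and rk: "block_perm nn nn rk" and k: "k < H"
    and s: "fst s0 ''m'' = 2 ^ (H - Suc k)" "fst s0 ''lr'' = Suc k * nn" "fst s0 ''N'' = nn" "fst s0 ''W'' = 2 * nn"
    and lev: "levels_at ''K'' ''Gk'' nn rk H H s0"
    and br: "braids nn (2 ^ (H - Suc k)) (lvl nn rk H (Suc k)) (snd s0 ''P'')"
    and W: "(H + 3) * (2 * nn) \<le> W" "2 \<le> W"
  shows "tri S W stage s0 (2000 * (H + 2) * (nn + 1)) (\<lambda>s. fst s ''m'' = 2 ^ (H - k) \<and> fst s ''lr'' = k * nn \<and>
     braids nn (2 ^ (H - k)) (lvl nn rk H k) (snd s ''P''))" (is "tri S W _ _ _ ?Q")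
proof -
  define m :: nat where "m = 2 ^ (H - Suc k)"
  have m2: "2 ^ (H - k) = 2 * m" unfolding m_def using k by (metis Suc_diff_Suc power_Suc)
  have m0: "0 < m" by (simp add: m_def)
  have md: "2 * m dvd nn" unfolding m2[symmetric] nn by (intro le_imp_power_dvd) simp
  have nn0: "0 < nn" by (simp add: nn)
  have rkb: "bij_betw rk {..<nn} {..<nn}" using rk by (simp add: block_perm_def)
  have Hd: "2 ^ H dvd nn" by (simp add: nn)
  let ?a = "lvl nn rk H k" let ?a' = "lvl nn rk H (Suc k)" let ?d = "dst ?a m"
  let ?lr = "Suc k * nn"
  define g where "g = (\<lambda>u. snd s0 ''Gk'' (?lr + u))"
  define p where "p = snd s0 ''P''"
  have gd: "g (?d i) = i" if "i < nn" for i
  proof -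
    have "?d i < nn" using dst_div(2)[OF lvl_bij[OF rkb Hd] m0 _ that] md by (simp add: dvd_mult_right)
    then have "g (?d i) = gmap nn rk H k (?d i)" using lev k unfolding g_def levels_at_def by blast
    then show ?thesis using lvl_dst(2)[OF rkb Hd that, of k] by (simp add: m_def)
  qed
  have ad: "?a' (?d i) = ?a i" if "i < nn" for i using lvl_dst(1)[OF rkb Hd that, of k] unfolding m_def .
  have bpa: "block_perm nn (2*m) ?a" unfolding m2[symmetric]
    by (rule lvl_block_perm[OF _ Hd]) (use rk in \<open>simp add: nn\<close>)
  have vs: "value_split (q*(2*m)) m ?a ?a' ?d g" if "q * (2*m) < nn" for q
    by (rule value_split_level[OF bpa m0 md that ad gd])
  have half: "2*q*m < nn" "(2*q+1)*m < nn" if "q * (2*m) < nn" for q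
  proof -
    have "q*(2*m) + 2*m \<le> nn" by (rule block_in_range[OF md that])
    moreover have "2*q*m = q*(2*m)" "(2*q+1)*m = q*(2*m) + m" by (simp_all add: algebra_simps)
    ultimately show "2*q*m < nn" "(2*q+1)*m < nn" using m0 by linarith+
  qed
  have idx: "2*(2*q*m) = 2*(q*(2*m))" "2*((2*q+1)*m) = 2*(q*(2*m)) + 2*m" "2*(q*(2*m)) + 2*m + 2*m = 2*(q*(2*m)) + 4*m"
    "2*q*m = q*(2*m)" "(2*q+1)*m = q*(2*m)+m" for q by (simp_all add: algebra_simps)
  have br': "bij_betw p {2*(q*m)..<2*(q*m)+2*m} {2*(q*m)..<2*(q*m)+2*m}" "repr ?a' p (q*m) m" if "q*m < nn" for q
    using br that unfolding braids_def p_def m_def by blast+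
  have bb: "build_block (q*(2*m)) m ?a ?a' ?d g p q" if q: "q * (2*m) < nn" for q
  proof -
    interpret value_split "q*(2*m)" m ?a ?a' ?d g by (rule vs[OF q])
    show ?thesis
    proof
      show "bij_betw p {2*(q*(2*m))..<2*(q*(2*m))+2*m} {2*(q*(2*m))..<2*(q*(2*m))+2*m}"
        using br'(1)[OF half(1)[OF q]] unfolding idx(1) .
      show "bij_betw p {2*(q*(2*m))+2*m..<2*(q*(2*m))+4*m} {2*(q*(2*m))+2*m..<2*(q*(2*m))+4*m}"
        using br'(1)[OF half(2)[OF q]] unfolding idx(2) unfolding idx(3) .
    qed (use m0 in simp_all)
  qed
  have Wk: "?lr + nn \<le> W" "2 * nn \<le> W" "1 \<le> W" "4 * m \<le> W" "2*m \<le> nn"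
  proof -
    have "(Suc k + 1) * nn \<le> (H + 3) * nn" using k by (intro mult_le_mono1) simp
    moreover have "(H + 3) * (2 * nn) = (H + 3) * nn + (H + 3) * nn" by (simp add: algebra_simps)
    moreover have "3 * nn \<le> (H + 3) * nn" by (intro mult_le_mono1) simp
    moreover have "(Suc k + 1) * nn = ?lr + nn" by simp
    ultimately show "?lr + nn \<le> W" "2 * nn \<le> W" using W(1) by linarith+
    show "2*m \<le> nn" using md nn0 by (rule dvd_imp_le)
    with \<open>2 * nn \<le> W\<close> show "4 * m \<le> W" by linarith
  qed (use W in simp)
  let ?s1 = "((fst s0)(''m2'' := 2*m, ''z0'' := 4*m, ''i'' := 0), snd s0)"
  have sm: "fst s0 ''m'' = m" using s by (simp add: m_def)
  show ?thesis unfolding stage_def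
  proof (rule tri_Seq)
    show "tri S W (Assign ''m2'' (Plus (V ''m'') (V ''m''));; Assign ''z0'' (Plus (V ''m2'') (V ''m2''));; Assign ''i'' (N 0)) s0 10 (\<lambda>s. s = ?s1)"
      by (rule tri_wp) (use sm Wk in \<open>auto simp: mult_2[symmetric]\<close>)
    fix s1 assume s1: "s1 = ?s1"
    show "tri S W (For ''i'' ''N'' build_body;; mult_prog;; Assign ''i'' (N 0);; For ''i'' ''W'' (Store ''P'' (V ''i'') (Load ''R'' (V ''i'')));;
      Assign ''lr'' (Minus (V ''lr'') (V ''N''));; Assign ''m'' (V ''m2'')) s1 (200 * (nn + 1) + (800 * (H + 2) * (2 * nn + 1) + (30 * (nn + 1) + 12))) ?Q"
    proof (rule tri_Seq)
      show "tri S W (For ''i'' ''N'' build_body) s1 (200 * (nn + 1))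
        (\<lambda>s. \<forall>u<nn. rows_ok m g (row_A m ?d g p) (row_B m ?d g p) (snd s ''A'') (snd s ''B'') u)"
        by (rule build_correct[OF bb m0 md, where lr = ?lr]) (use s1 s sm g_def p_def Wk in auto)
      fix s2 assume s2: "\<forall>u<nn. rows_ok m g (row_A m ?d g p) (row_B m ?d g p) (snd s2 ''A'') (snd s2 ''B'') u"
        and f2: "\<And>x. x \<notin> regs (For ''i'' ''N'' build_body) \<Longrightarrow> fst s2 x = fst s1 x"
          "\<And>a. a \<notin> arrs (For ''i'' ''N'' build_body) \<Longrightarrow> snd s2 a = snd s1 a"
      let ?A = "snd s2 ''A''" let ?B = "snd s2 ''B''"
      have bm: "braid_merge (q*(2*m)) m ?a ?a' ?d g p ?A ?B" if q: "q * (2*m) < nn" for q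
      proof -
        interpret build_block "q*(2*m)" m ?a ?a' ?d g p q by (rule bb[OF q])
        have ok: "rows_ok m g (row_A m ?d g p) (row_B m ?d g p) ?A ?B u" "u div (2*m) * (2*m) = q*(2*m)"
          if "u \<in> {q*(2*m)..<q*(2*m)+2*m}" for u
        proof -
          show "u div (2*m) * (2*m) = q*(2*m)" using div_eq_iff_block[of "2*m" u q] that m0 by simp
          have "u < nn" using block_in_range[OF md q] that by auto
          then show "rows_ok m g (row_A m ?d g p) (row_B m ?d g p) ?A ?B u" using s2 by blast
        qed
        show ?thesis
        proof (rule braid_merge_rows)
          show "repr ?a' p (q*(2*m)) m" using br'(2)[OF half(1)[OF q]] unfolding idx(4) .
          show "repr ?a' p (q*(2*m)+m) m" using br'(2)[OF half(2)[OF q]] unfolding idx(5) .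
        qed (use ok in \<open>simp_all add: rows_ok_def Let_def\<close>)
      qed
      have b4: "0 < 4 * m" "4 * m dvd 2 * nn" using m0 md by (auto elim!: dvdE)
      have lt: "q*(2*m) < nn" if "q * (4*m) < 2*nn" for q
      proof -
        have "q * (4*m) = 2 * (q * (2*m))" by simp
        then show ?thesis using that by linarith
      qed
      have e4: "q * (4*m) = 2 * (q * (2*m))" for q by simp
      have bpA: "block_perm (2*nn) (4*m) ?A"
      proof (rule block_perm_of_blocks[OF b4])
        fix q assume "q * (4*m) < 2*nn"
        then interpret bm: braid_merge "q*(2*m)" m ?a ?a' ?d g p ?A ?B by (intro bm lt)
        show "bij_betw ?A {q*(4*m)..<q*(4*m)+4*m} {q*(4*m)..<q*(4*m)+4*m}" unfolding e4 by (rule bm.bij_A)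
      qed
      have bpB: "block_perm (2*nn) (4*m) ?B"
      proof (rule block_perm_of_blocks[OF b4])
        fix q assume "q * (4*m) < 2*nn"
        then interpret bm: braid_merge "q*(2*m)" m ?a ?a' ?d g p ?A ?B by (intro bm lt)
        show "bij_betw ?B {q*(4*m)..<q*(4*m)+4*m} {q*(4*m)..<q*(4*m)+4*m}" unfolding e4 by (rule bm.bij_B)
      qed
      \<comment> \<open>The factors have blocks of \<open>4 * m = 2 ^ (H - k + 1)\<close> strands,
        two for each of the \<open>2 * m = 2 ^ (H - k)\<close> positions of a merged block.\<close>
      define L where "L = H - k + 1"
      have mL: "4 * m = 2 ^ L" using m2 by (simp add: L_def)
      have r2: "fst s2 ''m2'' = 2*m" "fst s2 ''z0'' = 4*m" "fst s2 ''lr'' = ?lr" "fst s2 ''N'' = nn" "fst s2 ''W'' = 2*nn"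
        using f2 s1 s by simp_all
      show "tri S W (mult_prog;; Assign ''i'' (N 0);; For ''i'' ''W'' (Store ''P'' (V ''i'') (Load ''R'' (V ''i'')));;
        Assign ''lr'' (Minus (V ''lr'') (V ''N''));; Assign ''m'' (V ''m2'')) s2 (800 * (H + 2) * (2 * nn + 1) + (30 * (nn + 1) + 12)) ?Q"
      proof (rule tri_Seq)
        have "(L + 2) * (2 * nn) \<le> (H + 3) * (2 * nn)" by (intro mult_le_mono1) (simp add: L_def)
        then have WL: "(L + 2) * (2 * nn) \<le> W" using W by linarith
        have "tri S W mult_prog s2 (800 * (L + 1) * (2 * nn + 1)) (\<lambda>s. block_sticky (2*nn) (2 ^ L) ?A ?B (snd s ''R''))"
          by (rule mult_prog_correct[OF bpA[unfolded mL] bpB[unfolded mL] b4(2)[unfolded mL] _ _ _ _ WL W(2)])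
            (use nn0 r2 mL in auto)
        then show "tri S W mult_prog s2 (800 * (H + 2) * (2 * nn + 1)) (\<lambda>s. block_sticky (2*nn) (4*m) ?A ?B (snd s ''R''))"
        proof (rule tri_conseq)
          have "800 * (L + 1) \<le> 800 * (H + 2)" by (simp add: L_def)
          then show "800 * (L + 1) * (2 * nn + 1) \<le> 800 * (H + 2) * (2 * nn + 1)" by (rule mult_le_mono1)
        qed (simp add: mL)
        fix s3 assume s3: "block_sticky (2*nn) (4*m) ?A ?B (snd s3 ''R'')"
          and f3: "\<And>x. x \<notin> regs mult_prog \<Longrightarrow> fst s3 x = fst s2 x" "\<And>a. a \<notin> arrs mult_prog \<Longrightarrow> snd s3 a = snd s2 a"
        have r3: "fst s3 ''m2'' = 2*m" "fst s3 ''lr'' = ?lr" "fst s3 ''N'' = nn" "fst s3 ''W'' = 2*nn"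
          using f3 r2 by simp_all
        let ?R = "snd s3 ''R''"
        have brR: "braids nn (2*m) ?a P" if P: "\<And>x. x < 2*nn \<Longrightarrow> P x = ?R x" for P
          unfolding braids_def
        proof (intro allI impI)
          fix q assume q: "q * (2*m) < nn"
          interpret bm: braid_merge "q*(2*m)" m ?a ?a' ?d g p ?A ?B by (rule bm[OF q])
          have "q*(4*m) < 2*nn" using q e4[of q] by linarith
          then have "sticky {q*(4*m)..<q*(4*m)+4*m} {q*(4*m)..<q*(4*m)+4*m} (q*(4*m)) (q*(4*m)+4*m) ?A ?B ?R"
            using s3 unfolding block_sticky_def by blast
          moreover have "q*(4*m)+4*m \<le> 2*nn" by (rule block_in_range[OF b4(2) \<open>q*(4*m) < 2*nn\<close>])
          then have "P x = ?R x" if "x \<in> {q*(4*m)..<q*(4*m)+4*m}" for x using P that by simp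
          from sticky_cong[of "{q*(4*m)..<q*(4*m)+4*m}" P ?R, OF this]
          have "sticky {q*(4*m)..<q*(4*m)+4*m} {q*(4*m)..<q*(4*m)+4*m} (q*(4*m)) (q*(4*m)+4*m) ?A ?B P
            \<longleftrightarrow> sticky {q*(4*m)..<q*(4*m)+4*m} {q*(4*m)..<q*(4*m)+4*m} (q*(4*m)) (q*(4*m)+4*m) ?A ?B ?R" by simp
          ultimately have st: "sticky bm.X bm.X (2*(q*(2*m))) (2*(q*(2*m))+4*m) ?A ?B P" unfolding e4 by simp
          have "bij_betw P bm.X bm.X" using st unfolding sticky_def by (rule conjunct1)
          moreover have "2 * (2*m) = 4*m" by simp
          ultimately show "bij_betw P {2*(q*(2*m))..<2*(q*(2*m))+2*(2*m)} {2*(q*(2*m))..<2*(q*(2*m))+2*(2*m)} \<and> repr ?a P (q*(2*m)) (2*m)"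
            using bm.repr_merge[OF st] by simp
        qed
        show "tri S W (Assign ''i'' (N 0);; For ''i'' ''W'' (Store ''P'' (V ''i'') (Load ''R'' (V ''i'')));;
          Assign ''lr'' (Minus (V ''lr'') (V ''N''));; Assign ''m'' (V ''m2'')) s3 (30 * (nn + 1) + 12) ?Q"
        proof (rule tri_Seq)
          show "tri S W (Assign ''i'' (N 0)) s3 2 (\<lambda>s. s = ((fst s3)(''i'' := 0), snd s3))"
            by (rule tri_wp) auto
          fix s4 assume s4: "s4 = ((fst s3)(''i'' := 0), snd s3)"
          show "tri S W (For ''i'' ''W'' (Store ''P'' (V ''i'') (Load ''R'' (V ''i'')));;
            Assign ''lr'' (Minus (V ''lr'') (V ''N''));; Assign ''m'' (V ''m2'')) s4 (30 * (nn + 1) + 10) ?Q"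
          proof (rule tri_Seq)
            show "tri S W (For ''i'' ''W'' (Store ''P'' (V ''i'') (Load ''R'' (V ''i'')))) s4 (30 * (nn + 1))
              (\<lambda>s. \<forall>x<2*nn. snd s ''P'' x = ?R x)"
              by (rule tri_For[where I="\<lambda>i s. snd s ''R'' = ?R \<and> (\<forall>x<i. snd s ''P'' x = ?R x)" and a=0 and b="2*nn" and B=4])
                (use s4 r3 Wk in \<open>auto intro!: tri_wp simp: less_Suc_eq\<close>)
            fix s5 assume s5: "\<forall>x<2*nn. snd s5 ''P'' x = ?R x"
              and f5: "\<And>x. x \<notin> regs (For ''i'' ''W'' (Store ''P'' (V ''i'') (Load ''R'' (V ''i'')))) \<Longrightarrow> fst s5 x = fst s4 x"
            have "braids nn (2*m) ?a (snd s5 ''P'')" by (rule brR) (use s5 in simp)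
            then show "tri S W (Assign ''lr'' (Minus (V ''lr'') (V ''N''));; Assign ''m'' (V ''m2'')) s5 10 ?Q"
              by (intro tri_wp) (use f5 s4 r3 in \<open>auto simp: m2\<close>)
          qed simp
        qed simp
      qed simp
    qed simp
  next
    show "10 + (200 * (nn + 1) + (800 * (H + 2) * (2 * nn + 1) + (30 * (nn + 1) + 12))) \<le> 2000 * (H + 2) * (nn + 1)"
      by (simp add: algebra_simps)
  qed
qed

section \<open>The result as birth thresholds of columns\<close>

text \<open>For \<open>v = 0\<close> the counts in \<open>repr\<close> read the rows from
  \<open>nn\<close> on, so \<open>D i\<close> is row \<open>nn + i\<close>. Storing
  \<open>i + 1\<close> in the inverse leaves the initial value 0 for the columns that no such row
  reaches, and makes \<open>T r \<le> l\<close> a correct test in both cases.\<close>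

definition out_body :: "vname \<Rightarrow> vname \<Rightarrow> com" where
  "out_body D T =
     Assign ''a'' (Load ''P'' (Plus (V ''N'') (V ''i'')));; Store D (V ''i'') (V ''a'');;
     Cond (Less (V ''a'') (V ''N'')) (Store T (V ''a'') (Plus (V ''i'') (N 1))) Skip"

definition sea_prog :: "vname \<Rightarrow> vname \<Rightarrow> com" where
  "sea_prog D T =
     Assign ''z'' (V ''N'');; split_prog ''K'' ''Gk'' ''N'';;
     (Assign ''lr'' (V ''l'');; Assign ''m'' (N 1);; Assign ''i'' (N 0));;
     For ''i'' ''W'' (Store ''P'' (V ''i'') (V ''i''));;
     While (Less (V ''m'') (V ''N'')) stage;;
     Assign ''i'' (N 0);; For ''i'' ''N'' (out_body D T)"

lemma regs_sea [simp]: "regs (sea_prog D T) = sea_regs" "arrs (sea_prog D T) = {D, T} \<union> sea_arrs"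
  by (auto simp: sea_prog_def out_body_def sea_regs_def sea_arrs_def)

text \<open>
  \<open>T r\<close> is \<open>i + 1\<close> for the \<open>i\<close> with \<open>D i = r\<close>, or \<open>0\<close> if there is none.
\<close>

definition deaths :: "nat \<Rightarrow> (nat \<Rightarrow> nat) \<Rightarrow> (nat \<Rightarrow> nat) \<Rightarrow> (nat \<Rightarrow> nat) \<Rightarrow> bool" where
  "deaths nn rk D T \<longleftrightarrow>
     (\<forall>l\<le>nn. \<forall>r\<le>nn. card {i\<in>{l..<nn}. D i < r} = (r - l) - lis rk l r) \<and>
     (\<forall>r<nn. \<forall>l. T r \<le> l \<longleftrightarrow> (\<forall>i<nn. l \<le> i \<longrightarrow> D i \<noteq> r)) \<and> inj_on D {..<nn}"

lemma repr_cong: "(\<And>x. x < 2*v+2*m \<Longrightarrow> p x = p' x) \<Longrightarrow> repr a p v m = repr a p' v m"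
proof -
  assume eq: "\<And>x. x < 2*v+2*m \<Longrightarrow> p x = p' x"
  have "{x\<in>{v+m+l..<2*v+2*m}. p x < v + r} = {x\<in>{v+m+l..<2*v+2*m}. p' x < v + r}" for l r
    using eq by auto
  then show ?thesis by (simp add: repr_def)
qed

lemma braids_1:
  assumes "\<And>x. x < 2*nn \<Longrightarrow> p x = x" shows "braids nn 1 a p"
  unfolding braids_def
proof (intro allI impI)
  fix q assume "q * 1 < nn"
  then have eq: "p x = id x" if "x < 2*q+2" for x using assms that by simp
  have "bij_betw p {2*(q*1)..<2*(q*1)+2*1} {2*(q*1)..<2*(q*1)+2*1} = bij_betw id {2*(q*1)..<2*(q*1)+2*1} {2*(q*1)..<2*(q*1)+2*1}"
    by (rule bij_betw_cong) (use eq in auto)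
  moreover have "repr a p (q*1) 1 = repr a id (q*1) 1" by (rule repr_cong) (use eq in auto)
  ultimately show "bij_betw p {2*(q*1)..<2*(q*1)+2*1} {2*(q*1)..<2*(q*1)+2*1} \<and> repr a p (q*1) 1"
    using repr_1 by (simp add: bij_betw_id)
qed

lemma out_correct:
  assumes nn0: "0 < nn" and p: "bij_betw p {..<2*nn} {..<2*nn}" and r: "repr rk p 0 nn"
    and s: "fst s0 ''i'' = 0" "fst s0 ''N'' = nn" "snd s0 ''P'' = p"
    and T0: "\<And>r. r < nn \<Longrightarrow> snd s0 T r = 0" and nm: "D \<noteq> T" "D \<noteq> ''P''" "T \<noteq> ''P''"
    and W: "2 * nn \<le> W" "1 \<le> W"
  shows "tri S W (For ''i'' ''N'' (out_body D T)) s0 (40 * (nn + 1)) (\<lambda>s. deaths nn rk (snd s D) (snd s T))"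
proof -
  have inj: "p (nn + i) = p (nn + j) \<longleftrightarrow> i = j" if "i < nn" "j < nn" for i j
    using bij_betw_imp_inj_on[OF p] that by (auto simp: inj_on_eq_iff)
  have nm': "T \<noteq> D" "''P'' \<noteq> D" "''P'' \<noteq> T" using nm by auto
  show ?thesis
  proof (rule tri_For[where a=0 and b=nn and B=30 and I="\<lambda>i s. snd s ''P'' = p \<and> (\<forall>j<i. snd s D j = p (nn + j)) \<and>
      (\<forall>r<nn. \<forall>l. snd s T r \<le> l \<longleftrightarrow> (\<forall>j<i. l \<le> j \<longrightarrow> p (nn + j) \<noteq> r))"])
    fix i s
    assume i: "i < nn" "fst s ''i'' = i" "fst s ''N'' = nn"
      and I: "snd s ''P'' = p \<and> (\<forall>j<i. snd s D j = p (nn + j)) \<and>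
      (\<forall>r<nn. \<forall>l. snd s T r \<le> l \<longleftrightarrow> (\<forall>j<i. l \<le> j \<longrightarrow> p (nn + j) \<noteq> r))"
    have ne: "p (nn + j) \<noteq> p (nn + i)" if "j < i" for j using inj[of j i] i that by auto
    have Tn: "Suc i \<le> l \<longleftrightarrow> (\<forall>j<Suc i. l \<le> j \<longrightarrow> p (nn + j) \<noteq> p (nn + i))" for l
      using ne by (auto simp: less_Suc_eq)
    have step: "snd s T r \<le> l \<longleftrightarrow> (\<forall>j<Suc i. l \<le> j \<longrightarrow> p (nn + j) \<noteq> r)" if "r < nn" "p (nn + i) \<noteq> r" for r l
      using I that by (auto simp: less_Suc_eq)
    have wi: "nn + i \<le> W" "i + 1 \<le> W" using i W by auto
    show "tri S W (out_body D T) s 30 (\<lambda>s'. fst s' ''i'' = i \<and> fst s' ''N'' = nn \<and>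
      snd ((fst s')(''i'' := Suc i), snd s') ''P'' = p \<and> (\<forall>j<Suc i. snd ((fst s')(''i'' := Suc i), snd s') D j = p (nn + j)) \<and>
      (\<forall>r<nn. \<forall>l. snd ((fst s')(''i'' := Suc i), snd s') T r \<le> l \<longleftrightarrow> (\<forall>j<Suc i. l \<le> j \<longrightarrow> p (nn + j) \<noteq> r)))"
    proof (rule tri_wp)
      show "wp S W (out_body D T) s (\<lambda>s'. fst s' ''i'' = i \<and> fst s' ''N'' = nn \<and>
      snd ((fst s')(''i'' := Suc i), snd s') ''P'' = p \<and> (\<forall>j<Suc i. snd ((fst s')(''i'' := Suc i), snd s') D j = p (nn + j)) \<and>
      (\<forall>r<nn. \<forall>l. snd ((fst s')(''i'' := Suc i), snd s') T r \<le> l \<longleftrightarrow> (\<forall>j<Suc i. l \<le> j \<longrightarrow> p (nn + j) \<noteq> r)))"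
      proof (cases "p (nn + i) < nn")
        case True
        have "\<forall>r<nn. \<forall>l. ((snd s T)(p (nn + i) := Suc i)) r \<le> l \<longleftrightarrow> (\<forall>j<Suc i. l \<le> j \<longrightarrow> p (nn + j) \<noteq> r)"
          using Tn step by (simp del: All_less_Suc)
        then show ?thesis using True I i wi nm nm' by (auto simp: out_body_def less_Suc_eq)
      next
        case False
        have "\<forall>r<nn. \<forall>l. snd s T r \<le> l \<longleftrightarrow> (\<forall>j<Suc i. l \<le> j \<longrightarrow> p (nn + j) \<noteq> r)"
          using step False by auto
        then show ?thesis using False I i wi nm nm' by (auto simp: out_body_def less_Suc_eq)
      qed
    qed (simp add: out_body_def)
  next
    fix s assume I: "snd s ''P'' = p \<and> (\<forall>j<nn. snd s D j = p (nn + j)) \<and>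
      (\<forall>r<nn. \<forall>l. snd s T r \<le> l \<longleftrightarrow> (\<forall>j<nn. l \<le> j \<longrightarrow> p (nn + j) \<noteq> r))"
    have "card {i\<in>{l..<nn}. snd s D i < r} = (r - l) - lis rk l r" if "l \<le> nn" "r \<le> nn" for l r
    proof -
      have "{x\<in>{nn+l..<2*nn}. p x < r} = (\<lambda>i. nn + i) ` {i\<in>{l..<nn}. snd s D i < r}"
      proof (intro equalityI subsetI)
        fix x assume x: "x \<in> {x\<in>{nn+l..<2*nn}. p x < r}"
        then have "x = nn + (x - nn)" "x - nn \<in> {l..<nn}" by auto
        then show "x \<in> (\<lambda>i. nn + i) ` {i\<in>{l..<nn}. snd s D i < r}" using x I by auto
      qed (use I in auto)
      then have "card {x\<in>{nn+l..<2*nn}. p x < r} = card {i\<in>{l..<nn}. snd s D i < r}" by (simp add: card_image)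
      moreover have "card {x\<in>{nn+l..<2*nn}. p x < r} = (r - l) - lis rk l r"
        using r that unfolding repr_def by simp
      ultimately show ?thesis by simp
    qed
    moreover have "inj_on (snd s D) {..<nn}" using I inj by (auto simp: inj_on_def)
    ultimately show "deaths nn rk (snd s D) (snd s T)" using I by (auto simp: deaths_def)
  qed (use s T0 W in auto)
qed

text \<open>Two logarithms meet in the bound: there are \<open>H\<close> stages, and each contains a
  product whose own recursion has depth at most \<open>H + 1\<close>.\<close>

lemma sea_prog_correct:
  assumes nn: "nn = 2 ^ H" and rk: "bij_betw rk {..<nn} {..<nn}"
    and s: "fst s0 ''N'' = nn" "fst s0 ''W'' = 2 * nn" "\<And>i. i < nn \<Longrightarrow> snd s0 ''K'' i = rk i"
    and T0: "\<And>r. r < nn \<Longrightarrow> snd s0 T r = 0" and nm: "D \<noteq> T" "D \<notin> sea_arrs" "T \<notin> sea_arrs"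
    and W: "(H + 3) * (2 * nn) \<le> W" "2 \<le> W"
  shows "tri S W (sea_prog D T) s0 (2500 * (H + 2) * (H + 1) * (nn + 1)) (\<lambda>s. deaths nn rk (snd s D) (snd s T))"
    (is "tri S W _ _ _ ?Q")
proof -
  have nn0: "0 < nn" by (simp add: nn)
  have Hd: "2 ^ H dvd nn" by (simp add: nn)
  have bp: "block_perm nn nn rk"
    unfolding block_perm_def using rk by (auto dest: bij_betwE)
  have "(H + 3) * (2 * nn) = (H + 2) * nn + (H + 2) * nn + 2 * nn" by (simp add: algebra_simps)
  then have W': "(H + 2) * nn \<le> W" "2 * nn \<le> W" "nn \<le> W" using W(1) by linarith+
  have nms: "split_names ''K'' ''Gk'' ''N''" by (simp add: split_names_def)
  let ?T1 = "(H + 1) * (90 * (nn + 1)) + 2"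
  let ?T2 = "(H + 1) * (2010 * (H + 2) * (nn + 1))"
  show ?thesis unfolding sea_prog_def
  proof (rule tri_Seq)
    show "tri S W (Assign ''z'' (V ''N'')) s0 2 (\<lambda>s. s = ((fst s0)(''z'' := nn), snd s0))"
      by (rule tri_wp) (use s in auto)
    fix s1 assume s1: "s1 = ((fst s0)(''z'' := nn), snd s0)"
    show "tri S W (split_prog ''K'' ''Gk'' ''N'';;
     (Assign ''lr'' (V ''l'');; Assign ''m'' (N 1);; Assign ''i'' (N 0));;
     For ''i'' ''W'' (Store ''P'' (V ''i'') (V ''i''));;
     While (Less (V ''m'') (V ''N'')) stage;;
     Assign ''i'' (N 0);; For ''i'' ''N'' (out_body D T)) s1 (?T1 + (6 + (30 * (nn + 1) + (?T2 + (42 * (nn + 1)))))) ?Q"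
    proof (rule tri_Seq)
      show "tri S W (split_prog ''K'' ''Gk'' ''N'') s1 ?T1
        (\<lambda>s. fst s ''l'' = H * nn \<and> fst s ''z'' = 1 \<and> levels_at ''K'' ''Gk'' nn rk H H s)"
        by (rule split_prog_correct[OF nms rk Hd _ _ _ W'(1) W(2)]) (use s s1 nn in auto)
      fix s2 assume s2: "fst s2 ''l'' = H * nn \<and> fst s2 ''z'' = 1 \<and> levels_at ''K'' ''Gk'' nn rk H H s2"
        and f2: "\<And>x. x \<notin> regs (split_prog ''K'' ''Gk'' ''N'') \<Longrightarrow> fst s2 x = fst s1 x"
         "\<And>x. x \<notin> arrs (split_prog ''K'' ''Gk'' ''N'') \<Longrightarrow> snd s2 x = snd s1 x"
      have "T \<notin> {''Q'', ''K'', ''Gk''}" using nm(3) by (auto simp: sea_arrs_def)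
      then have r2: "fst s2 ''N'' = nn" "fst s2 ''W'' = 2 * nn" "snd s2 T = snd s0 T" using f2 s1 s by simp_all
      let ?s3 = "((fst s2)(''lr'' := H * nn, ''m'' := 1, ''i'' := 0), snd s2)"
      show "tri S W ((Assign ''lr'' (V ''l'');; Assign ''m'' (N 1);; Assign ''i'' (N 0));;
       For ''i'' ''W'' (Store ''P'' (V ''i'') (V ''i''));;
       While (Less (V ''m'') (V ''N'')) stage;;
       Assign ''i'' (N 0);; For ''i'' ''N'' (out_body D T)) s2 (6 + (30 * (nn + 1) + (?T2 + (42 * (nn + 1))))) ?Q"
      proof (rule tri_Seq)
        show "tri S W (Assign ''lr'' (V ''l'');; Assign ''m'' (N 1);; Assign ''i'' (N 0)) s2 6 (\<lambda>s. s = ?s3)"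
          by (rule tri_wp) (use s2 W in auto)
        fix s3 assume s3: "s3 = ?s3"
        show "tri S W (For ''i'' ''W'' (Store ''P'' (V ''i'') (V ''i''));;
         While (Less (V ''m'') (V ''N'')) stage;;
         Assign ''i'' (N 0);; For ''i'' ''N'' (out_body D T)) s3 (30 * (nn + 1) + (?T2 + (42 * (nn + 1)))) ?Q"
        proof (rule tri_Seq)
          show "tri S W (For ''i'' ''W'' (Store ''P'' (V ''i'') (V ''i''))) s3 (30 * (nn + 1)) (\<lambda>s. \<forall>x<2*nn. snd s ''P'' x = x)"
            by (rule tri_For[where I="\<lambda>i s. \<forall>x<i. snd s ''P'' x = x" and a=0 and b="2*nn" and B=3])
              (use s3 r2 W' in \<open>auto intro!: tri_wp simp: less_Suc_eq\<close>)
          fix s4 assume s4: "\<forall>x<2*nn. snd s4 ''P'' x = x"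
            and f4: "\<And>x. x \<notin> regs (For ''i'' ''W'' (Store ''P'' (V ''i'') (V ''i''))) \<Longrightarrow> fst s4 x = fst s3 x"
              "\<And>x. x \<notin> arrs (For ''i'' ''W'' (Store ''P'' (V ''i'') (V ''i''))) \<Longrightarrow> snd s4 x = snd s3 x"
          have "T \<noteq> ''P''" using nm(3) by (auto simp: sea_arrs_def)
          then have r4: "fst s4 ''N'' = nn" "fst s4 ''W'' = 2 * nn" "fst s4 ''m'' = 1" "fst s4 ''lr'' = H * nn"
            "snd s4 ''K'' = snd s2 ''K''" "snd s4 ''Gk'' = snd s2 ''Gk''" "snd s4 T = snd s0 T"
            using f4 s3 r2 by simp_all
          let ?I = "\<lambda>n s. n \<le> H \<and> fst s ''m'' = 2 ^ (H - n) \<and> fst s ''lr'' = n * nn \<and> fst s ''N'' = nn \<and> fst s ''W'' = 2 * nn \<and>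
            levels_at ''K'' ''Gk'' nn rk H H s \<and> braids nn (2 ^ (H - n)) (lvl nn rk H n) (snd s ''P'') \<and> snd s T = snd s0 T"
          define J where "J = ?I 0"
          show "tri S W (While (Less (V ''m'') (V ''N'')) stage;;
            Assign ''i'' (N 0);; For ''i'' ''N'' (out_body D T)) s4 (?T2 + (42 * (nn + 1))) ?Q"
          proof (rule tri_Seq)
            show "tri S W (While (Less (V ''m'') (V ''N'')) stage) s4 ?T2 J"
            proof (rule tri_While[where I = ?I and n = H and B = "2000 * (H + 2) * (nn + 1)"])
              have "braids nn 1 (lvl nn rk H H) (snd s4 ''P'')" by (rule braids_1) (use s4 in simp)
              then show "?I H s4" using r4 s2 levels_at_cong[of s4 "''K''" s2 "''Gk''"] by simp
              fix n s assume I: "?I n s"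
              show "bfits S W s (Less (V ''m'') (V ''N'')) \<and>
                (bval S s (Less (V ''m'') (V ''N'')) \<longrightarrow> 0 < n \<and>
                  tri S W stage s (2000 * (H + 2) * (nn + 1)) (\<lambda>s'. \<exists>m<n. ?I m s')) \<and>
                (\<not> bval S s (Less (V ''m'') (V ''N'')) \<longrightarrow> J s)"
              proof (intro conjI impI)
                assume "bval S s (Less (V ''m'') (V ''N''))"
                then show n: "0 < n" using I nn by (cases n) auto
                then obtain k where k: "n = Suc k" by (cases n) auto
                have "tri S W stage s (2000 * (H + 2) * (nn + 1)) (\<lambda>s. fst s ''m'' = 2 ^ (H - k) \<and> fst s ''lr'' = k * nn \<and>
                   braids nn (2 ^ (H - k)) (lvl nn rk H k) (snd s ''P''))"
                  by (rule stage_correct[OF nn bp _ _ _ _ _ _ _ W]) (use I k in \<open>auto simp del: lvl.simps mult_Suc\<close>)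
                then show "tri S W stage s (2000 * (H + 2) * (nn + 1)) (\<lambda>s'. \<exists>m<n. ?I m s')"
                proof (rule tri_conseq)
                  fix s5 assume 5: "fst s5 ''m'' = 2 ^ (H - k) \<and> fst s5 ''lr'' = k * nn \<and>
                   braids nn (2 ^ (H - k)) (lvl nn rk H k) (snd s5 ''P'')"
                    and f5: "\<And>x. x \<notin> regs stage \<Longrightarrow> fst s5 x = fst s x" "\<And>x. x \<notin> arrs stage \<Longrightarrow> snd s5 x = snd s x"
                  have "T \<notin> arrs stage" using nm(3) by (auto simp: sea_arrs_def)
                  then have "?I k s5"
                    using 5 f5 I k levels_at_cong[of s5 "''K''" s "''Gk''"] by (simp add: sea_regs_def)
                  then show "\<exists>m<n. ?I m s5" using k by blast
                qed simp
              next
                assume "\<not> bval S s (Less (V ''m'') (V ''N''))"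
                then have "\<not> (2::nat) ^ (H - n) < 2 ^ H" using I nn by simp
                then have "\<not> H - n < H" by simp
                then have "n = 0" using I by auto
                then show "J s" using I unfolding J_def by simp
              qed simp
            next
              have "2000 * (H + 2) * (nn + 1) + 1 + bcost (Less (V ''m'') (V ''N'')) \<le> 2010 * (H + 2) * (nn + 1)"
                by (simp add: algebra_simps)
              then show "(H + 1) * (2000 * (H + 2) * (nn + 1) + 1 + bcost (Less (V ''m'') (V ''N''))) \<le> ?T2"
                by (rule mult_le_mono2)
            qed
            fix s5 assume "J s5"
            then have I5: "?I 0 s5" by (simp only: J_def)
            show "tri S W (Assign ''i'' (N 0);; For ''i'' ''N'' (out_body D T)) s5 (42 * (nn + 1)) ?Q"
            proof (rule tri_Seq)
              show "tri S W (Assign ''i'' (N 0)) s5 2 (\<lambda>s. s = ((fst s5)(''i'' := 0), snd s5))"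
                by (rule tri_wp) auto
              fix s6 assume s6: "s6 = ((fst s5)(''i'' := 0), snd s5)"
              have "bij_betw (snd s5 ''P'') {..<2*nn} {..<2*nn}" "repr rk (snd s5 ''P'') 0 nn"
                using I5 nn0 nn unfolding braids_def by (auto simp: lessThan_atLeast0)
              then show "tri S W (For ''i'' ''N'' (out_body D T)) s6 (40 * (nn + 1)) ?Q"
                using nm by (intro out_correct[OF nn0]) (use s6 I5 T0 W W' in \<open>auto simp: sea_arrs_def\<close>)
            qed simp
          qed simp
        qed simp
      qed simp
    qed simp
  next
    show "2 + (?T1 + (6 + (30 * (nn + 1) + (?T2 + (42 * (nn + 1)))))) \<le> 2500 * (H + 2) * (H + 1) * (nn + 1)"
      by (simp add: algebra_simps)
  qed
qed

section \<open>The recursion for rollercoasters\<close>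

text \<open>
  A direction is a truth value; \<open>True\<close> stands for increasing.
\<close>

definition lt :: "bool \<Rightarrow> 'a::linorder \<Rightarrow> 'a \<Rightarrow> bool" where
  "lt b x y \<longleftrightarrow> (if b then x < y else y < x)"

definition slope :: "bool \<Rightarrow> 'a::linorder list \<Rightarrow> nat \<Rightarrow> nat \<Rightarrow> bool" where
  "slope b ys i j \<longleftrightarrow> (\<forall>c. i \<le> c \<longrightarrow> Suc c < j \<longrightarrow> lt b (ys ! c) (ys ! Suc c))"

text \<open>
  Unlike the maximality of runs, this description of rollercoasters is stable under gluing lists together.
\<close>

definition covered :: "nat \<Rightarrow> 'a::linorder list \<Rightarrow> bool" where
  "covered k ys \<longleftrightarrow> (\<forall>a. Suc a < length ys \<longrightarrow>
     (\<exists>i j b. i \<le> a \<and> Suc a < j \<and> j \<le> length ys \<and> k \<le> j - i \<and> slope b ys i j))"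

lemma lt_unique: "lt b x y \<Longrightarrow> lt b' x y \<Longrightarrow> b = b'"
  by (cases b; cases b') (auto simp: lt_def)

lemma lt_neg: "x \<noteq> y \<Longrightarrow> lt (\<not> b) x y \<longleftrightarrow> \<not> lt b x y"
  by (auto simp: lt_def)

lemma transp_lt: "transp (lt b)"
  by (auto simp: transp_def lt_def split: if_splits)

lemma monotonic_slice:
  assumes "j \<le> length ys" shows "monotonic (slice ys i j) \<longleftrightarrow> (\<exists>b. slope b ys i j)"
proof -
  have len: "length (slice ys i j) = j - i" using assms by (auto simp: slice_def)
  have "sorted_wrt (lt b) (slice ys i j) \<longleftrightarrow> slope b ys i j" for b
  proof -
    have "sorted_wrt (lt b) (slice ys i j) \<longleftrightarrow>
        (\<forall>c. Suc c < j - i \<longrightarrow> lt b (slice ys i j ! c) (slice ys i j ! Suc c))"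
      by (simp add: sorted_wrt_iff_nth_Suc_transp[OF transp_lt] len)
    also have "\<dots> \<longleftrightarrow> (\<forall>c. Suc c < j - i \<longrightarrow> lt b (ys ! (i + c)) (ys ! Suc (i + c)))"
      using assms by (simp add: slice_def)
    also have "\<dots> \<longleftrightarrow> slope b ys i j"
      unfolding slope_def
    proof (intro iffI allI impI)
      fix c assume *: "\<forall>c. Suc c < j - i \<longrightarrow> lt b (ys ! (i + c)) (ys ! Suc (i + c))" "i \<le> c" "Suc c < j"
      then show "lt b (ys ! c) (ys ! Suc c)" using spec[OF *(1), of "c - i"] by simp
    qed auto
    finally show ?thesis .
  qed
  moreover have "monotonic xs \<longleftrightarrow> (\<exists>b. sorted_wrt (lt b) xs)" for xs :: "'a list"
  proof -
    have "lt True = ((<) :: 'a \<Rightarrow> 'a \<Rightarrow> bool)" "lt False = ((>) :: 'a \<Rightarrow> 'a \<Rightarrow> bool)" by (auto simp: lt_def fun_eq_iff)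
    then show ?thesis unfolding monotonic_def by (metis (full_types))
  qed
  ultimately show ?thesis by simp
qed

text \<open>Both intervals contain the pair \<open>a\<close>, \<open>Suc a\<close>, so every
  adjacent pair of the union lies in one of them.\<close>

lemma slope_union:
  assumes "slope b ys i j" "slope b ys i' j'" "i \<le> a" "Suc a < j" "i' \<le> a" "Suc a < j'"
  shows "slope b ys (min i i') (max j j')"
  unfolding slope_def
proof (intro allI impI)
  fix c assume c: "min i i' \<le> c" "Suc c < max j j'"
  show "lt b (ys ! c) (ys ! Suc c)"
  proof (cases "i \<le> c \<and> Suc c < j")
    case True then show ?thesis using assms(1) by (simp add: slope_def)
  next
    case False
    then have "i' \<le> c \<and> Suc c < j'" using c assms(3-6) by (auto simp: min_def max_def split: if_splits)
    then show ?thesis using assms(2) by (simp add: slope_def)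
  qed
qed

text \<open>A run of two or more elements shares its first pair with a covering slope, which then
  has the same direction; the union is monotone, and by maximality the run contains the slope. A run
  of one element lies inside the slope covering a pair with this element, and maximality makes the
  two equal.\<close>

lemma rollercoaster_if_covered:
  assumes cov: "covered k ys" and k: "3 \<le> k" and len: "2 \<le> length ys"
  shows "rollercoaster k ys"
  unfolding rollercoaster_def
proof (intro allI impI)
  fix i j assume run: "is_run ys i j"
  then have ij: "i < j" "j \<le> length ys" and m: "monotonic (slice ys i j)"
    and maxi: "\<And>i' j'. i' \<le> i \<Longrightarrow> j \<le> j' \<Longrightarrow> j' \<le> length ys \<Longrightarrow> monotonic (slice ys i' j') \<Longrightarrow> i' = i \<and> j' = j"
    by (auto simp: is_run_def)
  show "k \<le> j - i"
  proof (cases "Suc i < j")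
    case True
    then obtain i' j' b' where c: "i' \<le> i" "Suc i < j'" "j' \<le> length ys" "k \<le> j' - i'" "slope b' ys i' j'"
      using cov ij unfolding covered_def by (metis less_le_trans)
    obtain b where b: "slope b ys i j" using m monotonic_slice[OF ij(2)] by blast
    have "b = b'" using b c True unfolding slope_def by (meson le_refl lt_unique)
    then have "slope b ys (min i i') (max j j')" using slope_union[OF b, of i' j' i] c True by simp
    then have "monotonic (slice ys (min i i') (max j j'))" using monotonic_slice[of "max j j'" ys] ij c by auto
    from maxi[OF _ _ _ this] have "min i i' = i" "max j j' = j" using ij c by auto
    then show ?thesis using c(4) by linarith
  next
    case False
    then have j: "j = Suc i" using ij by simp
    define a where "a = (if Suc i < length ys then i else i - 1)"
    have a: "Suc a < length ys" "a = i \<or> Suc a = i" using len ij j by (auto simp: a_def)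
    then obtain i' j' b' where c: "i' \<le> a" "Suc a < j'" "j' \<le> length ys" "k \<le> j' - i'" "slope b' ys i' j'"
      using cov unfolding covered_def by blast
    then have "monotonic (slice ys i' j')" using monotonic_slice by blast
    from maxi[OF _ _ c(3) this] have "i' = i" "j' = j" using a c j by auto
    then show ?thesis using c(4) by simp
  qed
qed

text \<open>Among the slopes around the pair in its own direction, a longest one cannot be extended
  monotonically; so it is a run and has length at least \<open>k\<close>.\<close>

lemma covered_if_rollercoaster:
  assumes rc: "rollercoaster k ys" and ne: "\<And>a. Suc a < length ys \<Longrightarrow> ys ! a \<noteq> ys ! Suc a"
  shows "covered k ys"
  unfolding covered_def
proof (intro allI impI)
  fix a assume a: "Suc a < length ys"
  obtain b where b: "lt b (ys ! a) (ys ! Suc a)"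
  proof (cases "ys ! a < ys ! Suc a")
    case True then show ?thesis using that[of True] by (simp add: lt_def)
  next
    case False then show ?thesis using that[of False] ne[OF a] by (simp add: lt_def)
  qed
  let ?P = "\<lambda>(i, j). i \<le> a \<and> Suc a < j \<and> j \<le> length ys \<and> slope b ys i j"
  have "?P (a, Suc (Suc a))" using a b by (auto simp: slope_def less_Suc_eq)
  moreover have "\<forall>p. ?P p \<longrightarrow> (\<lambda>(i, j). j - i) p < Suc (length ys)" by auto
  ultimately obtain p where p: "?P p" "\<And>p'. ?P p' \<Longrightarrow> (\<lambda>(i, j). j - i) p' \<le> (\<lambda>(i, j). j - i) p"
    using ex_has_greatest_nat[of ?P "(a, Suc (Suc a))" "\<lambda>(i, j). j - i" "Suc (length ys)"] by blast
  obtain i j where ij: "p = (i, j)" by (cases p)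
  have P: "i \<le> a" "Suc a < j" "j \<le> length ys" "slope b ys i j" using p(1) ij by auto
  have "is_run ys i j"
    unfolding is_run_def
  proof (intro conjI allI impI)
    show "monotonic (slice ys i j)" using monotonic_slice[OF P(3)] P(4) by blast
    fix i' j' assume *: "i' \<le> i \<and> j \<le> j' \<and> j' \<le> length ys \<and> monotonic (slice ys i' j')"
    then obtain b' where b': "slope b' ys i' j'" using monotonic_slice by blast
    then have "lt b' (ys ! a) (ys ! Suc a)" using * P unfolding slope_def by simp
    then have "b' = b" using b lt_unique by blast
    then have "j' - i' \<le> j - i" using p(2)[of "(i', j')"] * P b' ij by auto
    then show "i' = i" "j' = j" using * P by auto
  qed (use P in auto)
  then have "k \<le> j - i" using rc by (simp add: rollercoaster_def)
  then show "\<exists>i j b. i \<le> a \<and> Suc a < j \<and> j \<le> length ys \<and> k \<le> j - i \<and> slope b ys i j" using P by blast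
qed

text \<open>A single element is itself a run, of length 1.\<close>

lemma rollercoaster_length:
  assumes "rollercoaster k ys" "ys \<noteq> []" "3 \<le> k" shows "2 \<le> length ys"
proof (rule ccontr)
  assume "\<not> 2 \<le> length ys"
  moreover have "length ys \<noteq> 0" using assms(2) by simp
  ultimately have len: "length ys = 1" by linarith
  then have "is_run ys 0 1" by (auto simp: is_run_def slice_def monotonic_def length_Suc_conv)
  then have "k \<le> 1 - 0" using assms(1) unfolding rollercoaster_def by blast
  then show False using assms(3) by simp
qed

lemma nth_append_end: "n \<le> length zs \<Longrightarrow> (ys @ zs) ! (length (ys @ zs) - n) = zs ! (length zs - n)"
  by (metis Nat.add_diff_assoc length_append nth_append_length_plus)

section \<open>Gluing and cutting at the last run\<close>

definition ends :: "bool \<Rightarrow> nat \<Rightarrow> 'a::linorder list \<Rightarrow> bool" where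
  "ends b k ys \<longleftrightarrow> covered k ys \<and> 2 \<le> length ys \<and> lt b (ys ! (length ys - 2)) (ys ! (length ys - 1))"

text \<open>The slope that covers the last pair contains the last element and hence reaches the end
  of the list; the direction of that pair is the direction of the slope.\<close>

lemma ends_last_run:
  assumes "ends b k ys"
  obtains i where "Suc i < length ys" "k \<le> length ys - i" "slope b ys i (length ys)"
proof -
  let ?a = "length ys - 2"
  have a: "Suc ?a < length ys" "Suc ?a = length ys - 1" using assms by (auto simp: ends_def)
  then obtain i j b' where c: "i \<le> ?a" "Suc ?a < j" "j \<le> length ys" "k \<le> j - i" "slope b' ys i j"
    using assms unfolding ends_def covered_def by blast
  have j: "j = length ys" using c a by simp
  have "lt b' (ys ! ?a) (ys ! Suc ?a)" using c unfolding slope_def by simp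
  then have "b' = b" using assms a unfolding ends_def by (metis lt_unique)
  then show ?thesis using that[of i] c a j by auto
qed

lemma slope_appendI1: "slope b ys i j \<Longrightarrow> j \<le> length ys \<Longrightarrow> slope b (ys @ zs) i j"
  by (auto simp: slope_def nth_append)

lemma slope_appendI2: "slope b zs i j \<Longrightarrow> slope b (ys @ zs) (length ys + i) (length ys + j)"
  unfolding slope_def
proof (intro allI impI)
  fix c assume *: "\<forall>c. i \<le> c \<longrightarrow> Suc c < j \<longrightarrow> lt b (zs ! c) (zs ! Suc c)" "length ys + i \<le> c" "Suc c < length ys + j"
  then show "lt b ((ys @ zs) ! c) ((ys @ zs) ! Suc c)"
    using spec[OF *(1), of "c - length ys"] by (simp add: nth_append Suc_diff_le)
qed

lemma ends_chain:
  assumes "slope b zs 0 (length zs)" "k \<le> length zs" "3 \<le> k" shows "ends b k zs"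
  unfolding ends_def covered_def
proof (intro conjI allI impI)
  fix a assume "Suc a < length zs"
  then show "\<exists>i j b. i \<le> a \<and> Suc a < j \<and> j \<le> length zs \<and> k \<le> j - i \<and> slope b zs i j"
    using assms by (intro exI[of _ 0] exI[of _ "length zs"] exI[of _ b]) auto
next
  show "2 \<le> length zs" using assms by simp
  have "Suc (length zs - 2) = length zs - 1" using assms by simp
  then show "lt b (zs ! (length zs - 2)) (zs ! (length zs - 1))" using assms unfolding slope_def by (metis diff_less le0 le_trans less_le_trans numeral_3_eq_3 zero_less_Suc zero_less_one)
qed

text \<open>Every adjacent pair lies entirely in one of the two parts, since these share the element
  \<open>x\<close>. The direction \<open>b'\<close> is free: if it equals \<open>b\<close>, the two
  slopes just merge into a longer run.\<close>

lemma ends_share: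
  assumes ys: "ends b' k (us @ [x])" and zs: "slope b (x # zs) 0 (length (x # zs))" "k \<le> length (x # zs)" and k: "3 \<le> k"
  shows "ends b k (us @ x # zs)"
  unfolding ends_def covered_def
proof (intro conjI allI impI)
  let ?w = "us @ x # zs"
  fix a assume a: "Suc a < length ?w"
  show "\<exists>i j b. i \<le> a \<and> Suc a < j \<and> j \<le> length ?w \<and> k \<le> j - i \<and> slope b ?w i j"
  proof (cases "a < length us")
    case True
    then have "Suc a < length (us @ [x])" by simp
    then obtain i j b where c: "i \<le> a" "Suc a < j" "j \<le> length (us @ [x])" "k \<le> j - i" "slope b (us @ [x]) i j"
      using ys unfolding ends_def covered_def by blast
    from slope_appendI1[OF c(5,3), of zs] have "slope b ?w i j" by simp
    then show ?thesis using c by (intro exI[of _ i] exI[of _ j] exI[of _ b]) auto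
  next
    case False
    then show ?thesis using slope_appendI2[OF zs(1), of us] zs(2) a
      by (intro exI[of _ "length us"] exI[of _ "length ?w"] exI[of _ b]) auto
  qed
next
  show "2 \<le> length (us @ x # zs)" using zs k by simp
  have "ends b k (x # zs)" by (rule ends_chain) (use zs k in auto)
  then have "lt b ((x # zs) ! (length (x # zs) - 2)) ((x # zs) ! (length (x # zs) - 1))" by (simp only: ends_def)
  moreover have "2 \<le> length (x # zs)" using zs k by simp
  ultimately show "lt b ((us @ x # zs) ! (length (us @ x # zs) - 2)) ((us @ x # zs) ! (length (us @ x # zs) - 1))"
    using nth_append_end[of 2 "x # zs" us] nth_append_end[of 1 "x # zs" us] by simp
qed

text \<open>Only the pair at the seam is new. If it goes in direction \<open>b\<close>, it prolongs
  \<open>zs\<close> to the front; otherwise it prolongs the last run of \<open>ys\<close>, which has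
  direction \<open>\<not> b\<close>.\<close>

lemma ends_concat:
  assumes ys: "ends (\<not> b) k ys" and zs: "slope b zs 0 (length zs)" "k \<le> length zs" and k: "3 \<le> k"
    and ne: "ys ! (length ys - 1) \<noteq> zs ! 0"
  shows "ends b k (ys @ zs)"
  unfolding ends_def covered_def
proof (intro conjI allI impI)
  let ?w = "ys @ zs"
  have ly: "2 \<le> length ys" using ys by (simp add: ends_def)
  fix a assume a: "Suc a < length ?w"
  consider "Suc a < length ys" | "Suc a = length ys" | "length ys \<le> a" by linarith
  then show "\<exists>i j b. i \<le> a \<and> Suc a < j \<and> j \<le> length ?w \<and> k \<le> j - i \<and> slope b ?w i j"
  proof cases
    case 1
    then obtain i j b where "i \<le> a" "Suc a < j" "j \<le> length ys" "k \<le> j - i" "slope b ys i j"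
      using ys unfolding ends_def covered_def by metis
    moreover from this have "slope b (ys @ zs) i j" by (intro slope_appendI1)
    ultimately show ?thesis by (intro exI[of _ i] exI[of _ j] exI[of _ b]) auto
  next
    case 3
    then show ?thesis using slope_appendI2[OF zs(1), of ys] zs(2) a
      by (intro exI[of _ "length ys"] exI[of _ "length ?w"] exI[of _ b]) auto
  next
    case 2
    then have aa: "a = length ys - 1" by simp
    have w: "?w ! a = ys ! (length ys - 1)" "?w ! Suc a = zs ! 0" using 2 ly by (simp_all add: nth_append aa)
    show ?thesis
    proof (cases "lt b (ys ! (length ys - 1)) (zs ! 0)")
      case True
      have "slope b ?w a (length ?w)"
        unfolding slope_def
      proof (intro allI impI)
        fix c assume c: "a \<le> c" "Suc c < length ?w"
        show "lt b (?w ! c) (?w ! Suc c)"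
        proof (cases "c = a")
          case False
          then have "length ys \<le> c" using c 2 by simp
          then show ?thesis using slope_appendI2[OF zs(1), of ys] c unfolding slope_def by simp
        qed (use True w in simp)
      qed
      then show ?thesis using a zs(2) aa by (intro exI[of _ a] exI[of _ "length ?w"] exI[of _ b]) auto
    next
      case False
      then have lt': "lt (\<not> b) (?w ! a) (?w ! Suc a)" using w lt_neg[OF ne] by simp
      obtain i where i: "Suc i < length ys" "k \<le> length ys - i" "slope (\<not> b) ys i (length ys)" using ends_last_run[OF ys] .
      have "slope (\<not> b) ?w i (Suc (length ys))"
        unfolding slope_def
      proof (intro allI impI)
        fix c assume c: "i \<le> c" "Suc c < Suc (length ys)"
        show "lt (\<not> b) (?w ! c) (?w ! Suc c)"
        proof (cases "c = a")
          case False
          then have "Suc c < length ys" using c 2 by simp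
          then show ?thesis using slope_appendI1[OF i(3), of zs] c unfolding slope_def by simp
        qed (use lt' in simp)
      qed
      moreover have "i \<le> a" "Suc a < Suc (length ys)" "Suc (length ys) \<le> length ?w" "k \<le> Suc (length ys) - i"
        using a i(1,2) 2 by linarith+
      ultimately show ?thesis by blast
    qed
  qed
next
  show "2 \<le> length (ys @ zs)" using zs k by simp
  have "ends b k zs" by (rule ends_chain) (use zs k in auto)
  then have "lt b (zs ! (length zs - 2)) (zs ! (length zs - 1))" by (simp only: ends_def)
  moreover have "2 \<le> length zs" using zs k by simp
  ultimately show "lt b ((ys @ zs) ! (length (ys @ zs) - 2)) ((ys @ zs) ! (length (ys @ zs) - 1))"
    using nth_append_end[of 2 zs ys] nth_append_end[of 1 zs ys] by simp
qed

text \<open>The cut is at the least start \<open>i\<close> of a slope reaching the end. By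
  minimality the pair before \<open>i\<close> has direction \<open>\<not> b\<close>, so no slope
  contains both this pair and the one after \<open>i\<close>. Hence the slopes that cover pairs of
  the prefix stay inside it.\<close>

lemma ends_decompose:
  assumes ys: "ends b k ys" and ne: "\<And>a. Suc a < length ys \<Longrightarrow> ys ! a \<noteq> ys ! Suc a"
  obtains i where "i < length ys" "k \<le> length ys - i" "slope b ys i (length ys)" "i = 0 \<or> ends (\<not> b) k (take (Suc i) ys)"
proof -
  obtain i0 where i0: "Suc i0 < length ys" "k \<le> length ys - i0" "slope b ys i0 (length ys)" using ends_last_run[OF ys] .
  define i where "i = (LEAST i. slope b ys i (length ys))"
  have i: "slope b ys i (length ys)" "i \<le> i0" unfolding i_def by (rule LeastI, rule i0(3)) (rule Least_le, rule i0(3))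
  have "i = 0 \<or> ends (\<not> b) k (take (Suc i) ys)"
  proof (cases i)
    case (Suc h)
    let ?t = "take (Suc i) ys"
    have len: "length ?t = Suc i" "Suc i < length ys" using i i0 by auto
    have nb: "\<not> lt b (ys ! h) (ys ! i)"
    proof
      assume "lt b (ys ! h) (ys ! i)"
      then have "slope b ys h (length ys)" using i(1) Suc unfolding slope_def by (metis Suc_leI le_neq_implies_less)
      then have "i \<le> h" unfolding i_def by (rule Least_le)
      then show False using Suc by simp
    qed
    then have lh: "lt (\<not> b) (ys ! h) (ys ! Suc h)" using ne[of h] lt_neg[of "ys ! h" "ys ! Suc h" b] Suc len by auto
    have nth: "?t ! c = ys ! c" if "c \<le> i" for c using that by simp
    have "covered k ?t"
      unfolding covered_def
    proof (intro allI impI)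
      fix a assume a: "Suc a < length ?t"
      then have ai: "Suc a < Suc i" "Suc a < length ys" using len by auto
      then obtain l j c where c: "l \<le> a" "Suc a < j" "j \<le> length ys" "k \<le> j - l" "slope c ys l j"
        using ys unfolding ends_def covered_def by blast
      have "j \<le> Suc i"
      proof (rule ccontr)
        assume j: "\<not> j \<le> Suc i"
        have "lt c (ys ! h) (ys ! Suc h)" using c j ai Suc unfolding slope_def by auto
        then have "c = (\<not> b)" using lh lt_unique by blast
        moreover have "lt c (ys ! i) (ys ! Suc i)" using c j ai unfolding slope_def by auto
        moreover have "lt b (ys ! i) (ys ! Suc i)" using i(1) len unfolding slope_def by auto
        ultimately show False using lt_unique by blast
      qed
      then have "slope c ?t l j" using c(5) unfolding slope_def by auto
      then show "\<exists>i' j b. i' \<le> a \<and> Suc a < j \<and> j \<le> length ?t \<and> k \<le> j - i' \<and> slope b ?t i' j"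
        using c \<open>j \<le> Suc i\<close> len by (metis)
    qed
    then show ?thesis using lh Suc len by (simp add: ends_def)
  qed simp
  then show ?thesis using that[of i] i i0 by simp
qed

section \<open>The recursion for the optimum\<close>

text \<open>The value 0 marks that there is no such rollercoaster; an existing one has at least two
  elements.\<close>

definition opt :: "bool \<Rightarrow> nat \<Rightarrow> 'a::linorder list \<Rightarrow> nat \<Rightarrow> nat" where
  "opt b k S r = Max (insert 0 {length ys |ys. subseq ys (take r S) \<and> ends b k ys})"

definition lisw :: "bool \<Rightarrow> 'a::linorder list \<Rightarrow> nat \<Rightarrow> nat \<Rightarrow> nat" where
  "lisw b S l r = Max {length zs |zs. subseq zs (drop l (take r S)) \<and> slope b zs 0 (length zs)}"

lemma finite_subseq_lengths: "finite {length ys |ys. subseq ys xs \<and> P ys}"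
  by (rule finite_subset[of _ "{..length xs}"]) (auto dest: list_emb_length)

lemma opt_ge: "subseq ys (take r S) \<Longrightarrow> ends b k ys \<Longrightarrow> length ys \<le> opt b k S r"
  unfolding opt_def by (rule Max_ge) (auto intro: finite_subseq_lengths)

lemma opt_attained:
  obtains "opt b k S r = 0" | ys where "subseq ys (take r S)" "ends b k ys" "opt b k S r = length ys"
proof -
  have "opt b k S r \<in> insert 0 {length ys |ys. subseq ys (take r S) \<and> ends b k ys}"
    unfolding opt_def by (rule Max_in) (auto intro: finite_subseq_lengths)
  then show ?thesis using that by auto
qed

lemma lisw_ge: "subseq zs (drop l (take r S)) \<Longrightarrow> slope b zs 0 (length zs) \<Longrightarrow> length zs \<le> lisw b S l r"
  unfolding lisw_def by (rule Max_ge) (auto intro: finite_subseq_lengths)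

lemma lisw_attained:
  obtains zs where "subseq zs (drop l (take r S))" "slope b zs 0 (length zs)" "lisw b S l r = length zs"
proof -
  have "lisw b S l r \<in> {length zs |zs. subseq zs (drop l (take r S)) \<and> slope b zs 0 (length zs)}"
    unfolding lisw_def
  proof (rule Max_in[OF finite_subseq_lengths])
    have "subseq [] (drop l (take r S)) \<and> slope b ([]::'a list) 0 (length ([]::'a list))" by (simp add: slope_def)
    then show "{length zs |zs. subseq zs (drop l (take r S)) \<and> slope b zs 0 (length zs)} \<noteq> {}" by blast
  qed
  then show ?thesis using that by auto
qed

lemma distinct_subseq: "subseq ys xs \<Longrightarrow> distinct xs \<Longrightarrow> distinct ys"
  by (metis distinct_nthsI subseq_conv_nths)

lemma distinct_adj: "distinct ys \<Longrightarrow> Suc a < length ys \<Longrightarrow> ys ! a \<noteq> ys ! Suc a"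
  by (simp add: nth_eq_iff_index_eq)

lemma subseq_middle:
  assumes "subseq (us @ x # vs) xs"
  obtains l where "l < length xs" "xs ! l = x" "subseq us (take l xs)" "subseq vs (drop (Suc l) xs)"
proof -
  from list_emb_appendD[OF assms] obtain X1 X2 where X: "xs = X1 @ X2" "subseq us X1" "subseq (x # vs) X2" by blast
  from list_emb_ConsD[OF X(3)] obtain Y1 y Y2 where Y: "X2 = Y1 @ y # Y2" "x = y" "subseq vs Y2" by auto
  show ?thesis
  proof (rule that[of "length (X1 @ Y1)"])
    show "subseq us (take (length (X1 @ Y1)) xs)" using X Y by (simp add: subseq_rev_drop_many)
  qed (use X Y in \<open>simp_all add: nth_append\<close>)
qed

text \<open>Let \<open>l\<close> be the position in \<open>S\<close> at which the last run starts.
  The run is a monotone subsequence of the window from \<open>l\<close> on, and the part up to and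
  including its first element is counted by \<open>opt (\<not> b)\<close> at \<open>Suc l\<close>,
  or by 1 if the run is everything. The first element is counted twice, hence the
  \<open>- 1\<close>.\<close>

lemma opt_upper:
  assumes S: "distinct S" and ys: "subseq ys (take r S)" "ends b k ys" and r: "r \<le> length S"
  shows "\<exists>l<r. k \<le> lisw b S l r \<and> length ys \<le> max 1 (opt (\<not> b) k S (Suc l)) + lisw b S l r - 1"
proof -
  have "distinct ys" using distinct_subseq[OF ys(1)] S by simp
  from ends_decompose[OF ys(2) distinct_adj[OF this]] obtain i where
    i: "i < length ys" "k \<le> length ys - i" "slope b ys i (length ys)" "i = 0 \<or> ends (\<not> b) k (take (Suc i) ys)" by blast
  have dec: "ys = take i ys @ ys ! i # drop (Suc i) ys" by (rule id_take_nth_drop[OF i(1)])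
  have "subseq (take i ys @ ys ! i # drop (Suc i) ys) (take r S)" using ys(1) dec by simp
  then obtain l where l: "l < length (take r S)" "take r S ! l = ys ! i" "subseq (take i ys) (take l (take r S))"
    "subseq (drop (Suc i) ys) (drop (Suc l) (take r S))" by (rule subseq_middle)
  have lr: "l < r" "l < length S" using l(1) by auto
  have "subseq (ys ! i # drop (Suc i) ys) (take r S ! l # drop (Suc l) (take r S))" using l by simp
  then have sub: "subseq (drop i ys) (drop l (take r S))"
    using Cons_nth_drop_Suc[OF i(1)] Cons_nth_drop_Suc[OF l(1)] by simp
  have "slope b (drop i ys) 0 (length (drop i ys))" using i(3) by (auto simp: slope_def)
  from lisw_ge[OF sub this] have L: "length ys - i \<le> lisw b S l r" by simp
  have "Suc i \<le> max 1 (opt (\<not> b) k S (Suc l))"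
  proof (cases "i = 0")
    case False
    then have e: "ends (\<not> b) k (take (Suc i) ys)" using i by simp
    have "take (Suc l) S = take l S @ [S ! l]" using lr by (simp add: take_Suc_conv_app_nth)
    moreover have "take (Suc i) ys = take i ys @ [ys ! i]" using i by (simp add: take_Suc_conv_app_nth)
    moreover have "S ! l = ys ! i" "take l (take r S) = take l S" using l(2) lr by simp_all
    ultimately have "subseq (take (Suc i) ys) (take (Suc l) S)" using l(3) by (simp add: list_emb_append_mono)
    from opt_ge[OF this e] show ?thesis using i by simp
  qed simp
  then show ?thesis using L i lr by (intro exI[of _ l]) linarith
qed

text \<open>The \<open>- 1\<close> pays for a conflict at position \<open>l\<close>, the only one
  that both parts may use. If \<open>ys\<close> ends and \<open>zs\<close> starts with
  \<open>S ! l\<close>, they share this element; otherwise they can be concatenated, which is even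
  one longer than needed.\<close>

lemma opt_lower:
  assumes S: "distinct S" and k: "3 \<le> k" and l: "l < r" "r \<le> length S" "k \<le> lisw b S l r"
  shows "max 1 (opt (\<not> b) k S (Suc l)) + lisw b S l r - 1 \<le> opt b k S r"
proof -
  obtain zs where zs: "subseq zs (drop l (take r S))" "slope b zs 0 (length zs)" "lisw b S l r = length zs"
    by (rule lisw_attained)
  have kz: "k \<le> length zs" using l zs by simp
  have split: "take r S = take l S @ S ! l # drop (Suc l) (take r S)" "drop l (take r S) = S ! l # drop (Suc l) (take r S)"
  proof -
    have "l < length (take r S)" using l by simp
    from id_take_nth_drop[OF this] Cons_nth_drop_Suc[OF this] show
      "take r S = take l S @ S ! l # drop (Suc l) (take r S)" "drop l (take r S) = S ! l # drop (Suc l) (take r S)"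
      using l by (simp_all add: min_def)
  qed
  have tS: "take (Suc l) S = take l S @ [S ! l]" using l by (simp add: take_Suc_conv_app_nth)
  show ?thesis
  proof (rule opt_attained[of "\<not> b" k S "Suc l"])
    assume "opt (\<not> b) k S (Suc l) = 0"
    moreover have "length zs \<le> opt b k S r"
    proof (rule opt_ge)
      show "subseq zs (take r S)" using zs(1) split by (metis subseq_drop_many)
      show "ends b k zs" by (rule ends_chain) (use zs kz k in auto)
    qed
    ultimately show ?thesis using zs by simp
  next
    fix ys assume ys: "subseq ys (take (Suc l) S)" "ends (\<not> b) k ys" "opt (\<not> b) k S (Suc l) = length ys"
    have ly: "2 \<le> length ys" using ys(2) by (simp add: ends_def)
    have concat: "length ys + length zs \<le> opt b k S r" if sub: "subseq (ys @ zs) (take r S)"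
    proof -
      have "distinct (ys @ zs)" using distinct_subseq[OF sub] S by simp
      moreover have "ys ! (length ys - 1) \<in> set ys" "zs ! 0 \<in> set zs" using ly kz k by (intro nth_mem; linarith)+
      ultimately have "ys ! (length ys - 1) \<noteq> zs ! 0" by auto
      from ends_concat[OF ys(2) zs(2) kz k this] show ?thesis using opt_ge[OF sub] by fastforce
    qed
    have "length ys + length zs - 1 \<le> opt b k S r"
    proof (cases "subseq zs (drop (Suc l) (take r S))")
      case True
      have "take r S = take (Suc l) S @ drop (Suc l) (take r S)" using split(1) tS by simp
      then have "subseq (ys @ zs) (take r S)" using list_emb_append_mono[OF ys(1) True] by simp
      then show ?thesis using concat by simp
    next
      case False
      then obtain zs' where z': "zs = S ! l # zs'" "subseq zs' (drop (Suc l) (take r S))"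
        using zs(1) unfolding split(2) by (cases zs) (auto split: if_splits)
      show ?thesis
      proof (cases "subseq ys (take l S)")
        case True
        then have "subseq (ys @ zs) (take r S)" using list_emb_append_mono[OF True zs(1)] split by metis
        then show ?thesis using concat by simp
      next
        case False
        from ys(1) obtain us vs where uv: "ys = us @ vs" "subseq us (take l S)" "subseq vs [S ! l]"
          unfolding tS by (auto simp: subseq_append_iff)
        have "vs \<noteq> []" using False uv by auto
        then have vs: "vs = [S ! l]" using uv(3) by (cases vs) (auto split: if_splits)
        have "ends b k (us @ S ! l # zs')"
          by (rule ends_share[of "\<not> b"]) (use ys(2) uv vs z' zs kz k in auto)
        moreover have "subseq (us @ S ! l # zs') (take r S)"
          using list_emb_append_mono[OF uv(2), of "S ! l # zs'" "S ! l # drop (Suc l) (take r S)"] z'(2) split(1) by simp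
        ultimately have "length (us @ S ! l # zs') \<le> opt b k S r" by (intro opt_ge)
        then show ?thesis using uv vs z' by simp
      qed
    qed
    then show ?thesis using ys zs ly by simp
  qed
qed

lemma longest_eq_opt:
  assumes S: "distinct S" and k: "3 \<le> k"
  shows "longest_rollercoaster_length k S = max (opt True k S (length S)) (opt False k S (length S))"
proof (rule antisym)
  obtain ys where ys: "subseq ys S" "rollercoaster k ys" "length ys = longest_rollercoaster_length k S"
    using longest_rollercoaster_length_attained(1) by blast
  show "longest_rollercoaster_length k S \<le> max (opt True k S (length S)) (opt False k S (length S))"
  proof (cases "ys = []")
    case False
    have d: "distinct ys" using distinct_subseq ys S by blast
    have cov: "covered k ys" by (rule covered_if_rollercoaster[OF ys(2) distinct_adj[OF d]])
    have len: "2 \<le> length ys" by (rule rollercoaster_length[OF ys(2) False k])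
    have "ys ! (length ys - 2) \<noteq> ys ! (length ys - 1)" using d len by (simp add: nth_eq_iff_index_eq)
    then have "ends True k ys \<or> ends False k ys" using cov len by (auto simp: ends_def lt_def)
    then show ?thesis using opt_ge[of ys "length S" S] ys by (fastforce simp: max_def)
  qed (use ys in simp)
next
  have "opt b k S (length S) \<le> longest_rollercoaster_length k S" for b
  proof (rule opt_attained[of b k S "length S"])
    fix ys assume ys: "subseq ys (take (length S) S)" "ends b k ys" "opt b k S (length S) = length ys"
    have "rollercoaster k ys" by (rule rollercoaster_if_covered[OF _ k]) (use ys in \<open>auto simp: ends_def\<close>)
    then show ?thesis using longest_rollercoaster_length_attained(2)[of ys S k] ys by simp
  qed simp
  then show "max (opt True k S (length S)) (opt False k S (length S)) \<le> longest_rollercoaster_length k S" by simp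
qed

lemma subseq_iff_filter: "subseq zs w \<longleftrightarrow> (\<exists>P. zs = map ((!) w) (filter P [0..<length w]))"
proof
  assume "subseq zs w"
  then obtain I where "zs = nths w I" by (auto simp: subseq_conv_nths)
  moreover have "nths w I = map ((!) w) (filter (\<lambda>i. i \<in> I) [0..<length w])"
  proof (induction w rule: rev_induct)
    case (snoc x w)
    have "map ((!) (w @ [x])) (filter (\<lambda>i. i \<in> I) [0..<length w]) = map ((!) w) (filter (\<lambda>i. i \<in> I) [0..<length w])"
      by (rule map_cong) (auto simp: nth_append)
    then show ?case using snoc by (simp add: nths_append)
  qed simp
  ultimately show "\<exists>P. zs = map ((!) w) (filter P [0..<length w])" by blast
next
  assume "\<exists>P. zs = map ((!) w) (filter P [0..<length w])"
  then obtain P where "zs = map ((!) w) (filter P [0..<length w])" by blast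
  moreover have "subseq (map ((!) w) (filter P [0..<length w])) (map ((!) w) [0..<length w])"
    by (intro subseq_map subseq_filter_left)
  ultimately show "subseq zs w" by (simp add: map_nth)
qed

lemma sorted_wrt_filter_upt:
  "sorted_wrt R (filter P [0..<m]) \<longleftrightarrow> (\<forall>j<m. \<forall>i<j. P i \<longrightarrow> P j \<longrightarrow> R i j)"
  by (induction m) (auto simp: sorted_wrt_append less_Suc_eq)

lemma slope_iff_sorted: "slope b zs 0 (length zs) \<longleftrightarrow> sorted_wrt (lt b) zs"
  by (simp add: slope_def sorted_wrt_iff_nth_Suc_transp[OF transp_lt])

text \<open>Subsequences of a window correspond to sets of positions, and monotonicity depends on
  comparisons only. So real numbers can be replaced by any ranks with the same order, reversed for
  the decreasing direction.\<close>

lemma lisw_eq_lis: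
  assumes rk: "\<And>p q. p < length S \<Longrightarrow> q < length S \<Longrightarrow> rk p < rk q \<longleftrightarrow> lt b (S ! p) (S ! q)"
    and lr: "l \<le> r" "r \<le> length S"
  shows "lisw b S l r = lis rk l r"
proof -
  let ?w = "drop l (take r S)"
  have len: "length ?w = r - l" and nth: "\<And>i. i < r - l \<Longrightarrow> ?w ! i = S ! (l + i)" using lr by auto
  have srt: "slope b (map ((!) ?w) (filter P [0..<length ?w])) 0 (length (map ((!) ?w) (filter P [0..<length ?w])))
     \<longleftrightarrow> strict_mono_on {x\<in>{l..<r}. P (x - l)} rk" for P
  proof -
    have "slope b (map ((!) ?w) (filter P [0..<length ?w])) 0 (length (map ((!) ?w) (filter P [0..<length ?w])))
      \<longleftrightarrow> (\<forall>j<r-l. \<forall>i<j. P i \<longrightarrow> P j \<longrightarrow> lt b (?w ! i) (?w ! j))"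
      unfolding slope_iff_sorted sorted_wrt_map sorted_wrt_filter_upt len ..
    also have "\<dots> \<longleftrightarrow> (\<forall>j<r-l. \<forall>i<j. P i \<longrightarrow> P j \<longrightarrow> rk (l + i) < rk (l + j))"
      using nth rk lr by (auto simp: less_diff_conv add.commute)
    also have "\<dots> \<longleftrightarrow> strict_mono_on {x\<in>{l..<r}. P (x - l)} rk"
    proof
      assume *: "\<forall>j<r-l. \<forall>i<j. P i \<longrightarrow> P j \<longrightarrow> rk (l + i) < rk (l + j)"
      show "strict_mono_on {x\<in>{l..<r}. P (x - l)} rk"
      proof (rule strict_mono_onI)
        fix x y assume "x \<in> {x\<in>{l..<r}. P (x - l)}" "y \<in> {x\<in>{l..<r}. P (x - l)}" "x < y"
        then show "rk x < rk y" using *[rule_format, of "y - l" "x - l"] by auto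
      qed
    next
      assume *: "strict_mono_on {x\<in>{l..<r}. P (x - l)} rk"
      show "\<forall>j<r-l. \<forall>i<j. P i \<longrightarrow> P j \<longrightarrow> rk (l + i) < rk (l + j)"
        by (intro allI impI strict_mono_onD[OF *]) auto
    qed
    finally show ?thesis .
  qed
  have card: "length (map ((!) ?w) (filter P [0..<length ?w])) = card {x\<in>{l..<r}. P (x - l)}" for P
  proof -
    have "length (filter P [0..<r-l]) = card {i. i < r - l \<and> P i}"
      using distinct_card[of "filter P [0..<r-l]"] by (simp add: conj_commute)
    also have "{x\<in>{l..<r}. P (x - l)} = (\<lambda>i. l + i) ` {i. i < r - l \<and> P i}"
    proof (intro equalityI subsetI)
      fix x assume "x \<in> {x\<in>{l..<r}. P (x - l)}"
      then show "x \<in> (\<lambda>i. l + i) ` {i. i < r - l \<and> P i}" by (intro image_eqI[of _ _ "x - l"]) auto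
    qed auto
    then have "card {i. i < r - l \<and> P i} = card {x\<in>{l..<r}. P (x - l)}" by (simp add: card_image)
    finally show ?thesis using len by (simp only: length_map)
  qed
  show ?thesis
  proof (rule antisym)
    obtain zs where zs: "subseq zs ?w" "slope b zs 0 (length zs)" "lisw b S l r = length zs" by (rule lisw_attained)
    then obtain P where P: "zs = map ((!) ?w) (filter P [0..<length ?w])" by (auto simp: subseq_iff_filter)
    have "strict_mono_on {x\<in>{l..<r}. P (x - l)} rk" using srt[of P] zs(2) unfolding P by blast
    then have "card {x\<in>{l..<r}. P (x - l)} \<le> lis rk l r" by (intro lis_ge) auto
    then show "lisw b S l r \<le> lis rk l r" using zs(3) card[of P] P by simp
  next
    obtain C where C: "C \<subseteq> {l..<r}" "strict_mono_on C rk" "lis rk l r = card C" by (rule lis_attained)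
    let ?P = "\<lambda>i. l + i \<in> C"
    have e: "{x\<in>{l..<r}. ?P (x - l)} = C" using C(1) by auto
    let ?zs = "map ((!) ?w) (filter ?P [0..<length ?w])"
    have "subseq ?zs ?w" unfolding subseq_iff_filter by blast
    moreover have "slope b ?zs 0 (length ?zs)" using srt[of ?P] C(2) unfolding e by blast
    ultimately have "length ?zs \<le> lisw b S l r" by (rule lisw_ge)
    then show "lis rk l r \<le> lisw b S l r" using card[of ?P] C(3) unfolding e by simp
  qed
qed

section \<open>Trees and ranks\<close>

definition climb :: "com \<Rightarrow> com" where
  "climb pull = Assign ''p'' (Div (V ''p'') (N 2));;
     While (Less (N 0) (V ''p'')) (pull;; Assign ''p'' (Div (V ''p'') (N 2)))"

lemma regs_climb [simp]: "regs (climb c) = insert ''p'' (regs c)" "arrs (climb c) = arrs c"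
  by (auto simp: climb_def)

definition local_cons :: "(state \<Rightarrow> nat \<Rightarrow> bool) \<Rightarrow> bool" where
  "local_cons cons \<longleftrightarrow> (\<forall>s s' u. (\<forall>a. \<forall>i\<in>{u, 2*u, 2*u+1}. snd s a i = snd s' a i) \<longrightarrow> cons s u \<longrightarrow> cons s' u)"

definition pull_ok :: "real list \<Rightarrow> nat \<Rightarrow> nat \<Rightarrow> com \<Rightarrow> nat \<Rightarrow> (state \<Rightarrow> bool) \<Rightarrow> (state \<Rightarrow> nat \<Rightarrow> bool) \<Rightarrow> bool" where
  "pull_ok S W nn pull B R cons \<longleftrightarrow> (\<forall>s u. fst s ''p'' = u \<longrightarrow> 1 \<le> u \<longrightarrow> u < nn \<longrightarrow> R s \<longrightarrow>
     tri S W pull s B (\<lambda>s'. fst s' ''p'' = u \<and> R s' \<and> cons s' u \<and> (\<forall>a i. i \<noteq> u \<longrightarrow> snd s' a i = snd s a i)))"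

text \<open>The invariant is that at most the current node \<open>p\<close> violates its equation.
  Pulling repairs it and can break only the equation of the parent, since by locality no other one
  reads entry \<open>p\<close>. Beyond the root, at \<open>p = 0\<close>, no violation is
  left.\<close>

lemma climb_correct:
  assumes nn: "nn = 2 ^ H" and loc: "local_cons cons" and pull: "pull_ok S W nn pull B R cons"
    and R: "\<And>s x. R s \<Longrightarrow> R ((fst s)(''p'' := x), snd s)"
    and cp: "\<And>s x u. cons s u \<Longrightarrow> cons ((fst s)(''p'' := x), snd s) u"
    and s: "fst s0 ''p'' = v" "v < 2 * nn" "R s0"
    and start: "\<And>u. 1 \<le> u \<Longrightarrow> u < nn \<Longrightarrow> u \<noteq> v div 2 \<Longrightarrow> cons s0 u"
    and W: "2 \<le> W"
  shows "tri S W (climb pull) s0 ((H + 1) * (B + 12)) (\<lambda>s. R s \<and> (\<forall>u. 1 \<le> u \<longrightarrow> u < nn \<longrightarrow> cons s u) \<and>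
     (\<forall>a i. nn \<le> i \<longrightarrow> snd s a i = snd s0 a i))" (is "tri S W _ _ _ ?Q")
  unfolding climb_def
proof (rule tri_Seq)
  show "tri S W (Assign ''p'' (Div (V ''p'') (N 2))) s0 4 (\<lambda>s. s = ((fst s0)(''p'' := v div 2), snd s0))"
    by (rule tri_wp) (use s W in auto)
  fix s1 assume s1: "s1 = ((fst s0)(''p'' := v div 2), snd s0)"
  let ?I = "\<lambda>n s. n \<le> H \<and> fst s ''p'' < 2 ^ n \<and> R s \<and> (\<forall>u. 1 \<le> u \<longrightarrow> u < nn \<longrightarrow> u \<noteq> fst s ''p'' \<longrightarrow> cons s u) \<and>
     (\<forall>a i. nn \<le> i \<longrightarrow> snd s a i = snd s0 a i)"
  show "tri S W (While (Less (N 0) (V ''p'')) (pull;; Assign ''p'' (Div (V ''p'') (N 2)))) s1 ((H + 1) * (B + 8)) ?Q"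
  proof (rule tri_While[where I = ?I and n = H and B = "B + 4"])
    show "?I H s1" using s1 s nn R[OF s(3)] start cp[of s0] by auto
    fix n s assume I: "?I n s"
    let ?b = "Less (N 0) (V ''p'')" let ?c = "pull;; Assign ''p'' (Div (V ''p'') (N 2))"
    show "bfits S W s ?b \<and> (bval S s ?b \<longrightarrow> 0 < n \<and> tri S W ?c s (B + 4) (\<lambda>s'. \<exists>m<n. ?I m s')) \<and> (\<not> bval S s ?b \<longrightarrow> ?Q s)"
    proof (intro conjI impI)
      assume b: "bval S s ?b"
      define u where "u = fst s ''p''"
      have u: "1 \<le> u" "u < 2 ^ n" "u < nn"
      proof -
        show "1 \<le> u" "u < 2 ^ n" using b I by (auto simp: u_def)
        moreover have "(2::nat) ^ n \<le> 2 ^ H" using I by (intro power_increasing) auto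
        ultimately show "u < nn" unfolding nn by linarith
      qed
      then show n: "0 < n" by (cases n) auto
      show "tri S W ?c s (B + 4) (\<lambda>s'. \<exists>m<n. ?I m s')"
      proof (rule tri_Seq)
        show "tri S W pull s B (\<lambda>s'. fst s' ''p'' = u \<and> R s' \<and> cons s' u \<and> (\<forall>a i. i \<noteq> u \<longrightarrow> snd s' a i = snd s a i))"
          using pull u I unfolding pull_ok_def u_def by blast
        fix s2 assume 2: "fst s2 ''p'' = u \<and> R s2 \<and> cons s2 u \<and> (\<forall>a i. i \<noteq> u \<longrightarrow> snd s2 a i = snd s a i)"
        let ?s3 = "((fst s2)(''p'' := u div 2), snd s2)"
        have cons: "cons ?s3 x" if x: "1 \<le> x" "x < nn" "x \<noteq> u div 2" for x
        proof (cases "x = u")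
          case True then show ?thesis using 2 cp by blast
        next
          case False
          have "cons s x" using I False x u_def by blast
          moreover have "\<forall>a. \<forall>i\<in>{x, 2*x, 2*x+1}. snd s a i = snd s2 a i"
            using 2 False x(3) by auto
          ultimately have "cons s2 x" using loc unfolding local_cons_def by blast
          then show ?thesis by (rule cp)
        qed
        obtain m where m: "n = Suc m" using n by (cases n) auto
        have "u div 2 < 2 ^ m" using u(2) m by auto
        moreover have "snd s2 a i = snd s0 a i" if "nn \<le> i" for a i using 2 I that u(3) by auto
        ultimately have "?I m ?s3" using 2 R cons m I by auto
        then show "tri S W (Assign ''p'' (Div (V ''p'') (N 2))) s2 4 (\<lambda>s'. \<exists>m<n. ?I m s')"
          using 2 W m by (intro tri_wp) auto
      qed simp
    next
      assume "\<not> bval S s ?b"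
      then have "fst s ''p'' = 0" by simp
      then show "R s" "\<forall>u. 1 \<le> u \<longrightarrow> u < nn \<longrightarrow> cons s u" "\<forall>a i. nn \<le> i \<longrightarrow> snd s a i = snd s0 a i" using I by auto
    qed simp
  qed simp
qed simp

section \<open>Ranks by a tournament\<close>

text \<open>Nodes are numbered as in a heap: the root is \<open>1\<close> and the leaves are \<open>nn, \<dots>, 2 * nn - 1\<close>.\<close>

definition win :: "real list \<Rightarrow> nat \<Rightarrow> nat \<Rightarrow> nat" where
  "win S a c = (if a < length S then if c < length S then if S ! a < S ! c then a else c else a else c)"

definition pullT :: com where
  "pullT =
     Assign ''a'' (Load ''Tr'' (Plus (V ''p'') (V ''p'')));;
     Assign ''c'' (Load ''Tr'' (Plus (Plus (V ''p'') (V ''p'')) (N 1)));;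
     Cond (Less (V ''a'') (V ''n''))
       (Cond (Less (V ''c'') (V ''n''))
          (Cond (InputLess (V ''a'') (V ''c'')) (Store ''Tr'' (V ''p'') (V ''a'')) (Store ''Tr'' (V ''p'') (V ''c'')))
          (Store ''Tr'' (V ''p'') (V ''a'')))
       (Store ''Tr'' (V ''p'') (V ''c''))"

lemma regs_pullT [simp]: "regs pullT = {''a'', ''c''}" "arrs pullT = {''Tr''}"
  by (auto simp: pullT_def)

definition consT :: "real list \<Rightarrow> state \<Rightarrow> nat \<Rightarrow> bool" where
  "consT S s u \<longleftrightarrow> snd s ''Tr'' u = win S (snd s ''Tr'' (2*u)) (snd s ''Tr'' (2*u+1))"

lemma local_consT: "local_cons (consT S)"
  unfolding local_cons_def consT_def by (metis insert_iff)

lemma pullT_ok: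
  assumes W: "2 * nn \<le> W" "1 \<le> W"
  shows "pull_ok S W nn pullT 30 (\<lambda>s. fst s ''n'' = length S) (consT S)"
  unfolding pull_ok_def
proof (intro allI impI)
  fix s :: state and u assume "fst s ''p'' = u" "1 \<le> u" "u < nn" "fst s ''n'' = length S"
  then show "tri S W pullT s 30 (\<lambda>s'. fst s' ''p'' = u \<and> fst s' ''n'' = length S \<and> consT S s' u \<and> (\<forall>a i. i \<noteq> u \<longrightarrow> snd s' a i = snd s a i))"
    using W by (intro tri_wp) (auto simp: pullT_def consT_def win_def mult_2)
qed

text \<open>The leaves below a node \<open>u\<close> of height \<open>h\<close> are
  \<open>u * 2 ^ h + x\<close> with \<open>x < 2 ^ h\<close>. An entry \<open>\<ge> length S\<close>
  stands for an absent element and loses against every present one.\<close>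

lemma tour_node:
  fixes t :: "nat \<Rightarrow> nat" and nn :: nat
  assumes nn: "nn = 2 ^ H" and cons: "\<And>u. 1 \<le> u \<Longrightarrow> u < nn \<Longrightarrow> t u = win S (t (2*u)) (t (2*u+1))"
  shows "h \<le> H \<Longrightarrow> 1 \<le> u \<Longrightarrow> u < 2 ^ (H - h + 1) \<Longrightarrow>
    (\<exists>x<2^h. t u = t (u * 2^h + x)) \<and> (\<forall>x<2^h. t (u * 2^h + x) < length S \<longrightarrow> t u < length S \<and> S ! t u \<le> S ! t (u * 2^h + x))"
proof (induction h arbitrary: u)
  case (Suc h)
  have u: "u < 2 ^ (H - h)" using Suc.prems by (metis Suc_diff_Suc Suc_eq_plus1 Suc_le_lessD)
  moreover have "(2::nat) ^ (H - h) \<le> 2 ^ H" by (intro power_increasing) auto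
  ultimately have "u < nn" unfolding nn by linarith
  note c = cons[OF Suc.prems(2) this]
  have "2*u < 2 ^ (H - h + 1)" "2*u+1 < 2 ^ (H - h + 1)" using u by auto
  note u2 = this
  have l: "(\<exists>x<2^h. t (2*u) = t (2*u * 2^h + x)) \<and> (\<forall>x<2^h. t (2*u * 2^h + x) < length S \<longrightarrow> t (2*u) < length S \<and> S ! t (2*u) \<le> S ! t (2*u * 2^h + x))"
    and r: "(\<exists>x<2^h. t (2*u+1) = t ((2*u+1) * 2^h + x)) \<and> (\<forall>x<2^h. t ((2*u+1) * 2^h + x) < length S \<longrightarrow> t (2*u+1) < length S \<and> S ! t (2*u+1) \<le> S ! t ((2*u+1) * 2^h + x))"
    by (rule Suc.IH; use u2 Suc.prems in simp)+
  have e: "2*u * 2^h = u * 2^Suc h" "(2*u+1) * 2^h + x = u * 2^Suc h + (2^h + x)" for x :: nat by (simp_all add: algebra_simps)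
  have p2: "(2::nat)^Suc h = 2^h + 2^h" by simp
  show ?case
  proof
    have "t u = t (2*u) \<or> t u = t (2*u+1)" unfolding c win_def by auto
    then show "\<exists>x<2^Suc h. t u = t (u * 2^Suc h + x)"
      using l r unfolding e p2 by (metis add_strict_left_mono trans_less_add1)
    show "\<forall>x<2^Suc h. t (u * 2^Suc h + x) < length S \<longrightarrow> t u < length S \<and> S ! t u \<le> S ! t (u * 2^Suc h + x)"
    proof (intro allI impI)
      fix x assume x: "x < (2::nat)^Suc h" "t (u * 2^Suc h + x) < length S"
      show "t u < length S \<and> S ! t u \<le> S ! t (u * 2^Suc h + x)"
      proof (cases "x < 2^h")
        case True
        then have "t (2*u) < length S \<and> S ! t (2*u) \<le> S ! t (u * 2^Suc h + x)" using l x unfolding e by blast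
        then show ?thesis unfolding c win_def by (auto simp del: power_Suc)
      next
        case False
        then obtain y where y: "x = 2^h + y" by (metis le_iff_add not_less)
        then have "y < 2^h" using x(1) p2 by simp
        then have "t (2*u+1) < length S \<and> S ! t (2*u+1) \<le> S ! t (u * 2^Suc h + x)" using r x unfolding e y by blast
        then show ?thesis unfolding c win_def by (auto simp del: power_Suc)
      qed
    qed
  qed
qed simp

lemma tour_root:
  fixes t :: "nat \<Rightarrow> nat" and nn :: nat
  assumes nn: "nn = 2 ^ H" and cons: "\<And>u. 1 \<le> u \<Longrightarrow> u < nn \<Longrightarrow> t u = win S (t (2*u)) (t (2*u+1))"
  shows "\<exists>x<nn. t 1 = t (nn + x)" and "x < nn \<Longrightarrow> t (nn + x) < length S \<Longrightarrow> t 1 < length S \<and> S ! t 1 \<le> S ! t (nn + x)"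
  using tour_node[OF nn cons, of H 1] nn by auto

definition rank :: "real list \<Rightarrow> nat \<Rightarrow> nat" where
  "rank S p = card {q. q < length S \<and> S ! q < S ! p}"

lemma rank_less: assumes "p < length S" "S ! p < S ! q" shows "rank S p < rank S q"
  unfolding rank_def by (rule psubset_card_mono) (use assms in auto)

lemma rank_less_iff: assumes "p < length S" "q < length S" shows "rank S p < rank S q \<longleftrightarrow> S ! p < S ! q"
proof
  assume *: "rank S p < rank S q"
  show "S ! p < S ! q"
  proof (rule ccontr)
    assume "\<not> S ! p < S ! q"
    then have "S ! q < S ! p \<or> S ! q = S ! p" by auto
    then show False using rank_less[OF assms(2), of p] * by (auto simp: rank_def)
  qed
qed (rule rank_less[OF assms(1)])

lemma rank_bij: assumes S: "distinct S" shows "bij_betw (rank S) {..<length S} {..<length S}"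
proof -
  have "rank S p < length S" if "p < length S" for p
  proof -
    have "{q. q < length S \<and> S ! q < S ! p} \<subset> {..<length S}" using that by auto
    from psubset_card_mono[OF _ this] show ?thesis by (simp add: rank_def)
  qed
  moreover have "inj_on (rank S) {..<length S}"
  proof (rule inj_onI)
    fix p q assume *: "p \<in> {..<length S}" "q \<in> {..<length S}" "rank S p = rank S q"
    then have "\<not> S ! p < S ! q" "\<not> S ! q < S ! p" using rank_less_iff[of p S q] rank_less_iff[of q S p] by auto
    then have "S ! p = S ! q" by simp
    then show "p = q" using S * by (simp add: nth_eq_iff_index_eq)
  qed
  ultimately have "rank S ` {..<length S} \<subseteq> {..<length S}" "inj_on (rank S) {..<length S}" by auto
  then show ?thesis by (simp add: bij_betw_def endo_inj_surj)
qed

definition sort_body :: com where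
  "sort_body =
     (Assign ''x'' (Load ''Tr'' (N 1));; Store ''K0'' (V ''x'') (V ''v'');; Assign ''p'' (Plus (V ''N'') (V ''x''));;
      Store ''Tr'' (V ''p'') (V ''N''));;
     climb pullT"

definition sort_prog :: com where
  "sort_prog =
     Assign ''i'' (N 0);; For ''i'' ''N'' (Store ''Tr'' (Plus (V ''N'') (V ''i'')) (V ''i'');; Store ''K0'' (V ''i'') (V ''i''));;
     Assign ''p'' (Minus (V ''N'') (N 1));; While (Less (N 0) (V ''p'')) (pullT;; Assign ''p'' (Minus (V ''p'') (N 1)));;
     Assign ''v'' (N 0);; For ''v'' ''n'' sort_body"

lemma regs_sort [simp]: "regs sort_prog = {''i'', ''p'', ''v'', ''x'', ''a'', ''c''}" "arrs sort_prog = {''Tr'', ''K0''}"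
  by (auto simp: sort_prog_def sort_body_def)

definition sort_inv :: "real list \<Rightarrow> nat \<Rightarrow> nat \<Rightarrow> state \<Rightarrow> bool" where
  "sort_inv S nn v s \<longleftrightarrow> (\<forall>u. 1 \<le> u \<longrightarrow> u < nn \<longrightarrow> consT S s u) \<and>
     (\<forall>p<length S. if rank S p < v then snd s ''Tr'' (nn + p) = nn \<and> snd s ''K0'' p = rank S p else snd s ''Tr'' (nn + p) = p) \<and>
     (\<forall>p<nn. length S \<le> p \<longrightarrow> snd s ''Tr'' (nn + p) = p \<and> snd s ''K0'' p = p)"

text \<open>The element of rank \<open>v\<close> is still in the tree, so the winner is not larger;
  all elements of rank below \<open>v\<close> have been removed, so the winner has rank exactly
  \<open>v\<close>. Removal writes \<open>nn\<close>, an entry that is not an index of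
  \<open>S\<close>, into its leaf.\<close>

lemma sort_body_correct:
  assumes S: "distinct S" and nn: "nn = 2 ^ H" "length S \<le> nn" and v: "v < length S" "fst s ''v'' = v"
    and s: "fst s ''N'' = nn" "fst s ''n'' = length S" and I: "sort_inv S nn v s" and W: "2 * nn \<le> W" "2 \<le> W"
  shows "tri S W sort_body s ((H + 1) * 70) (\<lambda>s'. sort_inv S nn (Suc v) s')"
proof -
  let ?t = "snd s ''Tr''"
  have c: "?t u = win S (?t (2*u)) (?t (2*u+1))" if "1 \<le> u" "u < nn" for u
    using I that by (simp add: sort_inv_def consT_def)
  have leaf: "?t (nn + p) = (if rank S p < v then nn else p)" if "p < length S" for p
    using I that unfolding sort_inv_def by (cases "rank S p < v") auto
  have leaf2: "?t (nn + p) = p" if "p < nn" "length S \<le> p" for p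
    using I that unfolding sort_inv_def by blast
  have "v \<in> rank S ` {..<length S}" using rank_bij[OF S] v by (simp add: bij_betw_def)
  then obtain y where y: "y < length S" "rank S y = v" by auto
  let ?x = "?t 1"
  have x1: "?x < length S" "S ! ?x \<le> S ! y"
    using tour_root(2)[OF nn(1) c, of y] leaf[OF y(1)] y nn(2) by auto
  obtain z where z: "z < nn" "?x = ?t (nn + z)" using tour_root(1)[OF nn(1) c] by blast
  have zl: "z < length S" using leaf2[OF z(1)] z x1 by (metis not_less)
  have zx: "z = ?x" "\<not> rank S ?x < v" using leaf[OF zl] z x1 nn(2) by (auto split: if_splits)
  have "\<not> S ! y < S ! ?x" using x1 by simp
  then have "\<not> v < rank S ?x" using rank_less_iff[OF y(1) x1(1)] y(2) by simp
  then have rx: "rank S ?x = v" using zx by simp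
  let ?s1 = "((fst s)(''x'' := ?x, ''p'' := nn + ?x), (snd s)(''K0'' := (snd s ''K0'')(?x := v), ''Tr'' := ?t(nn + ?x := nn)))"
  have inj: "rank S p = v \<longleftrightarrow> p = ?x" if "p < length S" for p
    using bij_betw_imp_inj_on[OF rank_bij[OF S]] that x1(1) rx by (auto simp: inj_on_def)
  show ?thesis unfolding sort_body_def
  proof (rule tri_Seq)
    show "tri S W (Assign ''x'' (Load ''Tr'' (N 1));; Store ''K0'' (V ''x'') (V ''v'');; Assign ''p'' (Plus (V ''N'') (V ''x''));;
      Store ''Tr'' (V ''p'') (V ''N'')) s 20 (\<lambda>s'. s' = ?s1)"
      by (rule tri_wp) (use s v W x1 nn in auto)
    fix s1 assume s1: "s1 = ?s1"
    have "tri S W (climb pullT) s1 ((H + 1) * (30 + 12)) (\<lambda>s'. fst s' ''n'' = length S \<and> (\<forall>u. 1 \<le> u \<longrightarrow> u < nn \<longrightarrow> consT S s' u) \<and>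
     (\<forall>a i. nn \<le> i \<longrightarrow> snd s' a i = snd s1 a i))"
    proof (rule climb_correct[OF nn(1) local_consT pullT_ok])
      show "2 * nn \<le> W" "1 \<le> W" "2 \<le> W" using W by auto
      show "fst s1 ''p'' = nn + ?x" "nn + ?x < 2 * nn" "fst s1 ''n'' = length S" using s1 s x1 nn by auto
      show "consT S s1 u" if "1 \<le> u" "u < nn" "u \<noteq> (nn + ?x) div 2" for u
        using c[OF that(1,2)] that s1 by (auto simp: consT_def)
    qed (auto simp: consT_def)
    then show "tri S W (climb pullT) s1 ((H + 1) * 42) (sort_inv S nn (Suc v))"
    proof (rule tri_conseq)
      fix s2 assume 2: "fst s2 ''n'' = length S \<and> (\<forall>u. 1 \<le> u \<longrightarrow> u < nn \<longrightarrow> consT S s2 u) \<and>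
        (\<forall>a i. nn \<le> i \<longrightarrow> snd s2 a i = snd s1 a i)"
        and f2: "\<And>x. x \<notin> arrs (climb pullT) \<Longrightarrow> snd s2 x = snd s1 x"
      have "snd s2 ''K0'' = snd s1 ''K0''" using f2 by simp
      then show "sort_inv S nn (Suc v) s2"
        using 2 s1 I x1(1) inj rx unfolding sort_inv_def
        by (auto simp: less_Suc_eq split: if_splits)
    qed simp
  qed simp
qed

lemma sort_correct:
  assumes S: "distinct S" and nn: "nn = 2 ^ H" "length S \<le> nn"
    and s: "fst s0 ''N'' = nn" "fst s0 ''n'' = length S" and W: "2 * nn \<le> W" "2 \<le> W"
  shows "tri S W sort_prog s0 (200 * (H + 1) * (nn + 1)) (\<lambda>s. \<forall>p<nn. snd s ''K0'' p = (if p < length S then rank S p else p))"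
    (is "tri S W _ _ _ ?Q")
  unfolding sort_prog_def
proof (rule tri_Seq)
  have nn1: "1 \<le> nn" using nn by simp
  show "tri S W (Assign ''i'' (N 0)) s0 2 (\<lambda>s. s = ((fst s0)(''i'' := 0), snd s0))"
    by (rule tri_wp) auto
  fix s1 assume s1: "s1 = ((fst s0)(''i'' := 0), snd s0)"
  let ?init = "For ''i'' ''N'' (Store ''Tr'' (Plus (V ''N'') (V ''i'')) (V ''i'');; Store ''K0'' (V ''i'') (V ''i''))"
  let ?up = "While (Less (N 0) (V ''p'')) (pullT;; Assign ''p'' (Minus (V ''p'') (N 1)))"
  show "tri S W (?init;; Assign ''p'' (Minus (V ''N'') (N 1));; ?up;; Assign ''v'' (N 0);; For ''v'' ''n'' sort_body) s1
    (20 * (nn + 1) + (4 + (40 * (nn + 1) + (2 + (nn + 1) * ((H + 1) * 78))))) ?Q"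
  proof (rule tri_Seq)
    show "tri S W ?init s1 (20 * (nn + 1)) (\<lambda>s. \<forall>i<nn. snd s ''Tr'' (nn + i) = i \<and> snd s ''K0'' i = i)"
      by (rule tri_For[where I="\<lambda>i s. \<forall>j<i. snd s ''Tr'' (nn + j) = j \<and> snd s ''K0'' j = j" and a=0 and b=nn and B=12])
        (use s1 s W in \<open>auto intro!: tri_wp simp: less_Suc_eq\<close>)
    fix s2 assume s2: "\<forall>i<nn. snd s2 ''Tr'' (nn + i) = i \<and> snd s2 ''K0'' i = i"
      and f2: "\<And>x. x \<notin> regs ?init \<Longrightarrow> fst s2 x = fst s1 x"
    have r2: "fst s2 ''N'' = nn" "fst s2 ''n'' = length S" using f2 s1 s by simp_all
    show "tri S W (Assign ''p'' (Minus (V ''N'') (N 1));; ?up;; Assign ''v'' (N 0);; For ''v'' ''n'' sort_body) s2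
      (4 + (40 * (nn + 1) + (2 + (nn + 1) * ((H + 1) * 78)))) ?Q"
    proof (rule tri_Seq)
      show "tri S W (Assign ''p'' (Minus (V ''N'') (N 1))) s2 4 (\<lambda>s. s = ((fst s2)(''p'' := nn - 1), snd s2))"
        by (rule tri_wp) (use r2 W in auto)
      fix s3 assume s3: "s3 = ((fst s2)(''p'' := nn - 1), snd s2)"
      show "tri S W (?up;; Assign ''v'' (N 0);; For ''v'' ''n'' sort_body) s3 (40 * (nn + 1) + (2 + (nn + 1) * ((H + 1) * 78))) ?Q"
      proof (rule tri_Seq)
        let ?I = "\<lambda>k s. fst s ''p'' = k \<and> k < nn \<and> fst s ''N'' = nn \<and> fst s ''n'' = length S \<and>
           (\<forall>i<nn. snd s ''Tr'' (nn + i) = i \<and> snd s ''K0'' i = i) \<and> (\<forall>u. k < u \<longrightarrow> u < nn \<longrightarrow> consT S s u)"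
        show "tri S W ?up s3 (40 * (nn + 1)) (\<lambda>s. fst s ''N'' = nn \<and> fst s ''n'' = length S \<and> sort_inv S nn 0 s)"
        proof (rule tri_While[where I = ?I and n = "nn - 1" and B = 34])
          show "?I (nn - 1) s3" using s3 s2 r2 nn1 by auto
          fix k s assume I: "?I k s"
          show "bfits S W s (Less (N 0) (V ''p'')) \<and>
            (bval S s (Less (N 0) (V ''p'')) \<longrightarrow> 0 < k \<and> tri S W (pullT;; Assign ''p'' (Minus (V ''p'') (N 1))) s 34 (\<lambda>s'. \<exists>m<k. ?I m s')) \<and>
            (\<not> bval S s (Less (N 0) (V ''p'')) \<longrightarrow> fst s ''N'' = nn \<and> fst s ''n'' = length S \<and> sort_inv S nn 0 s)"
          proof (intro conjI impI)
            assume "bval S s (Less (N 0) (V ''p''))"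
            then show k: "0 < k" using I by simp
            show "tri S W (pullT;; Assign ''p'' (Minus (V ''p'') (N 1))) s 34 (\<lambda>s'. \<exists>m<k. ?I m s')"
            proof (rule tri_Seq)
              show "tri S W pullT s 30 (\<lambda>s'. fst s' ''p'' = k \<and> fst s' ''n'' = length S \<and> consT S s' k \<and> (\<forall>a i. i \<noteq> k \<longrightarrow> snd s' a i = snd s a i))"
              proof -
                have "pull_ok S W nn pullT 30 (\<lambda>s. fst s ''n'' = length S) (consT S)" by (rule pullT_ok) (use W in auto)
                then show ?thesis using I k unfolding pull_ok_def by (elim allE[of _ s] allE[of _ k]) simp
              qed
              fix s4 assume 4: "fst s4 ''p'' = k \<and> fst s4 ''n'' = length S \<and> consT S s4 k \<and> (\<forall>a i. i \<noteq> k \<longrightarrow> snd s4 a i = snd s a i)"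
                and f4: "\<And>x. x \<notin> regs pullT \<Longrightarrow> fst s4 x = fst s x" "\<And>x. x \<notin> arrs pullT \<Longrightarrow> snd s4 x = snd s x"
              have cons: "consT S s4 u" if "k - 1 < u" "u < nn" for u
              proof (cases "u = k")
                case False
                then have "k < u" using that by simp
                then have "consT S s u" using I that by blast
                moreover have "snd s4 a i = snd s a i" if "k < i" for a i using 4 that by simp
                ultimately show ?thesis using \<open>k < u\<close> by (simp add: consT_def)
              qed (use 4 in simp)
              have "snd s4 ''K0'' = snd s ''K0''" "fst s4 ''N'' = nn" using f4 I by simp_all
              then have "?I (k - 1) ((fst s4)(''p'' := k - 1), snd s4)"
                using 4 I k cons by (auto simp: consT_def)
              then show "tri S W (Assign ''p'' (Minus (V ''p'') (N 1))) s4 4 (\<lambda>s'. \<exists>m<k. ?I m s')"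
                using 4 k W by (intro tri_wp) (auto intro!: exI[of _ "k - 1"])
            qed simp
          next
            assume "\<not> bval S s (Less (N 0) (V ''p''))"
            then show "fst s ''N'' = nn" "fst s ''n'' = length S" "sort_inv S nn 0 s" using I nn(2) by (auto simp: sort_inv_def)
          qed simp
        qed (use nn1 in simp)
        fix s4 assume 4: "fst s4 ''N'' = nn \<and> fst s4 ''n'' = length S \<and> sort_inv S nn 0 s4"
        show "tri S W (Assign ''v'' (N 0);; For ''v'' ''n'' sort_body) s4 (2 + (nn + 1) * ((H + 1) * 78)) ?Q"
        proof (rule tri_Seq)
          show "tri S W (Assign ''v'' (N 0)) s4 2 (\<lambda>s. s = ((fst s4)(''v'' := 0), snd s4))"
            by (rule tri_wp) auto
          fix s5 assume s5: "s5 = ((fst s4)(''v'' := 0), snd s4)"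
          show "tri S W (For ''v'' ''n'' sort_body) s5 ((nn + 1) * ((H + 1) * 78)) ?Q"
          proof (rule tri_For[where I="\<lambda>v s. fst s ''N'' = nn \<and> sort_inv S nn v s" and a=0 and b="length S" and B="(H + 1) * 70"])
            show "fst s5 ''N'' = nn \<and> sort_inv S nn 0 s5" using 4 s5 by (simp add: sort_inv_def consT_def)
            fix v s assume v: "v < length S" "fst s ''v'' = v" "fst s ''n'' = length S" and I: "fst s ''N'' = nn \<and> sort_inv S nn v s"
            have "tri S W sort_body s ((H + 1) * 70) (sort_inv S nn (Suc v))"
              by (rule sort_body_correct[OF S nn v(1,2) _ v(3) _ W]) (use I in auto)
            then show "tri S W sort_body s ((H + 1) * 70) (\<lambda>s'. fst s' ''v'' = v \<and> fst s' ''n'' = length S \<and>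
              fst ((fst s')(''v'' := Suc v), snd s') ''N'' = nn \<and> sort_inv S nn (Suc v) ((fst s')(''v'' := Suc v), snd s'))"
              by (rule tri_conseq) (use v I in \<open>auto simp: sort_body_def sort_inv_def consT_def\<close>)
          next
            fix s assume I: "fst s ''N'' = nn \<and> sort_inv S nn (length S) s"
            have "rank S p < length S" if "p < length S" for p using rank_bij[OF S] that by (auto dest: bij_betwE)
            then show "?Q s" using I by (auto simp: sort_inv_def)
          next
            have "length S - 0 + 1 \<le> nn + 1" using nn(2) by simp
            then show "(length S - 0 + 1) * ((H + 1) * 70 + 8) \<le> (nn + 1) * ((H + 1) * 78)" by (intro mult_le_mono) simp_all
          qed (use s5 4 nn W in auto)
        qed simp
      qed simp
    qed simp
  qed simp
next
  show "2 + (20 * (nn + 1) + (4 + (40 * (nn + 1) + (2 + (nn + 1) * ((H + 1) * 78))))) \<le> 200 * (H + 1) * (nn + 1)"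
    by (simp add: algebra_simps)
qed

section \<open>The dynamic program\<close>

text \<open>One program text serves both directions; the first character keeps their registers and
  arrays apart.\<close>

definition nm :: "string \<Rightarrow> bool \<Rightarrow> vname" where
  "nm x b = (if b then CHR ''I'' else CHR ''D'') # x"

lemma nm_eq [simp]: "nm x b = nm y b' \<longleftrightarrow> x = y \<and> b = b'"
  by (auto simp: nm_def)

lemma nm_Cons [simp]: "nm x b = a # y \<longleftrightarrow> a = (if b then CHR ''I'' else CHR ''D'') \<and> x = y"
    "a # y = nm x b \<longleftrightarrow> a = (if b then CHR ''I'' else CHR ''D'') \<and> x = y"
  by (auto simp: nm_def)

section \<open>A tree for prefix sums and their maximum\<close>

definition pullD :: "bool \<Rightarrow> com" where
  "pullD b =
     Store (nm ''c'' b) (V ''p'') (Plus (Load (nm ''c'' b) (Plus (V ''p'') (V ''p''))) (Load (nm ''c'' b) (Plus (Plus (V ''p'') (V ''p'')) (N 1))));;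
     Assign ''y'' (Plus (Load (nm ''c'' b) (Plus (V ''p'') (V ''p''))) (Load (nm ''b'' b) (Plus (Plus (V ''p'') (V ''p'')) (N 1))));;
     Cond (Less (V ''y'') (Load (nm ''b'' b) (Plus (V ''p'') (V ''p''))))
       (Store (nm ''b'' b) (V ''p'') (Load (nm ''b'' b) (Plus (V ''p'') (V ''p''))))
       (Store (nm ''b'' b) (V ''p'') (V ''y''))"

lemma regs_pullD [simp]: "regs (pullD b) = {''y''}" "arrs (pullD b) = {nm ''c'' b, nm ''b'' b}"
  by (auto simp: pullD_def)

text \<open>Solved downwards, \<open>c u\<close> is the sum of \<open>c\<close> over the leaves
  below \<open>u\<close>, and \<open>d u\<close> is the maximum over these leaves of their
  \<open>d\<close> plus the sum of \<open>c\<close> over the leaves strictly to the left. Increasing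
  \<open>c\<close> at one leaf thus raises all leaves to its right in constant time, up to the
  climb.\<close>

definition node :: "(nat \<Rightarrow> nat) \<Rightarrow> (nat \<Rightarrow> nat) \<Rightarrow> nat \<Rightarrow> bool" where
  "node c d u \<longleftrightarrow> c u = c (2*u) + c (2*u+1) \<and> d u = max (d (2*u)) (c (2*u) + d (2*u+1))"

text \<open>The weight \<open>u\<close> makes this bound inductive: a node gets at most the sum of its children.\<close>

definition bounded :: "nat \<Rightarrow> (nat \<Rightarrow> nat) \<Rightarrow> bool" where
  "bounded nn c \<longleftrightarrow> (\<forall>u. 1 \<le> u \<longrightarrow> u < 2 * nn \<longrightarrow> c u * u \<le> 2 * nn * (3 * nn))"

definition tree :: "nat \<Rightarrow> (nat \<Rightarrow> nat) \<Rightarrow> (nat \<Rightarrow> nat) \<Rightarrow> bool" where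
  "tree nn c d \<longleftrightarrow> (\<forall>u. 1 \<le> u \<longrightarrow> u < nn \<longrightarrow> node c d u) \<and> bounded nn c \<and> bounded nn d"

text \<open>During a climb the ancestors are stale, so their size cannot be inferred from the
  leaves, yet every sum must fit into a word. The weighted bound survives each single update:
  children of weight \<open>2*u\<close> and \<open>2*u+1\<close> give a sum of weight
  \<open>u\<close>. The left child may come from another array \<open>c'\<close>, because the update
  of \<open>d\<close> mixes the two.\<close>

lemma bounded_upd:
  assumes c: "bounded nn c" and u: "1 \<le> u" "u < nn" and x: "x \<le> c' (2*u) + c (2*u+1)" "bounded nn c'"
  shows "bounded nn (c(u := x))" "x \<le> 2 * nn * (3 * nn)"
proof -
  have "c' (2*u) * (2*u) \<le> 2 * nn * (3 * nn)" "c (2*u+1) * (2*u+1) \<le> 2 * nn * (3 * nn)"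
    using c[unfolded bounded_def, rule_format, of "2*u+1"] x(2)[unfolded bounded_def, rule_format, of "2*u"] u by simp_all
  then have "(c' (2*u) + c (2*u+1)) * u \<le> 2 * nn * (3 * nn)" by (simp add: algebra_simps)
  with mult_le_mono1[OF x(1), of u] have *: "x * u \<le> 2 * nn * (3 * nn)" by linarith
  then show "bounded nn (c(u := x))" using c by (auto simp: bounded_def)
  have "x * 1 \<le> x * u" using u by (intro mult_le_mono2) simp
  then show "x \<le> 2 * nn * (3 * nn)" using * by linarith
qed

lemma pullD_ok:
  assumes W: "6 * nn * nn \<le> W"
  shows "pull_ok S W nn (pullD b) 40 (\<lambda>s. bounded nn (snd s (nm ''c'' b)) \<and> bounded nn (snd s (nm ''b'' b)))
    (\<lambda>s. node (snd s (nm ''c'' b)) (snd s (nm ''b'' b)))"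
  unfolding pull_ok_def
proof (intro allI impI)
  fix s :: state and u assume p: "fst s ''p'' = u" and u: "1 \<le> u" "u < nn"
    and R: "bounded nn (snd s (nm ''c'' b)) \<and> bounded nn (snd s (nm ''b'' b))"
  let ?c = "snd s (nm ''c'' b)" let ?d = "snd s (nm ''b'' b)"
  have nn: "1 \<le> nn" "nn \<le> nn * nn" using u by auto
  have W': "2 * nn \<le> W" "1 \<le> W" using W nn unfolding mult.assoc by linarith+
  have c: "bounded nn (?c(u := ?c (2*u) + ?c (2*u+1)))" "?c (2*u) + ?c (2*u+1) \<le> W"
    using bounded_upd[of nn ?c u "?c (2*u) + ?c (2*u+1)" ?c] R u W by auto
  have d: "bounded nn (?d(u := ?c (2*u) + ?d (2*u+1)))" "?c (2*u) + ?d (2*u+1) \<le> W"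
    using bounded_upd[of nn ?d u "?c (2*u) + ?d (2*u+1)" ?c] R u W by auto
  have d': "bounded nn (?d(u := ?d (2*u)))"
    using bounded_upd(1)[of nn ?d u "?d (2*u)" ?d] R u by auto
  have e: "u + u = 2 * u" by simp
  show "tri S W (pullD b) s 40 (\<lambda>s'. fst s' ''p'' = u \<and> (bounded nn (snd s' (nm ''c'' b)) \<and> bounded nn (snd s' (nm ''b'' b))) \<and>
      node (snd s' (nm ''c'' b)) (snd s' (nm ''b'' b)) u \<and> (\<forall>a i. i \<noteq> u \<longrightarrow> snd s' a i = snd s a i))"
    using c d d' p u W' by (intro tri_wp) (auto simp: pullD_def node_def e)
qed

lemma climbD_correct:
  assumes nn: "nn = 2 ^ H" and W: "6 * nn * nn \<le> W" "2 \<le> W"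
    and tree: "tree nn c d" and x: "x < nn" "e \<le> 3 * nn" "f \<le> 3 * nn"
    and s: "fst s ''p'' = nn + x" "snd s (nm ''c'' b) = c(nn + x := e)" "snd s (nm ''b'' b) = d(nn + x := f)"
  shows "tri S W (climb (pullD b)) s ((H + 1) * 52)
    (\<lambda>s'. tree nn (snd s' (nm ''c'' b)) (snd s' (nm ''b'' b)) \<and> (\<forall>a i. nn \<le> i \<longrightarrow> snd s' a i = snd s a i))"
proof -
  have mul: "g * (nn + x) \<le> 2 * nn * (3 * nn)" if "g \<le> 3 * nn" for g
    using mult_le_mono[OF that, of "nn + x" "2 * nn"] x(1) by (simp add: mult.commute)
  have "tri S W (climb (pullD b)) s ((H + 1) * (40 + 12))
    (\<lambda>s'. (bounded nn (snd s' (nm ''c'' b)) \<and> bounded nn (snd s' (nm ''b'' b))) \<and>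
      (\<forall>u. 1 \<le> u \<longrightarrow> u < nn \<longrightarrow> node (snd s' (nm ''c'' b)) (snd s' (nm ''b'' b)) u) \<and> (\<forall>a i. nn \<le> i \<longrightarrow> snd s' a i = snd s a i))"
  proof (rule climb_correct[OF nn _ pullD_ok[OF W(1)]])
    show "local_cons (\<lambda>s. node (snd s (nm ''c'' b)) (snd s (nm ''b'' b)))"
      unfolding local_cons_def node_def by (metis insert_iff)
    show "fst s ''p'' = nn + x" "nn + x < 2 * nn" "2 \<le> W" using s x W by auto
    show "bounded nn (snd s (nm ''c'' b)) \<and> bounded nn (snd s (nm ''b'' b))"
      unfolding s(2,3) using tree mul[OF x(2)] mul[OF x(3)] by (auto simp: tree_def bounded_def)
    fix u assume u: "1 \<le> u" "u < nn" "u \<noteq> (nn + x) div 2"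
    then have "2 * u \<noteq> nn + x" "2 * u + 1 \<noteq> nn + x" by auto
    then show "node (snd s (nm ''c'' b)) (snd s (nm ''b'' b)) u"
      unfolding s(2,3) using tree u by (auto simp: tree_def node_def)
  qed auto
  then show ?thesis by (rule tri_conseq) (auto simp: tree_def)
qed

lemma tree_node:
  assumes nn: "nn = 2 ^ H" and tree: "tree nn c d"
  shows "h \<le> H \<Longrightarrow> 1 \<le> u \<Longrightarrow> u < 2 ^ (H - h + 1) \<Longrightarrow>
    c u = (\<Sum>y<2^h. c (u * 2^h + y)) \<and>
    (\<exists>x<2^h. d u = (\<Sum>y<x. c (u * 2^h + y)) + d (u * 2^h + x)) \<and>
    (\<forall>x<2^h. (\<Sum>y<x. c (u * 2^h + y)) + d (u * 2^h + x) \<le> d u)"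
proof (induction h arbitrary: u)
  case (Suc h)
  have u: "u < 2 ^ (H - h)" using Suc.prems by (metis Suc_diff_Suc Suc_eq_plus1 Suc_le_lessD)
  moreover have "(2::nat) ^ (H - h) \<le> 2 ^ H" by (intro power_increasing) auto
  ultimately have "u < nn" unfolding nn by linarith
  then have n: "node c d u" using tree Suc.prems by (simp add: tree_def)
  have "2*u < 2 ^ (H - h + 1)" "2*u+1 < 2 ^ (H - h + 1)" using u by auto
  note u2 = this
  define v where "v = u * 2 ^ Suc h"
  have e: "2*u * 2^h = v" "(2*u+1) * 2^h = v + 2^h" by (simp_all add: v_def algebra_simps)
  have l: "c (2*u) = (\<Sum>y<2^h. c (2*u * 2^h + y)) \<and>
    (\<exists>x<2^h. d (2*u) = (\<Sum>y<x. c (2*u * 2^h + y)) + d (2*u * 2^h + x)) \<and>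
    (\<forall>x<2^h. (\<Sum>y<x. c (2*u * 2^h + y)) + d (2*u * 2^h + x) \<le> d (2*u))"
   and r: "c (2*u+1) = (\<Sum>y<2^h. c ((2*u+1) * 2^h + y)) \<and>
    (\<exists>x<2^h. d (2*u+1) = (\<Sum>y<x. c ((2*u+1) * 2^h + y)) + d ((2*u+1) * 2^h + x)) \<and>
    (\<forall>x<2^h. (\<Sum>y<x. c ((2*u+1) * 2^h + y)) + d ((2*u+1) * 2^h + x) \<le> d (2*u+1))"
    by (rule Suc.IH; use u2 Suc.prems in simp)+
  note l = l[unfolded e] and r = r[unfolded e]
  have p2: "(2::nat)^Suc h = 2^h + 2^h" by simp
  have add: "(\<Sum>y<2^h + x. c (v + y)) = c (2*u) + (\<Sum>y<x. c (v + 2^h + y))" for x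
  proof -
    have "(\<Sum>y<2^h + x. c (v + y)) = (\<Sum>y<2^h. c (v + y)) + (\<Sum>y=2^h..<2^h + x. c (v + y))"
      by (simp add: sum.atLeastLessThan_concat lessThan_atLeast0)
    moreover have "(\<Sum>y=2^h..<2^h + x. c (v + y)) = (\<Sum>y<x. c (v + 2^h + y))"
      using sum.shift_bounds_nat_ivl[of "\<lambda>y. c (v + y)" 0 "2^h" x] by (simp add: lessThan_atLeast0 algebra_simps)
    ultimately show ?thesis using l by simp
  qed
  show ?case unfolding v_def[symmetric] unfolding p2
  proof (intro conjI)
    show "c u = (\<Sum>y<2^h + 2^h. c (v + y))" unfolding add using n r by (simp add: node_def)
    obtain x1 where x1: "x1 < 2^h" "d (2*u) = (\<Sum>y<x1. c (v + y)) + d (v + x1)" using l by blast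
    obtain x2 where x2: "x2 < 2^h" "d (2*u+1) = (\<Sum>y<x2. c (v + 2^h + y)) + d (v + 2^h + x2)" using r by blast
    show "\<exists>x<2^h + 2^h. d u = (\<Sum>y<x. c (v + y)) + d (v + x)"
    proof (cases "d u = d (2*u)")
      case True
      then show ?thesis using x1 by (intro exI[of _ x1]) simp
    next
      case False
      then have "d u = c (2*u) + d (2*u+1)" using n unfolding node_def by linarith
      then show ?thesis using x2 add[of x2] by (intro exI[of _ "2^h + x2"]) (simp add: add.assoc)
    qed
    show "\<forall>x<2^h + 2^h. (\<Sum>y<x. c (v + y)) + d (v + x) \<le> d u"
    proof (intro allI impI)
      fix x :: nat assume x: "x < 2^h + 2^h"
      have du: "d (2*u) \<le> d u" "c (2*u) + d (2*u+1) \<le> d u" using n by (simp_all add: node_def)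
      show "(\<Sum>y<x. c (v + y)) + d (v + x) \<le> d u"
      proof (cases "x < 2^h")
        case True
        then have "(\<Sum>y<x. c (v + y)) + d (v + x) \<le> d (2*u)" using l by blast
        then show ?thesis using du by linarith
      next
        case False
        then obtain y where y: "x = 2^h + y" by (metis le_iff_add not_less)
        then have "y < 2^h" using x by simp
        then have "(\<Sum>z<y. c (v + 2^h + z)) + d (v + 2^h + y) \<le> d (2*u+1)" using r by blast
        then show ?thesis using du unfolding y add by (simp add: add.assoc)
      qed
    qed
  qed
qed simp

lemma tree_root:
  assumes nn: "nn = 2 ^ H" and tree: "tree nn c d"
  shows "\<exists>x<nn. d 1 = (\<Sum>y<x. c (nn + y)) + d (nn + x)" and "x < nn \<Longrightarrow> (\<Sum>y<x. c (nn + y)) + d (nn + x) \<le> d 1"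
  using tree_node[OF nn tree, of H 1] nn by auto

section \<open>Chain lengths as prefix counts\<close>

lemma lis_mono: "l' \<le> l \<Longrightarrow> r \<le> r' \<Longrightarrow> lis a l r \<le> lis a l' r'"
proof -
  assume *: "l' \<le> l" "r \<le> r'"
  obtain C where C: "C \<subseteq> {l..<r}" "strict_mono_on C a" "card C = lis a l r" using lis_attained by metis
  have "C \<subseteq> {l'..<r'}" using C(1) * by auto
  from lis_ge[OF this C(2)] C(3) show ?thesis by simp
qed

context
  fixes nn rk D T assumes d: "deaths nn rk D T"
begin

lemma deaths_born: assumes lr: "l \<le> r" "r \<le> nn" shows "card {q. q < r \<and> T q \<le> l} = l + lis rk l r"
proof -
  have T: "T q \<le> l \<longleftrightarrow> (\<forall>i<nn. l \<le> i \<longrightarrow> D i \<noteq> q)" if "q < r" for q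
    using d that lr unfolding deaths_def by auto
  let ?X = "{i\<in>{l..<nn}. D i < r}"
  have inj: "inj_on D ?X" using d unfolding deaths_def by (auto intro: inj_on_subset)
  have "{q. q < r \<and> T q \<le> l} = {..<r} - D ` ?X" using T by auto
  moreover have "card ({..<r} - D ` ?X) = r - card ?X"
    using card_Diff_subset[of "D ` ?X" "{..<r}"] card_image[OF inj] by auto
  moreover have "card ?X = (r - l) - lis rk l r" using d lr unfolding deaths_def by auto
  ultimately show ?thesis using lis_le[of rk l r] lr by simp
qed

lemma deaths_step_l: assumes lr: "l < r" "r \<le> nn" shows "lis rk l r = lis rk (Suc l) r + (if D l < r then 0 else 1)"
proof -
  have c: "card {i\<in>{l..<nn}. D i < r} = (r - l) - lis rk l r" "card {i\<in>{Suc l..<nn}. D i < r} = (r - Suc l) - lis rk (Suc l) r"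
    using d lr unfolding deaths_def by auto
  have "{i\<in>{l..<nn}. D i < r} = {i\<in>{Suc l..<nn}. D i < r} \<union> (if D l < r then {l} else {})"
    using lr by (auto simp: le_less Suc_le_eq)
  then have "card {i\<in>{l..<nn}. D i < r} = card {i\<in>{Suc l..<nn}. D i < r} + (if D l < r then 1 else 0)" by auto
  then show ?thesis using c lis_le[of rk l r] lis_le[of rk "Suc l" r] lr by (auto split: if_splits)
qed

text \<open>By \<open>deaths_born\<close> both chain lengths are counts of thresholds, and these
  counts differ in column \<open>r\<close> only. So \<open>T r\<close> is the start from which on
  windows profit from the element \<open>r\<close>.\<close>

lemma deaths_step_r: assumes lr: "l \<le> r" "r < nn" shows "lis rk l (Suc r) = lis rk l r + (if T r \<le> l then 1 else 0)"
proof -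
  have "{q. q < Suc r \<and> T q \<le> l} = {q. q < r \<and> T q \<le> l} \<union> (if T r \<le> l then {r} else {})"
    by (auto simp: less_Suc_eq)
  then have "card {q. q < Suc r \<and> T q \<le> l} = card {q. q < r \<and> T q \<le> l} + (if T r \<le> l then 1 else 0)" by auto
  then show ?thesis using deaths_born[of l r] deaths_born[of l "Suc r"] lr by auto
qed

text \<open>The window consisting of \<open>r\<close> alone profits from the element
  \<open>r\<close>, so its start is not below the threshold.\<close>

lemma deaths_T_le: assumes "r < nn" shows "T r \<le> r"
proof -
  have "1 \<le> lis rk r (Suc r)" using lis_ge[of "{r}" r "Suc r" rk] by (simp add: monotone_on_def)
  then show ?thesis using deaths_step_r[of r r] lis_le[of rk r r] assms by (auto split: if_splits)
qed

end

section \<open>The recursion on the tree\<close>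

text \<open>
  A start \<open>l\<close> is activated once a monotone sequence from \<open>l\<close> has length \<open>k\<close>; from then on it contributes
  \<open>nn - l + max 1 (opt (\<not> b) k S (Suc l))\<close> to its leaf, where the shift by \<open>nn - l\<close> turns the number \<open>l + lis rk l r\<close>
  of elements counted left of the leaf into \<open>nn + lis rk l r\<close>. So inactive starts stay below the active ones.
\<close>

definition gain :: "nat \<Rightarrow> nat \<Rightarrow> real list \<Rightarrow> bool \<Rightarrow> nat \<Rightarrow> nat \<Rightarrow> nat" where
  "gain nn k S b J l = (if l < J then nn - l + max 1 (opt (\<not> b) k S (Suc l)) else 0)"

text \<open>\<open>J\<close> is the first inactive start and \<open>u\<close> the chain length it
  has attained. Chain lengths fall with the start, so watching \<open>J\<close> alone suffices. That
  \<open>u\<close> never exceeds \<open>k\<close> reflects that starts are activated before a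
  further element is added.\<close>

definition side :: "nat \<Rightarrow> nat \<Rightarrow> real list \<Rightarrow> bool \<Rightarrow> (nat \<Rightarrow> nat) \<Rightarrow> nat \<Rightarrow> (nat \<Rightarrow> nat) \<Rightarrow> (nat \<Rightarrow> nat) \<Rightarrow>
    (nat \<Rightarrow> nat) \<Rightarrow> (nat \<Rightarrow> nat) \<Rightarrow> nat \<Rightarrow> nat \<Rightarrow> bool" where
  "side nn k S b rk r c d D T J u \<longleftrightarrow> tree nn c d \<and> deaths nn rk D T \<and>
     (\<forall>l<nn. c (nn + l) = card {q. q < r \<and> T q = l} \<and> d (nn + l) = card {q. q < r \<and> T q = l} + gain nn k S b J l) \<and>
     J \<le> r \<and> u = lis rk J r \<and> u \<le> k \<and> (\<forall>l<J. k \<le> lis rk l r)"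

abbreviation "side_at nn k S b rk r s \<equiv> side nn k S b rk r (snd s (nm ''c'' b)) (snd s (nm ''b'' b))
  (snd s (nm ''D'' b)) (snd s (nm ''T'' b)) (fst s (nm ''J'' b)) (fst s (nm ''u'' b))"

lemma opt_le: "opt b k S r \<le> r"
proof (rule opt_attained[of b k S r])
  fix ys assume "subseq ys (take r S)" "opt b k S r = length ys"
  then show ?thesis using list_emb_length[of "(=)" ys "take r S"] by simp
qed simp

lemma side_sum:
  assumes sd: "side nn k S b rk r c d D T J u" and l: "l < nn"
  shows "(\<Sum>y<l. c (nn + y)) + d (nn + l) = card {q. q < r \<and> T q \<le> l} + gain nn k S b J l"
proof -
  have e: "c (nn + y) = card {q. q < r \<and> T q = y}" if "y < nn" for y using sd that by (simp add: side_def)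
  have "(\<Sum>y<Suc l. c (nn + y)) = (\<Sum>y<Suc l. card {q. q < r \<and> T q = y})"
    by (rule sum.cong) (use e l in auto)
  also have "\<dots> = card (\<Union>y\<in>{..<Suc l}. {q. q < r \<and> T q = y})"
    by (rule card_UN_disjoint[symmetric]) auto
  also have "(\<Union>y\<in>{..<Suc l}. {q. q < r \<and> T q = y}) = {q. q < r \<and> T q \<le> l}" by auto
  finally show ?thesis using sd l by (simp add: side_def)
qed

text \<open>By \<open>u < k\<close> every start with chain length at least \<open>k\<close> is
  active. An active leaf evaluates to
  \<open>nn + lis rk l r + max 1 (opt (\<not> b) k S (Suc l))\<close>, an inactive one to at most
  \<open>nn\<close>. The truncated subtraction of \<open>nn + 1\<close> therefore yields the maximum
  of the recursion, or 0 if no start is active.\<close>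

lemma side_rec:
  assumes nn: "nn = 2 ^ H" "length S \<le> nn" and S: "distinct S" and k: "3 \<le> k" and r: "r \<le> length S"
    and rk: "\<And>p q. p < length S \<Longrightarrow> q < length S \<Longrightarrow> rk p < rk q \<longleftrightarrow> lt b (S ! p) (S ! q)"
    and sd: "side nn k S b rk r c d D T J u" and u: "u < k"
  shows "d 1 - (nn + 1) = opt b k S r"
proof -
  have de: "deaths nn rk D T" and tr: "tree nn c d" and J: "J \<le> r" "u = lis rk J r" "\<And>l. l < J \<Longrightarrow> k \<le> lis rk l r"
    using sd by (auto simp: side_def)
  have lw: "lisw b S l r = lis rk l r" if "l \<le> r" for l by (rule lisw_eq_lis[OF rk]) (use that r in auto)
  have val: "(\<Sum>y<l. c (nn + y)) + d (nn + l) = nn + lis rk l r + max 1 (opt (\<not> b) k S (Suc l))" if "l < J" for l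
    using side_sum[OF sd, of l] deaths_born[OF de, of l r] that J r nn by (simp add: gain_def)
  have val0: "(\<Sum>y<l. c (nn + y)) + d (nn + l) \<le> nn" if "\<not> l < J" "l < nn" for l
  proof -
    have "card {q. q < r \<and> T q \<le> l} \<le> r" using card_mono[of "{..<r}" "{q. q < r \<and> T q \<le> l}"] by auto
    then show ?thesis using side_sum[OF sd that(2)] that r nn by (simp add: gain_def)
  qed
  show ?thesis
  proof (rule antisym)
    obtain l where l: "l < nn" "d 1 = (\<Sum>y<l. c (nn + y)) + d (nn + l)" using tree_root(1)[OF nn(1) tr] by blast
    show "d 1 - (nn + 1) \<le> opt b k S r"
    proof (cases "l < J")
      case True
      then have "max 1 (opt (\<not> b) k S (Suc l)) + lisw b S l r - 1 \<le> opt b k S r"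
        using J lw[of l] by (intro opt_lower[OF S k _ r]) auto
      then show ?thesis using l(2) val[OF True] lw[of l] True J by simp
    next
      case False
      then show ?thesis using val0[OF False l(1)] l(2) by simp
    qed
    show "opt b k S r \<le> d 1 - (nn + 1)"
    proof (rule opt_attained[of b k S r])
      fix ys assume ys: "subseq ys (take r S)" "ends b k ys" "opt b k S r = length ys"
      obtain l where l: "l < r" "k \<le> lisw b S l r" "length ys \<le> max 1 (opt (\<not> b) k S (Suc l)) + lisw b S l r - 1"
        using opt_upper[OF S ys(1,2) r] by blast
      have "l < J"
      proof (rule ccontr)
        assume "\<not> l < J"
        then have "lis rk l r \<le> lis rk J r" by (intro lis_mono) auto
        then show False using l lw[of l] J u by simp
      qed
      then have "nn + lis rk l r + max 1 (opt (\<not> b) k S (Suc l)) \<le> d 1"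
        using tree_root(2)[OF nn(1) tr, of l] val[of l] l r nn(2) by simp
      then show ?thesis using l ys lw[of l] by simp
    qed simp
  qed
qed

text \<open>Replacing \<open>x = 0\<close> by 1 realizes \<open>max 1\<close>. Array
  \<open>D\<close> serves to update \<open>u\<close>: by \<open>deaths_step_l\<close> it tells
  whether moving the start from \<open>J\<close> to \<open>J + 1\<close> costs an element of the
  chain.\<close>

definition activate :: "bool \<Rightarrow> com" where
  "activate b =
     (Assign ''p'' (Plus (V ''N'') (V (nm ''J'' b)));; Assign ''x'' (Load (nm ''F'' (\<not> b)) (Plus (V (nm ''J'' b)) (N 1)));;
      Cond (Less (N 0) (V ''x'')) Skip (Assign ''x'' (N 1));;
      Store (nm ''b'' b) (V ''p'') (Plus (Load (nm ''b'' b) (V ''p'')) (Plus (Minus (V ''N'') (V (nm ''J'' b))) (V ''x''))));;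
     climb (pullD b);;
     Cond (Less (Load (nm ''D'' b) (V (nm ''J'' b))) (V ''r'')) Skip (Assign (nm ''u'' b) (Minus (V (nm ''u'' b)) (N 1)));;
     Assign (nm ''J'' b) (Plus (V (nm ''J'' b)) (N 1))"

definition append_elem :: "bool \<Rightarrow> com" where
  "append_elem b =
     (Assign ''x'' (Load (nm ''T'' b) (V ''r''));; Assign ''p'' (Plus (V ''N'') (V ''x''));;
      Store (nm ''c'' b) (V ''p'') (Plus (Load (nm ''c'' b) (V ''p'')) (N 1));;
      Store (nm ''b'' b) (V ''p'') (Plus (Load (nm ''b'' b) (V ''p'')) (N 1)));;
     climb (pullD b);;
     Cond (Less (V (nm ''J'' b)) (Load (nm ''T'' b) (V ''r''))) Skip (Assign (nm ''u'' b) (Plus (V (nm ''u'' b)) (N 1)))"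

lemma regs_activate [simp]: "regs (activate b) = {''p'', ''x'', ''y'', nm ''u'' b, nm ''J'' b}" "arrs (activate b) = {nm ''c'' b, nm ''b'' b}"
  by (auto simp: activate_def)

lemma regs_append [simp]: "regs (append_elem b) = {''p'', ''x'', ''y'', nm ''u'' b}" "arrs (append_elem b) = {nm ''c'' b, nm ''b'' b}"
  by (auto simp: append_elem_def)

text \<open>At most \<open>r\<close> elements have been counted and a gain is at most
  \<open>2 * nn\<close>. The strict versions leave room for the increment of the next
  element.\<close>

lemma leaf_le:
  assumes sd: "side nn k S b rk r c d D T J u" and l: "l < nn" and r: "r \<le> nn"
  shows "c (nn + l) \<le> nn" "d (nn + l) \<le> 3 * nn" "J \<le> l \<Longrightarrow> d (nn + l) \<le> nn"
    and "T r = l \<Longrightarrow> r < nn \<Longrightarrow> c (nn + l) < nn" "T r = l \<Longrightarrow> r < nn \<Longrightarrow> d (nn + l) < 3 * nn"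
proof -
  have le: "card {q. q < r \<and> T q = l} \<le> r" using card_mono[of "{..<r}" "{q. q < r \<and> T q = l}"] by auto
  have g: "gain nn k S b J l \<le> 2 * nn" using opt_le[of "\<not> b" k S "Suc l"] l by (auto simp: gain_def)
  have g0: "J \<le> l \<Longrightarrow> gain nn k S b J l = 0" by (simp add: gain_def)
  have "c (nn + l) = card {q. q < r \<and> T q = l}" "d (nn + l) = card {q. q < r \<and> T q = l} + gain nn k S b J l"
    using sd l by (auto simp: side_def)
  then show "c (nn + l) \<le> nn" "d (nn + l) \<le> 3 * nn" "J \<le> l \<Longrightarrow> d (nn + l) \<le> nn"
    "T r = l \<Longrightarrow> r < nn \<Longrightarrow> c (nn + l) < nn" "T r = l \<Longrightarrow> r < nn \<Longrightarrow> d (nn + l) < 3 * nn"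
    using le g g0 r by linarith+
qed

lemma activate_correct:
  assumes nn: "nn = 2 ^ H" and k: "3 \<le> k" and W: "6 * nn * nn \<le> W" "2 \<le> W"
    and s: "fst s ''N'' = nn" "fst s ''r'' = r" "r \<le> nn" and sd: "side_at nn k S b rk r s"
    and u: "\<not> fst s (nm ''u'' b) < k" and F: "\<And>q. q < r \<Longrightarrow> snd s (nm ''F'' (\<not> b)) q = opt (\<not> b) k S q"
  shows "tri S W (activate b) s ((H + 1) * 52 + 60) (\<lambda>s'. side_at nn k S b rk r s' \<and> fst s' (nm ''J'' b) = Suc (fst s (nm ''J'' b)))"
    and "fst s (nm ''J'' b) < r"
proof -
  let ?c = "snd s (nm ''c'' b)" let ?d = "snd s (nm ''b'' b)" let ?D = "snd s (nm ''D'' b)" let ?T = "snd s (nm ''T'' b)"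
  define J where "J = fst s (nm ''J'' b)"
  define v where "v = fst s (nm ''u'' b)"
  have sd': "side nn k S b rk r ?c ?d ?D ?T J v" using sd by (simp add: J_def v_def)
  have J: "J \<le> r" "v = lis rk J r" "v = k" "\<And>l. l < J \<Longrightarrow> k \<le> lis rk l r" and tr: "tree nn ?c ?d" and de: "deaths nn rk ?D ?T"
    and lf: "\<And>l. l < nn \<Longrightarrow> ?c (nn + l) = card {q. q < r \<and> ?T q = l} \<and> ?d (nn + l) = card {q. q < r \<and> ?T q = l} + gain nn k S b J l"
    using sd' u unfolding v_def[symmetric] by (auto simp: side_def)
  \<comment> \<open>A window with a chain of length \<open>k \<ge> 3\<close> has at least three
    elements. Hence \<open>Suc J < r\<close>, and the value
    \<open>opt (\<not> b) k S (Suc J)\<close> has already been recorded.\<close>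
  have J3: "J + 3 \<le> r" using lis_le[of rk J r] J k by linarith
  then show "fst s (nm ''J'' b) < r" by (simp add: J_def)
  have Jn: "J < nn" using J3 s(3) by simp
  have nn1: "3 \<le> nn" "3 * nn \<le> nn * nn" using J3 s(3) by auto
  then have W': "6 * nn \<le> W" "2 * nn \<le> W" "J + 1 \<le> W" "nn \<le> W" using W Jn unfolding mult.assoc by linarith+
  define f where "f = max 1 (opt (\<not> b) k S (Suc J))"
  have FJ: "snd s (nm ''F'' (\<not> b)) (Suc J) = opt (\<not> b) k S (Suc J)" using F[of "Suc J"] J3 by simp
  have f: "f \<le> nn" using opt_le[of "\<not> b" k S "Suc J"] Jn nn1 by (simp add: f_def)
  have dJ: "?d (nn + J) \<le> nn" using leaf_le(3)[OF sd' Jn s(3)] by simp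
  define e where "e = ?d (nn + J) + (nn - J + f)"
  have e: "e \<le> 3 * nn" using dJ f by (simp add: e_def)
  let ?pre = "Assign ''p'' (Plus (V ''N'') (V (nm ''J'' b)));; Assign ''x'' (Load (nm ''F'' (\<not> b)) (Plus (V (nm ''J'' b)) (N 1)));;
      Cond (Less (N 0) (V ''x'')) Skip (Assign ''x'' (N 1));;
      Store (nm ''b'' b) (V ''p'') (Plus (Load (nm ''b'' b) (V ''p'')) (Plus (Minus (V ''N'') (V (nm ''J'' b))) (V ''x'')))"
  let ?s1 = "\<lambda>s1. fst s1 ''p'' = nn + J \<and> snd s1 (nm ''b'' b) (nn + J) = e \<and> (\<forall>i. i \<noteq> nn + J \<longrightarrow> snd s1 (nm ''b'' b) i = ?d i)"
  have step: "lis rk J r = lis rk (Suc J) r + (if ?D J < r then 0 else 1)"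
    by (rule deaths_step_l[OF de]) (use J3 s(3) in auto)
  show "tri S W (activate b) s ((H + 1) * 52 + 60) (\<lambda>s'. side_at nn k S b rk r s' \<and> fst s' (nm ''J'' b) = Suc (fst s (nm ''J'' b)))"
    unfolding activate_def
  proof (rule tri_Seq)
    show "tri S W ?pre s 40 ?s1"
      using s(1) W W' Jn FJ f e unfolding e_def f_def
      by (intro tri_wp) (auto simp: J_def[symmetric] max_def Suc_le_eq split: if_splits)
    fix s1 assume s1: "?s1 s1" and f1: "\<And>x. x \<notin> regs ?pre \<Longrightarrow> fst s1 x = fst s x" "\<And>x. x \<notin> arrs ?pre \<Longrightarrow> snd s1 x = snd s x"
    have r1: "fst s1 (nm ''J'' b) = J" "fst s1 (nm ''u'' b) = v" "fst s1 ''r'' = r" using f1 s by (simp_all add: J_def v_def)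
    have a1: "snd s1 (nm ''c'' b) = ?c" "snd s1 (nm ''D'' b) = ?D" "snd s1 (nm ''T'' b) = ?T" "snd s1 (nm ''b'' b) = ?d(nn + J := e)"
      using f1(2) s1 by (simp, simp, simp, intro ext, simp)
    show "tri S W (climb (pullD b);;
     Cond (Less (Load (nm ''D'' b) (V (nm ''J'' b))) (V ''r'')) Skip (Assign (nm ''u'' b) (Minus (V (nm ''u'' b)) (N 1)));;
     Assign (nm ''J'' b) (Plus (V (nm ''J'' b)) (N 1))) s1 ((H + 1) * 52 + 20) (\<lambda>s'. side_at nn k S b rk r s' \<and> fst s' (nm ''J'' b) = Suc (fst s (nm ''J'' b)))"
    proof (rule tri_Seq)
      show "tri S W (climb (pullD b)) s1 ((H + 1) * 52)
        (\<lambda>s'. tree nn (snd s' (nm ''c'' b)) (snd s' (nm ''b'' b)) \<and> (\<forall>a i. nn \<le> i \<longrightarrow> snd s' a i = snd s1 a i))"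
        by (rule climbD_correct[OF nn W tr Jn _ e, where e = "?c (nn + J)"]) (use s1 a1 leaf_le(1)[OF sd' Jn s(3)] in auto)
      fix s2 assume 2: "tree nn (snd s2 (nm ''c'' b)) (snd s2 (nm ''b'' b)) \<and> (\<forall>a i. nn \<le> i \<longrightarrow> snd s2 a i = snd s1 a i)"
        and f2: "\<And>x. x \<notin> regs (climb (pullD b)) \<Longrightarrow> fst s2 x = fst s1 x" "\<And>x. x \<notin> arrs (climb (pullD b)) \<Longrightarrow> snd s2 x = snd s1 x"
      have r2: "fst s2 (nm ''J'' b) = J" "fst s2 (nm ''u'' b) = v" "fst s2 ''r'' = r" using f2 r1 by simp_all
      have a2: "snd s2 (nm ''D'' b) = ?D" "snd s2 (nm ''T'' b) = ?T" using f2 a1 by simp_all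
      have l2: "snd s2 (nm ''c'' b) (nn + l) = ?c (nn + l)" "snd s2 (nm ''b'' b) (nn + l) = (if l = J then e else ?d (nn + l))" for l
        using 2 a1 by auto
      have sd2: "side nn k S b rk r (snd s2 (nm ''c'' b)) (snd s2 (nm ''b'' b)) ?D ?T (Suc J) (lis rk (Suc J) r)"
        unfolding side_def
      proof (intro conjI allI impI)
        show "tree nn (snd s2 (nm ''c'' b)) (snd s2 (nm ''b'' b))" using 2 by blast
        fix l assume l: "l < nn"
        show "snd s2 (nm ''c'' b) (nn + l) = card {q. q < r \<and> ?T q = l}" using l2 lf[OF l] by simp
        show "snd s2 (nm ''b'' b) (nn + l) = card {q. q < r \<and> ?T q = l} + gain nn k S b (Suc J) l"
          using l2(2)[of l] lf[OF l] by (auto simp: gain_def e_def f_def)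
      next
        fix l assume "l < Suc J"
        then show "k \<le> lis rk l r" using J by (auto simp: less_Suc_eq)
      next
        show "lis rk (Suc J) r \<le> k" using lis_mono[of J "Suc J" r r rk] J by simp
      qed (use de J3 in auto)
      show "tri S W (Cond (Less (Load (nm ''D'' b) (V (nm ''J'' b))) (V ''r'')) Skip (Assign (nm ''u'' b) (Minus (V (nm ''u'' b)) (N 1)));;
         Assign (nm ''J'' b) (Plus (V (nm ''J'' b)) (N 1))) s2 20 (\<lambda>s'. side_at nn k S b rk r s' \<and> fst s' (nm ''J'' b) = Suc (fst s (nm ''J'' b)))"
        using sd2 step J W W' by (intro tri_wp) (auto simp: r2 a2 J_def[symmetric])
    qed simp
  qed simp
qed

text \<open>All starts \<open>l \<ge> T r\<close> gain one, but a single leaf is updated: the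
  increment of \<open>c\<close> at leaf \<open>T r\<close> reaches the leaves strictly to the right,
  and the increment of \<open>d\<close> reaches the leaf itself.\<close>

lemma append_correct:
  assumes nn: "nn = 2 ^ H" and W: "6 * nn * nn \<le> W" "2 \<le> W"
    and s: "fst s ''N'' = nn" "fst s ''r'' = r" "r < nn" and sd: "side_at nn k S b rk r s"
    and u: "fst s (nm ''u'' b) < k"
  shows "tri S W (append_elem b) s ((H + 1) * 52 + 60) (side_at nn k S b rk (Suc r))"
proof -
  let ?c = "snd s (nm ''c'' b)" let ?d = "snd s (nm ''b'' b)" let ?D = "snd s (nm ''D'' b)" let ?T = "snd s (nm ''T'' b)"
  define J where "J = fst s (nm ''J'' b)"
  define v where "v = fst s (nm ''u'' b)"
  have sd': "side nn k S b rk r ?c ?d ?D ?T J v" using sd by (simp add: J_def v_def)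
  have J: "J \<le> r" "v = lis rk J r" "v < k" "\<And>l. l < J \<Longrightarrow> k \<le> lis rk l r" and tr: "tree nn ?c ?d" and de: "deaths nn rk ?D ?T"
    and lf: "\<And>l. l < nn \<Longrightarrow> ?c (nn + l) = card {q. q < r \<and> ?T q = l} \<and> ?d (nn + l) = card {q. q < r \<and> ?T q = l} + gain nn k S b J l"
    using sd' u unfolding v_def[symmetric] by (auto simp: side_def)
  define x where "x = ?T r"
  have x: "x < nn" using deaths_T_le[OF de s(3)] s(3) by (simp add: x_def)
  have nn1: "1 \<le> nn" "nn \<le> nn * nn" using s(3) by auto
  then have W': "3 * nn \<le> W" "2 * nn \<le> W" using W unfolding mult.assoc by linarith+
  have le: "?c (nn + x) + 1 \<le> 3 * nn" "?d (nn + x) + 1 \<le> 3 * nn"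
    using leaf_le(4,5)[OF sd' x _ x_def[symmetric] s(3)] s(3) by auto
  let ?pre = "Assign ''x'' (Load (nm ''T'' b) (V ''r''));; Assign ''p'' (Plus (V ''N'') (V ''x''));;
      Store (nm ''c'' b) (V ''p'') (Plus (Load (nm ''c'' b) (V ''p'')) (N 1));;
      Store (nm ''b'' b) (V ''p'') (Plus (Load (nm ''b'' b) (V ''p'')) (N 1))"
  let ?s1 = "\<lambda>s1. fst s1 ''p'' = nn + x \<and>
    snd s1 = (snd s)(nm ''c'' b := ?c(nn + x := ?c (nn + x) + 1), nm ''b'' b := ?d(nn + x := ?d (nn + x) + 1))"
  have step: "lis rk l (Suc r) = lis rk l r + (if ?T r \<le> l then 1 else 0)" if "l \<le> r" for l
    by (rule deaths_step_r[OF de that s(3)])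
  have card_Suc: "card {q. q < Suc r \<and> ?T q = l} = card {q. q < r \<and> ?T q = l} + (if x = l then 1 else 0)" for l
  proof -
    have "{q. q < Suc r \<and> ?T q = l} = {q. q < r \<and> ?T q = l} \<union> (if x = l then {r} else {})"
      by (auto simp: less_Suc_eq x_def)
    then show ?thesis by auto
  qed
  show ?thesis unfolding append_elem_def
  proof (rule tri_Seq)
    show "tri S W ?pre s 40 ?s1"
      using s W W' x le by (intro tri_wp) (auto simp: x_def[symmetric])
    fix s1 assume s1: "?s1 s1" and f1: "\<And>x. x \<notin> regs ?pre \<Longrightarrow> fst s1 x = fst s x"
    have r1: "fst s1 (nm ''J'' b) = J" "fst s1 (nm ''u'' b) = v" "fst s1 ''r'' = r" using f1 s by (simp_all add: J_def v_def)
    show "tri S W (climb (pullD b);;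
       Cond (Less (V (nm ''J'' b)) (Load (nm ''T'' b) (V ''r''))) Skip (Assign (nm ''u'' b) (Plus (V (nm ''u'' b)) (N 1)))) s1
      ((H + 1) * 52 + 20) (side_at nn k S b rk (Suc r))"
    proof (rule tri_Seq)
      show "tri S W (climb (pullD b)) s1 ((H + 1) * 52)
        (\<lambda>s'. tree nn (snd s' (nm ''c'' b)) (snd s' (nm ''b'' b)) \<and> (\<forall>a i. nn \<le> i \<longrightarrow> snd s' a i = snd s1 a i))"
        by (rule climbD_correct[OF nn W tr x le]) (use s1 in auto)
      fix s2 assume 2: "tree nn (snd s2 (nm ''c'' b)) (snd s2 (nm ''b'' b)) \<and> (\<forall>a i. nn \<le> i \<longrightarrow> snd s2 a i = snd s1 a i)"
        and f2: "\<And>x. x \<notin> regs (climb (pullD b)) \<Longrightarrow> fst s2 x = fst s1 x" "\<And>x. x \<notin> arrs (climb (pullD b)) \<Longrightarrow> snd s2 x = snd s1 x"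
      have r2: "fst s2 (nm ''J'' b) = J" "fst s2 (nm ''u'' b) = v" "fst s2 ''r'' = r" using f2 r1 by simp_all
      have a2: "snd s2 (nm ''D'' b) = ?D" "snd s2 (nm ''T'' b) = ?T" using f2 s1 by simp_all
      have l2: "snd s2 (nm ''c'' b) (nn + l) = ?c (nn + l) + (if x = l then 1 else 0)"
        "snd s2 (nm ''b'' b) (nn + l) = ?d (nn + l) + (if x = l then 1 else 0)" for l
        using 2 s1 by auto
      have sd2: "side nn k S b rk (Suc r) (snd s2 (nm ''c'' b)) (snd s2 (nm ''b'' b)) ?D ?T J (lis rk J (Suc r))"
        unfolding side_def
      proof (intro conjI allI impI)
        show "tree nn (snd s2 (nm ''c'' b)) (snd s2 (nm ''b'' b))" using 2 by blast
        fix l assume l: "l < nn"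
        show "snd s2 (nm ''c'' b) (nn + l) = card {q. q < Suc r \<and> ?T q = l}"
          "snd s2 (nm ''b'' b) (nn + l) = card {q. q < Suc r \<and> ?T q = l} + gain nn k S b J l"
          unfolding card_Suc using l2 lf[OF l] by simp_all
      next
        fix l assume "l < J"
        then show "k \<le> lis rk l (Suc r)" using J(4)[of l] lis_mono[of l l r "Suc r" rk] by simp
      next
        show "lis rk J (Suc r) \<le> k" using step[of J] J by auto
      qed (use de J in auto)
      have "v < 2 * nn" using lis_le[of rk J r] J s(3) by simp
      then show "tri S W (Cond (Less (V (nm ''J'' b)) (Load (nm ''T'' b) (V ''r''))) Skip (Assign (nm ''u'' b) (Plus (V (nm ''u'' b)) (N 1)))) s2 20
        (side_at nn k S b rk (Suc r))"
        using sd2 step[of J] J W W' by (intro tri_wp) (auto simp: r2 a2)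
    qed simp
  qed simp
qed

section \<open>The main loop\<close>

definition record_opt :: "bool \<Rightarrow> com" where
  "record_opt b = Store (nm ''F'' b) (V ''r'') (Minus (Load (nm ''b'' b) (N 1)) (Plus (V ''N'') (N 1)))"

definition advance :: com where
  "advance =
     (record_opt True;; record_opt False);;
     Cond (Less (V ''r'') (V ''n'')) (append_elem True;; append_elem False) Skip;;
     Assign ''r'' (Plus (V ''r'') (N 1))"

text \<open>Activations in both directions have priority over the next element. So whenever the
  optimum is read from the tree, all starts with chain length at least \<open>k\<close> are in
  it.\<close>

definition dp_body :: com where
  "dp_body = Cond (Less (V (nm ''u'' True)) (V ''k''))
     (Cond (Less (V (nm ''u'' False)) (V ''k'')) advance (activate False)) (activate True)"

definition dp_prog :: com where
  "dp_prog =
     Assign ''r'' (N 0);; While (Neg (Less (V ''n'') (V ''r''))) dp_body;;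
     Cond (Less (Load (nm ''F'' True) (V ''n'')) (Load (nm ''F'' False) (V ''n'')))
       (Assign ''out'' (Load (nm ''F'' False) (V ''n''))) (Assign ''out'' (Load (nm ''F'' True) (V ''n'')))"

text \<open>After the last round, with \<open>r = length S + 1\<close>, the trees no longer describe
  anything; only the table of optima is kept.\<close>

definition dp_inv :: "nat \<Rightarrow> nat \<Rightarrow> real list \<Rightarrow> (bool \<Rightarrow> nat \<Rightarrow> nat) \<Rightarrow> nat \<Rightarrow> state \<Rightarrow> bool" where
  "dp_inv nn k S rk r s \<longleftrightarrow> fst s ''N'' = nn \<and> fst s ''n'' = length S \<and> fst s ''k'' = k \<and> fst s ''r'' = r \<and>
     r \<le> length S + 1 \<and> (\<forall>b. \<forall>q<r. snd s (nm ''F'' b) q = opt b k S q) \<and>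
     (r \<le> length S \<longrightarrow> (\<forall>b. side_at nn k S b (rk b) r s))"

lemma advance_correct:
  assumes nn: "nn = 2 ^ H" "length S \<le> nn" and S: "distinct S" and k: "3 \<le> k" and W: "6 * nn * nn \<le> W" "2 \<le> W"
    and rk: "\<And>b p q. p < length S \<Longrightarrow> q < length S \<Longrightarrow> rk b p < rk b q \<longleftrightarrow> lt b (S ! p) (S ! q)"
    and s: "dp_inv nn k S rk r s" "r \<le> length S" and u: "\<And>b. fst s (nm ''u'' b) < k"
  shows "tri S W advance s ((H + 1) * 104 + 200)
    (\<lambda>s'. dp_inv nn k S rk (Suc r) s' \<and> (\<forall>b. fst s' (nm ''J'' b) = fst s (nm ''J'' b)))"
  unfolding advance_def
proof (rule tri_Seq)
  have nn1: "1 \<le> nn" using nn by simp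
  then have "nn * 1 \<le> nn * nn" by (intro mult_le_mono2)
  then have W': "nn + 1 \<le> W" "r + 1 \<le> W" using W s(2) nn nn1 unfolding mult.assoc by linarith+
  have regs: "fst s ''N'' = nn" "fst s ''n'' = length S" "fst s ''k'' = k" "fst s ''r'' = r" using s(1) by (auto simp: dp_inv_def)
  have sd: "side_at nn k S b (rk b) r s" for b using s by (simp add: dp_inv_def)
  have F: "snd s (nm ''F'' b) q = opt b k S q" if "q < r" for b q using s(1) that by (simp add: dp_inv_def)
  \<comment> \<open>The optimum for \<open>r\<close> is read before element \<open>r\<close> is
    added, when the trees describe exactly the first \<open>r\<close> elements.\<close>
  have new: "snd s (nm ''b'' b) 1 - (nn + 1) = opt b k S r" for b
    by (rule side_rec[OF nn S k s(2) rk sd u])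
  let ?s1 = "\<lambda>s1. fst s1 = fst s \<and> (\<forall>b. \<forall>q<Suc r. snd s1 (nm ''F'' b) q = opt b k S q)"
  show "tri S W (record_opt True;; record_opt False) s 20 ?s1"
    using W W' new[of True] new[of False] F by (intro tri_wp) (auto simp: record_opt_def regs less_Suc_eq)
  fix s1 assume s1: "?s1 s1" and f1: "\<And>a. a \<notin> arrs (record_opt True;; record_opt False) \<Longrightarrow> snd s1 a = snd s a"
  have sd1: "side_at nn k S b (rk b) r s1" for b using sd[of b] s1 f1 by (simp add: record_opt_def)
  let ?Q = "\<lambda>s'. dp_inv nn k S rk (Suc r) s' \<and> (\<forall>b. fst s' (nm ''J'' b) = fst s (nm ''J'' b))"
  show "tri S W (Cond (Less (V ''r'') (V ''n'')) (append_elem True;; append_elem False) Skip;;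
     Assign ''r'' (Plus (V ''r'') (N 1))) s1 (((H + 1) * 104 + 130) + 4) ?Q"
  proof (rule tri_Seq)
    let ?s2 = "\<lambda>s2. r < length S \<longrightarrow> (\<forall>b. side_at nn k S b (rk b) (Suc r) s2)"
    let ?C = "Cond (Less (V ''r'') (V ''n'')) (append_elem True;; append_elem False) Skip"
    show "tri S W ?C s1 ((H + 1) * 104 + 130) ?s2"
    proof (rule tri_Cond)
      assume "bval S s1 (Less (V ''r'') (V ''n''))"
      then have r: "r < length S" "r < nn" using s1 regs nn by auto
      show "tri S W (append_elem True;; append_elem False) s1 ((H + 1) * 104 + 120) ?s2"
      proof (rule tri_Seq)
        show "tri S W (append_elem True) s1 ((H + 1) * 52 + 60) (side_at nn k S True (rk True) (Suc r))"
          by (rule append_correct[OF nn(1) W _ _ r(2) sd1]) (use s1 regs u in auto)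
        fix s2 assume t2: "side_at nn k S True (rk True) (Suc r) s2"
          and f2: "\<And>x. x \<notin> regs (append_elem True) \<Longrightarrow> fst s2 x = fst s1 x" "\<And>a. a \<notin> arrs (append_elem True) \<Longrightarrow> snd s2 a = snd s1 a"
        have 2: "side_at nn k S False (rk False) r s2" using sd1[of False] f2 by simp
        have "tri S W (append_elem False) s2 ((H + 1) * 52 + 60) (side_at nn k S False (rk False) (Suc r))"
          by (rule append_correct[OF nn(1) W _ _ r(2) 2]) (use s1 f2 regs u in auto)
        then show "tri S W (append_elem False) s2 ((H + 1) * 52 + 60) ?s2"
        proof (rule tri_conseq)
          fix s3 assume 3: "side_at nn k S False (rk False) (Suc r) s3"
            and f3: "\<And>x. x \<notin> regs (append_elem False) \<Longrightarrow> fst s3 x = fst s2 x" "\<And>a. a \<notin> arrs (append_elem False) \<Longrightarrow> snd s3 a = snd s2 a"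
          have "side_at nn k S True (rk True) (Suc r) s3" using t2 f3 by simp
          then have "side_at nn k S b (rk b) (Suc r) s3" for b using 3 by (cases b) simp_all
          then show "?s2 s3" by blast
        qed simp
      qed simp
    next
      assume "\<not> bval S s1 (Less (V ''r'') (V ''n''))"
      then have "\<not> r < length S" using s1 regs by simp
      then show "tri S W Skip s1 ((H + 1) * 104 + 120) ?s2" by (intro tri_wp) auto
    qed simp_all
    fix s2 assume s2: "?s2 s2" and f2: "\<And>x. x \<notin> regs ?C \<Longrightarrow> fst s2 x = fst s1 x" "\<And>a. a \<notin> arrs ?C \<Longrightarrow> snd s2 a = snd s1 a"
    have "fst s2 ''N'' = nn" "fst s2 ''n'' = length S" "fst s2 ''k'' = k" "fst s2 ''r'' = r"
      "\<And>b. fst s2 (nm ''J'' b) = fst s (nm ''J'' b)" "\<And>b. snd s2 (nm ''F'' b) = snd s1 (nm ''F'' b)"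
      using f2 s1 regs by simp_all
    then show "tri S W (Assign ''r'' (Plus (V ''r'') (N 1))) s2 4 ?Q"
      using s2 s1 s W W' by (intro tri_wp) (auto simp: dp_inv_def Suc_le_eq)
  qed simp
qed simp

lemma activate_inv:
  assumes nn: "nn = 2 ^ H" "length S \<le> nn" and k: "3 \<le> k" and W: "6 * nn * nn \<le> W" "2 \<le> W"
    and s: "dp_inv nn k S rk r s" "r \<le> length S" and u: "\<not> fst s (nm ''u'' b) < k"
  shows "tri S W (activate b) s ((H + 1) * 104 + 200)
    (\<lambda>s'. dp_inv nn k S rk r s' \<and> fst s' (nm ''J'' b) = Suc (fst s (nm ''J'' b)) \<and> fst s' (nm ''J'' (\<not> b)) = fst s (nm ''J'' (\<not> b)))"
    and "fst s (nm ''J'' b) < r"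
proof -
  have regs: "fst s ''N'' = nn" "fst s ''n'' = length S" "fst s ''k'' = k" "fst s ''r'' = r" using s(1) by (auto simp: dp_inv_def)
  have sd: "side_at nn k S b (rk b) r s" for b using s by (simp add: dp_inv_def)
  have F: "snd s (nm ''F'' b) q = opt b k S q" if "q < r" for b q using s(1) that by (simp add: dp_inv_def)
  have rn: "r \<le> nn" using s(2) nn by simp
  note c = activate_correct[OF nn(1) k W regs(1,4) rn sd u F]
  show "fst s (nm ''J'' b) < r" by (rule c(2))
  show "tri S W (activate b) s ((H + 1) * 104 + 200)
    (\<lambda>s'. dp_inv nn k S rk r s' \<and> fst s' (nm ''J'' b) = Suc (fst s (nm ''J'' b)) \<and> fst s' (nm ''J'' (\<not> b)) = fst s (nm ''J'' (\<not> b)))"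
  proof (rule tri_conseq[OF c(1)])
    fix s1 assume 1: "side_at nn k S b (rk b) r s1 \<and> fst s1 (nm ''J'' b) = Suc (fst s (nm ''J'' b))"
      and f: "\<And>x. x \<notin> regs (activate b) \<Longrightarrow> fst s1 x = fst s x" "\<And>a. a \<notin> arrs (activate b) \<Longrightarrow> snd s1 a = snd s a"
    have "side_at nn k S (\<not> b) (rk (\<not> b)) r s1" using sd[of "\<not> b"] f by simp
    then have "side_at nn k S b' (rk b') r s1" for b' using 1 by (cases "b' = b") auto
    then show "dp_inv nn k S rk r s1 \<and> fst s1 (nm ''J'' b) = Suc (fst s (nm ''J'' b)) \<and> fst s1 (nm ''J'' (\<not> b)) = fst s (nm ''J'' (\<not> b))"
      using s(1) 1 f by (auto simp: dp_inv_def)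
  qed simp_all
qed

lemma dp_correct:
  assumes nn: "nn = 2 ^ H" "length S \<le> nn" and S: "distinct S" and k: "3 \<le> k" and W: "6 * nn * nn \<le> W" "2 \<le> W"
    and rk: "\<And>b p q. p < length S \<Longrightarrow> q < length S \<Longrightarrow> rk b p < rk b q \<longleftrightarrow> lt b (S ! p) (S ! q)"
    and s: "fst s0 ''N'' = nn" "fst s0 ''n'' = length S" "fst s0 ''k'' = k"
    and z: "\<And>b. fst s0 (nm ''J'' b) = 0" "\<And>b. fst s0 (nm ''u'' b) = 0"
      "\<And>b i. snd s0 (nm ''c'' b) i = 0" "\<And>b i. snd s0 (nm ''b'' b) i = 0"
    and de: "\<And>b. deaths nn (rk b) (snd s0 (nm ''D'' b)) (snd s0 (nm ''T'' b))"
  shows "tri S W dp_prog s0 (1400 * (H + 1) * (nn + 1)) (\<lambda>s. fst s ''out'' = longest_rollercoaster_length k S)"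
  unfolding dp_prog_def
proof (rule tri_Seq)
  show "tri S W (Assign ''r'' (N 0)) s0 2 (\<lambda>s. s = ((fst s0)(''r'' := 0), snd s0))" by (rule tri_wp) auto
  fix s1 assume s1: "s1 = ((fst s0)(''r'' := 0), snd s0)"
  \<comment> \<open>Amortization: a round advances \<open>r\<close> or one of the two pointers
    \<open>J\<close>, and each of them moves at most \<open>length S + 1\<close> times. So the
    number of rounds is linear, although many activations may happen between two elements.\<close>
  let ?m = "\<lambda>r s. (length S + 1 - r) + (length S + 1 - fst s (nm ''J'' True)) + (length S + 1 - fst s (nm ''J'' False))"
  let ?I = "\<lambda>m s. \<exists>r. dp_inv nn k S rk r s \<and> m = ?m r s"
  let ?F = "\<lambda>s. fst s ''n'' = length S \<and> (\<forall>b. snd s (nm ''F'' b) (length S) = opt b k S (length S))"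
  let ?fin = "Cond (Less (Load (nm ''F'' True) (V ''n'')) (Load (nm ''F'' False) (V ''n'')))
       (Assign ''out'' (Load (nm ''F'' False) (V ''n''))) (Assign ''out'' (Load (nm ''F'' True) (V ''n'')))"
  let ?b = "Neg (Less (V ''n'') (V ''r''))"
  show "tri S W (While ?b dp_body;; ?fin) s1 ((4 * nn + 4) * ((H + 1) * 104 + 220) + 10) (\<lambda>s. fst s ''out'' = longest_rollercoaster_length k S)"
  proof (rule tri_Seq)
    show "tri S W (While ?b dp_body) s1 ((4 * nn + 4) * ((H + 1) * 104 + 220)) ?F"
    proof (rule tri_While[where I = ?I and n = "3 * (length S + 1)" and B = "(H + 1) * 104 + 210"])
      have "node (\<lambda>_. 0) (\<lambda>_. 0) u" for u by (simp add: node_def)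
      then have "tree nn (\<lambda>_. 0) (\<lambda>_. 0)" by (simp add: tree_def bounded_def)
      moreover have "snd s0 (nm ''c'' b) = (\<lambda>_. 0)" "snd s0 (nm ''b'' b) = (\<lambda>_. 0)" for b using z by auto
      moreover have "lis a 0 0 = 0" for a using lis_le[of a 0 0] by simp
      ultimately have "side_at nn k S b (rk b) 0 s1" for b
        using de z s1 by (simp add: side_def gain_def)
      then show "?I (3 * (length S + 1)) s1"
        using s s1 z by (intro exI[of _ 0]) (auto simp: dp_inv_def)
      fix m s assume "?I m s"
      then obtain r where I: "dp_inv nn k S rk r s" and m: "m = ?m r s" by blast
      have regs: "fst s ''n'' = length S" "fst s ''r'' = r" "fst s ''k'' = k" and rS: "r \<le> length S + 1" using I by (auto simp: dp_inv_def)
      show "bfits S W s ?b \<and> (bval S s ?b \<longrightarrow> 0 < m \<and> tri S W dp_body s ((H + 1) * 104 + 210) (\<lambda>s'. \<exists>m'<m. ?I m' s')) \<and> (\<not> bval S s ?b \<longrightarrow> ?F s)"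
      proof (intro conjI impI)
        assume "\<not> bval S s ?b"
        then have "r = length S + 1" using regs rS by simp
        then show "fst s ''n'' = length S" "\<forall>b. snd s (nm ''F'' b) (length S) = opt b k S (length S)"
          using I by (auto simp: dp_inv_def)
      next
        assume "bval S s ?b"
        then have r: "r \<le> length S" using regs by simp
        then show "0 < m" using m by simp
        have act: "tri S W (activate b) s ((H + 1) * 104 + 200) (\<lambda>s'. \<exists>m'<m. ?I m' s')" if u: "\<not> fst s (nm ''u'' b) < k" for b
        proof (rule tri_conseq[OF activate_inv(1)[OF nn k W I r u]])
          fix s' assume *: "dp_inv nn k S rk r s' \<and> fst s' (nm ''J'' b) = Suc (fst s (nm ''J'' b)) \<and> fst s' (nm ''J'' (\<not> b)) = fst s (nm ''J'' (\<not> b))"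
          then have "?m r s' < m" using m activate_inv(2)[OF nn k W I r u] r by (cases b) auto
          then show "\<exists>m'<m. ?I m' s'" using * by blast
        qed simp
        have adv: "tri S W advance s ((H + 1) * 104 + 200) (\<lambda>s'. \<exists>m'<m. ?I m' s')" if u: "\<And>b. fst s (nm ''u'' b) < k"
        proof (rule tri_conseq[OF advance_correct[OF nn S k W rk I r u]])
          fix s' assume *: "dp_inv nn k S rk (Suc r) s' \<and> (\<forall>b. fst s' (nm ''J'' b) = fst s (nm ''J'' b))"
          then have "?m (Suc r) s' < m" using m r by simp
          then show "\<exists>m'<m. ?I m' s'" using * by blast
        qed simp_all
        show "tri S W dp_body s ((H + 1) * 104 + 210) (\<lambda>s'. \<exists>m'<m. ?I m' s')"
          unfolding dp_body_def
        proof (rule tri_Cond)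
          assume *: "bval S s (Less (V (nm ''u'' True)) (V ''k''))"
          show "tri S W (Cond (Less (V (nm ''u'' False)) (V ''k'')) advance (activate False)) s ((H + 1) * 104 + 205) (\<lambda>s'. \<exists>m'<m. ?I m' s')"
          proof (rule tri_Cond)
            assume "bval S s (Less (V (nm ''u'' False)) (V ''k''))"
            then have "fst s (nm ''u'' b) < k" for b using * regs by (cases b) auto
            then show "tri S W advance s ((H + 1) * 104 + 200) (\<lambda>s'. \<exists>m'<m. ?I m' s')" by (rule adv)
          next
            assume "\<not> bval S s (Less (V (nm ''u'' False)) (V ''k''))"
            then show "tri S W (activate False) s ((H + 1) * 104 + 200) (\<lambda>s'. \<exists>m'<m. ?I m' s')" using regs by (intro act) simp
          qed simp_all
        next
          assume "\<not> bval S s (Less (V (nm ''u'' True)) (V ''k''))"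
          then have "tri S W (activate True) s ((H + 1) * 104 + 200) (\<lambda>s'. \<exists>m'<m. ?I m' s')" using regs by (intro act) simp
          then show "tri S W (activate True) s ((H + 1) * 104 + 205) (\<lambda>s'. \<exists>m'<m. ?I m' s')" by (rule tri_conseq) auto
        qed simp_all
      qed simp
    next
      show "(3 * (length S + 1) + 1) * ((H + 1) * 104 + 210 + 1 + bcost ?b) \<le> (4 * nn + 4) * ((H + 1) * 104 + 220)"
        using nn(2) by (intro mult_le_mono) simp_all
    qed
    fix s2 assume s2: "?F s2"
    have "tri S W ?fin s2 10 (\<lambda>s. fst s ''out'' = max (opt True k S (length S)) (opt False k S (length S)))"
      using s2 by (intro tri_wp) auto
    then show "tri S W ?fin s2 10 (\<lambda>s. fst s ''out'' = longest_rollercoaster_length k S)"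
      by (simp add: longest_eq_opt[OF S k])
  qed simp
qed (simp add: algebra_simps)

section \<open>The whole algorithm\<close>

text \<open>The decreasing direction is handled by the same code on reversed ranks; the original
  ranks are therefore kept in \<open>''K0''\<close> and copied to \<open>''K''\<close> for each
  use.\<close>

definition main_prog :: com where
  "main_prog =
     (Assign ''N'' (N 1);; While (Less (V ''N'') (V ''n'')) (Assign ''N'' (Plus (V ''N'') (V ''N''))));;
     Assign ''W'' (Plus (V ''N'') (V ''N''));;
     sort_prog;;
     (Assign ''i'' (N 0);; For ''i'' ''N'' (Store ''K'' (V ''i'') (Load ''K0'' (V ''i''))));;
     sea_prog (nm ''D'' True) (nm ''T'' True);;
     (Assign ''i'' (N 0);; For ''i'' ''N'' (Store ''K'' (V ''i'') (Minus (Minus (V ''N'') (N 1)) (Load ''K0'' (V ''i'')))));;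
     sea_prog (nm ''D'' False) (nm ''T'' False);;
     dp_prog"

lemma copy_correct:
  assumes s: "fst s ''N'' = nn" and W: "nn \<le> W" "1 \<le> W"
    and e: "\<And>s i. fst s ''N'' = nn \<Longrightarrow> fst s ''i'' = i \<Longrightarrow> snd s ''K0'' i = v i \<Longrightarrow> afits W s e \<and> aval s e = f i" "acost e \<le> 6"
    and v: "\<And>i. i < nn \<Longrightarrow> snd s ''K0'' i = v i"
  shows "tri S W (Assign ''i'' (N 0);; For ''i'' ''N'' (Store ''K'' (V ''i'') e)) s (20 * (nn + 1)) (\<lambda>s. \<forall>i<nn. snd s ''K'' i = f i)"
proof (rule tri_Seq)
  show "tri S W (Assign ''i'' (N 0)) s 2 (\<lambda>s'. s' = ((fst s)(''i'' := 0), snd s))" by (rule tri_wp) auto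
  fix s1 assume s1: "s1 = ((fst s)(''i'' := 0), snd s)"
  show "tri S W (For ''i'' ''N'' (Store ''K'' (V ''i'') e)) s1 (16 * (nn + 1)) (\<lambda>s. \<forall>i<nn. snd s ''K'' i = f i)"
  proof (rule tri_For[where I = "\<lambda>i s. (\<forall>j<i. snd s ''K'' j = f j) \<and> (\<forall>j<nn. snd s ''K0'' j = v j)" and a = 0 and b = nn and B = 8])
    fix i and s :: state assume *: "0 \<le> i" "i < nn" "fst s ''i'' = i" "fst s ''N'' = nn" "(\<forall>j<i. snd s ''K'' j = f j) \<and> (\<forall>j<nn. snd s ''K0'' j = v j)"
    then have "afits W s e" "aval s e = f i" using e(1)[of s i] by auto
    then show "tri S W (Store ''K'' (V ''i'') e) s 8 (\<lambda>s'. fst s' ''i'' = i \<and> fst s' ''N'' = nn \<and>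
      (\<forall>j<Suc i. snd ((fst s')(''i'' := Suc i), snd s') ''K'' j = f j) \<and> (\<forall>j<nn. snd ((fst s')(''i'' := Suc i), snd s') ''K0'' j = v j))"
      using * e(2) by (intro tri_wp) (auto simp: less_Suc_eq)
  qed (use s1 s v W in auto)
qed simp

lemma size_correct:
  assumes W: "4 * length S + 2 \<le> W"
  and s: "fst s ''n'' = length S"
  shows "tri S W (Assign ''N'' (N 1);; While (Less (V ''N'') (V ''n'')) (Assign ''N'' (Plus (V ''N'') (V ''N'')))) s (10 * (length S + 1))
    (\<lambda>s. \<exists>H. fst s ''N'' = 2 ^ H \<and> length S \<le> 2 ^ H \<and> 2 ^ H \<le> 2 * length S + 1)"
proof (rule tri_Seq)
  show "tri S W (Assign ''N'' (N 1)) s 2 (\<lambda>s'. s' = ((fst s)(''N'' := 1), snd s))" by (rule tri_wp) (use W in auto)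
  fix s1 assume s1: "s1 = ((fst s)(''N'' := 1), snd s)"
  show "tri S W (While (Less (V ''N'') (V ''n'')) (Assign ''N'' (Plus (V ''N'') (V ''N'')))) s1 ((length S + 1) * 8)
    (\<lambda>s. \<exists>H. fst s ''N'' = 2 ^ H \<and> length S \<le> 2 ^ H \<and> 2 ^ H \<le> 2 * length S + 1)"
  proof (rule tri_While[where I = "\<lambda>m s. fst s ''n'' = length S \<and> m = length S - fst s ''N'' \<and> (\<exists>H. fst s ''N'' = 2 ^ H) \<and> fst s ''N'' \<le> 2 * length S + 1" and n = "length S - 1" and B = 4])
    show "fst s1 ''n'' = length S \<and> length S - 1 = length S - fst s1 ''N'' \<and> (\<exists>H. fst s1 ''N'' = 2 ^ H) \<and> fst s1 ''N'' \<le> 2 * length S + 1"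
      using s1 s by (auto intro: exI[of _ 0])
    fix m and s :: state
    assume *: "fst s ''n'' = length S \<and> m = length S - fst s ''N'' \<and> (\<exists>H. fst s ''N'' = 2 ^ H) \<and> fst s ''N'' \<le> 2 * length S + 1"
    then obtain H where H: "fst s ''N'' = 2 ^ H" by blast
    obtain H' where H': "(2::nat) ^ H + 2 ^ H = 2 ^ H'" using power_Suc[of "2::nat" H] by (metis mult_2)
    have "(0::nat) < 2 ^ H" by simp
    then have "(2::nat) ^ H < 2 ^ H'" using H' by linarith
    then show "bfits S W s (Less (V ''N'') (V ''n'')) \<and>
      (bval S s (Less (V ''N'') (V ''n'')) \<longrightarrow> 0 < m \<and> tri S W (Assign ''N'' (Plus (V ''N'') (V ''N''))) s 4
        (\<lambda>s'. \<exists>m'<m. fst s' ''n'' = length S \<and> m' = length S - fst s' ''N'' \<and> (\<exists>H. fst s' ''N'' = 2 ^ H) \<and> fst s' ''N'' \<le> 2 * length S + 1)) \<and>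
      (\<not> bval S s (Less (V ''N'') (V ''n'')) \<longrightarrow> (\<exists>H. fst s ''N'' = 2 ^ H \<and> length S \<le> 2 ^ H \<and> 2 ^ H \<le> 2 * length S + 1))"
      using * W H H' by (auto intro!: tri_wp diff_less_mono2)
  qed simp
qed simp

lemma main_correct:
  fixes S :: "real list"
  assumes S: "distinct S" and k: "3 \<le> k" and W: "W = (length S + k) ^ 5"
  shows "\<exists>H. 2 ^ H \<le> 2 * length S + 1 \<and> tri S W main_prog (initial_state S k) (8000 * (H + 2)\<^sup>2 * (2 * length S + 2))
    (\<lambda>s. result s = longest_rollercoaster_length k S)"
proof -
  define m where "m = length S + k"
  have m: "3 \<le> m" "length S + 3 \<le> m" using k by (auto simp: m_def)
  \<comment> \<open>Since \<open>nn \<le> 2 * m\<close>, the largest numbers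
    \<open>6 * nn * nn\<close> need \<open>24 * m * m\<close>. Of the five factors
    \<open>m \<ge> 3\<close> in \<open>W\<close>, three already give 27; this is the origin of the
    exponent 5.\<close>
  have W24: "24 * m * m \<le> W"
  proof -
    have "(3::nat) ^ 3 \<le> m ^ 3" using m by (intro power_mono) auto
    then have "24 * (m * m) \<le> m ^ 3 * (m * m)" by (intro mult_le_mono1) simp
    also have "\<dots> = W" by (simp add: W m_def[symmetric] power_numeral_reduce)
    finally show ?thesis by simp
  qed
  have "m * 3 \<le> m * m" using m by (intro mult_le_mono2)
  then have W0: "72 * m \<le> W" using W24 unfolding mult.assoc by linarith
  define s0 where "s0 = initial_state S k"
  have s0: "fst s0 ''n'' = length S" "fst s0 ''k'' = k" "\<And>b. fst s0 (nm ''J'' b) = 0" "\<And>b. fst s0 (nm ''u'' b) = 0"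
    "\<And>a i. snd s0 a i = 0" by (simp_all add: s0_def initial_state_def)
  let ?size = "Assign ''N'' (N 1);; While (Less (V ''N'') (V ''n'')) (Assign ''N'' (Plus (V ''N'') (V ''N'')))"
  have "tri S W ?size s0 (10 * (length S + 1)) (\<lambda>s. \<exists>H. fst s ''N'' = 2 ^ H \<and> length S \<le> 2 ^ H \<and> 2 ^ H \<le> 2 * length S + 1)"
    by (rule size_correct) (use W0 m s0 in auto)
  then obtain t s1 H where ex: "exec S W ?size s0 t s1" "t \<le> 10 * (length S + 1)"
    and H: "fst s1 ''N'' = 2 ^ H" "length S \<le> 2 ^ H" "2 ^ H \<le> 2 * length S + 1" unfolding tri_def by blast
  define nn :: nat where "nn = 2 ^ H"
  have nn: "nn = 2 ^ H" "length S \<le> nn" "nn \<le> 2 * length S + 1" "1 \<le> nn" using H by (auto simp: nn_def)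
  have Hn: "H < nn" by (simp add: nn_def)
  have n2: "nn \<le> 2 * m" using nn m by simp
  have W6: "6 * nn * nn \<le> W"
  proof -
    have "6 * nn * nn \<le> 6 * (2 * m) * (2 * m)" using n2 by (intro mult_le_mono) auto
    then show ?thesis using W24 by simp
  qed
  have nnn: "nn \<le> nn * nn" using nn by simp
  have WH: "(H + 3) * (2 * nn) \<le> W"
  proof -
    have "(H + 3) * (2 * nn) \<le> (nn + 2) * (2 * nn)" using Hn by (intro mult_le_mono1) simp
    also have "\<dots> = 2 * (nn * nn) + 4 * nn" by (simp add: algebra_simps)
    finally show ?thesis using W6 nnn unfolding mult.assoc by linarith
  qed
  have W2: "2 * nn \<le> W" "2 \<le> W" "nn \<le> W" "1 \<le> W" using W0 m n2 by linarith+
  \<comment> \<open>The positions beyond the input fill up to a power of two and take the remaining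
    values. Windows with \<open>r \<le> length S\<close>, the only ones used, never see
    them.\<close>
  define rk where "rk p = (if p < length S then rank S p else p)" for p
  have rbij: "bij_betw rk {..<nn} {..<nn}"
  proof -
    have "bij_betw rk {..<length S} {..<length S}"
      using rank_bij[OF S] by (rule bij_betw_cong[THEN iffD1, rotated]) (simp add: rk_def)
    moreover have "bij_betw rk {length S..<nn} {length S..<nn}"
      using bij_betw_id by (rule bij_betw_cong[THEN iffD1, rotated]) (simp add: rk_def)
    ultimately have "bij_betw rk ({..<length S} \<union> {length S..<nn}) ({..<length S} \<union> {length S..<nn})"
      by (rule bij_betw_combine) auto
    moreover have "{..<length S} \<union> {length S..<nn} = {..<nn}" using nn(2) by auto
    ultimately show ?thesis by simp
  qed
  \<comment> \<open>Reflecting the ranks in \<open>{..<nn}\<close> turns decreasing subsequences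
    into increasing ones and keeps the permutation.\<close>
  define rks where "rks b p = (if b then rk p else nn - 1 - rk p)" for b p
  have rk_lt: "rk p < nn" if "p < nn" for p using bij_betwE[OF rbij] that by auto
  have rks: "bij_betw (rks b) {..<nn} {..<nn}" for b
  proof (cases b)
    case False
    have "bij_betw (\<lambda>x. nn - 1 - x) {..<nn} {..<nn}"
      by (rule bij_betw_byWitness[where f' = "\<lambda>x. nn - 1 - x"]) auto
    from bij_betw_trans[OF rbij this] show ?thesis using False by (simp add: rks_def[abs_def] comp_def)
  qed (use rbij in \<open>simp add: rks_def[abs_def]\<close>)
  have rks_lt: "rks b p < rks b q \<longleftrightarrow> lt b (S ! p) (S ! q)" if "p < length S" "q < length S" for b p q
  proof -
    have "rk p < nn" "rk q < nn" using rk_lt that nn(2) by auto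
    then show ?thesis using rank_less_iff[of p S q] rank_less_iff[of q S p] that by (auto simp: rks_def lt_def rk_def)
  qed
  let ?rest5 = "sea_prog (nm ''D'' False) (nm ''T'' False);; dp_prog"
  let ?copyF = "Assign ''i'' (N 0);; For ''i'' ''N'' (Store ''K'' (V ''i'') (Minus (Minus (V ''N'') (N 1)) (Load ''K0'' (V ''i''))))"
  let ?rest4 = "?copyF;; ?rest5"
  let ?rest3 = "sea_prog (nm ''D'' True) (nm ''T'' True);; ?rest4"
  let ?copyT = "Assign ''i'' (N 0);; For ''i'' ''N'' (Store ''K'' (V ''i'') (Load ''K0'' (V ''i'')))"
  let ?rest2 = "?copyT;; ?rest3"
  define Q where "Q = (\<lambda>s. result s = longest_rollercoaster_length k S)"
  define A where "A = (H + 2) * (H + 1) * (nn + 1)"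
  have A: "(H + 1) * (nn + 1) \<le> A" "nn + 1 \<le> A" by (simp_all add: A_def algebra_simps)
  have sea: "tri S W (sea_prog (nm ''D'' b) (nm ''T'' b)) s (2500 * A) (\<lambda>s. deaths nn (rks b) (snd s (nm ''D'' b)) (snd s (nm ''T'' b)))"
    if "fst s ''N'' = nn" "fst s ''W'' = 2 * nn" "\<And>i. i < nn \<Longrightarrow> snd s ''K'' i = rks b i" "\<And>r. snd s (nm ''T'' b) r = 0" for s b
  proof -
    have "tri S W (sea_prog (nm ''D'' b) (nm ''T'' b)) s (2500 * (H + 2) * (H + 1) * (nn + 1)) (\<lambda>s. deaths nn (rks b) (snd s (nm ''D'' b)) (snd s (nm ''T'' b)))"
      by (rule sea_prog_correct[OF nn(1) rks that(1-3)]) (use that WH W2 in \<open>auto simp: sea_arrs_def\<close>)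
    then show ?thesis by (rule tri_conseq) (simp_all add: A_def algebra_simps)
  qed
  have f1: "fst s1 x = fst s0 x" if "x \<noteq> ''N''" for x using exec_frame[OF ex(1)] that by auto
  have f1': "snd s1 = snd s0" using exec_frame[OF ex(1)] by auto
  have "tri S W (Assign ''W'' (Plus (V ''N'') (V ''N''));; sort_prog;; ?rest2) s1 (4 + (200 * A + (20 * A + (2500 * A + (20 * A + (2500 * A + 1400 * A)))))) Q"
  proof (rule tri_Seq)
    show "tri S W (Assign ''W'' (Plus (V ''N'') (V ''N''))) s1 4 (\<lambda>s. s = ((fst s1)(''W'' := 2 * nn), snd s1))"
      by (rule tri_wp) (use H W2 nn_def in auto)
    fix s2 assume "s2 = ((fst s1)(''W'' := 2 * nn), snd s1)"
    then have s2: "fst s2 ''N'' = nn" "fst s2 ''W'' = 2 * nn" "fst s2 ''n'' = length S" "fst s2 ''k'' = k"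
      "\<And>b. fst s2 (nm ''J'' b) = 0" "\<And>b. fst s2 (nm ''u'' b) = 0" "\<And>a i. snd s2 a i = 0"
      using f1 f1' s0 H nn_def by simp_all
    show "tri S W (sort_prog;; ?rest2) s2 (200 * A + (20 * A + (2500 * A + (20 * A + (2500 * A + 1400 * A))))) Q"
    proof (rule tri_Seq)
      have "tri S W sort_prog s2 (200 * (H + 1) * (nn + 1)) (\<lambda>s. \<forall>p<nn. snd s ''K0'' p = (if p < length S then rank S p else p))"
        by (rule sort_correct[OF S nn(1,2) s2(1,3) W2(1,2)])
      then show "tri S W sort_prog s2 (200 * A) (\<lambda>s. \<forall>p<nn. snd s ''K0'' p = rk p)"
        by (rule tri_conseq) (use A in \<open>auto simp: rk_def algebra_simps\<close>)
      fix s3 assume K3: "\<forall>p<nn. snd s3 ''K0'' p = rk p"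
        and f: "\<And>x. x \<notin> regs sort_prog \<Longrightarrow> fst s3 x = fst s2 x" "\<And>x. x \<notin> arrs sort_prog \<Longrightarrow> snd s3 x = snd s2 x"
      have s3: "fst s3 ''N'' = nn" "fst s3 ''W'' = 2 * nn" "fst s3 ''n'' = length S" "fst s3 ''k'' = k"
        "\<And>b. fst s3 (nm ''J'' b) = 0" "\<And>b. fst s3 (nm ''u'' b) = 0" "\<And>b x i. snd s3 (nm x b) i = 0"
        using f s2 by simp_all
      show "tri S W ?rest2 s3 (20 * A + (2500 * A + (20 * A + (2500 * A + 1400 * A)))) Q"
      proof (rule tri_Seq)
        have "tri S W ?copyT s3 (20 * (nn + 1)) (\<lambda>s. \<forall>i<nn. snd s ''K'' i = rks True i)"
          by (rule copy_correct[OF s3(1) W2(3,4), where v = rk]) (use K3 in \<open>auto simp: rks_def\<close>)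
        then show "tri S W ?copyT s3 (20 * A) (\<lambda>s. \<forall>i<nn. snd s ''K'' i = rks True i)"
          by (rule tri_conseq) (use A in auto)
        fix s4 assume K4: "\<forall>i<nn. snd s4 ''K'' i = rks True i"
          and f: "\<And>x. x \<notin> regs ?copyT \<Longrightarrow> fst s4 x = fst s3 x" "\<And>x. x \<notin> arrs ?copyT \<Longrightarrow> snd s4 x = snd s3 x"
        have s4: "fst s4 ''N'' = nn" "fst s4 ''W'' = 2 * nn" "fst s4 ''n'' = length S" "fst s4 ''k'' = k"
          "\<And>b. fst s4 (nm ''J'' b) = 0" "\<And>b. fst s4 (nm ''u'' b) = 0" "\<And>b x i. snd s4 (nm x b) i = 0" "\<forall>p<nn. snd s4 ''K0'' p = rk p"
          using f s3 K3 by simp_all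
        show "tri S W ?rest3 s4 (2500 * A + (20 * A + (2500 * A + 1400 * A))) Q"
        proof (rule tri_Seq[OF sea])
          fix s5 assume D5: "deaths nn (rks True) (snd s5 (nm ''D'' True)) (snd s5 (nm ''T'' True))"
            and f: "\<And>x. x \<notin> regs (sea_prog (nm ''D'' True) (nm ''T'' True)) \<Longrightarrow> fst s5 x = fst s4 x"
              "\<And>x. x \<notin> arrs (sea_prog (nm ''D'' True) (nm ''T'' True)) \<Longrightarrow> snd s5 x = snd s4 x"
          have s5: "fst s5 ''N'' = nn" "fst s5 ''W'' = 2 * nn" "fst s5 ''n'' = length S" "fst s5 ''k'' = k"
            "\<And>b. fst s5 (nm ''J'' b) = 0" "\<And>b. fst s5 (nm ''u'' b) = 0" "\<And>i. snd s5 (nm ''T'' False) i = 0"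
            "\<And>b i. snd s5 (nm ''c'' b) i = 0" "\<And>b i. snd s5 (nm ''b'' b) i = 0" "\<forall>p<nn. snd s5 ''K0'' p = rk p"
            using f s4 by (simp_all add: sea_regs_def sea_arrs_def)
          show "tri S W ?rest4 s5 (20 * A + (2500 * A + 1400 * A)) Q"
          proof (rule tri_Seq)
            have "tri S W ?copyF s5 (20 * (nn + 1)) (\<lambda>s. \<forall>i<nn. snd s ''K'' i = rks False i)"
              by (rule copy_correct[OF s5(1) W2(3,4), where v = rk]) (use s5(10) W2 in \<open>auto simp: rks_def\<close>)
            then show "tri S W ?copyF s5 (20 * A) (\<lambda>s. \<forall>i<nn. snd s ''K'' i = rks False i)"
              by (rule tri_conseq) (use A in auto)
            fix s6 assume K6: "\<forall>i<nn. snd s6 ''K'' i = rks False i"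
              and f: "\<And>x. x \<notin> regs ?copyF \<Longrightarrow> fst s6 x = fst s5 x" "\<And>x. x \<notin> arrs ?copyF \<Longrightarrow> snd s6 x = snd s5 x"
            have s6: "fst s6 ''N'' = nn" "fst s6 ''W'' = 2 * nn" "fst s6 ''n'' = length S" "fst s6 ''k'' = k"
              "\<And>b. fst s6 (nm ''J'' b) = 0" "\<And>b. fst s6 (nm ''u'' b) = 0" "\<And>i. snd s6 (nm ''T'' False) i = 0"
              "\<And>b i. snd s6 (nm ''c'' b) i = 0" "\<And>b i. snd s6 (nm ''b'' b) i = 0"
              "deaths nn (rks True) (snd s6 (nm ''D'' True)) (snd s6 (nm ''T'' True))"
              using f s5 D5 by simp_all
            show "tri S W ?rest5 s6 (2500 * A + 1400 * A) Q"
            proof (rule tri_Seq[OF sea])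
              fix s7 assume D7: "deaths nn (rks False) (snd s7 (nm ''D'' False)) (snd s7 (nm ''T'' False))"
                and f: "\<And>x. x \<notin> regs (sea_prog (nm ''D'' False) (nm ''T'' False)) \<Longrightarrow> fst s7 x = fst s6 x"
                  "\<And>x. x \<notin> arrs (sea_prog (nm ''D'' False) (nm ''T'' False)) \<Longrightarrow> snd s7 x = snd s6 x"
              have s7: "fst s7 ''N'' = nn" "fst s7 ''n'' = length S" "fst s7 ''k'' = k"
                "\<And>b. fst s7 (nm ''J'' b) = 0" "\<And>b. fst s7 (nm ''u'' b) = 0"
                "\<And>b i. snd s7 (nm ''c'' b) i = 0" "\<And>b i. snd s7 (nm ''b'' b) i = 0"
                "deaths nn (rks True) (snd s7 (nm ''D'' True)) (snd s7 (nm ''T'' True))"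
                using f s6 by (simp_all add: sea_regs_def sea_arrs_def)
              have "deaths nn (rks b) (snd s7 (nm ''D'' b)) (snd s7 (nm ''T'' b))" for b
                using D7 s7(8) by (cases b) auto
              from dp_correct[OF nn(1,2) S k W6 W2(2) rks_lt s7(1-7) this]
              show "tri S W dp_prog s7 (1400 * A) Q"
                by (rule tri_conseq) (use A in \<open>auto simp: Q_def result_def algebra_simps\<close>)
            qed (use K6 s6 in auto)
          qed simp
        qed (use K4 s4 in auto)
      qed simp
    qed simp
  qed simp
  then obtain t2 s' where ex2: "exec S W (Assign ''W'' (Plus (V ''N'') (V ''N''));; sort_prog;; ?rest2) s1 t2 s'"
    "t2 \<le> 4 + (200 * A + (20 * A + (2500 * A + (20 * A + (2500 * A + 1400 * A)))))" "Q s'" unfolding tri_def by blast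
  have "exec S W main_prog s0 (t + t2) s'" unfolding main_prog_def using ex(1) ex2(1) by (rule exec.Seq)
  moreover have "t + t2 \<le> 8000 * (H + 2)\<^sup>2 * (2 * length S + 2)"
  proof -
    have "A \<le> (H + 2) * (H + 2) * (2 * length S + 2)" unfolding A_def using nn(3) by (intro mult_le_mono) simp_all
    then have "8000 * A \<le> 8000 * ((H + 2) * (H + 2) * (2 * length S + 2))" by (rule mult_le_mono2)
    then have *: "8000 * A \<le> 8000 * (H + 2)\<^sup>2 * (2 * length S + 2)" unfolding power2_eq_square mult.assoc .
    have 1: "length S + 1 \<le> A" using A nn(2) by linarith
    have t1: "t \<le> 10 * A" by (rule order_trans[OF ex(2) mult_le_mono2[OF 1]])
    have 2: "4 \<le> 4 * A" using 1 by linarith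
    have 3: "200 * A + (20 * A + (2500 * A + (20 * A + (2500 * A + 1400 * A)))) = 6640 * A" by simp
    have "t + t2 \<le> 10 * A + (4 * A + 6640 * A)"
      using add_mono[OF t1 order_trans[OF ex2(2)[unfolded 3] add_right_mono[OF 2]]] .
    also have "\<dots> \<le> 8000 * A" by simp
    finally have "t + t2 \<le> 8000 * A" .
    then show ?thesis using * by (rule order_trans)
  qed
  ultimately show ?thesis using H(3) ex2(3) unfolding tri_def Q_def s0_def by blast
qed

theorem theorem22:
  "\<exists>P T. computes_longest_rollercoaster_length_in_time P T \<and>
     (\<lambda>n. real (T n)) \<in> O(\<lambda>n. real n * (log 2 (real n))\<^sup>2)"
proof -
  \<comment> \<open>\<open>main_correct\<close> yields some \<open>H\<close> with
    \<open>2 ^ H \<le> 2 * n + 1\<close>. The rounded logarithm bounds every such exponent, so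
    \<open>T\<close> depends on \<open>n\<close> alone.\<close>
  define T :: "nat \<Rightarrow> nat" where "T n = 8000 * (nat \<lfloor>log 2 (real (2 * n + 1))\<rfloor> + 2)\<^sup>2 * (2 * n + 2)" for n
  have "computes_longest_rollercoaster_length_in_time main_prog T"
    unfolding computes_longest_rollercoaster_length_in_time_def
  proof (rule exI[of _ 5], intro conjI allI impI)
    fix S :: "real list" and k :: nat assume *: "distinct S" "3 \<le> k"
    obtain H where H: "2 ^ H \<le> 2 * length S + 1" and t: "tri S ((length S + k) ^ 5) main_prog (initial_state S k) (8000 * (H + 2)\<^sup>2 * (2 * length S + 2))
      (\<lambda>s. result s = longest_rollercoaster_length k S)" using main_correct[OF * refl] by blast
    have "real (2 ^ H) \<le> real (2 * length S + 1)" using H by (rule of_nat_mono)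
    then have "real H \<le> log 2 (real (2 * length S + 1))" by (simp add: le_log_iff powr_realpow)
    then have "H \<le> nat \<lfloor>log 2 (real (2 * length S + 1))\<rfloor>" by (simp add: le_nat_floor)
    then have "8000 * (H + 2)\<^sup>2 * (2 * length S + 2) \<le> T (length S)"
      unfolding T_def by (intro mult_le_mono power_mono) auto
    then show "\<exists>t s. exec S ((length S + k) ^ 5) main_prog (initial_state S k) t s \<and> t \<le> T (length S) \<and> result s = longest_rollercoaster_length k S"
      using t unfolding tri_def by (meson order_trans)
  qed simp
  moreover have "(\<lambda>n. real (T n)) \<in> O(\<lambda>n. real n * (log 2 (real n))\<^sup>2)"
  \<comment> \<open>For \<open>n \<ge> 2\<close> the rounded logarithm plus 2 is at most
    \<open>5 * log 2 n\<close>, whose square gives the 25, and \<open>2 * n + 2 \<le> 3 * n\<close>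
    gives the 3.\<close>
  proof (rule bigoI[where c = "8000 * 25 * 3"])
    show "\<forall>\<^sub>F n in at_top. norm (real (T n)) \<le> 8000 * 25 * 3 * norm (real n * (log 2 (real n))\<^sup>2)"
      using eventually_ge_at_top[of 2]
    proof eventually_elim
      case (elim n)
      have l1: "1 \<le> log 2 (real n)" using elim by (simp add: le_log_iff)
      have "log 2 (real (2 * n + 1)) \<le> log 2 (4 * real n)" using elim by simp
      also have "\<dots> = log 2 4 + log 2 (real n)" using elim by (simp add: log_mult)
      also have "log 2 (4::real) = 2" using log_pow_cancel[of 2 2] by simp
      finally have "log 2 (real (2 * n + 1)) \<le> 2 + log 2 (real n)" .
      moreover have "real (nat \<lfloor>log 2 (real (2 * n + 1))\<rfloor>) \<le> log 2 (real (2 * n + 1))"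
        by (rule of_nat_floor) (simp add: zero_le_log_cancel_iff)
      ultimately have "real (nat \<lfloor>log 2 (real (2 * n + 1))\<rfloor> + 2) \<le> 5 * log 2 (real n)"
        using l1 by linarith
      then have "(real (nat \<lfloor>log 2 (real (2 * n + 1))\<rfloor> + 2))\<^sup>2 \<le> (5 * log 2 (real n))\<^sup>2" by (intro power_mono) auto
      moreover have "real (2 * n + 2) \<le> 3 * real n" using elim by simp
      ultimately have "(real (nat \<lfloor>log 2 (real (2 * n + 1))\<rfloor> + 2))\<^sup>2 * real (2 * n + 2) \<le> (5 * log 2 (real n))\<^sup>2 * (3 * real n)"
        by (intro mult_mono) auto
      then have "8000 * ((real (nat \<lfloor>log 2 (real (2 * n + 1))\<rfloor> + 2))\<^sup>2 * real (2 * n + 2)) \<le> 8000 * ((5 * log 2 (real n))\<^sup>2 * (3 * real n))"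
        by (rule mult_left_mono) simp
      then show ?case unfolding T_def by (simp add: power_mult_distrib algebra_simps)
    qed
  qed
  ultimately show ?thesis by blast
qed

end
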